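(* The Markov semigroup $\{T(t)\}_{t\ge0}$ in $C(\Omega)$ described in the context gives rise to a diffusion process $\boldsymbol\omega_{z,z'}(t)$ in $\Omega$: a strong Markov process with transition semigroup $\{T(t)\}$, which can start from any point or any probability distribution on $\Omega$, and whose sample paths are continuous almost surely.
   Context: Young diagrams: $\mathbb Y_n$ is the set of Young diagrams with $n$ boxes; $\mu\nearrow\lambda$ (equivalently $\lambda\searrow\mu$) means $\mu\subset\lambda$, $|\lambda|=|\mu|+1$; $(z)_\theta=\prod_{(i,j)\in\theta}(z+j-i)$ for a skew diagram $\theta$ ($(i,j)$ = row $i$, column $j$); $\dim\lambda$ = number of standard Young tableaux of shape $\lambda$. Modified Frobenius coordinates $\lambda=(a_1,\dots,a_d\mid b_1,\dots,b_d)$: $d$ the number of diagonal boxes, $a_i=\lambda_i-i+\frac12$, $b_i=\lambda'_i-i+\frac12$. $(z,z')$ is fixed in the principal series ($z\notin\mathbb R$, $z'=\bar z$) or complementary series ($z,z'\in(N,N+1)$, $N\in\mathbb Z$). $p^\downarrow(\nu,\lambda)=\dim\lambda/\dim\nu$ if $\lambda\nearrow\nu$, else 0; for $\lambda\in\mathbb Y_n$, $p^\uparrow(\lambda,\nu)=\frac{(z)_{\nu/\lambda}(z')_{\nu/\lambda}}{zz'+n}\frac{\dim\nu}{(n+1)\dim\lambda}$ if $\nu\searrow\lambda$, else 0; $(T_ng)(\lambda)=\sum_{\nu\in\mathbb Y_{n+1}}p^\uparrow(\lambda,\nu)\sum_{\tilde\lambda\in\mathbb Y_n}p^\downarrow(\nu,\tilde\lambda)g(\tilde\lambda)$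 on real functions on $\mathbb Y_n$ (norm $\|g\|_n=\max|g|$). Thoma simplex $\Omega$: pairs $\omega=(\alpha,\beta)$ of nonincreasing sequences of nonnegative reals with $\sum_i(\alpha_i+\beta_i)\le1$, topology from $[0,1]^\infty\times[0,1]^\infty$; $C(\Omega)$ with sup norm. $\iota_n(\lambda)=(\alpha,\beta)$ with $\alpha_i=a_i/n$, $\beta_i=b_i/n$ for $i\le d$, 0 otherwise; $\pi_nf=f\circ\iota_n$. $\Lambda^\circ=\mathbb R[q_1,q_2,\dots]\subset C(\Omega)$ with moment coordinates $q_k(\omega)=\sum_i\alpha_i^{k+1}+(-1)^k\sum_i\beta_i^{k+1}$ (equivalently $\Lambda/(p_1-1)$ with $p^\circ_{k+1}=q_k$, $s^\circ_\mu$ the images of Schur functions). $A=A_{z,z'}:\Lambda^\circ\to\Lambda^\circ$ is the operator $A s^\circ_\mu=-m(m-1+zz')s^\circ_\mu+\sum_{\mu_\bullet\nearrow\mu}(z)_{\mu/\mu_\bullet}(z')_{\mu/\mu_\bullet}s^\circ_{\mu_\bullet}$, $m=|\mu|$; it satisfies $\|n^2(T_n-\mathbf 1)\pi_nf-\pi_n(Af)\|_n\to0$ for $f\in\Lambda^\circ$, is closable in $C(\Omega)$, and its closure generates a strongly continuous conservative Markov semigroup $\{T(t)\}$ in $C(\Omega)$ (contractions preserving nonnegativity and fixing $1$) with $\|T_n^{[n^2t]}\pi_nf-\pi_n(T(t)f)\|_n\to0$ for all $f\in C(\Omega)$. *)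

theory Defs
  imports "HOL-Probability.Probability"
begin

text \<open>A Young diagram is a nonincreasing list of positive naturals (its row lengths).\<close>

definition young :: "nat list \<Rightarrow> bool" where
  "young lam \<longleftrightarrow> sorted (rev lam) \<and> 0 \<notin> set lam"

definition YD :: "nat \<Rightarrow> nat list set" where
  "YD n = {lam. young lam \<and> sum_list lam = n}"

text \<open>Boxes (i,j) = (row, column), both 1-indexed.\<close>
definition boxes :: "nat list \<Rightarrow> (nat \<times> nat) set" where
  "boxes lam = {(i, j). 1 \<le> i \<and> i \<le> length lam \<and> 1 \<le> j \<and> j \<le> lam ! (i - 1)}"

definition covers :: "nat list \<Rightarrow> nat list \<Rightarrow> bool" where
  "covers mu lam \<longleftrightarrow> boxes mu \<subseteq> boxes lam \<and> card (boxes lam) = card (boxes mu) + 1"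

definition SYT :: "nat list \<Rightarrow> ((nat \<times> nat) \<Rightarrow> nat) set" where
  "SYT lam = {T. T \<in> boxes lam \<rightarrow>\<^sub>E {1..sum_list lam} \<and> bij_betw T (boxes lam) {1..sum_list lam}
      \<and> (\<forall>i j. (i, j) \<in> boxes lam \<and> (i, Suc j) \<in> boxes lam \<longrightarrow> T (i, j) < T (i, Suc j))
      \<and> (\<forall>i j. (i, j) \<in> boxes lam \<and> (Suc i, j) \<in> boxes lam \<longrightarrow> T (i, j) < T (Suc i, j))}"

definition dimY :: "nat list \<Rightarrow> nat" where
  "dimY lam = card (SYT lam)"

definition poch_skew :: "complex \<Rightarrow> nat list \<Rightarrow> nat list \<Rightarrow> complex" where
  "poch_skew z nu lam = (\<Prod>(i, j)\<in>boxes nu - boxes lam. z + of_nat j - of_nat i)"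

definition p_down :: "nat list \<Rightarrow> nat list \<Rightarrow> real" where
  "p_down nu lam = (if covers lam nu then real (dimY lam) / real (dimY nu) else 0)"

definition p_up :: "complex \<Rightarrow> complex \<Rightarrow> nat \<Rightarrow> nat list \<Rightarrow> nat list \<Rightarrow> real" where
  "p_up z z' n lam nu = (if covers lam nu then
      Re (poch_skew z nu lam * poch_skew z' nu lam / (z * z' + of_nat n))
        * real (dimY nu) / (real (n + 1) * real (dimY lam))
    else 0)"

definition Tn :: "complex \<Rightarrow> complex \<Rightarrow> nat \<Rightarrow> (nat list \<Rightarrow> real) \<Rightarrow> (nat list \<Rightarrow> real)" where
  "Tn z z' n g = (\<lambda>lam. \<Sum>nu\<in>YD (Suc n). p_up z z' n lam nu *
      (\<Sum>lam'\<in>YD n. p_down nu lam' * g lam'))"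

type_synonym thoma_pt = "(nat \<Rightarrow> real) \<times> (nat \<Rightarrow> real)"

text \<open>Sequences are 0-indexed: alpha 0 is alpha_1. The topology is the product topology.\<close>
definition thoma :: "thoma_pt set" where
  "thoma = {(a, b). decseq a \<and> decseq b \<and> (\<forall>i. 0 \<le> a i \<and> 0 \<le> b i)
              \<and> (\<forall>N. (\<Sum>i<N. a i + b i) \<le> 1)}"

definition conjY :: "nat list \<Rightarrow> nat \<Rightarrow> nat" where
  "conjY lam k = card {i. i < length lam \<and> k \<le> lam ! i}"

definition diagY :: "nat list \<Rightarrow> nat" where
  "diagY lam = card {i. i < length lam \<and> Suc i \<le> lam ! i}"

text \<open>iota_n via modified Frobenius coordinates a_i = lam_i - i + 1/2, b_i = lam'_i - i + 1/2.\<close>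
definition iota :: "nat \<Rightarrow> nat list \<Rightarrow> thoma_pt" where
  "iota n lam =
     ((\<lambda>i. if i < diagY lam then (real (lam ! i) - real (Suc i) + 1/2) / real n else 0),
      (\<lambda>i. if i < diagY lam then (real (conjY lam (Suc i)) - real (Suc i) + 1/2) / real n else 0))"

definition proj_n :: "nat \<Rightarrow> (thoma_pt \<Rightarrow> real) \<Rightarrow> (nat list \<Rightarrow> real)" where
  "proj_n n f = f \<circ> iota n"

definition approximates_semigroup ::
  "complex \<Rightarrow> complex \<Rightarrow> (real \<Rightarrow> (thoma_pt \<Rightarrow> real) \<Rightarrow> (thoma_pt \<Rightarrow> real)) \<Rightarrow> bool" where
  "approximates_semigroup z z' T \<longleftrightarrow>
     (\<forall>t\<ge>0. \<forall>f. continuous_on thoma f \<longrightarrow> continuous_on thoma (T t f) \<and>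
        (\<lambda>n. Max ((\<lambda>lam. \<bar>((Tn z z' n) ^^ nat \<lfloor>real n ^ 2 * t\<rfloor>) (proj_n n f) lam
                          - proj_n n (T t f) lam\<bar>) ` YD n)) \<longlonglongrightarrow> 0)"

definition zz'_admissible :: "complex \<Rightarrow> complex \<Rightarrow> bool" where
  "zz'_admissible z z' \<longleftrightarrow>
     (z \<notin> \<real> \<and> z' = cnj z) \<or>
     (\<exists>N::int. z \<in> \<real> \<and> z' \<in> \<real> \<and> of_int N < Re z \<and> Re z < of_int N + 1
                \<and> of_int N < Re z' \<and> Re z' < of_int N + 1)"

definition thoma_space :: "thoma_pt measure" where
  "thoma_space = restrict_space borel thoma"

type_synonym path = "real \<Rightarrow> thoma_pt"

definition is_filtration :: "'a measure \<Rightarrow> (real \<Rightarrow> 'a measure) \<Rightarrow> bool" where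
  "is_filtration P F \<longleftrightarrow>
     (\<forall>t\<ge>0. space (F t) = space P \<and> sets (F t) \<subseteq> sets P) \<and>
     (\<forall>s t. 0 \<le> s \<and> s \<le> t \<longrightarrow> sets (F s) \<subseteq> sets (F t))"

definition is_stopping_time :: "'a measure \<Rightarrow> (real \<Rightarrow> 'a measure) \<Rightarrow> ('a \<Rightarrow> ennreal) \<Rightarrow> bool" where
  "is_stopping_time P F \<tau> \<longleftrightarrow> (\<forall>t\<ge>0. {\<omega>\<in>space P. \<tau> \<omega> \<le> ennreal t} \<in> sets (F t))"

definition pre_tau_sets :: "'a measure \<Rightarrow> (real \<Rightarrow> 'a measure) \<Rightarrow> ('a \<Rightarrow> ennreal) \<Rightarrow> 'a set set" where
  "pre_tau_sets P F \<tau> = {A \<in> sets P. \<forall>t\<ge>0. {\<omega>\<in>A. \<tau> \<omega> \<le> ennreal t} \<in> sets (F t)}"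

definition is_diffusion ::
  "(real \<Rightarrow> (thoma_pt \<Rightarrow> real) \<Rightarrow> (thoma_pt \<Rightarrow> real)) \<Rightarrow> thoma_pt measure
    \<Rightarrow> 'a measure \<Rightarrow> (real \<Rightarrow> 'a measure) \<Rightarrow> (real \<Rightarrow> 'a \<Rightarrow> thoma_pt) \<Rightarrow> bool" where
  "is_diffusion T mu P F X \<longleftrightarrow>
     prob_space P \<and> is_filtration P F \<and>
     (\<forall>t\<ge>0. X t \<in> measurable (F t) thoma_space) \<and>
     distr P thoma_space (X 0) = mu \<and>
     (AE \<omega> in P. continuous_on {0..} (\<lambda>t. X t \<omega>)) \<and>
     (\<forall>\<tau> s f A. is_stopping_time P F \<tau> \<and> 0 \<le> s \<and> continuous_on thoma f
         \<and> A \<in> pre_tau_sets P F \<tau> \<longrightarrow>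
        (let B = A \<inter> {\<omega>. \<tau> \<omega> < \<infinity>} in
          integrable P (\<lambda>\<omega>. indicator B \<omega> * f (X (enn2real (\<tau> \<omega>) + s) \<omega>)) \<and>
          integrable P (\<lambda>\<omega>. indicator B \<omega> * T s f (X (enn2real (\<tau> \<omega>)) \<omega>)) \<and>
          (\<lambda>\<omega>. indicator {\<omega>. \<tau> \<omega> < \<infinity>} \<omega> * f (X (enn2real (\<tau> \<omega>)) \<omega>))
             \<in> borel_measurable (sigma (space P) (pre_tau_sets P F \<tau>)) \<and>
          (\<integral>\<omega>. indicator B \<omega> * f (X (enn2real (\<tau> \<omega>) + s) \<omega>) \<partial>P)
            = (\<integral>\<omega>. indicator B \<omega> * T s f (X (enn2real (\<tau> \<omega>)) \<omega>) \<partial>P)))"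

end

theory Submission
  imports Defs
begin

text \<open>
  The generator is not needed.  The observables \<open>test_fun j\<close> separate the points of the Thoma
  simplex, and along the up-down chain on diagrams with \<open>n\<close> boxes they have drift \<open>O(n\<^sup>-\<^sup>2)\<close> and
  jumps \<open>O(n\<^sup>-\<^sup>1)\<close>, by Kerov's identities for the transition and co-transition measures.  Hence their
  increments over \<open>n\<^sup>2 t\<close> steps have fourth moments of order \<open>t\<^sup>2\<close>, uniformly in \<open>n\<close>.  Coding the rescaled
  chain at dyadic times by a single real number, Helly's selection theorem gives a limit process at
  dyadic times which is Markov with semigroup \<open>T\<close> and inherits the moment bound, so that the
  Kolmogorov-Chentsov argument yields a continuous version.  The Markov property passes to real times
  and to the natural filtration, and to stopping times by approximating them with dyadic ones from above.
\<close>

text \<open>The assumption on \<open>T\<close> is one limit for each fixed time and gives no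
  regularity in time. So every path estimate, and even the continuity of \<open>T t f\<close> in
  \<open>t\<close>, has to be read off the finite chains, uniformly in \<open>n\<close>. The
  observables are values of Thoma's generating function: exp(v) times the product over i of exp(-v
  (\<alpha>_i + \<beta>_i)) (1 + v \<beta>_i) / (1 - v \<alpha>_i). They suit the chain because on a
  diagram they become a product over boxes of 1 + 1/(u - c), with c the content and u = n/v - 1/2.
  Adding or removing a box changes one factor, so the mean over a half-step involves a weighted sum
  of 1/(u - c) over the addable or removable boxes, which Kerov's identities evaluate. The gain of
  the up step and the loss of the down step are each of order 1/n; the small drift comes from their
  cancellation at that order. Fourth moments are used because Kolmogorov's criterion needs a power
  of the elapsed time above one, and second moments would give only the first power.\<close>

definition box_content :: "nat \<times> nat \<Rightarrow> int" where
  "box_content b = int (snd b) - int (fst b)"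

section \<open>Diagrams as finite order ideals of the positive quadrant, and their corners\<close>

definition yideal :: "(nat \<times> nat) set \<Rightarrow> bool" where
  "yideal I \<longleftrightarrow> finite I \<and> (\<forall>i j. (i, j) \<in> I \<longrightarrow> 1 \<le> i \<and> 1 \<le> j) \<and>
     (\<forall>i j i' j'. (i, j) \<in> I \<and> 1 \<le> i' \<and> i' \<le> i \<and> 1 \<le> j' \<and> j' \<le> j \<longrightarrow> (i', j') \<in> I)"

text \<open>Corners are defined through the ideal property of the changed set, so that unions and
  intersections of ideals apply to them directly, as in \<open>move_box_commute\<close>. The
  neighbour form is \<open>addable_iff\<close> and \<open>removable_iff\<close>.\<close>

definition addable :: "(nat \<times> nat) set \<Rightarrow> (nat \<times> nat) set" where
  "addable I = {b. b \<notin> I \<and> yideal (insert b I)}"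

definition removable :: "(nat \<times> nat) set \<Rightarrow> (nat \<times> nat) set" where
  "removable I = {b \<in> I. yideal (I - {b})}"

lemma yideal_finite: "yideal I \<Longrightarrow> finite I"
  and yideal_pos: "yideal I \<Longrightarrow> (i, j) \<in> I \<Longrightarrow> 1 \<le> i \<and> 1 \<le> j"
  and yideal_down: "yideal I \<Longrightarrow> (i, j) \<in> I \<Longrightarrow> 1 \<le> i' \<Longrightarrow> i' \<le> i \<Longrightarrow> 1 \<le> j' \<Longrightarrow> j' \<le> j \<Longrightarrow> (i', j') \<in> I"
  unfolding yideal_def by blast+

lemma yideal_empty: "yideal {}"
  by (simp add: yideal_def)

lemma addable_iff:
  assumes I: "yideal I"
  shows "(i, j) \<in> addable I \<longleftrightarrow> (i, j) \<notin> I \<and> 1 \<le> i \<and> 1 \<le> j \<and>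
    (i = 1 \<or> (i - 1, j) \<in> I) \<and> (j = 1 \<or> (i, j - 1) \<in> I)" (is "?L \<longleftrightarrow> ?R")
proof
  assume L: ?L
  then have ni: "(i, j) \<notin> I" and J: "yideal (insert (i, j) I)" by (auto simp: addable_def)
  have p: "1 \<le> i" "1 \<le> j" using yideal_pos[OF J] by auto
  have "i = 1 \<or> (i - 1, j) \<in> insert (i, j) I"
    using yideal_down[OF J insertI1, of "i - 1" j] p by auto
  moreover have "j = 1 \<or> (i, j - 1) \<in> insert (i, j) I"
    using yideal_down[OF J insertI1, of i "j - 1"] p by auto
  ultimately show ?R using ni p by auto
next
  assume R: ?R
  have "(i', j') \<in> insert (i, j) I"
    if *: "1 \<le> i'" "i' \<le> i" "1 \<le> j'" "j' \<le> j" for i' j'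
  proof (cases "i' = i \<and> j' = j")
    case False
    then consider "i' \<le> i - 1" "i \<noteq> 1" | "j' \<le> j - 1" "j \<noteq> 1" using * by linarith
    then show ?thesis
    proof cases
      case 1
      then show ?thesis using R * yideal_down[OF I, of "i - 1" j i' j'] by auto
    next
      case 2
      then show ?thesis using R * yideal_down[OF I, of i "j - 1" i' j'] by auto
    qed
  qed auto
  then have "yideal (insert (i, j) I)"
    unfolding yideal_def using yideal_finite[OF I] yideal_pos[OF I] yideal_down[OF I] R
    by (metis finite_insert insert_iff prod.inject)
  then show ?L using R by (simp add: addable_def)
qed

lemma removable_iff:
  assumes I: "yideal I"
  shows "(i, j) \<in> removable I \<longleftrightarrow> (i, j) \<in> I \<and> (i, Suc j) \<notin> I \<and> (Suc i, j) \<notin> I" (is "?L \<longleftrightarrow> ?R")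
proof
  assume L: ?L
  then have ni: "(i, j) \<in> I" and J: "yideal (I - {(i, j)})" by (auto simp: removable_def)
  have p: "1 \<le> i" "1 \<le> j" using yideal_pos[OF I ni] by auto
  show ?R using ni p yideal_down[OF J, of i "Suc j" i j] yideal_down[OF J, of "Suc i" j i j] by auto
next
  assume R: ?R
  have p: "1 \<le> i" "1 \<le> j" using yideal_pos[OF I] R by auto
  have "(i, j) \<noteq> (i', j')"
    if "(a, b) \<in> I" "(a, b) \<noteq> (i, j)" "1 \<le> i'" "i' \<le> a" "1 \<le> j'" "j' \<le> b" for a b i' j'
  proof
    assume "(i, j) = (i', j')"
    then have "Suc i \<le> a \<or> Suc j \<le> b" using that by auto
    then show False
      using R that \<open>(i, j) = (i', j')\<close> p yideal_down[OF I that(1), of "Suc i" j] yideal_down[OF I that(1), of i "Suc j"]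
      by auto
  qed
  moreover have "(i', j') \<in> I"
    if "(a, b) \<in> I" "1 \<le> i'" "i' \<le> a" "1 \<le> j'" "j' \<le> b" for a b i' j'
    using that yideal_down[OF I] by blast
  ultimately have "yideal (I - {(i, j)})"
    using yideal_finite[OF I] yideal_pos[OF I] unfolding yideal_def by blast
  then show ?L using R by (simp add: removable_def)
qed

lemma addable_ideal: "b \<in> addable I \<Longrightarrow> yideal (insert b I)"
  and addable_notin: "b \<in> addable I \<Longrightarrow> b \<notin> I"
  and removable_ideal: "b \<in> removable I \<Longrightarrow> yideal (I - {b})"
  and removable_in: "b \<in> removable I \<Longrightarrow> b \<in> I"
  by (auto simp: addable_def removable_def)

lemma removable_insert: "yideal I \<Longrightarrow> b \<in> addable I \<Longrightarrow> b \<in> removable (insert b I)"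
  by (auto simp: addable_def removable_def)

lemma addable_remove: "yideal I \<Longrightarrow> b \<in> removable I \<Longrightarrow> b \<in> addable (I - {b})"
  by (auto simp: addable_def removable_def insert_absorb)

text \<open>Take a box of \<open>K - I\<close> with maximal i + j. A right or lower neighbour in
  \<open>K\<close> would have a larger sum, hence lie in \<open>I\<close>, and then the box itself
  would lie in \<open>I\<close>.\<close>

lemma yideal_maximal_removable:
  assumes I: "yideal I" and K: "yideal K" and "I \<subset> K"
  obtains b where "b \<in> removable K" "b \<notin> I"
proof -
  let ?f = "\<lambda>(i, j). i + j :: nat"
  have fin: "finite (K - I)" using K yideal_finite by auto
  have ne: "K - I \<noteq> {}" using assms by auto
  obtain b where b: "b \<in> K - I" and bm: "\<And>b'. b' \<in> K - I \<Longrightarrow> ?f b' \<le> ?f b"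
  proof -
    have "Max (?f ` (K - I)) \<in> ?f ` (K - I)" using fin ne by (intro Max_in) auto
    then obtain b where "b \<in> K - I" "Max (?f ` (K - I)) = ?f b" by blast
    then show ?thesis using that[of b] Max_ge[of "?f ` (K - I)"] fin by (metis finite_imageI image_eqI)
  qed
  obtain i j where bij: "b = (i, j)" by (cases b)
  have p: "1 \<le> i" "1 \<le> j" using yideal_pos[OF K] b bij by auto
  have "(i, Suc j) \<notin> K"
    using bm[of "(i, Suc j)"] b bij p yideal_down[OF I, of i "Suc j" i j] by auto
  moreover have "(Suc i, j) \<notin> K"
    using bm[of "(Suc i, j)"] b bij p yideal_down[OF I, of "Suc i" j i j] by auto
  ultimately have "b \<in> removable K" using b bij by (simp add: removable_iff[OF K])
  then show ?thesis using that b by auto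
qed

lemma removable_nonempty:
  assumes "yideal I" "I \<noteq> {}" shows "removable I \<noteq> {}"
  using yideal_maximal_removable[OF yideal_empty assms(1)] assms(2) by blast

lemma yideal_induct [consumes 1, case_names empty insert]:
  assumes "yideal J" and "P {}"
    and step: "\<And>I b. yideal I \<Longrightarrow> b \<in> addable I \<Longrightarrow> P I \<Longrightarrow> P (insert b I)"
  shows "P J"
  using assms(1)
proof (induction "card J" arbitrary: J)
  case 0
  then show ?case using yideal_finite[of J] assms(2) by auto
next
  case (Suc n)
  then have "J \<noteq> {}" by auto
  then obtain b where b: "b \<in> removable J" using removable_nonempty Suc.prems by blast
  have bJ: "b \<in> J" using b by (simp add: removable_def)
  have "P (J - {b})"
    using Suc.hyps(1)[of "J - {b}"] Suc.hyps(2) bJ removable_ideal[OF b] yideal_finite[OF Suc.prems] by auto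
  then have "P (insert b (J - {b}))"
    using step[of "J - {b}" b] removable_ideal[OF b] addable_remove[OF Suc.prems b] by blast
  then show ?case using bJ by (simp add: insert_absorb)
qed

text \<open>Corners of the larger ideal outside the smaller one are peeled off until the size is
  right. This later adjusts an approximating diagram to exactly \<open>n\<close> boxes.\<close>

lemma yideal_between:
  assumes "yideal I" "yideal K" "I \<subseteq> K" "card I \<le> n" "n \<le> card K"
  obtains J where "yideal J" "I \<subseteq> J" "J \<subseteq> K" "card J = n"
proof -
  have "\<exists>J. yideal J \<and> I \<subseteq> J \<and> J \<subseteq> K \<and> card J = n" using assms(2,3,5)
  proof (induction "card K - n" arbitrary: K)
    case 0
    then show ?case by (intro exI[of _ K]) auto
  next
    case (Suc d)
    then have "I \<noteq> K" using assms(4) by auto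
    then obtain b where b: "b \<in> removable K" "b \<notin> I"
      using yideal_maximal_removable[OF assms(1) Suc.prems(1)] Suc.prems by blast
    have bK: "b \<in> K" using removable_in b by auto
    have card: "card (K - {b}) = card K - 1" using bK yideal_finite[OF Suc.prems(1)] by simp
    have "\<exists>J. yideal J \<and> I \<subseteq> J \<and> J \<subseteq> K - {b} \<and> card J = n"
    proof (rule Suc.hyps(1))
      show "d = card (K - {b}) - n" "n \<le> card (K - {b})" using Suc.hyps(2) card by auto
    qed (use Suc.prems b removable_ideal[OF b(1)] in auto)
    then show ?case by blast
  qed
  then show ?thesis using that by blast
qed

text \<open>Of two corners on one diagonal, the lower one at (i + k, j + k) forces (i + k - 1, j +
  k) into the ideal, hence also (i, j) and (i, j + 1). Then (i, j) is neither addable nor removable.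
  Consequently all poles in the partial fractions below are simple.\<close>

lemma content_inj:
  assumes I: "yideal I" and b: "b \<in> addable I \<union> removable I" and b': "b' \<in> addable I \<union> removable I"
    and c: "box_content b = box_content b'"
  shows "b = b'"
proof -
  have *: False if "(i, j) \<in> addable I \<union> removable I" "(i + k, j + k) \<in> addable I \<union> removable I" "k \<ge> 1" for i j k
  proof -
    have p: "1 \<le> i" "1 \<le> j" using that(1) yideal_pos[OF I] by (auto simp: addable_iff[OF I] removable_iff[OF I])
    have "(i + k - 1, j + k) \<in> I"
      using that p yideal_down[OF I, of "i + k" "j + k" "i + k - 1" "j + k"]
      by (auto simp: addable_iff[OF I] removable_iff[OF I])
    then have "(i, Suc j) \<in> I" "(i, j) \<in> I"
      using that p yideal_down[OF I, of "i + k - 1" "j + k" i "Suc j"] yideal_down[OF I, of "i + k - 1" "j + k" i j]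
      by auto
    then show False using that(1) by (auto simp: addable_iff[OF I] removable_iff[OF I])
  qed
  obtain i j i' j' where e: "b = (i, j)" "b' = (i', j')" by (cases b, cases b')
  have c': "int j - int i = int j' - int i'" using c by (simp add: box_content_def e)
  consider "i = i'" | "i < i'" | "i' < i" by linarith
  then show ?thesis
  proof cases
    case 1 then show ?thesis using c' e by auto
  next
    case 2
    have "i' = i + (i' - i)" "j' = j + (i' - i)" using 2 c' by auto
    moreover have "1 \<le> i' - i" using 2 by simp
    ultimately show ?thesis using *[of i j "i' - i"] b b' e by metis
  next
    case 3
    have "i = i' + (i - i')" "j = j' + (i - i')" using 3 c' by auto
    moreover have "1 \<le> i - i'" using 3 by simp
    ultimately show ?thesis using *[of i' j' "i - i'"] b b' e by metis
  qed
qed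

lemma content_inj_on: "yideal I \<Longrightarrow> inj_on box_content (addable I)" "yideal I \<Longrightarrow> inj_on box_content (removable I)"
  using content_inj by (auto simp: inj_on_def)

lemma finite_removable: "yideal I \<Longrightarrow> finite (removable I)"
  by (rule finite_subset[of _ I]) (auto simp: removable_def yideal_finite)

text \<open>Only the right and lower neighbours of the new box can become addable, each depending on
  one further box; every other box keeps its status.\<close>

lemma addable_insert:
  assumes I: "yideal I" and b: "(i, j) \<in> addable I"
  shows "addable (insert (i, j) I) = (addable I - {(i, j)})
     \<union> (if i = 1 \<or> (i - 1, Suc j) \<in> I then {(i, Suc j)} else {})
     \<union> (if j = 1 \<or> (Suc i, j - 1) \<in> I then {(Suc i, j)} else {})" (is "_ = ?R")
proof -
  have b': "(i, j) \<notin> I" "1 \<le> i" "1 \<le> j" using b by (auto simp: addable_iff[OF I])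
  have n: "(i, Suc j) \<notin> I" "(Suc i, j) \<notin> I"
    using yideal_down[OF I, of i "Suc j" i j] yideal_down[OF I, of "Suc i" j i j] b' by auto
  show ?thesis
  proof (intro set_eqI, clarify)
    fix a b
    note iffs = addable_iff[OF I] addable_iff[OF addable_ideal[OF b]]
    consider "(a, b) = (i, j)" | "(a, b) = (i, Suc j)" | "(a, b) = (Suc i, j)"
      | "(a, b) \<noteq> (i, j)" "(a, b) \<noteq> (i, Suc j)" "(a, b) \<noteq> (Suc i, j)" by blast
    then show "(a, b) \<in> addable (insert (i, j) I) \<longleftrightarrow> (a, b) \<in> ?R"
    proof cases
      case 4
      have "(a - 1, b) = (i, j) \<Longrightarrow> a = 1" "(a, b - 1) = (i, j) \<Longrightarrow> b = 1" using 4 by auto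
      then have "(a, b) \<in> addable (insert (i, j) I) \<longleftrightarrow> (a, b) \<in> addable I"
        using 4 unfolding iffs by (metis insert_iff)
      then show ?thesis using 4 by (auto split: if_splits)
    qed (use b' n in \<open>simp_all add: iffs\<close>)
  qed
qed

text \<open>The boxes above and to the left of the new box may stop being removable. They are put
  back on the left-hand side to avoid set difference. Their conditions are complementary to those in
  \<open>addable_insert\<close>, which makes the multiset count below balance.\<close>

lemma removable_insert_eq:
  assumes I: "yideal I" and b: "(i, j) \<in> addable I"
  shows "removable (insert (i, j) I) \<union> (if i = 1 \<or> (i - 1, Suc j) \<in> I then {} else {(i - 1, j)})
      \<union> (if j = 1 \<or> (Suc i, j - 1) \<in> I then {} else {(i, j - 1)}) = insert (i, j) (removable I)" (is "?L = ?R")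
proof -
  have b': "(i, j) \<notin> I" "1 \<le> i" "1 \<le> j" "i = 1 \<or> (i - 1, j) \<in> I" "j = 1 \<or> (i, j - 1) \<in> I"
    using b by (auto simp: addable_iff[OF I])
  have n: "(i, Suc j) \<notin> I" "(Suc i, j) \<notin> I"
    using yideal_down[OF I, of i "Suc j" i j] yideal_down[OF I, of "Suc i" j i j] b' by auto
  show ?thesis
  proof (intro set_eqI, clarify)
    fix a b
    note iffs = removable_iff[OF I] removable_iff[OF addable_ideal[OF b]]
    consider "(a, b) = (i, j)" | "(a, Suc b) = (i, j)" | "(Suc a, b) = (i, j)"
      | "(a, b) \<noteq> (i, j)" "(a, Suc b) \<noteq> (i, j)" "(Suc a, b) \<noteq> (i, j)" by blast
    then show "(a, b) \<in> ?L \<longleftrightarrow> (a, b) \<in> ?R"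
    proof cases
      case 2
      then show ?thesis using b' n yideal_pos[OF I, of a b] by (cases "b = 0") (auto simp: iffs)
    next
      case 3
      then show ?thesis using b' n yideal_pos[OF I, of a b] by (cases "a = 0") (auto simp: iffs)
    next
      case 4
      have "(a, b) \<in> removable (insert (i, j) I) \<longleftrightarrow> (a, b) \<in> removable I"
        using 4 unfolding iffs by (metis insert_iff)
      then show ?thesis using 4 b' by auto
    qed (use b' n in \<open>simp_all add: iffs\<close>)
  qed
qed

lemma addable_empty: "addable {} = {(1, 1)}"
  by (auto simp: addable_iff[OF yideal_empty])

lemma finite_addable: "yideal I \<Longrightarrow> finite (addable I)"
proof (induction rule: yideal_induct)
  case empty then show ?case by (simp add: addable_empty)
next
  case (insert I b)
  then show ?case by (cases b) (simp add: addable_insert)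
qed

section \<open>Interlacing of addable and removable contents\<close>

abbreviation content_mset :: "(nat \<times> nat) set \<Rightarrow> int multiset" where
  "content_mset A \<equiv> image_mset box_content (mset_set A)"

text \<open>Adding a box of content \<open>c\<close> either creates an addable box of content \<open>c + 1\<close>
  or destroys a removable one, and likewise for \<open>c - 1\<close>.\<close>

lemma content_mset_addable:
  "yideal I \<Longrightarrow> content_mset (addable I) + content_mset I + content_mset I
     = {#0#} + content_mset (removable I) + image_mset (\<lambda>b. box_content b + 1) (mset_set I)
        + image_mset (\<lambda>b. box_content b - 1) (mset_set I)"
proof (induction rule: yideal_induct)
  case empty
  then show ?case by (simp add: addable_empty removable_def box_content_def)
next
  case (insert I b)
  obtain i j where bij: "b = (i, j)" by (cases b)
  define p where "p \<longleftrightarrow> i = 1 \<or> (i - 1, Suc j) \<in> I"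
  define q where "q \<longleftrightarrow> j = 1 \<or> (Suc i, j - 1) \<in> I"
  have I: "yideal I" and b: "(i, j) \<in> addable I" using insert bij by auto
  have b': "(i, j) \<notin> I" "1 \<le> i" "1 \<le> j" "i = 1 \<or> (i - 1, j) \<in> I" "j = 1 \<or> (i, j - 1) \<in> I"
    using b by (auto simp: addable_iff[OF I])
  have n: "(i, Suc j) \<notin> I" "(Suc i, j) \<notin> I"
    using yideal_down[OF I, of i "Suc j" i j] yideal_down[OF I, of "Suc i" j i j] b' by auto
  note fin = yideal_finite[OF I] finite_addable[OF I] finite_removable[OF I]
    finite_removable[OF addable_ideal[OF b]]
  have n2: "(i, Suc j) \<notin> addable I" "(Suc i, j) \<notin> addable I"
    using b' by (auto simp: addable_iff[OF I])
  have n3: "(i, j) \<notin> removable I" using b' by (auto simp: removable_def)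
  have c: "box_content (i, Suc j) = box_content b + 1" "box_content (Suc i, j) = box_content b - 1"
    "i \<noteq> 1 \<Longrightarrow> box_content (i - 1, j) = box_content b + 1"
    "j \<noteq> 1 \<Longrightarrow> box_content (i, j - 1) = box_content b - 1"
    using b' by (auto simp: box_content_def bij)
  \<comment> \<open>The lost content is added on the left because truncated multiset subtraction
    would not cancel.\<close>
  have e1: "content_mset (addable (insert b I)) + {#box_content b#}
      = content_mset (addable I) + (if p then {#box_content b + 1#} else {#}) + (if q then {#box_content b - 1#} else {#})"
  proof -
    have "addable (insert b I) = (addable I - {b}) \<union> (if p then {(i, Suc j)} else {}) \<union> (if q then {(Suc i, j)} else {})"
      unfolding bij addable_insert[OF I b] p_def q_def ..
    then have "content_mset (addable (insert b I)) = content_mset (addable I - {b})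
        + (if p then {#box_content b + 1#} else {#}) + (if q then {#box_content b - 1#} else {#})"
      using fin n2 c by auto
    moreover have "content_mset (addable I) = content_mset (addable I - {b}) + {#box_content b#}"
      using mset_set.remove[OF fin(2) b] by (simp add: bij)
    ultimately show ?thesis by simp
  qed
  have r: "(i - 1, j) \<notin> removable (insert b I)" if "\<not> p"
    using that b' by (auto simp: p_def bij removable_iff[OF addable_ideal[OF b]])
  have r': "(i, j - 1) \<notin> removable (insert b I)" if "\<not> q"
    using that b' by (auto simp: q_def bij removable_iff[OF addable_ideal[OF b]])
  have pq: "\<not> p \<Longrightarrow> i \<noteq> 1" "\<not> q \<Longrightarrow> j \<noteq> 1" by (auto simp: p_def q_def)
  have e2: "content_mset (removable (insert b I)) + (if p then {#} else {#box_content b + 1#})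
       + (if q then {#} else {#box_content b - 1#}) = content_mset (removable I) + {#box_content b#}"
  proof -
    have "(i - 1, j) \<noteq> (i, j - 1)" using b' by auto
    then have "content_mset (removable (insert b I) \<union> (if p then {} else {(i - 1, j)})
      \<union> (if q then {} else {(i, j - 1)})) = content_mset (removable (insert b I)) + (if p then {#} else {#box_content b + 1#})
       + (if q then {#} else {#box_content b - 1#})"
      using r r' fin(4) c(3,4) pq by (cases p; cases q) (auto simp: bij)
    moreover have "content_mset (insert (i, j) (removable I)) = content_mset (removable I) + {#box_content b#}"
      using n3 fin by (simp add: bij)
    ultimately show ?thesis
      using removable_insert_eq[OF I b] unfolding bij p_def q_def by simp
  qed
  have e3: "mset_set (insert b I) = mset_set I + {#b#}" using b' fin bij by simp
  show ?case
  proof (rule multiset_eqI)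
    fix x
    \<comment> \<open>Of the two conditionals, one in \<open>e1\<close> and the other in
      \<open>e2\<close>, exactly one is nonempty, so together they always contribute the shifted
      content once.\<close>
    have p: "count (if p then {#box_content b + 1#} else {#}) x + count (if p then {#} else {#box_content b + 1#}) x
        = count {#box_content b + 1#} x" by simp
    have q: "count (if q then {#box_content b - 1#} else {#}) x + count (if q then {#} else {#box_content b - 1#}) x
        = count {#box_content b - 1#} x" by simp
    show "count (content_mset (addable (insert b I)) + content_mset (insert b I) + content_mset (insert b I)) x =
      count ({#0#} + content_mset (removable (insert b I)) + image_mset (\<lambda>b. box_content b + 1) (mset_set (insert b I))
        + image_mset (\<lambda>b. box_content b - 1) (mset_set (insert b I))) x"
      using arg_cong[OF e1, of "\<lambda>m. count m x"] arg_cong[OF e2, of "\<lambda>m. count m x"]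
        arg_cong[OF insert.IH, of "\<lambda>m. count m x"] p q
      unfolding e3 image_mset_union image_mset_single count_union by linarith
  qed
qed

text \<open>Each box contributes a second difference of \<open>w\<close>. For constant
  \<open>w\<close> the corner counts differ by one, for linear \<open>w\<close> the content sums
  agree, and for quadratic \<open>w\<close> the box terms are constant.\<close>

lemma sum_addable_minus_removable:
  fixes w :: "int \<Rightarrow> real"
  assumes "yideal I"
  shows "(\<Sum>b\<in>addable I. w (box_content b)) - (\<Sum>b\<in>removable I. w (box_content b))
    = w 0 + (\<Sum>b\<in>I. w (box_content b + 1) - 2 * w (box_content b) + w (box_content b - 1))"
proof -
  have "(\<Sum>x\<in>#content_mset (addable I) + content_mset I + content_mset I. w x)
    = (\<Sum>x\<in>#{#0#} + content_mset (removable I) + image_mset (\<lambda>b. box_content b + 1) (mset_set I)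
        + image_mset (\<lambda>b. box_content b - 1) (mset_set I). w x)"
    by (simp only: content_mset_addable[OF assms])
  then have "(\<Sum>b\<in>addable I. w (box_content b)) + (\<Sum>b\<in>I. w (box_content b)) + (\<Sum>b\<in>I. w (box_content b))
    = w 0 + (\<Sum>b\<in>removable I. w (box_content b)) + (\<Sum>b\<in>I. w (box_content b + 1)) + (\<Sum>b\<in>I. w (box_content b - 1))"
    by (simp add: sum_unfold_sum_mset image_mset.compositionality comp_def)
  then show ?thesis by (simp add: sum.distrib sum_subtractf sum_distrib_left[symmetric])
qed

lemma prod_addable_removable:
  fixes w :: "int \<Rightarrow> real"
  assumes "yideal I"
  shows "(\<Prod>b\<in>addable I. w (box_content b)) * (\<Prod>b\<in>I. (w (box_content b))\<^sup>2)
    = w 0 * (\<Prod>b\<in>removable I. w (box_content b)) * (\<Prod>b\<in>I. w (box_content b + 1) * w (box_content b - 1))"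
proof -
  have "(\<Prod>x\<in>#content_mset (addable I) + content_mset I + content_mset I. w x)
    = (\<Prod>x\<in>#{#0#} + content_mset (removable I) + image_mset (\<lambda>b. box_content b + 1) (mset_set I)
        + image_mset (\<lambda>b. box_content b - 1) (mset_set I). w x)"
    by (simp only: content_mset_addable[OF assms])
  then show ?thesis
    by (simp add: prod_unfold_prod_mset image_mset.compositionality comp_def power2_eq_square mult_ac prod_mset.distrib)
qed

lemma yideal_Un: "yideal I \<Longrightarrow> yideal J \<Longrightarrow> yideal (I \<union> J)"
  unfolding yideal_def by (metis Un_iff finite_Un)

lemma yideal_Int: "yideal I \<Longrightarrow> yideal J \<Longrightarrow> yideal (I \<inter> J)"
  unfolding yideal_def by (metis Int_iff finite_Int)

section \<open>Standard tableaux and the branching rule\<close>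

definition ideal_SYT :: "(nat \<times> nat) set \<Rightarrow> ((nat \<times> nat) \<Rightarrow> nat) set" where
  "ideal_SYT I = {T. T \<in> I \<rightarrow>\<^sub>E {1..card I} \<and> bij_betw T I {1..card I}
      \<and> (\<forall>i j. (i, j) \<in> I \<and> (i, Suc j) \<in> I \<longrightarrow> T (i, j) < T (i, Suc j))
      \<and> (\<forall>i j. (i, j) \<in> I \<and> (Suc i, j) \<in> I \<longrightarrow> T (i, j) < T (Suc i, j))}"

definition ideal_dim :: "(nat \<times> nat) set \<Rightarrow> real" where
  "ideal_dim I = real (card (ideal_SYT I))"

lemma finite_ideal_SYT: "finite I \<Longrightarrow> finite (ideal_SYT I)"
  by (rule finite_subset[of _ "I \<rightarrow>\<^sub>E {1..card I}"]) (auto simp: ideal_SYT_def intro: finite_PiE)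

lemma ideal_dim_empty: "ideal_dim {} = 1"
  by (simp add: ideal_dim_def ideal_SYT_def bij_betw_def)

lemma ideal_SYT_update:
  assumes I: "yideal I" and b: "b \<in> removable I" and T: "T \<in> ideal_SYT (I - {b})"
  shows "T(b := card I) \<in> ideal_SYT I"
proof -
  have fin: "finite I" and bI: "b \<in> I" using yideal_finite[OF I] removable_in[OF b] by auto
  have c: "card (I - {b}) = card I - 1" and pos: "card I \<ge> 1"
    using fin bI by (auto simp: Suc_le_eq card_gt_0_iff)
  from T have T1: "T \<in> I - {b} \<rightarrow>\<^sub>E {1..card I - 1}" and T2: "bij_betw T (I - {b}) {1..card I - 1}"
    and T3: "\<And>i j. (i, j) \<in> I - {b} \<Longrightarrow> (i, Suc j) \<in> I - {b} \<Longrightarrow> T (i, j) < T (i, Suc j)"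
    and T4: "\<And>i j. (i, j) \<in> I - {b} \<Longrightarrow> (Suc i, j) \<in> I - {b} \<Longrightarrow> T (i, j) < T (Suc i, j)"
    by (auto simp: ideal_SYT_def c)
  let ?S = "T(b := card I)"
  have e1: "insert b (I - {b}) = I" "insert (card I) {1..card I - 1} = {1..card I}"
    using bI pos by auto
  have "bij_betw ?S (I - {b}) {1..card I - 1}"
    using T2 by (rule bij_betw_cong[THEN iffD1, rotated]) auto
  then have "bij_betw ?S (insert b (I - {b})) (insert (?S b) {1..card I - 1})"
    using pos notIn_Un_bij_betw[of b "I - {b}" ?S "{1..card I - 1}"] by simp
  then have B: "bij_betw ?S I {1..card I}" using e1 by simp
  have lt: "T x < card I" if "x \<in> I" "x \<noteq> b" for x
    using PiE_mem[OF T1, of x] that pos by auto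
  have E: "?S \<in> I \<rightarrow>\<^sub>E {1..card I}"
    using B T1 bI by (auto simp: bij_betw_def PiE_iff extensional_def)
  obtain i0 j0 where b0: "b = (i0, j0)" by (cases b)
  have nb: "(i0, Suc j0) \<notin> I" "(Suc i0, j0) \<notin> I" using b b0 by (auto simp: removable_iff[OF I])
  show ?thesis
    unfolding ideal_SYT_def
    using B E lt T3 T4 nb b0 by auto
qed

text \<open>The largest entry has no room for a larger right or lower neighbour, so it sits in a
  corner; deleting it leaves a tableau of the smaller ideal.\<close>

lemma ideal_SYT_last:
  assumes I: "yideal I" and ne: "I \<noteq> {}" and S: "S \<in> ideal_SYT I"
  obtains b T where "b \<in> removable I" "T \<in> ideal_SYT (I - {b})" "S = T(b := card I)"
proof -
  have fin: "finite I" using yideal_finite[OF I] .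
  have pos: "card I \<ge> 1" using fin ne by (simp add: Suc_le_eq card_gt_0_iff)
  from S have S1: "S \<in> I \<rightarrow>\<^sub>E {1..card I}" and S2: "bij_betw S I {1..card I}"
    and S3: "\<And>i j. (i, j) \<in> I \<Longrightarrow> (i, Suc j) \<in> I \<Longrightarrow> S (i, j) < S (i, Suc j)"
    and S4: "\<And>i j. (i, j) \<in> I \<Longrightarrow> (Suc i, j) \<in> I \<Longrightarrow> S (i, j) < S (Suc i, j)"
    by (auto simp: ideal_SYT_def)
  have "card I \<in> S ` I" using S2 pos by (simp add: bij_betw_def)
  then obtain b where b: "b \<in> I" "S b = card I" by auto
  obtain i j where bij: "b = (i, j)" by (cases b)
  have le: "S x \<le> card I" if "x \<in> I" for x using S1 that by (auto simp: PiE_iff)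
  have rem: "b \<in> removable I"
    unfolding bij removable_iff[OF I] using b bij S3[of i j] S4[of i j] le by fastforce
  let ?T = "S(b := undefined)"
  have c: "card (I - {b}) = card I - 1" using b fin by simp
  have "bij_betw S (I - {b}) ({1..card I} - {S b})" 
    using b le[OF b(1)] pos by (intro bij_betw_DiffI[OF S2]) (auto simp: bij_betw_def)
  moreover have "{1..card I} - {S b} = {1..card I - 1}" using b pos by auto
  ultimately have "bij_betw S (I - {b}) {1..card I - 1}" by simp
  then have B: "bij_betw ?T (I - {b}) {1..card I - 1}"
    by (rule bij_betw_cong[THEN iffD1, rotated]) auto
  have E: "?T \<in> I - {b} \<rightarrow>\<^sub>E {1..card I - 1}"
    using B S1 by (auto simp: bij_betw_def PiE_iff extensional_def)
  have "?T \<in> ideal_SYT (I - {b})"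
    unfolding ideal_SYT_def c using B E S3 S4 by auto
  moreover have "S = ?T(b := card I)" using b by auto
  ultimately show ?thesis using rem that by blast
qed

text \<open>Tableaux are classified by the corner that holds the largest entry. Entries are
  injective, so the classes are disjoint.\<close>

lemma ideal_dim_rec:
  assumes I: "yideal I" and ne: "I \<noteq> {}"
  shows "ideal_dim I = (\<Sum>b\<in>removable I. ideal_dim (I - {b}))"
proof -
  let ?f = "\<lambda>b T. T(b := card I)"
  have fin: "finite I" using yideal_finite[OF I] .
  have eq: "ideal_SYT I = (\<Union>b\<in>removable I. ?f b ` ideal_SYT (I - {b}))"
  proof
    show "ideal_SYT I \<subseteq> (\<Union>b\<in>removable I. ?f b ` ideal_SYT (I - {b}))"
      using ideal_SYT_last[OF I ne] by blast
    show "(\<Union>b\<in>removable I. ?f b ` ideal_SYT (I - {b})) \<subseteq> ideal_SYT I"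
      using ideal_SYT_update[OF I] by blast
  qed
  have inj: "inj_on (?f b) (ideal_SYT (I - {b}))" for b
  proof (rule inj_onI)
    fix T T' assume T: "T \<in> ideal_SYT (I - {b})" "T' \<in> ideal_SYT (I - {b})" "?f b T = ?f b T'"
    have "T b = undefined" "T' b = undefined" using T(1,2) PiE_arb[of T "I - {b}" _ b] PiE_arb[of T' "I - {b}" _ b]
      by (auto simp: ideal_SYT_def)
    then show "T = T'" using T(3) by (metis fun_upd_triv fun_upd_upd)
  qed
  have disj: "?f b ` ideal_SYT (I - {b}) \<inter> ?f b' ` ideal_SYT (I - {b'}) = {}"
    if "b \<in> removable I" "b' \<in> removable I" "b \<noteq> b'" for b b'
  proof -
    have False if S: "S \<in> ideal_SYT I" "S b = card I" "S b' = card I" for S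
      using S \<open>b \<noteq> b'\<close> removable_in[OF \<open>b \<in> removable I\<close>] removable_in[OF \<open>b' \<in> removable I\<close>]
      by (metis (no_types, lifting) bij_betw_imp_inj_on ideal_SYT_def inj_on_def mem_Collect_eq)
    moreover have "S b = card I" "S \<in> ideal_SYT I" if "S \<in> ?f b ` ideal_SYT (I - {b})" for S
      using that ideal_SYT_update[OF I \<open>b \<in> removable I\<close>] by auto
    moreover have "S b' = card I" if "S \<in> ?f b' ` ideal_SYT (I - {b'})" for S
      using that by auto
    ultimately show ?thesis by blast
  qed
  have "card (ideal_SYT I) = (\<Sum>b\<in>removable I. card (?f b ` ideal_SYT (I - {b})))"
    unfolding eq using finite_removable[OF I] fin disj
    by (intro card_UN_disjoint) (auto intro!: finite_imageI finite_ideal_SYT)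
  also have "\<dots> = (\<Sum>b\<in>removable I. card (ideal_SYT (I - {b})))"
    by (intro sum.cong refl card_image inj)
  finally show ?thesis by (simp add: ideal_dim_def)
qed

lemma ideal_dim_pos: "yideal I \<Longrightarrow> ideal_dim I > 0"
proof (induction rule: yideal_induct)
  case empty
  then show ?case by (simp add: ideal_dim_empty)
next
  case (insert I b)
  have J: "yideal (insert b I)" using insert addable_ideal by blast
  have "ideal_dim I \<le> (\<Sum>b'\<in>removable (insert b I). ideal_dim (insert b I - {b'}))"
    using member_le_sum[of b "removable (insert b I)" "\<lambda>b'. ideal_dim (insert b I - {b'})"]
      removable_insert[OF insert(1,2)] finite_removable[OF J] addable_notin[OF insert(2)]
    by (auto simp: ideal_dim_def)
  then show ?case using insert ideal_dim_rec[OF J] by auto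
qed

text \<open>The unnormalised transition measure of Plancherel growth, integrated against
  \<open>w\<close>. Its total mass is (|I| + 1) dim I, the constant case of
  \<open>up_sum_quadratic\<close>.\<close>

definition up_sum :: "(int \<Rightarrow> real) \<Rightarrow> (nat \<times> nat) set \<Rightarrow> real" where
  "up_sum w I = (\<Sum>b\<in>addable I. w (box_content b) * ideal_dim (insert b I))"

text \<open>Adding \<open>b\<close> and removing a different \<open>b'\<close> can be done in either
  order. Intersection and union of \<open>I\<close> with the moved ideal are the two intermediate
  shapes, so both are ideals as soon as the end result is one.\<close>

lemma move_box_commute:
  assumes I: "yideal I"
  shows "(SIGMA b:addable I. removable (insert b I) - {b})
     = prod.swap ` (SIGMA b':removable I. addable (I - {b'}) - {b'})"
proof -
  have "b \<in> addable I \<and> b' \<in> removable (insert b I) - {b} \<longleftrightarrow> b' \<in> removable I \<and> b \<in> addable (I - {b'}) - {b'}"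
    for b b'
  proof (cases "b = b' \<or> b \<in> I \<or> b' \<notin> I")
    case True
    then show ?thesis by (auto simp: addable_def removable_def)
  next
    case False
    have e: "insert b I - {b'} = insert b (I - {b'})" "I \<inter> insert b (I - {b'}) = I - {b'}"
      "I \<union> insert b (I - {b'}) = insert b I" using False by auto
    have i: "yideal (insert b (I - {b'})) \<Longrightarrow> yideal (I - {b'})" "yideal (insert b (I - {b'})) \<Longrightarrow> yideal (insert b I)"
      using yideal_Int[OF I, of "insert b (I - {b'})"] yideal_Un[OF I, of "insert b (I - {b'})"] unfolding e by auto
    have "b \<in> addable I \<and> b' \<in> removable (insert b I) - {b} \<longleftrightarrow> yideal (insert b I) \<and> yideal (insert b (I - {b'}))"
      using False by (auto simp: addable_def removable_def e(1))
    also have "\<dots> \<longleftrightarrow> b' \<in> removable I \<and> b \<in> addable (I - {b'}) - {b'}"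
      using False i by (auto simp: addable_def removable_def)
    finally show ?thesis .
  qed
  note * = this
  show ?thesis
  proof (rule set_eqI)
    fix x :: "(nat \<times> nat) \<times> (nat \<times> nat)"
    obtain b b' where x: "x = (b, b')" by (cases x)
    have "x \<in> prod.swap ` (SIGMA b':removable I. addable (I - {b'}) - {b'})
        \<longleftrightarrow> (b', b) \<in> (SIGMA b':removable I. addable (I - {b'}) - {b'})"
      unfolding x by force
    then show "x \<in> (SIGMA b:addable I. removable (insert b I) - {b}) \<longleftrightarrow>
        x \<in> prod.swap ` (SIGMA b':removable I. addable (I - {b'}) - {b'})"
      using *[of b b'] unfolding x by simp
  qed
qed

text \<open>Apply the branching rule to each enlarged ideal. Removing the box just added returns
  \<open>I\<close> and gives the addable sum. The remaining terms are reordered by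
  \<open>move_box_commute\<close>; compared with the sums over \<open>I - {b'}\<close> they lack
  only the terms that re-add \<open>b'\<close>, which give the removable sum.\<close>

lemma up_sum_rec:
  assumes I: "yideal I"
  shows "up_sum w I = ((\<Sum>b\<in>addable I. w (box_content b)) - (\<Sum>b\<in>removable I. w (box_content b))) * ideal_dim I
     + (\<Sum>b'\<in>removable I. up_sum w (I - {b'}))"
proof -
  let ?g = "\<lambda>b b'. w (box_content b) * ideal_dim (insert b I - {b'})"
  let ?S = "SIGMA b:addable I. removable (insert b I) - {b}"
  have fa: "finite (addable I)" "finite (removable I)" using finite_addable[OF I] finite_removable[OF I] by auto
  have 1: "up_sum w I = (\<Sum>b\<in>addable I. w (box_content b)) * ideal_dim I + (\<Sum>(b, b')\<in>?S. ?g b b')"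
  proof -
    have "w (box_content b) * ideal_dim (insert b I)
        = w (box_content b) * ideal_dim I + (\<Sum>b'\<in>removable (insert b I) - {b}. ?g b b')"
      if b: "b \<in> addable I" for b
    proof -
      have J: "yideal (insert b I)" using addable_ideal b by blast
      have "ideal_dim (insert b I) = ideal_dim (insert b I - {b}) + (\<Sum>b'\<in>removable (insert b I) - {b}. ideal_dim (insert b I - {b'}))"
        unfolding ideal_dim_rec[OF J insert_not_empty]
        by (rule sum.remove[OF finite_removable[OF J] removable_insert[OF I b]])
      then show ?thesis using addable_notin[OF b] by (simp add: algebra_simps sum_distrib_left)
    qed
    moreover have "(\<Sum>(b, b')\<in>?S. ?g b b') = (\<Sum>b\<in>addable I. \<Sum>b'\<in>removable (insert b I) - {b}. ?g b b')"
      using fa finite_removable addable_ideal by (subst sum.Sigma) (auto simp: finite_removable addable_ideal)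
    ultimately show ?thesis
      by (simp add: up_sum_def sum.distrib sum_distrib_right)
  qed
  have 2: "(\<Sum>b'\<in>removable I. up_sum w (I - {b'})) = (\<Sum>b\<in>removable I. w (box_content b)) * ideal_dim I
      + (\<Sum>(b, b')\<in>?S. ?g b b')"
  proof -
    have "up_sum w (I - {b'}) = w (box_content b') * ideal_dim I + (\<Sum>b\<in>addable (I - {b'}) - {b'}. ?g b b')"
      if b': "b' \<in> removable I" for b'
    proof -
      have K: "yideal (I - {b'})" using removable_ideal b' by blast
      have "up_sum w (I - {b'}) = w (box_content b') * ideal_dim (insert b' (I - {b'}))
          + (\<Sum>b\<in>addable (I - {b'}) - {b'}. w (box_content b) * ideal_dim (insert b (I - {b'})))"
        unfolding up_sum_def by (rule sum.remove[OF finite_addable[OF K] addable_remove[OF I b']])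
      also have "insert b' (I - {b'}) = I" using removable_in[OF b'] by auto
      also have "(\<Sum>b\<in>addable (I - {b'}) - {b'}. w (box_content b) * ideal_dim (insert b (I - {b'})))
         = (\<Sum>b\<in>addable (I - {b'}) - {b'}. ?g b b')"
        by (intro sum.cong refl) (auto simp: insert_Diff_if)
      finally show ?thesis .
    qed
    moreover have "(\<Sum>(b, b')\<in>?S. ?g b b') = (\<Sum>b'\<in>removable I. \<Sum>b\<in>addable (I - {b'}) - {b'}. ?g b b')"
    proof -
      have "(\<Sum>(b, b')\<in>?S. ?g b b') = (\<Sum>(b', b)\<in>(SIGMA b':removable I. addable (I - {b'}) - {b'}). ?g b b')"
        unfolding move_box_commute[OF I]
        by (subst sum.reindex) (auto simp: inj_on_def case_prod_unfold)
      also have "\<dots> = (\<Sum>b'\<in>removable I. \<Sum>b\<in>addable (I - {b'}) - {b'}. ?g b b')"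
        using fa by (subst sum.Sigma) (auto simp: finite_addable removable_ideal)
      finally show ?thesis .
    qed
    ultimately show ?thesis
      by (simp add: sum.distrib sum_distrib_right)
  qed
  show ?thesis unfolding 1 2 by (simp add: algebra_simps)
qed

section \<open>Kerov's identities for transition and co-transition measures\<close>

abbreviation rcontent :: "nat \<times> nat \<Rightarrow> real" where
  "rcontent b \<equiv> real_of_int (box_content b)"

definition content_R :: "(nat \<times> nat) set \<Rightarrow> real \<Rightarrow> real" where
  "content_R I u = (\<Prod>b\<in>I. 1 - 1 / (u - rcontent b)\<^sup>2)"

text \<open>The quotient of the monic polynomials with roots at the addable and at the removable
  contents, see \<open>content_Q_addable_removable\<close>. By \<open>kerov_up\<close> it is the
  reciprocal of the Cauchy transform of the transition measure.\<close>

definition content_Q :: "(nat \<times> nat) set \<Rightarrow> real \<Rightarrow> real" where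
  "content_Q I u = u * content_R I u"

lemma nonint_diff: "u \<notin> \<int> \<Longrightarrow> u - real_of_int k \<noteq> 0"
  by (metis Ints_of_int eq_iff_diff_eq_0)

lemma nonint_sq_diff: "u \<notin> \<int> \<Longrightarrow> (u - real_of_int k)\<^sup>2 - 1 \<noteq> 0"
proof
  assume u: "u \<notin> \<int>" and "(u - real_of_int k)\<^sup>2 - 1 = 0"
  then have "u - real_of_int (k + 1) = 0 \<or> u - real_of_int (k - 1) = 0" by (auto simp: power2_eq_1_iff)
  then show False using nonint_diff[OF u, of "k + 1"] nonint_diff[OF u, of "k - 1"] by blast
qed

lemma content_R_nonzero: "u \<notin> \<int> \<Longrightarrow> finite I \<Longrightarrow> content_R I u \<noteq> 0"
  unfolding content_R_def using nonint_sq_diff nonint_diff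
  by (auto simp: field_simps)

lemma content_Q_nonzero: "u \<notin> \<int> \<Longrightarrow> finite I \<Longrightarrow> content_Q I u \<noteq> 0"
  using content_R_nonzero nonint_diff[of u 0] by (simp add: content_Q_def)

lemma content_Q_insert:
  "finite I \<Longrightarrow> b \<notin> I \<Longrightarrow> content_Q (insert b I) u = content_Q I u * (1 - 1 / (u - rcontent b)\<^sup>2)"
  by (simp add: content_Q_def content_R_def)

text \<open>This is \<open>prod_addable_removable\<close> with factor u - x, since (u - c - 1)(u - c
  + 1) equals (u - c)^2 times the factor of \<open>content_R\<close>.\<close>

lemma content_Q_addable_removable:
  assumes I: "yideal I" and u: "u \<notin> \<int>"
  shows "content_Q I u * (\<Prod>b\<in>removable I. u - rcontent b) = (\<Prod>b\<in>addable I. u - rcontent b)"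
proof -
  let ?w = "\<lambda>x. u - real_of_int x"
  have nz: "(\<Prod>b\<in>I. (u - rcontent b)\<^sup>2) \<noteq> 0"
    using nonint_diff[OF u] yideal_finite[OF I] by simp
  have "(\<Prod>b\<in>I. ?w (box_content b + 1) * ?w (box_content b - 1)) = (\<Prod>b\<in>I. (1 - 1 / (u - rcontent b)\<^sup>2) * (u - rcontent b)\<^sup>2)"
  proof (intro prod.cong refl)
    fix b assume "b \<in> I"
    have gen: "(c - 1) * (c + 1) = (1 - 1 / c\<^sup>2) * c\<^sup>2" if "c \<noteq> 0" for c :: real
      using that by (simp add: field_simps power2_eq_square)
    show "?w (box_content b + 1) * ?w (box_content b - 1) = (1 - 1 / (u - rcontent b)\<^sup>2) * (u - rcontent b)\<^sup>2"
      using gen[OF nonint_diff[OF u, of "box_content b"]] by (simp add: algebra_simps)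
  qed
  also have "\<dots> = content_R I u * (\<Prod>b\<in>I. (u - rcontent b)\<^sup>2)"
    by (simp add: content_R_def prod.distrib)
  finally have "(\<Prod>b\<in>addable I. u - rcontent b) * (\<Prod>b\<in>I. (u - rcontent b)\<^sup>2)
    = (content_Q I u * (\<Prod>b\<in>removable I. u - rcontent b)) * (\<Prod>b\<in>I. (u - rcontent b)\<^sup>2)"
    using prod_addable_removable[OF I, of ?w] by (simp add: content_Q_def mult_ac)
  then show ?thesis using nz by simp
qed

lemma degree_prod_linear:
  fixes S :: "real set"
  assumes "finite S" shows "degree (\<Prod>x\<in>S. [:- x, 1:]) = card S" "coeff (\<Prod>x\<in>S. [:- x, 1:]) (card S) = 1"
proof -
  show 1: "degree (\<Prod>x\<in>S. [:- x, 1:]) = card S"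
    by (subst degree_prod_eq_sum_degree) auto
  show "coeff (\<Prod>x\<in>S. [:- x, 1:]) (card S) = 1"
    using lead_coeff_prod[of "\<lambda>x. [:- x, 1:]" S] by (simp add: 1)
qed

lemma coeff_prod_linear_pred:
  fixes S :: "real set"
  assumes "finite S" "S \<noteq> {}"
  shows "coeff (\<Prod>x\<in>S. [:- x, 1:]) (card S - 1) = - \<Sum>S"
  using assms
proof (induction rule: finite_ne_induct)
  case (singleton x)
  then show ?case by simp
next
  case (insert x S)
  then obtain k where k: "card S = Suc k" by (metis card_eq_0_iff not0_implies_Suc)
  show ?case
    using insert degree_prod_linear(2)[OF insert(1)] k by simp
qed

text \<open>The Lagrange interpolant \<open>q\<close> agrees with \<open>p\<close> at more points
  than either degree, so they coincide; dividing by the node polynomial gives the claim.\<close>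

lemma partial_fractions:
  fixes Y :: "real set"
  assumes fin: "finite Y" and deg: "degree p < card Y" and u: "u \<notin> Y"
  shows "poly p u / (\<Prod>y\<in>Y. u - y) = (\<Sum>c\<in>Y. poly p c / (\<Prod>y\<in>Y - {c}. c - y) / (u - c))"
proof -
  define q where "q = (\<Sum>c\<in>Y. smult (poly p c / (\<Prod>y\<in>Y - {c}. c - y)) (\<Prod>y\<in>Y - {c}. [:- y, 1:]))"
  have pr: "poly (\<Prod>y\<in>A. [:- y, 1:]) x = (\<Prod>y\<in>A. x - y)" for A :: "real set" and x
    by (simp add: poly_prod)
  have "degree q \<le> card Y - 1"
    unfolding q_def
  proof (rule degree_sum_le[OF fin])
    fix c assume "c \<in> Y"
    then show "degree (smult (poly p c / (\<Prod>y\<in>Y - {c}. c - y)) (\<Prod>y\<in>Y - {c}. [:- y, 1:])) \<le> card Y - 1"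
      using degree_prod_linear(1)[of "Y - {c}"] fin by simp
  qed
  then have dq: "degree q < card Y" using deg by linarith
  have "poly q x = poly p x" if x: "x \<in> Y" for x
  proof -
    have "poly q x = (\<Sum>c\<in>Y. poly p c / (\<Prod>y\<in>Y - {c}. c - y) * (\<Prod>y\<in>Y - {c}. x - y))"
      by (simp add: q_def poly_sum pr)
    also have "\<dots> = (\<Sum>c\<in>Y. if c = x then poly p x else 0)"
    proof (intro sum.cong refl)
      fix c assume "c \<in> Y"
      have "c \<noteq> x \<Longrightarrow> (\<Prod>y\<in>Y - {c}. x - y) = 0" using x fin by (intro prod_zero) auto
      moreover have "(\<Prod>y\<in>Y - {x}. x - y) \<noteq> 0" using fin by auto
      ultimately show "poly p c / (\<Prod>y\<in>Y - {c}. c - y) * (\<Prod>y\<in>Y - {c}. x - y) = (if c = x then poly p x else 0)"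
        by auto
    qed
    finally show ?thesis using x fin by simp
  qed
  then have "q = p" using dq deg by (intro poly_eqI_degree[of Y]) auto
  moreover have "poly q u = (\<Sum>c\<in>Y. poly p c / (\<Prod>y\<in>Y - {c}. c - y) * (\<Prod>y\<in>Y - {c}. u - y))"
    by (simp add: q_def poly_sum pr)
  ultimately have "poly p u / (\<Prod>y\<in>Y. u - y) = (\<Sum>c\<in>Y. poly p c / (\<Prod>y\<in>Y - {c}. c - y) * (\<Prod>y\<in>Y - {c}. u - y)) / (\<Prod>y\<in>Y. u - y)"
    by simp
  also have "\<dots> = (\<Sum>c\<in>Y. poly p c / (\<Prod>y\<in>Y - {c}. c - y) / (u - c))"
    unfolding sum_divide_distrib
  proof (intro sum.cong refl)
    fix c assume c: "c \<in> Y"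
    have "(\<Prod>y\<in>Y. u - y) = (u - c) * (\<Prod>y\<in>Y - {c}. u - y)" by (rule prod.remove[OF fin c])
    moreover have "(\<Prod>y\<in>Y - {c}. u - y) \<noteq> 0" using u fin by auto
    ultimately show "poly p c / (\<Prod>y\<in>Y - {c}. c - y) * (\<Prod>y\<in>Y - {c}. u - y) / (\<Prod>y\<in>Y. u - y)
        = poly p c / (\<Prod>y\<in>Y - {c}. c - y) / (u - c)" by simp
  qed
  finally show ?thesis .
qed

lemma eventually_at_int_nonint: "eventually (\<lambda>u::real. u \<notin> \<int>) (at (real_of_int c))"
proof -
  have "u \<notin> \<int>" if "u \<noteq> real_of_int c" "dist u (real_of_int c) < 1" for u :: real
  proof
    assume "u \<in> \<int>"
    then obtain k where k: "u = real_of_int k" by (auto elim: Ints_cases)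
    then have "\<bar>k - c\<bar> < 1" using that(2) by (simp add: dist_real_def)
    then show False using that k by auto
  qed
  then show ?thesis unfolding eventually_at by (intro exI[of _ 1]) auto
qed

lemma sum_rcontent_addable:
  assumes I: "yideal I"
  shows "real (card (addable I)) = real (card (removable I)) + 1"
    "(\<Sum>b\<in>addable I. rcontent b) = (\<Sum>b\<in>removable I. rcontent b)"
proof -
  show "real (card (addable I)) = real (card (removable I)) + 1"
    using sum_addable_minus_removable[OF I, of "\<lambda>_. 1"] by simp
  show "(\<Sum>b\<in>addable I. rcontent b) = (\<Sum>b\<in>removable I. rcontent b)"
    using sum_addable_minus_removable[OF I, of real_of_int] by simp
qed

text \<open>Lagrange interpolation at the removable contents; the two leading coefficients cancel.\<close>

lemma removable_partial_fractions:
  assumes I: "yideal I" and ne: "I \<noteq> {}" and u: "u \<notin> \<int>"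
  shows "u - content_Q I u = (\<Sum>b\<in>removable I. - (\<Prod>a\<in>addable I. rcontent b - rcontent a)
      / (\<Prod>a\<in>removable I - {b}. rcontent b - rcontent a) / (u - rcontent b))"
proof -
  define X where "X = rcontent ` addable I"
  define Y where "Y = rcontent ` removable I"
  have iX: "inj_on rcontent (addable I)" and iY: "inj_on rcontent (removable I)"
    using content_inj_on[OF I] by (auto simp: inj_on_def)
  have fX: "finite X" and fY: "finite Y" using finite_addable[OF I] finite_removable[OF I] by (auto simp: X_def Y_def)
  have cX: "card X = card Y + 1" using sum_rcontent_addable(1)[OF I] iX iY by (simp add: X_def Y_def card_image)
  have sX: "\<Sum>X = \<Sum>Y" using sum_rcontent_addable(2)[OF I] iX iY by (simp add: X_def Y_def sum.reindex)
  have neY: "Y \<noteq> {}" using removable_nonempty[OF I ne] by (simp add: Y_def)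
  then have cY: "card Y > 0" using fY by (simp add: card_gt_0_iff)
  have neX: "X \<noteq> {}" using cX by auto
  let ?A = "\<Prod>x\<in>X. [:- x, 1:]" and ?B = "\<Prod>y\<in>Y. [:- y, 1:]"
  define p where "p = pCons 0 ?B - ?A"
  \<comment> \<open>At degree card Y + 1 both products are monic; at degree card Y the coefficients
    are minus the content sums, which agree. So the degree of \<open>p\<close> falls below the
    number of nodes.\<close>
  have "coeff p k = 0" if k: "k > card Y - 1" for k
  proof -
    consider "k = card Y" | "k = card Y + 1" | "k > card Y + 1" using k by linarith
    then show ?thesis
    proof cases
      case 1
      then obtain k' where k': "k = Suc k'" using cY by (metis gr0_implies_Suc)
      have "coeff ?B (card Y - 1) = - \<Sum>Y" "coeff ?A (card X - 1) = - \<Sum>X"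
        using coeff_prod_linear_pred[OF fY neY] coeff_prod_linear_pred[OF fX neX] by auto
      moreover have "k' = card Y - 1" "k = card X - 1" using 1 k' cX by auto
      moreover have "coeff p k = coeff ?B k' - coeff ?A k" by (simp add: p_def k')
      ultimately show ?thesis using sX by (metis diff_self)
    next
      case 2
      then show ?thesis using degree_prod_linear(2)[OF fY] degree_prod_linear(2)[OF fX] cX by (simp add: p_def)
    next
      case 3
      then obtain k' where k': "k = Suc k'" by (cases k) auto
      have "coeff ?A k = 0" "coeff ?B k' = 0"
        using 3 cX k' degree_prod_linear(1)[OF fY] degree_prod_linear(1)[OF fX] by (auto intro!: coeff_eq_0)
      then show ?thesis by (simp add: p_def k')
    qed
  qed
  then have "degree p \<le> card Y - 1" by (intro degree_le) auto
  then have deg: "degree p < card Y" using cY by linarith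
  have uY: "u \<notin> Y" using nonint_diff[OF u] by (auto simp: Y_def)
  have ev: "poly p x = x * (\<Prod>y\<in>Y. x - y) - (\<Prod>y\<in>X. x - y)" for x
    by (simp add: p_def poly_prod)
  have nzB: "(\<Prod>y\<in>Y. u - y) \<noteq> 0" using uY fY by auto
  have rX: "(\<Prod>y\<in>X. x - y) = (\<Prod>a\<in>addable I. x - rcontent a)" and rY: "(\<Prod>y\<in>Y. x - y) = (\<Prod>a\<in>removable I. x - rcontent a)" for x
    using iX iY by (simp_all add: X_def Y_def prod.reindex)
  have "u - content_Q I u = poly p u / (\<Prod>y\<in>Y. u - y)"
    using content_Q_addable_removable[OF I u] nzB unfolding ev by (simp add: rX rY field_simps)
  also have "\<dots> = (\<Sum>c\<in>Y. poly p c / (\<Prod>y\<in>Y - {c}. c - y) / (u - c))"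
    by (rule partial_fractions[OF fY deg uY])
  also have "\<dots> = (\<Sum>b\<in>removable I. poly p (rcontent b) / (\<Prod>y\<in>Y - {rcontent b}. rcontent b - y) / (u - rcontent b))"
    unfolding Y_def using iY by (simp add: sum.reindex)
  also have "\<dots> = (\<Sum>b\<in>removable I. - (\<Prod>a\<in>addable I. rcontent b - rcontent a)
      / (\<Prod>a\<in>removable I - {b}. rcontent b - rcontent a) / (u - rcontent b))"
  proof (intro sum.cong refl)
    fix b assume b: "b \<in> removable I"
    have "(\<Prod>y\<in>Y. rcontent b - y) = 0" using b fY by (intro prod_zero) (auto simp: Y_def)
    moreover have "Y - {rcontent b} = rcontent ` (removable I - {b})"
      using iY b by (auto simp: Y_def inj_on_def)
    moreover have "inj_on rcontent (removable I - {b})" using iY by (auto simp: inj_on_def)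
    ultimately show "poly p (rcontent b) / (\<Prod>y\<in>Y - {rcontent b}. rcontent b - y) / (u - rcontent b)
      = - (\<Prod>a\<in>addable I. rcontent b - rcontent a) / (\<Prod>a\<in>removable I - {b}. rcontent b - rcontent a) / (u - rcontent b)"
      unfolding ev rX by (simp add: prod.reindex)
  qed
  finally show ?thesis .
qed

abbreviation cauchy :: "real \<Rightarrow> int \<Rightarrow> real" where
  "cauchy u c \<equiv> 1 / (u - real_of_int c)"

text \<open>The logarithmic derivative is a sum of second differences of 1/(u - c). By
  \<open>sum_addable_minus_removable\<close> it equals the addable minus the removable sum, the
  coefficient that occurs in \<open>up_sum_rec\<close>.\<close>

lemma content_Q_deriv:
  assumes fin: "finite I" and u: "u \<notin> \<int>"
  shows "(content_Q I has_field_derivative content_Q I u * (cauchy u 0 +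
      (\<Sum>b\<in>I. cauchy u (box_content b + 1) - 2 * cauchy u (box_content b) + cauchy u (box_content b - 1)))) (at u)"
  using fin
proof (induction rule: finite_induct)
  case empty
  then show ?case using nonint_diff[OF u, of 0] by (simp add: content_Q_def content_R_def)
next
  case (insert b I)
  define c where "c = u - rcontent b"
  have nz: "c \<noteq> 0" "c\<^sup>2 - 1 \<noteq> 0" "c - 1 \<noteq> 0" "c + 1 \<noteq> 0"
    using nonint_diff[OF u, of "box_content b"] nonint_sq_diff[OF u, of "box_content b"]
      nonint_diff[OF u, of "box_content b + 1"] nonint_diff[OF u, of "box_content b - 1"] by (auto simp: c_def)
  let ?G = "cauchy u 0 + (\<Sum>b\<in>I. cauchy u (box_content b + 1) - 2 * cauchy u (box_content b) + cauchy u (box_content b - 1))"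
  have eq: "content_Q (insert b I) = (\<lambda>v. content_Q I v * (1 - 1 / (v - rcontent b)\<^sup>2))"
    using content_Q_insert[OF insert(1,2)] by auto
  have d: "((\<lambda>v. 1 - 1 / (v - rcontent b)\<^sup>2) has_field_derivative 2 / c ^ 3) (at u)"
  proof -
    have u': "u = rcontent b + c" by (simp add: c_def)
    show ?thesis
      unfolding u' using nz(1)
      by (auto intro!: derivative_eq_intros simp: power2_eq_square power3_eq_cube; simp add: field_simps)
  qed
  let ?h = "cauchy u (box_content b + 1) - 2 * cauchy u (box_content b) + cauchy u (box_content b - 1)"
  have h: "2 / c ^ 3 = (1 - 1 / c\<^sup>2) * ?h"
  proof -
    have "cauchy u (box_content b + 1) = 1 / (c - 1)" "cauchy u (box_content b) = 1 / c" "cauchy u (box_content b - 1) = 1 / (c + 1)"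
      by (auto simp: c_def algebra_simps)
    moreover have "2 / c ^ 3 = (1 - 1 / c\<^sup>2) * (1 / (c - 1) - 2 * (1 / c) + 1 / (c + 1))"
      using nz by (simp add: divide_simps) (simp add: power2_eq_square power3_eq_cube algebra_simps)
    ultimately show ?thesis by (simp only:)
  qed
  have "content_Q I u * ?G * (1 - 1 / c\<^sup>2) + 2 / c ^ 3 * content_Q I u
      = content_Q I u * (1 - 1 / c\<^sup>2) * (?G + ?h)"
    unfolding h by (simp only: distrib_left mult_ac)
  then have "content_Q I u * ?G * (1 - 1 / c\<^sup>2) + 2 / c ^ 3 * content_Q I u
      = content_Q (insert b I) u * (cauchy u 0 + (\<Sum>b\<in>insert b I. cauchy u (box_content b + 1) - 2 * cauchy u (box_content b) + cauchy u (box_content b - 1)))"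
    using content_Q_insert[OF insert(1,2), of u] insert(1,2) by (simp add: c_def add_ac)
  moreover have "(content_Q (insert b I) has_field_derivative (content_Q I u * ?G * (1 - 1 / c\<^sup>2) + 2 / c ^ 3 * content_Q I u)) (at u)"
    unfolding eq c_def using DERIV_mult[OF insert.IH d] by (simp add: c_def mult_ac add_ac)
  ultimately show ?case by (simp only:)
qed

text \<open>Multiplication by u minus the content of \<open>b\<close> isolates the atom at
  \<open>b\<close> as u tends to that content: the other terms vanish since corner contents are
  distinct.\<close>

lemma kerov_residue:
  assumes K: "yideal K" and b: "b \<in> addable K"
    and a: "\<And>u. u \<notin> \<int> \<Longrightarrow> up_sum (cauchy u) K = (card K + 1) * ideal_dim K / content_Q K u"
  shows "((\<lambda>u. (u - rcontent b) / content_Q K u) \<longlongrightarrow> ideal_dim (insert b K) / ((card K + 1) * ideal_dim K)) (at (rcontent b))"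
proof -
  have fin: "finite (addable K)" using finite_addable[OF K] .
  have pos: "ideal_dim K > 0" using ideal_dim_pos[OF K] .
  let ?f = "\<lambda>u. (ideal_dim (insert b K) + (\<Sum>x\<in>addable K - {b}. (u - rcontent b) / (u - rcontent x) * ideal_dim (insert x K)))
     / ((card K + 1) * ideal_dim K)"
  have "(?f \<longlongrightarrow> (ideal_dim (insert b K) + (\<Sum>x\<in>addable K - {b}. (rcontent b - rcontent b) / (rcontent b - rcontent x) * ideal_dim (insert x K)))
     / ((card K + 1) * ideal_dim K)) (at (rcontent b))"
  proof (intro tendsto_intros)
    fix x assume x: "x \<in> addable K - {b}"
    then have "box_content x \<noteq> box_content b" using content_inj_on(1)[OF K] b by (auto simp: inj_on_def)
    then show "rcontent b - rcontent x \<noteq> 0" by simp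
  qed (use pos in auto)
  then have lim: "(?f \<longlongrightarrow> ideal_dim (insert b K) / ((card K + 1) * ideal_dim K)) (at (rcontent b))"
    by simp
  have "eventually (\<lambda>u. ?f u = (u - rcontent b) / content_Q K u) (at (rcontent b))"
    using eventually_at_int_nonint[of "box_content b"]
  proof (rule eventually_mono)
    fix u :: real assume u: "u \<notin> \<int>"
    have nz: "u - rcontent b \<noteq> 0" using nonint_diff[OF u] .
    have "up_sum (cauchy u) K = 1 / (u - rcontent b) * ideal_dim (insert b K) + (\<Sum>x\<in>addable K - {b}. 1 / (u - rcontent x) * ideal_dim (insert x K))"
      unfolding up_sum_def by (rule sum.remove[OF fin b])
    then have "(u - rcontent b) * up_sum (cauchy u) K = ideal_dim (insert b K) + (\<Sum>x\<in>addable K - {b}. (u - rcontent b) / (u - rcontent x) * ideal_dim (insert x K))"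
      using nz by (simp add: distrib_left sum_distrib_left)
    then have "?f u = (u - rcontent b) * up_sum (cauchy u) K / ((card K + 1) * ideal_dim K)" by simp
    also have "\<dots> = (u - rcontent b) / content_Q K u"
      unfolding a[OF u] using pos by simp
    finally show "?f u = (u - rcontent b) / content_Q K u" .
  qed
  then show ?thesis using lim by (rule Lim_transform_eventually[rotated])
qed

text \<open>For K = I - {b}, the residue of 1/Q_K at the content c of \<open>b\<close> is dim I /
  (|I| dim K). Since Q_I = Q_K (1 - 1/(u - c)^2), the residue of Q_I there is minus the reciprocal.
  These are the coefficients in \<open>removable_partial_fractions\<close>.\<close>

lemma kerov_down_of_up:
  assumes I: "yideal I" and ne: "I \<noteq> {}" and u: "u \<notin> \<int>"
    and a: "\<And>b u. b \<in> removable I \<Longrightarrow> u \<notin> \<int> \<Longrightarrow>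
       up_sum (cauchy u) (I - {b}) = card I * ideal_dim (I - {b}) / content_Q (I - {b}) u"
  shows "(\<Sum>b\<in>removable I. card I * ideal_dim (I - {b}) / ideal_dim I / (u - rcontent b)) = u - content_Q I u"
  unfolding removable_partial_fractions[OF I ne u]
proof (intro sum.cong refl)
  fix b assume b: "b \<in> removable I"
  let ?K = "I - {b}" and ?c = "rcontent b"
  have K: "yideal ?K" and fin: "finite I" and bI: "b \<in> I"
    using removable_ideal b yideal_finite[OF I] removable_in by auto
  have card: "card ?K + 1 = card I" and pos: "card I > 0"
    using card_Suc_Diff1[OF fin bI] by linarith+
  have ins: "insert b ?K = I" using bI by auto
  define m where "m = ideal_dim I / (card I * ideal_dim ?K)"
  have m0: "m \<noteq> 0" using ideal_dim_pos[OF I] ideal_dim_pos[OF K] pos by (simp add: m_def)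
  have "((\<lambda>u. (u - ?c) / content_Q ?K u) \<longlongrightarrow> m) (at ?c)"
  proof -
    have "real (card ?K + 1) = real (card I)" using card by simp
    then show ?thesis
      using kerov_residue[OF K addable_remove[OF I b]] a[OF b] unfolding ins m_def by metis
  qed
  then have l1: "((\<lambda>u. ((u - ?c)\<^sup>2 - 1) / ((u - ?c) / content_Q ?K u)) \<longlongrightarrow> ((?c - ?c)\<^sup>2 - 1) / m) (at ?c)"
    by (intro tendsto_intros m0)
  have l2: "((\<lambda>u. (\<Prod>a\<in>addable I. u - rcontent a) / (\<Prod>a\<in>removable I - {b}. u - rcontent a)) \<longlongrightarrow>
     (\<Prod>a\<in>addable I. ?c - rcontent a) / (\<Prod>a\<in>removable I - {b}. ?c - rcontent a)) (at ?c)"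
  proof (intro tendsto_intros)
    show "(\<Prod>a\<in>removable I - {b}. ?c - rcontent a) \<noteq> 0"
      using content_inj_on(2)[OF I] b finite_removable[OF I] by (auto simp: inj_on_def)
  qed
  have gen: "(d\<^sup>2 - 1) / (d / k) = A / P" if "d \<noteq> 0" "P \<noteq> 0" "k * (1 - 1 / d\<^sup>2) * (d * P) = A" for d k A P :: real
    using that(1,2) unfolding that(3)[symmetric] by (simp add: field_simps power2_eq_square)
  have "eventually (\<lambda>u. ((u - ?c)\<^sup>2 - 1) / ((u - ?c) / content_Q ?K u)
      = (\<Prod>a\<in>addable I. u - rcontent a) / (\<Prod>a\<in>removable I - {b}. u - rcontent a)) (at ?c)"
    using eventually_at_int_nonint[of "box_content b"]
  proof (rule eventually_mono)
    fix u :: real assume u: "u \<notin> \<int>"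
    have nz: "u - ?c \<noteq> 0" "(\<Prod>a\<in>removable I - {b}. u - rcontent a) \<noteq> 0"
      using nonint_diff[OF u] finite_removable[OF I] by auto
    have "content_Q I u = content_Q ?K u * (1 - 1 / (u - ?c)\<^sup>2)"
      using content_Q_insert[of ?K b u] fin unfolding ins by simp
    moreover have "content_Q I u * ((u - ?c) * (\<Prod>a\<in>removable I - {b}. u - rcontent a)) = (\<Prod>a\<in>addable I. u - rcontent a)"
      using content_Q_addable_removable[OF I u] prod.remove[OF finite_removable[OF I] b, of "\<lambda>b. u - rcontent b"] by simp
    ultimately show "((u - ?c)\<^sup>2 - 1) / ((u - ?c) / content_Q ?K u)
      = (\<Prod>a\<in>addable I. u - rcontent a) / (\<Prod>a\<in>removable I - {b}. u - rcontent a)"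
      using gen[OF nz] by metis
  qed
  then have "((\<lambda>u. (\<Prod>a\<in>addable I. u - rcontent a) / (\<Prod>a\<in>removable I - {b}. u - rcontent a)) \<longlongrightarrow> ((?c - ?c)\<^sup>2 - 1) / m) (at ?c)"
    using l1 by (rule Lim_transform_eventually[rotated])
  from tendsto_unique[OF _ l2 this]
  have "(\<Prod>a\<in>addable I. ?c - rcontent a) / (\<Prod>a\<in>removable I - {b}. ?c - rcontent a) = - 1 / m" by simp
  then show "card I * ideal_dim ?K / ideal_dim I / (u - ?c)
     = - (\<Prod>a\<in>addable I. ?c - rcontent a) / (\<Prod>a\<in>removable I - {b}. ?c - rcontent a) / (u - ?c)"
    by (simp add: m_def)
qed

text \<open>Induction on the number of boxes. The identity for all \<open>I - {b}\<close> yields the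
  co-transition identity for \<open>I\<close>, whose derivative supplies the sum with squared
  denominators required by \<open>up_sum_rec\<close>. The logarithmic derivative \<open>G\<close>
  then cancels.\<close>

lemma kerov_up:
  assumes "yideal I" "u \<notin> \<int>"
  shows "up_sum (cauchy u) I = (card I + 1) * ideal_dim I / content_Q I u"
  using assms
proof (induction "card I" arbitrary: I u rule: less_induct)
  case less
  note I = less.prems(1) and u = less.prems(2)
  have fin: "finite I" using yideal_finite[OF I] .
  show ?case
  proof (cases "I = {}")
    case True
    have "yideal {(1, 1)}" using addable_ideal[of "(1,1)" "{}"] by (simp add: addable_empty)
    moreover have "removable {(1, 1)} = {(1::nat, 1::nat)}"
      using removable_nonempty[OF \<open>yideal {(1, 1)}\<close>] by (auto simp: removable_def)
    ultimately have "ideal_dim {(1, 1)} = 1"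
      using ideal_dim_rec[of "{(1, 1)}"] by (simp add: ideal_dim_empty)
    then show ?thesis
      by (simp add: True up_sum_def addable_empty ideal_dim_empty content_Q_def content_R_def box_content_def)
  next
    case False
    have cK: "card (I - {b}) + 1 = card I" if "b \<in> removable I" for b
      using card_Suc_Diff1[OF fin removable_in[OF that]] by linarith
    have a: "up_sum (cauchy u) (I - {b}) = card I * ideal_dim (I - {b}) / content_Q (I - {b}) u"
      if "b \<in> removable I" "u \<notin> \<int>" for b u
      using less.hyps[of "I - {b}" u] cK[OF that(1)] removable_ideal[OF that(1)] that(2)
      by (metis less_add_one)
    note down = kerov_down_of_up[OF I False _ a]
    define r where "r b = card I * ideal_dim (I - {b}) / ideal_dim I" for b
    have pos: "ideal_dim I > 0" using ideal_dim_pos[OF I] .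
    define G where "G = (\<Sum>b\<in>addable I. cauchy u (box_content b)) - (\<Sum>b\<in>removable I. cauchy u (box_content b))"
    have Qd: "(content_Q I has_field_derivative content_Q I u * G) (at u)"
      using content_Q_deriv[OF fin u] sum_addable_minus_removable[OF I, of "cauchy u"] by (simp add: G_def)
    have Q0: "content_Q I u \<noteq> 0" using content_Q_nonzero[OF u fin] .
    have op: "open (- \<int> :: real set)" using closed_Ints by (simp add: open_Compl)
    \<comment> \<open>The co-transition identity holds on the open set of nonintegers, so both sides
      may be differentiated there.\<close>
    have d1: "((\<lambda>v. \<Sum>b\<in>removable I. r b / (v - rcontent b)) has_field_derivative 1 - content_Q I u * G) (at u)"
    proof (rule has_field_derivative_transform_within_open[OF _ op])
      show "((\<lambda>v. v - content_Q I v) has_field_derivative 1 - content_Q I u * G) (at u)"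
        by (intro derivative_intros Qd)
      show "u \<in> - \<int>" using u by simp
      show "v - content_Q I v = (\<Sum>b\<in>removable I. r b / (v - rcontent b))" if "v \<in> - \<int>" for v
        using down[of v] that by (simp add: r_def)
    qed
    have d2: "((\<lambda>v. \<Sum>b\<in>removable I. r b / (v - rcontent b)) has_field_derivative (\<Sum>b\<in>removable I. - r b / (u - rcontent b)\<^sup>2)) (at u)"
      using nonint_diff[OF u]
      by (auto intro!: derivative_eq_intros DERIV_sum sum.cong simp: power2_eq_square field_simps)
    have s2: "(\<Sum>b\<in>removable I. r b / (u - rcontent b)\<^sup>2) = content_Q I u * G - 1"
      using DERIV_unique[OF d1 d2] by (simp add: sum_negf)
    have s0: "(\<Sum>b\<in>removable I. r b) = card I"
      using ideal_dim_rec[OF I False] pos by (simp add: r_def sum_divide_distrib[symmetric] sum_distrib_left[symmetric])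
    \<comment> \<open>Here 1/Q of the smaller ideal is 1/Q of \<open>I\<close> times 1 - 1/(u -
      c)^2, which brings all terms to a common denominator.\<close>
    have K: "up_sum (cauchy u) (I - {b}) = ideal_dim I / content_Q I u * (r b - r b / (u - rcontent b)\<^sup>2)" if b: "b \<in> removable I" for b
    proof -
      have "content_Q I u = content_Q (I - {b}) u * (1 - 1 / (u - rcontent b)\<^sup>2)"
        using content_Q_insert[of "I - {b}" b u] fin removable_in[OF b] by (simp add: insert_absorb)
      moreover have "content_Q (I - {b}) u \<noteq> 0" using content_Q_nonzero[OF u] fin by simp
      moreover have "ideal_dim I / (q * t) * (r b * t) = card I * ideal_dim (I - {b}) / q" if "q * t \<noteq> 0" for q t
        using pos that by (simp add: r_def)
      ultimately show ?thesis
        using Q0 unfolding a[OF b u] by (metis (no_types, lifting) mult.right_neutral right_diff_distrib times_divide_eq_right)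
    qed
    have "up_sum (cauchy u) I = G * ideal_dim I + (\<Sum>b\<in>removable I. ideal_dim I / content_Q I u * (r b - r b / (u - rcontent b)\<^sup>2))"
      unfolding up_sum_rec[OF I] G_def by (intro arg_cong2[of _ _ _ _ "(+)"] sum.cong refl K)
    also have "\<dots> = G * ideal_dim I + ideal_dim I / content_Q I u * (card I - (content_Q I u * G - 1))"
      unfolding sum_distrib_left[symmetric] sum_subtractf s0 s2 ..
    also have "\<dots> = (card I + 1) * ideal_dim I / content_Q I u"
      using Q0 by (simp add: field_simps)
    finally show ?thesis .
  qed
qed

lemma kerov_down:
  assumes I: "yideal I" and u: "u \<notin> \<int>" and ne: "I \<noteq> {}"
  shows "(\<Sum>b\<in>removable I. card I * ideal_dim (I - {b}) / ideal_dim I / (u - rcontent b)) = u - content_Q I u"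
proof (rule kerov_down_of_up[OF I ne u])
  fix b and v :: real assume b: "b \<in> removable I" and v: "v \<notin> \<int>"
  then show "up_sum (cauchy v) (I - {b}) = card I * ideal_dim (I - {b}) / content_Q (I - {b}) v"
    using kerov_up[OF removable_ideal[OF b] v] card_Suc_Diff1[OF yideal_finite[OF I] removable_in[OF b]]
    by (metis Suc_eq_plus1)
qed

section \<open>Translation between ideals and row-length lists\<close>

lemma initial_segment_eq:
  fixes S :: "nat set"
  assumes fin: "finite S" and pos: "\<And>i. i \<in> S \<Longrightarrow> 1 \<le> i"
    and down: "\<And>i j. i \<in> S \<Longrightarrow> 1 \<le> j \<Longrightarrow> j \<le> i \<Longrightarrow> j \<in> S"
  shows "S = {1..card S}"
proof (cases "S = {}")
  case False
  have "S = {1..Max S}"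
  proof
    show "S \<subseteq> {1..Max S}" using pos Max_ge[OF fin] by auto
    show "{1..Max S} \<subseteq> S" using down[OF Max_in[OF fin False]] by auto
  qed
  then show ?thesis by (metis card_atLeastAtMost diff_Suc_1)
qed simp

lemma boxes_Sigma: "boxes lam = Sigma {1..length lam} (\<lambda>i. {1..lam ! (i - 1)})"
  by (auto simp: boxes_def)

lemma card_boxes: "card (boxes lam) = sum_list lam"
proof -
  have "card (boxes lam) = (\<Sum>i = 1..length lam. lam ! (i - 1))"
    unfolding boxes_Sigma by (subst card_SigmaI) auto
  also have "\<dots> = (\<Sum>i = 0..<length lam. lam ! i)"
    by (rule sum.reindex_bij_witness[of _ Suc "\<lambda>i. i - 1"]) auto
  finally show ?thesis by (simp add: sum_list_sum_nth)
qed

lemma young_nth_mono: "young lam \<Longrightarrow> i \<le> j \<Longrightarrow> j < length lam \<Longrightarrow> lam ! j \<le> lam ! i"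
  unfolding young_def using sorted_rev_nth_mono by blast

lemma young_nth_pos: "young lam \<Longrightarrow> i < length lam \<Longrightarrow> 1 \<le> lam ! i"
  unfolding young_def by (metis One_nat_def Suc_leI gr0I nth_mem)

lemma yideal_boxes: "young lam \<Longrightarrow> yideal (boxes lam)"
proof -
  assume y: "young lam"
  have "finite (boxes lam)" unfolding boxes_Sigma by auto
  moreover have "(i', j') \<in> boxes lam" if "(i, j) \<in> boxes lam" "1 \<le> i'" "i' \<le> i" "1 \<le> j'" "j' \<le> j" for i j i' j'
  proof -
    have "lam ! (i - 1) \<le> lam ! (i' - 1)" using that by (intro young_nth_mono[OF y]) (auto simp: boxes_def)
    then show ?thesis using that by (auto simp: boxes_def)
  qed
  moreover have "1 \<le> i \<and> 1 \<le> j" if "(i, j) \<in> boxes lam" for i j using that by (auto simp: boxes_def)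
  ultimately show ?thesis unfolding yideal_def by blast
qed

lemma boxes_inj: "young lam \<Longrightarrow> young mu \<Longrightarrow> boxes lam = boxes mu \<Longrightarrow> lam = mu"
proof -
  assume y: "young lam" "young mu" and e: "boxes lam = boxes mu"
  have row: "{j. (Suc i, j) \<in> boxes nu} = {1..nu ! i}" if "i < length nu" for nu i
    using that by (auto simp: boxes_def)
  have col: "{i. (i, 1) \<in> boxes nu} = {1..length nu}" if "young nu" for nu
    using young_nth_pos[OF that] by (auto simp: boxes_def)
  have len: "length lam = length mu" using col[OF y(1)] col[OF y(2)] e by (metis card_atLeastAtMost diff_Suc_1)
  show ?thesis
  proof (rule nth_equalityI[OF len])
    fix i assume "i < length lam"
    then show "lam ! i = mu ! i" using row[of i lam] row[of i mu] len e by (metis card_atLeastAtMost diff_Suc_1)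
  qed
qed

lemma boxes_surj:
  assumes I: "yideal I" obtains lam where "young lam" "boxes lam = I"
proof -
  define r where "r i = card {j. (i, j) \<in> I}" for i
  define L where "L = card {i. (i, 1) \<in> I}"
  have fr: "finite {j. (i, j) \<in> I}" for i
    by (rule finite_subset[of _ "snd ` I"]) (auto simp: yideal_finite[OF I] image_iff, force)
  have fc: "finite {i. (i, 1) \<in> I}"
    by (rule finite_subset[of _ "fst ` I"]) (auto simp: yideal_finite[OF I] image_iff, force)
  have row: "{j. (i, j) \<in> I} = {1..r i}" for i
    unfolding r_def
  proof (rule initial_segment_eq[OF fr])
    fix a b assume ab: "a \<in> {j. (i, j) \<in> I}" "1 \<le> b" "b \<le> a"
    then show "b \<in> {j. (i, j) \<in> I}" using yideal_pos[OF I, of i a] yideal_down[OF I, of i a i b] by blast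
  qed (use yideal_pos[OF I] in blast)
  have col: "{i. (i, 1) \<in> I} = {1..L}"
    unfolding L_def
  proof (rule initial_segment_eq[OF fc])
    fix a b assume ab: "a \<in> {i. (i, 1) \<in> I}" "1 \<le> b" "b \<le> a"
    then show "b \<in> {i. (i, 1) \<in> I}" using yideal_down[OF I, of a 1 b 1] by blast
  qed (use yideal_pos[OF I] in blast)
  have rm: "r j \<le> r i" if "1 \<le> i" "i \<le> j" for i j
    unfolding r_def
  proof (rule card_mono[OF fr], rule subsetI)
    fix k assume "k \<in> {k. (j, k) \<in> I}"
    then show "k \<in> {k. (i, k) \<in> I}" using that yideal_pos[OF I, of j k] yideal_down[OF I, of j k i k] by blast
  qed
  define lam where "lam = map (\<lambda>i. r (Suc i)) [0..<L]"
  have mem: "(i, j) \<in> I \<longleftrightarrow> 1 \<le> i \<and> i \<le> L \<and> 1 \<le> j \<and> j \<le> r i" for i j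
  proof -
    have "(i, j) \<in> I \<longleftrightarrow> 1 \<le> j \<and> j \<le> r i" "(i, 1) \<in> I \<longleftrightarrow> 1 \<le> i \<and> i \<le> L"
      using row[of i] col by auto
    moreover have "(i, j) \<in> I \<Longrightarrow> (i, 1) \<in> I"
      using yideal_pos[OF I, of i j] yideal_down[OF I, of i j i 1] by blast
    ultimately show ?thesis by blast
  qed
  have "boxes lam = I"
    by (auto simp: boxes_def lam_def mem)
  moreover have "young lam"
  proof -
    have "sorted_wrt (\<ge>) lam"
      unfolding lam_def sorted_wrt_map by (rule sorted_wrt_mono_rel[of _ "(<)"]) (auto intro!: rm)
    moreover have "0 \<notin> set lam" 
    proof
      assume "0 \<in> set lam"
      then obtain i where "i < L" "r (Suc i) = 0" by (auto simp: lam_def)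
      then show False using mem[of "Suc i" 1] col by auto
    qed
    ultimately show ?thesis by (simp add: young_def sorted_wrt_rev)
  qed
  ultimately show ?thesis using that by blast
qed

definition diagram_of :: "(nat \<times> nat) set \<Rightarrow> nat list" where
  "diagram_of I = (SOME lam. young lam \<and> boxes lam = I)"

lemma diagram_of:
  assumes "yideal I" shows "young (diagram_of I)" "boxes (diagram_of I) = I"
  using someI_ex[of "\<lambda>lam. young lam \<and> boxes lam = I"] boxes_surj[OF assms] unfolding diagram_of_def by blast+

lemma diagram_of_boxes: "young lam \<Longrightarrow> diagram_of (boxes lam) = lam"
  using diagram_of[OF yideal_boxes] boxes_inj by blast

lemma YD_iff: "lam \<in> YD n \<longleftrightarrow> young lam \<and> card (boxes lam) = n"
  by (simp add: YD_def card_boxes)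

lemma diagram_of_YD: "yideal I \<Longrightarrow> diagram_of I \<in> YD (card I)"
  using diagram_of[of I] by (simp add: YD_iff)

text \<open>The boxes above and to the left of (i, j), with the box itself, number i + j - 1 and all
  lie in the ideal. Hence contents are at most |I| - 1 in absolute value, which keeps points u of
  size at least 2n away from them.\<close>

lemma box_hook_le:
  assumes I: "yideal I" and b: "(i, j) \<in> I" shows "i + j \<le> card I + 1"
proof -
  have p: "1 \<le> i" "1 \<le> j" using yideal_pos[OF I b] by auto
  have "(\<lambda>k. (k, j)) ` {1..i} \<union> (\<lambda>k. (i, k)) ` {1..<j} \<subseteq> I"
    using yideal_down[OF I b] p by (auto simp: Suc_le_eq)
  then have "card ((\<lambda>k. (k, j)) ` {1..i} \<union> (\<lambda>k. (i, k)) ` {1..<j}) \<le> card I"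
    using yideal_finite[OF I] by (intro card_mono)
  moreover have "card ((\<lambda>k. (k, j)) ` {1..i} \<union> (\<lambda>k. (i, k)) ` {1..<j}) = i + (j - 1)"
    by (subst card_Un_disjoint) (auto simp: card_image inj_on_def)
  ultimately show ?thesis using p by linarith
qed

lemma rcontent_bound: "yideal I \<Longrightarrow> b \<in> I \<Longrightarrow> \<bar>rcontent b\<bar> \<le> real (card I) - 1"
  using box_hook_le[of I "fst b" "snd b"] yideal_pos[of I "fst b" "snd b"]
  by (auto simp: box_content_def)

lemma finite_YD: "finite (YD n)"
proof (rule finite_imageD)
  have "boxes ` YD n \<subseteq> Pow ({1..n} \<times> {1..n})"
  proof clarify
    fix lam i j assume l: "lam \<in> YD n" and b: "(i, j) \<in> boxes lam"
    then have I: "yideal (boxes lam)" "card (boxes lam) = n" using yideal_boxes by (auto simp: YD_iff)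
    show "i \<in> {1..n} \<and> j \<in> {1..n}"
      using box_hook_le[OF I(1) b] yideal_pos[OF I(1) b] I(2) by auto
  qed
  then show "finite (boxes ` YD n)" by (rule finite_subset) simp
  show "inj_on boxes (YD n)" using boxes_inj by (auto simp: inj_on_def YD_iff)
qed

lemma dimY_eq: "real (dimY lam) = ideal_dim (boxes lam)"
  by (simp add: dimY_def SYT_def ideal_dim_def ideal_SYT_def card_boxes)

lemma covers_iff_addable:
  assumes "young lam" "young nu"
  shows "covers lam nu \<longleftrightarrow> (\<exists>b\<in>addable (boxes lam). nu = diagram_of (insert b (boxes lam)))"
proof
  assume c: "covers lam nu"
  have fin: "finite (boxes nu)" using yideal_finite[OF yideal_boxes[OF assms(2)]] .
  have "card (boxes nu - boxes lam) = 1"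
    using c fin card_Diff_subset[of "boxes lam" "boxes nu"] finite_subset[of "boxes lam" "boxes nu"] by (auto simp: covers_def)
  then obtain b where b: "boxes nu - boxes lam = {b}" by (auto simp: card_1_singleton_iff)
  then have "boxes nu = insert b (boxes lam)" using c by (auto simp: covers_def)
  moreover have "b \<notin> boxes lam" using b by auto
  ultimately show "\<exists>b\<in>addable (boxes lam). nu = diagram_of (insert b (boxes lam))"
    using yideal_boxes[OF assms(2)] diagram_of_boxes[OF assms(2)] by (metis addable_def mem_Collect_eq)
next
  assume "\<exists>b\<in>addable (boxes lam). nu = diagram_of (insert b (boxes lam))"
  then obtain b where b: "b \<in> addable (boxes lam)" "boxes nu = insert b (boxes lam)"
    using diagram_of(2) addable_ideal by metis
  then show "covers lam nu"
    using yideal_finite[OF yideal_boxes[OF assms(1)]] addable_notin[OF b(1)] by (auto simp: covers_def)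
qed

lemma covers_iff_removable:
  assumes "young lam" "young nu"
  shows "covers lam nu \<longleftrightarrow> (\<exists>b\<in>removable (boxes nu). lam = diagram_of (boxes nu - {b}))"
proof
  assume "covers lam nu"
  then obtain b where b: "b \<in> addable (boxes lam)" "boxes nu = insert b (boxes lam)"
    using covers_iff_addable[OF assms] diagram_of(2) addable_ideal by metis
  then have "boxes lam = boxes nu - {b}" using addable_notin[OF b(1)] by auto
  moreover have "b \<in> removable (boxes nu)" using b removable_insert[OF yideal_boxes[OF assms(1)]] by simp
  ultimately show "\<exists>b\<in>removable (boxes nu). lam = diagram_of (boxes nu - {b})"
    using diagram_of_boxes[OF assms(1)] by metis
next
  assume "\<exists>b\<in>removable (boxes nu). lam = diagram_of (boxes nu - {b})"
  then obtain b where b: "b \<in> removable (boxes nu)" "boxes lam = boxes nu - {b}"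
    using diagram_of(2) removable_ideal by metis
  then have "boxes nu = insert b (boxes lam)" "b \<in> addable (boxes lam)"
    using removable_in[OF b(1)] addable_remove[OF yideal_boxes[OF assms(2)] b(1)] by auto
  then show "covers lam nu" using covers_iff_addable[OF assms] diagram_of_boxes[OF assms(2)] by metis
qed

text \<open>Inserting a corner is injective from addable boxes to diagrams and its image consists of
  the covers, so a sum over a whole level collapses to corners.\<close>

lemma sum_covers_up:
  assumes lam: "lam \<in> YD n"
  shows "(\<Sum>nu\<in>YD (Suc n). if covers lam nu then g nu else 0)
    = (\<Sum>b\<in>addable (boxes lam). g (diagram_of (insert b (boxes lam))) :: real)"
proof -
  let ?I = "boxes lam" and ?f = "\<lambda>b. diagram_of (insert b (boxes lam))"
  have y: "young lam" and c: "card ?I = n" and I: "yideal ?I" using lam yideal_boxes by (auto simp: YD_iff)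
  have inj: "inj_on ?f (addable ?I)"
  proof (rule inj_onI)
    fix b b' assume b: "b \<in> addable ?I" "b' \<in> addable ?I" "?f b = ?f b'"
    then have "insert b ?I = insert b' ?I" using diagram_of(2) addable_ideal by metis
    then show "b = b'" using b addable_notin by blast
  qed
  have sub: "?f ` addable ?I \<subseteq> YD (Suc n)"
    using diagram_of_YD[OF addable_ideal] addable_notin c yideal_finite[OF I] by fastforce
  have "(\<Sum>nu\<in>YD (Suc n). if covers lam nu then g nu else 0) = (\<Sum>nu\<in>?f ` addable ?I. if covers lam nu then g nu else 0)"
    using covers_iff_addable[OF y] by (intro sum.mono_neutral_right finite_YD sub) (auto simp: YD_iff)
  also have "\<dots> = (\<Sum>nu\<in>?f ` addable ?I. g nu)"
  proof (intro sum.cong refl)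
    fix nu assume nu: "nu \<in> ?f ` addable ?I"
    then have "young nu" using sub by (auto simp: YD_iff)
    then have "covers lam nu" using covers_iff_addable[OF y] nu by blast
    then show "(if covers lam nu then g nu else 0) = g nu" by simp
  qed
  finally show ?thesis using inj by (simp add: sum.reindex)
qed

lemma sum_covers_down:
  assumes nu: "nu \<in> YD (Suc n)"
  shows "(\<Sum>lam\<in>YD n. if covers lam nu then g lam else 0)
    = (\<Sum>b\<in>removable (boxes nu). g (diagram_of (boxes nu - {b})) :: real)"
proof -
  let ?J = "boxes nu" and ?f = "\<lambda>b. diagram_of (boxes nu - {b})"
  have y: "young nu" and c: "card ?J = Suc n" and J: "yideal ?J" using nu yideal_boxes by (auto simp: YD_iff)
  have inj: "inj_on ?f (removable ?J)"
  proof (rule inj_onI)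
    fix b b' assume b: "b \<in> removable ?J" "b' \<in> removable ?J" "?f b = ?f b'"
    then have "?J - {b} = ?J - {b'}" using diagram_of(2) removable_ideal by metis
    then show "b = b'" using b removable_in by blast
  qed
  have sub: "?f ` removable ?J \<subseteq> YD n"
    using diagram_of_YD[OF removable_ideal] removable_in c yideal_finite[OF J] by fastforce
  have "(\<Sum>lam\<in>YD n. if covers lam nu then g lam else 0) = (\<Sum>lam\<in>?f ` removable ?J. if covers lam nu then g lam else 0)"
    using covers_iff_removable[OF _ y] by (intro sum.mono_neutral_right finite_YD sub) (auto simp: YD_iff)
  also have "\<dots> = (\<Sum>lam\<in>?f ` removable ?J. g lam)"
  proof (intro sum.cong refl)
    fix lam assume lam: "lam \<in> ?f ` removable ?J"
    then have "young lam" using sub by (auto simp: YD_iff)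
    then have "covers lam nu" using covers_iff_removable[OF _ y] lam by blast
    then show "(if covers lam nu then g lam else 0) = g lam" by simp
  qed
  finally show ?thesis using inj by (simp add: sum.reindex)
qed

text \<open>The second difference of a quadratic is the constant 2p, so the coefficient in
  \<open>up_sum_rec\<close> is r + 2p|I| and the induction closes. In other words the transition
  measure has mean 0 and second moment |I|.\<close>

lemma up_sum_quadratic:
  "yideal I \<Longrightarrow> up_sum (\<lambda>c. p * (real_of_int c)\<^sup>2 + q * real_of_int c + r) I
     = (real (card I) + 1) * (p * real (card I) + r) * ideal_dim I"
proof (induction "card I" arbitrary: I rule: less_induct)
  case less
  note I = less.prems
  have fin: "finite I" using yideal_finite[OF I] .
  let ?w = "\<lambda>c. p * (real_of_int c)\<^sup>2 + q * real_of_int c + r"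
  have G: "(\<Sum>b\<in>addable I. ?w (box_content b)) - (\<Sum>b\<in>removable I. ?w (box_content b)) = r + 2 * p * card I"
    unfolding sum_addable_minus_removable[OF I, of ?w]
    by (simp add: power2_eq_square algebra_simps)
  show ?case
  proof (cases "I = {}")
    case True
    then show ?thesis using up_sum_rec[OF I, of ?w] G by (simp add: removable_def)
  next
    case False
    have "(\<Sum>b\<in>removable I. up_sum ?w (I - {b})) = (\<Sum>b\<in>removable I. real (card I) * (p * (real (card I) - 1) + r) * ideal_dim (I - {b}))"
    proof (intro sum.cong refl)
      fix b assume b: "b \<in> removable I"
      have c: "card I = card (I - {b}) + 1" using card_Suc_Diff1[OF fin removable_in[OF b]] by simp
      then have lt: "card (I - {b}) < card I" by linarith
      show "up_sum ?w (I - {b}) = real (card I) * (p * (real (card I) - 1) + r) * ideal_dim (I - {b})"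
      proof -
        have r: "real (card (I - {b})) = real (card I) - 1" using c by linarith
        show ?thesis using less.hyps[OF lt removable_ideal[OF b]] unfolding r by simp
      qed
    qed
    also have "\<dots> = real (card I) * (p * (real (card I) - 1) + r) * ideal_dim I"
      unfolding ideal_dim_rec[OF I False] sum_distrib_left ..
    finally show ?thesis unfolding up_sum_rec[OF I, of ?w] G by (simp add: algebra_simps)
  qed
qed

text \<open>In the principal series (z + k)(z' + k) is a squared modulus with nonzero imaginary
  part. In the complementary series z + k and z' + k are real with the same sign, since no integer
  separates z from z'.\<close>

lemma admissible_facts:
  assumes "zz'_admissible z z'"
  shows "z + z' = of_real (Re (z + z'))" "z * z' = of_real (Re (z * z'))"
    "Re ((z + of_int k) * (z' + of_int k)) > 0"
    "Re (z * z') > 0"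
proof -
  have main: "z + z' = of_real (Re (z + z')) \<and> z * z' = of_real (Re (z * z')) \<and>
     (\<forall>k::int. Re ((z + of_int k) * (z' + of_int k)) > 0)"
    using assms unfolding zz'_admissible_def
  proof (elim disjE exE conjE)
    assume z: "z \<notin> \<real>" "z' = cnj z"
    have im: "Im z \<noteq> 0" using z(1) complex_is_Real_iff by blast
    have "Re ((z + of_int k) * (z' + of_int k)) = (Re z + of_int k)\<^sup>2 + (Im z)\<^sup>2" for k :: int
      by (simp add: z(2) power2_eq_square)
    moreover have "(Re z + of_int k)\<^sup>2 + (Im z)\<^sup>2 > 0" for k :: int
      using im by (intro add_nonneg_pos) auto
    ultimately show ?thesis by (auto simp: z(2) complex_eq_iff)
  next
    fix N :: int
    assume z: "z \<in> \<real>" "z' \<in> \<real>" and b: "of_int N < Re z" "Re z < of_int N + 1" "of_int N < Re z'" "Re z' < of_int N + 1"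
    have im: "Im z = 0" "Im z' = 0" using z complex_is_Real_iff by auto
    have "Re ((z + of_int k) * (z' + of_int k)) > 0" for k :: int
    proof -
      have "Re ((z + of_int k) * (z' + of_int k)) = (Re z + of_int k) * (Re z' + of_int k)" by (simp add: im)
      also have "\<dots> > 0"
      proof (cases "N + k \<ge> 0")
        case True
        then have "real_of_int N + real_of_int k \<ge> 0" by linarith
        then show ?thesis using b by (intro mult_pos_pos) linarith+
      next
        case False
        then have "real_of_int N + real_of_int k + 1 \<le> 0" by linarith
        then show ?thesis using b by (intro mult_neg_neg) linarith+
      qed
      finally show ?thesis .
    qed
    then show ?thesis using im by (auto simp: complex_eq_iff)
  qed
  then show "z + z' = of_real (Re (z + z'))" "z * z' = of_real (Re (z * z'))" "Re ((z + of_int k) * (z' + of_int k)) > 0" by blast+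
  show "Re (z * z') > 0" using main[THEN conjunct2, THEN conjunct2, rule_format, of 0] by simp
qed

section \<open>Transition probabilities of the up-down chain in terms of corners\<close>

definition up_weight :: "real \<Rightarrow> real \<Rightarrow> real \<Rightarrow> real" where
  "up_weight a b c = c\<^sup>2 + a * c + b"

text \<open>With a = z + z' and b = z z', \<open>up_weight a b c\<close> is (z + c)(z' + c). Working
  with \<open>a\<close> and \<open>b\<close> keeps everything real.\<close>

definition up_prob :: "real \<Rightarrow> real \<Rightarrow> (nat \<times> nat) set \<Rightarrow> nat \<times> nat \<Rightarrow> real" where
  "up_prob a b I x = up_weight a b (rcontent x) * ideal_dim (insert x I) / ((b + card I) * (card I + 1) * ideal_dim I)"

definition down_prob :: "(nat \<times> nat) set \<Rightarrow> nat \<times> nat \<Rightarrow> real" where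
  "down_prob J x = ideal_dim (J - {x}) / ideal_dim J"

lemma p_up_eq:
  assumes adm: "zz'_admissible z z'" and lam: "lam \<in> YD n" and x: "x \<in> addable (boxes lam)"
  shows "p_up z z' n lam (diagram_of (insert x (boxes lam))) = up_prob (Re (z + z')) (Re (z * z')) (boxes lam) x"
proof -
  let ?I = "boxes lam" and ?nu = "diagram_of (insert x (boxes lam))"
  have y: "young lam" and c: "card ?I = n" and I: "yideal ?I" using lam yideal_boxes by (auto simp: YD_iff)
  have nu: "young ?nu" "boxes ?nu = insert x ?I" using diagram_of[OF addable_ideal[OF x]] by auto
  have cov: "covers lam ?nu" using covers_iff_addable[OF y nu(1)] x by blast
  have d: "boxes ?nu - ?I = {x}" using nu addable_notin[OF x] by auto
  have poch: "poch_skew v ?nu lam = v + of_int (box_content x)" for v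
    unfolding poch_skew_def d by (simp add: box_content_def case_prod_unfold)
  let ?c = "complex_of_int (box_content x)"
  have den: "z * z' + of_nat n = of_real (Re (z * z') + n)" using admissible_facts(2)[OF adm] by simp
  have "(z + ?c) * (z' + ?c) = ?c\<^sup>2 + (z + z') * ?c + z * z'" by (simp add: algebra_simps power2_eq_square)
  also have "\<dots> = of_real (up_weight (Re (z + z')) (Re (z * z')) (rcontent x))"
    by (subst admissible_facts(1)[OF adm], subst admissible_facts(2)[OF adm]) (simp add: up_weight_def)
  finally have num: "(z + ?c) * (z' + ?c) = of_real (up_weight (Re (z + z')) (Re (z * z')) (rcontent x))" .
  have q: "Re (poch_skew z ?nu lam * poch_skew z' ?nu lam / (z * z' + of_nat n))
     = up_weight (Re (z + z')) (Re (z * z')) (rcontent x) / (Re (z * z') + n)"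
    unfolding poch num den by (metis Re_complex_of_real of_real_divide)
  show ?thesis
    unfolding p_up_def q up_prob_def using cov by (simp add: c dimY_eq nu mult_ac add_ac)
qed

lemma Tn_eq:
  assumes adm: "zz'_admissible z z'" and lam: "lam \<in> YD n"
  shows "Tn z z' n g lam = (\<Sum>x\<in>addable (boxes lam). up_prob (Re (z + z')) (Re (z * z')) (boxes lam) x *
     (\<Sum>y\<in>removable (insert x (boxes lam)). down_prob (insert x (boxes lam)) y * g (diagram_of (insert x (boxes lam) - {y}))))"
proof -
  let ?I = "boxes lam"
  have y: "young lam" and c: "card ?I = n" and I: "yideal ?I" using lam yideal_boxes by (auto simp: YD_iff)
  let ?h = "\<lambda>nu. \<Sum>lam'\<in>YD n. p_down nu lam' * g lam'"
  have "Tn z z' n g lam = (\<Sum>nu\<in>YD (Suc n). if covers lam nu then p_up z z' n lam nu * ?h nu else 0)"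
    unfolding Tn_def by (intro sum.cong refl) (simp add: p_up_def)
  also have "\<dots> = (\<Sum>x\<in>addable ?I. p_up z z' n lam (diagram_of (insert x ?I)) * ?h (diagram_of (insert x ?I)))"
    by (rule sum_covers_up[OF lam])
  also have "\<dots> = (\<Sum>x\<in>addable ?I. up_prob (Re (z + z')) (Re (z * z')) ?I x *
     (\<Sum>y\<in>removable (insert x ?I). down_prob (insert x ?I) y * g (diagram_of (insert x ?I - {y}))))"
  proof (intro sum.cong refl arg_cong2[of _ _ _ _ "(*)"] p_up_eq[OF adm lam])
    fix x assume x: "x \<in> addable ?I"
    let ?J = "insert x ?I" and ?nu = "diagram_of (insert x ?I)"
    have nu: "young ?nu" "boxes ?nu = ?J" using diagram_of[OF addable_ideal[OF x]] by auto
    have nuY: "?nu \<in> YD (Suc n)" using nu addable_notin[OF x] c yideal_finite[OF I] by (simp add: YD_iff)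
    have "?h ?nu = (\<Sum>lam'\<in>YD n. if covers lam' ?nu then real (dimY lam') / real (dimY ?nu) * g lam' else 0)"
      by (intro sum.cong refl) (simp add: p_down_def)
    also have "\<dots> = (\<Sum>b\<in>removable (boxes ?nu). real (dimY (diagram_of (boxes ?nu - {b}))) / real (dimY ?nu) * g (diagram_of (boxes ?nu - {b})))"
      by (rule sum_covers_down[OF nuY])
    also have "\<dots> = (\<Sum>y\<in>removable ?J. down_prob ?J y * g (diagram_of (?J - {y})))"
      unfolding nu by (intro sum.cong refl) (simp add: down_prob_def dimY_eq nu diagram_of(2)[OF removable_ideal])
    finally show "?h ?nu = (\<Sum>y\<in>removable ?J. down_prob ?J y * g (diagram_of (?J - {y})))" .
  qed
  finally show ?thesis .
qed

lemma down_prob_sum: "yideal J \<Longrightarrow> J \<noteq> {} \<Longrightarrow> (\<Sum>y\<in>removable J. down_prob J y) = 1"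
  using ideal_dim_rec[of J] ideal_dim_pos[of J] by (simp add: down_prob_def sum_divide_distrib[symmetric])

lemma up_prob_sum_weighted:
  fixes a b :: real
  shows "(\<Sum>x\<in>addable I. up_prob a b I x * f (box_content x))
    = up_sum (\<lambda>c. up_weight a b (real_of_int c) * f c) I / ((b + real (card I)) * (real (card I) + 1) * ideal_dim I)"
  unfolding up_prob_def up_sum_def sum_divide_distrib by (intro sum.cong refl) (simp add: ac_simps)

text \<open>The weight is quadratic in the content, so \<open>up_sum_quadratic\<close> with p = 1, q
  = a, r = b gives exactly the normaliser.\<close>

lemma up_prob_sum:
  fixes a b :: real
  assumes I: "yideal I" and b: "b > 0"
  shows "(\<Sum>x\<in>addable I. up_prob a b I x) = 1"
proof -
  have "up_sum (\<lambda>c. up_weight a b (real_of_int c) * 1) I = (real (card I) + 1) * (real (card I) + b) * ideal_dim I"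
    using up_sum_quadratic[OF I, of 1 a b] by (simp add: up_weight_def)
  then show ?thesis
    using up_prob_sum_weighted[of a b I "\<lambda>_. 1"] ideal_dim_pos[OF I] b
    by (simp add: mult.commute add.commute)
qed

lemma up_prob_nonneg:
  assumes adm: "zz'_admissible z z'"
  shows "up_prob (Re (z + z')) (Re (z * z')) I x \<ge> 0"
proof -
  have "up_weight (Re (z + z')) (Re (z * z')) (rcontent x) = Re ((z + of_int (box_content x)) * (z' + of_int (box_content x)))"
    by (simp add: up_weight_def algebra_simps power2_eq_square)
  then show ?thesis
    unfolding up_prob_def using admissible_facts(3)[OF adm, of "box_content x"] admissible_facts(4)[OF adm]
    by (intro divide_nonneg_nonneg mult_nonneg_nonneg) (auto simp: ideal_dim_def)
qed

section \<open>The multiplicative observable and its one-step drift\<close>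

definition content_F :: "(nat \<times> nat) set \<Rightarrow> real \<Rightarrow> real" where
  "content_F I u = (\<Prod>b\<in>I. 1 + 1 / (u - rcontent b))"

lemma content_F_insert: "finite I \<Longrightarrow> b \<notin> I \<Longrightarrow> content_F (insert b I) u = content_F I u * (1 + 1 / (u - rcontent b))"
  by (simp add: content_F_def)

lemma nonint_add1: "u \<notin> \<int> \<Longrightarrow> u + 1 \<notin> (\<int> :: real set)"
  by (metis Ints_1 Ints_diff add_diff_cancel_right')

text \<open>Boxwise, (1 + 1/(d + 1)) / (1 + 1/d) = 1 - 1/(d + 1)^2. So the function R from Kerov's
  identities is a quotient of two values of F, and the average over a down step is again expressible
  by F.\<close>

lemma content_F_shift:
  assumes u: "u \<notin> \<int>"
  shows "content_F I (u + 1) = content_F I u * content_R I (u + 1)"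
  unfolding content_F_def content_R_def prod.distrib[symmetric]
proof (intro prod.cong refl)
  fix b
  have gen: "1 + 1 / (d + 1) = (1 + 1 / d) * (1 - 1 / (d + 1)\<^sup>2)" if "d \<noteq> 0" "d + 1 \<noteq> 0" for d :: real
    using that by (simp add: divide_simps) (simp add: power2_eq_square algebra_simps)
  have "u + 1 - rcontent b = (u - rcontent b) + 1" by simp
  then show "1 + 1 / (u + 1 - rcontent b) = (1 + 1 / (u - rcontent b)) * (1 - 1 / (u + 1 - rcontent b)\<^sup>2)"
    using gen[of "u - rcontent b"] nonint_diff[OF u, of "box_content b"] nonint_diff[OF nonint_add1[OF u], of "box_content b"] by metis
qed

lemma content_F_remove:
  assumes u: "u \<notin> \<int>" and fin: "finite J" and y: "y \<in> J"
  shows "content_F (J - {y}) u = content_F J u * (1 - 1 / (u + 1 - rcontent y))"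
proof -
  have gen: "(1 + 1 / d) * (1 - 1 / (d + 1)) = 1" if "d \<noteq> 0" "d + 1 \<noteq> 0" for d :: real
    using that by (simp add: divide_simps)
  have nz: "u - rcontent y \<noteq> 0" "u - rcontent y + 1 \<noteq> 0"
    using nonint_diff[OF u, of "box_content y"] nonint_diff[OF nonint_add1[OF u], of "box_content y"] by (auto simp: algebra_simps)
  have "content_F J u = content_F (J - {y}) u * (1 + 1 / (u - rcontent y))"
    using content_F_insert[of "J - {y}" y u] fin y by (simp add: insert_absorb)
  then have "content_F J u * (1 - 1 / (u - rcontent y + 1)) = content_F (J - {y}) u * ((1 + 1 / (u - rcontent y)) * (1 - 1 / (u - rcontent y + 1)))"
    by simp
  then show ?thesis unfolding gen[OF nz] by (simp add: algebra_simps)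
qed

text \<open>Removing \<open>y\<close> multiplies F(u) by 1 - 1/(u + 1 - c), so the average is
  Kerov's co-transition sum at u + 1; \<open>content_F_shift\<close> absorbs the resulting R(u +
  1).\<close>

lemma down_average_F:
  assumes J: "yideal J" and ne: "J \<noteq> {}" and u: "u \<notin> \<int>"
  shows "(\<Sum>y\<in>removable J. down_prob J y * content_F (J - {y}) u)
     = (1 - (u + 1) / card J) * content_F J u + (u + 1) / card J * content_F J (u + 1)"
proof -
  have fin: "finite J" using yideal_finite[OF J] .
  have pos: "card J > 0" using fin ne by (simp add: card_gt_0_iff)
  have u1: "u + 1 \<notin> \<int>" using nonint_add1[OF u] .
  have k: "card J * (\<Sum>y\<in>removable J. down_prob J y / (u + 1 - rcontent y)) = (u + 1) - content_Q J (u + 1)"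
    using kerov_down[OF J u1 ne] by (simp add: down_prob_def sum_distrib_left)
  have "(\<Sum>y\<in>removable J. down_prob J y * content_F (J - {y}) u)
     = (\<Sum>y\<in>removable J. content_F J u * (down_prob J y - down_prob J y / (u + 1 - rcontent y)))"
    using removable_in by (intro sum.cong refl) (simp add: content_F_remove[OF u fin] algebra_simps)
  also have "\<dots> = content_F J u * (1 - (\<Sum>y\<in>removable J. down_prob J y / (u + 1 - rcontent y)))"
    unfolding sum_distrib_left[symmetric] sum_subtractf down_prob_sum[OF J ne] ..
  also have "(\<Sum>y\<in>removable J. down_prob J y / (u + 1 - rcontent y)) = (u + 1) / card J * (1 - content_R J (u + 1))"
    using k pos by (simp add: content_Q_def field_simps)
  also have "content_F J u * (1 - (u + 1) / card J * (1 - content_R J (u + 1)))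
     = (1 - (u + 1) / card J) * content_F J u + (u + 1) / card J * (content_F J u * content_R J (u + 1))"
  proof -
    have "f * (1 - s * (1 - r)) = (1 - s) * f + s * (f * r)" for f s r :: real by (simp add: algebra_simps)
    then show ?thesis .
  qed
  finally show ?thesis by (simp add: content_F_shift[OF u])
qed

definition up_excess :: "real \<Rightarrow> real \<Rightarrow> (nat \<times> nat) set \<Rightarrow> real \<Rightarrow> real" where
  "up_excess a b I u = (up_weight a b u / content_Q I u - u - a) / (b + card I)"

text \<open>Divide the weight, as a polynomial in c, by u - c: the remainder is its value at u,
  handled by \<open>kerov_up\<close>, and the quotient is linear in c, handled by
  \<open>up_sum_quadratic\<close>. The result \<open>up_excess\<close> is the mean of 1/(u - c) for
  the added box.\<close>

lemma up_average_F:
  assumes I: "yideal I" and b: "b > 0" and u: "u \<notin> \<int>"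
  shows "(\<Sum>x\<in>addable I. up_prob a b I x * content_F (insert x I) u) = content_F I u * (1 + up_excess a b I u)"
proof -
  have fin: "finite I" using yideal_finite[OF I] .
  have pos: "ideal_dim I > 0" using ideal_dim_pos[OF I] .
  have w: "up_weight a b (real_of_int c) * cauchy u c = up_weight a b u * cauchy u c + (- 1) * (0 * (real_of_int c)\<^sup>2 + 1 * real_of_int c + (u + a))" for c
    using nonint_diff[OF u, of c] by (simp add: up_weight_def divide_simps) (simp add: power2_eq_square algebra_simps)
  have "up_sum (\<lambda>c. up_weight a b (real_of_int c) * cauchy u c) I
     = up_weight a b u * up_sum (cauchy u) I + (- 1) * up_sum (\<lambda>c. 0 * (real_of_int c)\<^sup>2 + 1 * real_of_int c + (u + a)) I"
    unfolding w up_sum_def sum_distrib_left sum.distrib[symmetric]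
    by (intro sum.cong refl) (simp add: algebra_simps)
  also have "\<dots> = (card I + 1) * ideal_dim I * (up_weight a b u / content_Q I u - u - a)"
    unfolding up_sum_quadratic[OF I] kerov_up[OF I u] by (simp add: algebra_simps add_divide_distrib)
  finally have e: "(\<Sum>x\<in>addable I. up_prob a b I x * cauchy u (box_content x)) = up_excess a b I u"
    using up_prob_sum_weighted[of a b I "cauchy u"] pos b unfolding up_excess_def
    by (simp add: add.commute[of 1] mult.commute[of "ideal_dim I"])
  have "(\<Sum>x\<in>addable I. up_prob a b I x * content_F (insert x I) u)
     = (\<Sum>x\<in>addable I. content_F I u * (up_prob a b I x + up_prob a b I x * cauchy u (box_content x)))"
    using addable_notin by (intro sum.cong refl) (simp add: content_F_insert[OF fin] algebra_simps)
  then show ?thesis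
    unfolding sum_distrib_left[symmetric] sum.distrib e up_prob_sum[OF I b] .
qed

text \<open>The down average involves F at u and at u + 1, so the up average is taken at both
  points. The shift identity then extracts the common factor F(u), leaving a relative change in
  which only R remains.\<close>

lemma Tn_content_F:
  assumes adm: "zz'_admissible z z'" and lam: "lam \<in> YD n" and u: "u \<notin> \<int>"
  defines "I \<equiv> boxes lam" and "a \<equiv> Re (z + z')" and "b \<equiv> Re (z * z')"
  shows "Tn z z' n (\<lambda>mu. content_F (boxes mu) u) lam = content_F I u *
    ((1 - (u + 1) / (real n + 1)) * (1 + up_excess a b I u)
      + (u + 1) / (real n + 1) * (content_R I (u + 1) * (1 + up_excess a b I (u + 1))))"
proof -
  have c: "card I = n" and I: "yideal I" using lam yideal_boxes by (auto simp: YD_iff I_def)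
  have b: "b > 0" using admissible_facts(4)[OF adm] by (simp add: b_def)
  let ?s = "(u + 1) / (real n + 1)"
  have "Tn z z' n (\<lambda>mu. content_F (boxes mu) u) lam = (\<Sum>x\<in>addable I. up_prob a b I x *
     (\<Sum>y\<in>removable (insert x I). down_prob (insert x I) y * content_F (insert x I - {y}) u))"
    unfolding Tn_eq[OF adm lam] I_def[symmetric] a_def[symmetric] b_def[symmetric]
    by (intro sum.cong refl arg_cong2[of _ _ _ _ "(*)"]) (simp add: diagram_of(2)[OF removable_ideal])
  also have "\<dots> = (\<Sum>x\<in>addable I. (1 - ?s) * (up_prob a b I x * content_F (insert x I) u) + ?s * (up_prob a b I x * content_F (insert x I) (u + 1)))"
  proof (intro sum.cong refl)
    fix x assume x: "x \<in> addable I"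
    have cJ: "real (card (insert x I)) = real n + 1" using c yideal_finite[OF I] addable_notin[OF x] by simp
    show "up_prob a b I x * (\<Sum>y\<in>removable (insert x I). down_prob (insert x I) y * content_F (insert x I - {y}) u)
       = (1 - ?s) * (up_prob a b I x * content_F (insert x I) u) + ?s * (up_prob a b I x * content_F (insert x I) (u + 1))"
      unfolding down_average_F[OF addable_ideal[OF x] insert_not_empty u] cJ by (simp add: algebra_simps)
  qed
  also have "\<dots> = (1 - ?s) * (content_F I u * (1 + up_excess a b I u)) + ?s * (content_F I (u + 1) * (1 + up_excess a b I (u + 1)))"
    unfolding sum.distrib sum_distrib_left[symmetric] up_average_F[OF I b u] up_average_F[OF I b nonint_add1[OF u]] ..
  also have "\<dots> = content_F I u * ((1 - ?s) * (1 + up_excess a b I u) + ?s * (content_R I (u + 1) * (1 + up_excess a b I (u + 1))))"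
  proof -
    have "(1 - s) * (f * p) + s * (f * r * q) = f * ((1 - s) * p + s * (r * q))" for s f p r q :: real
      by (simp add: algebra_simps)
    then show ?thesis unfolding content_F_shift[OF u] .
  qed
  finally show ?thesis .
qed

text \<open>For u at least 2n every |u - c| is at least n + 1. So R has n factors 1 - O(n^-2), and a
  unit shift changes each factor by O(n^-3).\<close>

lemma content_R_bounds:
  assumes I: "yideal I" and n: "card I = n" "n \<ge> 1" and u: "u \<ge> 2 * real n"
  shows "content_R I u \<le> 1" "1 - content_R I u \<le> 1 / n" "content_R I u \<ge> 1 / 2"
    "\<bar>content_R I (u + 1) - content_R I u\<bar> \<le> 2 / (real n)\<^sup>2"
proof -
  have d: "u - rcontent b \<ge> n + 1" if "b \<in> I" for b
    using rcontent_bound[OF I that] n u by linarith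
  let ?x = "\<lambda>b. 1 / (u - rcontent b)\<^sup>2"
  have x: "0 \<le> ?x b" "?x b \<le> 1 / (real n + 1)\<^sup>2" "?x b \<le> 1" if "b \<in> I" for b
  proof -
    have le: "(real n + 1)\<^sup>2 \<le> (u - rcontent b)\<^sup>2" using d[OF that] by (intro power_mono) auto
    moreover have "0 < (real n + 1)\<^sup>2" by (intro zero_less_power) simp
    ultimately show "?x b \<le> 1 / (real n + 1)\<^sup>2" by (intro divide_left_mono mult_pos_pos) linarith+
    have "1 \<le> (real n + 1)\<^sup>2" by (simp add: power2_eq_square algebra_simps)
    then have "1 \<le> (u - rcontent b)\<^sup>2" using le by linarith
    moreover have "1 / x \<le> 1" if "1 \<le> x" for x :: real using that by (simp add: divide_le_eq)
    ultimately show "?x b \<le> 1" by blast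
  qed simp
  show 1: "content_R I u \<le> 1"
    unfolding content_R_def using x by (intro prod_le_1) auto
  have "\<bar>content_R I u - 1\<bar> \<le> (\<Sum>b\<in>I. \<bar>(1 - ?x b) - 1\<bar>)"
    unfolding content_R_def using norm_prod_diff[of I "\<lambda>b. 1 - ?x b" "\<lambda>_. 1"] x by simp
  also have "\<dots> \<le> (\<Sum>b\<in>I. 1 / (real n + 1)\<^sup>2)" using x by (intro sum_mono) auto
  also have "\<dots> = n / (real n + 1)\<^sup>2" using n by simp
  finally have *: "1 - content_R I u \<le> n / (real n + 1)\<^sup>2" using 1 by simp
  have "real n / (real n + 1)\<^sup>2 \<le> 1 / n"
    using n by (simp add: divide_simps power2_eq_square algebra_simps not_less)
  then show "1 - content_R I u \<le> 1 / n" using * by linarith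
  have "real n / (real n + 1)\<^sup>2 \<le> 1 / 2"
    by (simp add: divide_simps power2_eq_square algebra_simps)
  then show "content_R I u \<ge> 1 / 2" using * by linarith
  let ?y = "\<lambda>b. 1 / (u + 1 - rcontent b)\<^sup>2"
  have y: "\<bar>?x b - ?y b\<bar> \<le> 2 / (real n) ^ 3" "0 \<le> ?y b" "?y b \<le> ?x b" if "b \<in> I" for b
  proof -
    define c where "c = u - rcontent b"
    have c: "c \<ge> n" "c > 0" "c \<ge> 1" using d[OF that] n by (auto simp: c_def)
    have e: "u + 1 - rcontent b = c + 1" by (simp add: c_def)
    show "?y b \<le> ?x b" unfolding e c_def[symmetric] using c by (intro divide_left_mono power_mono) auto
    have "1 / c\<^sup>2 - 1 / (c + 1)\<^sup>2 = (2 * c + 1) / (c\<^sup>2 * (c + 1)\<^sup>2)"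
      using c by (simp add: divide_simps) (simp add: power2_eq_square algebra_simps)
    also have "\<dots> \<le> (2 * (c + 1)) / (c\<^sup>2 * (c + 1)\<^sup>2)" using c by (intro divide_right_mono) auto
    also have "\<dots> = 2 / (c\<^sup>2 * (c + 1))"
    proof -
      have "2 * k / (c\<^sup>2 * k\<^sup>2) = 2 / (c\<^sup>2 * k)" if "k \<noteq> 0" for k using that by (simp add: power2_eq_square)
      from this[of "c + 1"] show ?thesis using c by linarith
    qed
    also have "\<dots> \<le> 2 / (real n) ^ 3"
    proof (rule divide_left_mono)
      have "(real n)\<^sup>2 * real n \<le> c\<^sup>2 * (c + 1)" using c by (intro mult_mono power_mono) auto
      then show "real n ^ 3 \<le> c\<^sup>2 * (c + 1)" by (simp add: power2_eq_square power3_eq_cube)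
    qed (use c n in auto)
    finally show "\<bar>?x b - ?y b\<bar> \<le> 2 / (real n) ^ 3"
      unfolding e c_def[symmetric] using \<open>?y b \<le> ?x b\<close> unfolding e c_def[symmetric] by simp
  qed simp
  have "\<bar>content_R I (u + 1) - content_R I u\<bar> \<le> (\<Sum>b\<in>I. \<bar>(1 - ?y b) - (1 - ?x b)\<bar>)"
    unfolding content_R_def using norm_prod_diff[of I "\<lambda>b. 1 - ?y b" "\<lambda>b. 1 - ?x b"] x y by force
  also have "\<dots> \<le> (\<Sum>b\<in>I. 2 / (real n) ^ 3)" using y by (intro sum_mono) auto
  also have "\<dots> = 2 / (real n)\<^sup>2" using n by (simp add: power2_eq_square power3_eq_cube)
  finally show "\<bar>content_R I (u + 1) - content_R I u\<bar> \<le> 2 / (real n)\<^sup>2" .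
qed

lemma abs_mult_le: "\<bar>x\<bar> \<le> X \<Longrightarrow> \<bar>y\<bar> \<le> Y \<Longrightarrow> \<bar>x * y\<bar> \<le> X * (Y :: real)"
  unfolding abs_mult by (intro mult_mono) auto

text \<open>The gain \<open>e\<close> of the up step and the loss s (1 - R1) of the down step both
  equal u (1 - R) / n to leading order, so their difference is O(n^-2). The terms s (e1 - e) and s
  (1 - R1) e1 are already of that size. The constant adds up the five bounds \<open>q1\<close> to
  \<open>q5\<close>.\<close>

lemma drift_bound:
  fixes a b u R R1 B n :: real
  assumes n: "n \<ge> 1" and b: "b > 0" and u: "2 * n \<le> u" "u \<le> B * n"
    and R: "1 / 2 \<le> R" "R \<le> 1" "1 - R \<le> 1 / n" and R1: "1 / 2 \<le> R1" "R1 \<le> 1" "1 - R1 \<le> 1 / n"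
    and RR: "\<bar>R1 - R\<bar> \<le> 2 / n\<^sup>2"
  defines "e \<equiv> (up_weight a b u / (u * R) - u - a) / (b + n)"
    and "e1 \<equiv> (up_weight a b (u + 1) / ((u + 1) * R1) - (u + 1) - a) / (b + n)"
    and "s \<equiv> (u + 1) / (n + 1)"
  shows "\<bar>(1 - s) * (1 + e) + s * (R1 * (1 + e1)) - 1\<bar>
    \<le> ((2 * \<bar>a\<bar> + 2 * b) + 2 * B * (1 + b) + (1 + 4 * B) + (B + 1) * (2 + 8 * B + 8 * \<bar>a\<bar> + 4 * b)
        + (B + 1) * (2 * B + 2 + 2 * \<bar>a\<bar> + 2 * b)) / n\<^sup>2"
proof -
  define h where "h = 1 / n"
  have h: "0 < h" "h \<le> 1" "n * h = 1" using n by (auto simp: h_def)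
  have h2: "1 / n\<^sup>2 = h * h" by (simp add: h_def power2_eq_square)
  have u0: "u \<ge> 1" "u > 0" using u n by auto
  have B: "B \<ge> 2"
  proof -
    have "2 * n \<le> B * n" using u by linarith
    then show ?thesis using n by simp
  qed
  have uh: "u * h \<le> B" using mult_right_mono[OF u(2), of h] h by (simp add: mult.assoc)
  \<comment> \<open>The reciprocals are introduced as opaque atoms, so that the later arithmetic is
    polynomial.\<close>
  obtain iu iu1 iN in1 iR iR1 where inv: "iu = 1 / u" "iu1 = 1 / (u + 1)" "iN = 1 / (b + n)" "in1 = 1 / (n + 1)"
    "iR = 1 / R" "iR1 = 1 / R1" by blast
  have iu: "0 \<le> iu" "iu \<le> h" "0 \<le> iu1" "iu1 \<le> h" unfolding h_def inv using u n by (auto intro!: divide_left_mono)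
  have iN: "0 \<le> iN" "iN \<le> h" "0 \<le> in1" "in1 \<le> h" unfolding h_def inv using b n by (auto intro!: divide_left_mono)
  \<comment> \<open>Both x and y are of order h, but x - y = -x y is of order h^2. This is the
    source of the cancellation between the two half-steps.\<close>
  define x where "x = 1 - R" define x1 where "x1 = 1 - R1"
  define y where "y = iR - 1" define y1 where "y1 = iR1 - 1"
  have Rpos: "R > 0" "R1 > 0" using R R1 by auto
  have x: "0 \<le> x" "x \<le> h" "0 \<le> x1" "x1 \<le> h" using R R1 by (auto simp: x_def x1_def h_def)
  have yx: "y = x * iR" "y1 = x1 * iR1" using Rpos by (auto simp: inv x_def x1_def y_def y1_def field_simps)
  have iR: "iR \<le> 2" "iR1 \<le> 2" "0 < iR" "0 < iR1" using R R1 by (auto simp: inv divide_le_eq)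
  have y: "0 \<le> y" "y \<le> 2 * h" "0 \<le> y1" "y1 \<le> 2 * h"
    unfolding yx using x iR mult_mono[of x h "iR" 2] mult_mono[of x1 h "iR1" 2] by auto
  have xx: "\<bar>x1 - x\<bar> \<le> 2 * (h * h)" using RR by (simp add: x_def x1_def h2[symmetric] abs_minus_commute)
  have xy: "\<bar>x - y\<bar> \<le> 2 * (h * h)"
  proof -
    have "x - y = - (x * y)" using Rpos by (simp add: inv x_def y_def field_simps)
    moreover have "x * y \<le> h * (2 * h)" using x y by (intro mult_mono) auto
    ultimately show ?thesis using x y by simp
  qed
  have yy: "\<bar>y1 - y\<bar> \<le> 8 * (h * h)"
  proof -
    have "y1 - y = (x1 - x) * (iR * iR1)" using Rpos by (simp add: inv x_def x1_def y_def y1_def field_simps)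
    moreover have "\<bar>iR * iR1\<bar> \<le> 2 * 2" using iR by (intro abs_mult_le) auto
    ultimately have "\<bar>y1 - y\<bar> \<le> (2 * (h * h)) * (2 * 2)" using abs_mult_le[OF xx] by metis
    then show ?thesis by simp
  qed
  define E where "E = u * y + (a * y + b * (iR * iu))"
  define E1 where "E1 = (u + 1) * y1 + (a * y1 + b * (iR1 * iu1))"
  have gE: "up_weight a b v / (v * r) - v - a = v * (1 / r - 1) + (a * (1 / r - 1) + b * (1 / r * (1 / v)))"
    if "v > 0" "r > 0" for v r using that
    by (simp add: up_weight_def field_simps power2_eq_square)
  have e: "e = E * iN" unfolding e_def gE[OF u0(2) Rpos(1)] E_def y_def inv by simp
  have e1: "e1 = E1 * iN" unfolding e1_def using gE[of "u + 1" R1] u0 Rpos unfolding E1_def y1_def inv by simp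
  have bu: "\<bar>b * (iR * iu)\<bar> \<le> 2 * b * h" "\<bar>b * (iR1 * iu1)\<bar> \<le> 2 * b * h"
  proof -
    have 1: "\<bar>iR * iu\<bar> \<le> 2 * h" using iR iu by (intro abs_mult_le) auto
    have 2: "\<bar>iR1 * iu1\<bar> \<le> 2 * h" using iR iu by (intro abs_mult_le) auto
    have "\<bar>b * (iR * iu)\<bar> \<le> b * (2 * h)" by (intro abs_mult_le 1) (use b in auto)
    moreover have "\<bar>b * (iR1 * iu1)\<bar> \<le> b * (2 * h)" by (intro abs_mult_le 2) (use b in auto)
    ultimately show "\<bar>b * (iR * iu)\<bar> \<le> 2 * b * h" "\<bar>b * (iR1 * iu1)\<bar> \<le> 2 * b * h"
      by (simp_all add: mult_ac)
  qed
  have ay: "\<bar>a * y\<bar> \<le> \<bar>a\<bar> * (2 * h)" "\<bar>a * y1\<bar> \<le> \<bar>a\<bar> * (2 * h)" 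
    using y by (intro abs_mult_le; simp)+
  have p1: "\<bar>u * y\<bar> \<le> 2 * B"
  proof -
    have "u * y \<le> u * (2 * h)" using y u0 by (intro mult_left_mono) auto
    also have "\<dots> = 2 * (u * h)" by simp
    finally have "u * y \<le> 2 * B" using uh by linarith
    then show ?thesis using y u0 by simp
  qed
  have p2: "\<bar>E - u * y\<bar> \<le> (2 * \<bar>a\<bar> + 2 * b) * h"
    unfolding E_def using ay(1) bu(1) by (simp add: algebra_simps)
  have p3: "\<bar>E1\<bar> \<le> 2 * B + 2 + 2 * \<bar>a\<bar> + 2 * b"
  proof -
    have "(u + 1) * y1 \<le> (u + 1) * (2 * h)" using y u0 by (intro mult_left_mono) auto
    then have "\<bar>(u + 1) * y1\<bar> \<le> 2 * B + 2" using uh y u0 h by (simp add: algebra_simps)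
    moreover have "\<bar>a\<bar> * (2 * h) \<le> \<bar>a\<bar> * (2 * 1)" "2 * b * h \<le> 2 * b * 1" using h b by (intro mult_left_mono; simp)+
    ultimately show ?thesis unfolding E1_def using ay(2) bu(2) by linarith
  qed
  have p4: "\<bar>E1 - E\<bar> \<le> (2 + 8 * B + 8 * \<bar>a\<bar> + 4 * b) * h"
  proof -
    have eq: "E1 - E = y1 + u * (y1 - y) + a * (y1 - y) + (b * (iR1 * iu1) - b * (iR * iu))"
      unfolding E_def E1_def by (simp add: algebra_simps)
    have "\<bar>u * (y1 - y)\<bar> \<le> u * (8 * (h * h))" using u0 yy by (intro abs_mult_le) auto
    also have "\<dots> = 8 * (u * h) * h" by simp
    also have "\<dots> \<le> 8 * B * h" using uh h by (intro mult_right_mono) auto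
    finally have 1: "\<bar>u * (y1 - y)\<bar> \<le> 8 * B * h" .
    have "\<bar>a * (y1 - y)\<bar> \<le> \<bar>a\<bar> * (8 * (h * h))" using yy by (intro abs_mult_le) auto
    also have "\<dots> \<le> \<bar>a\<bar> * (8 * (h * 1))" using h by (intro mult_left_mono) auto
    finally have 2: "\<bar>a * (y1 - y)\<bar> \<le> 8 * \<bar>a\<bar> * h" by simp
    have "(2 + 8 * B + 8 * \<bar>a\<bar> + 4 * b) * h = 2 * h + 8 * B * h + 8 * \<bar>a\<bar> * h + (2 * b * h + 2 * b * h)"
      by (simp add: algebra_simps)
    then show ?thesis unfolding eq using 1 2 bu y by linarith
  qed
  have p5: "\<bar>u * y - (u + 1) * x1\<bar> \<le> (1 + 4 * B) * h"
  proof -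
    have eq: "u * y - (u + 1) * x1 = - x1 + u * (y - x1)" by (simp add: algebra_simps)
    have "\<bar>y - x1\<bar> \<le> 4 * (h * h)" using xx xy by linarith
    then have "\<bar>u * (y - x1)\<bar> \<le> u * (4 * (h * h))" using u0 by (intro abs_mult_le) auto
    also have "\<dots> = 4 * (u * h) * h" by simp
    also have "\<dots> \<le> 4 * B * h" using uh h by (intro mult_right_mono) auto
    finally have "\<bar>u * (y - x1)\<bar> \<le> 4 * B * h" .
    then show ?thesis unfolding eq using x by (simp add: algebra_simps)
  qed
  have s: "0 \<le> s" "s \<le> B + 1"
  proof -
    show "0 \<le> s" using u0 n by (simp add: s_def)
    have "u + 1 \<le> (B + 1) * (n + 1)" using u B n by (simp add: algebra_simps)
    then show "s \<le> B + 1" using n by (simp add: s_def divide_le_eq)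
  qed
  have q1: "\<bar>(E - u * y) * iN\<bar> \<le> ((2 * \<bar>a\<bar> + 2 * b) * h) * h"
    using p2 iN by (intro abs_mult_le) auto
  have q2: "\<bar>u * y * (iN - in1)\<bar> \<le> (2 * B) * ((1 + b) * (h * h))"
  proof (rule abs_mult_le[OF p1])
    have "iN - in1 = (1 - b) * (iN * in1)" using b n by (simp add: inv field_simps)
    moreover have "\<bar>iN * in1\<bar> \<le> h * h" using iN by (intro abs_mult_le) auto
    moreover have "\<bar>1 - b\<bar> \<le> 1 + b" using b by auto
    ultimately show "\<bar>iN - in1\<bar> \<le> (1 + b) * (h * h)" using abs_mult_le by metis
  qed
  have q3: "\<bar>(u * y - (u + 1) * x1) * in1\<bar> \<le> ((1 + 4 * B) * h) * h"
    using p5 iN by (intro abs_mult_le) auto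
  have q4: "\<bar>s * ((E1 - E) * iN)\<bar> \<le> (B + 1) * (((2 + 8 * B + 8 * \<bar>a\<bar> + 4 * b) * h) * h)"
    using p4 iN s by (intro abs_mult_le) auto
  have q5: "\<bar>s * (x1 * (E1 * iN))\<bar> \<le> (B + 1) * (h * ((2 * B + 2 + 2 * \<bar>a\<bar> + 2 * b) * h))"
    using p3 iN s x by (intro abs_mult_le) auto
  have sx: "s * x1 = (u + 1) * x1 * in1" by (simp add: s_def inv)
  \<comment> \<open>Substituting R1 = 1 - x1 exposes the difference \<open>e - s * x1\<close>. It is
    split next into the error of replacing E by u y, the mismatch of the normalisers b + n and n +
    1, and the difference of u y and (u + 1) x1.\<close>
  have "(1 - s) * (1 + e) + s * (R1 * (1 + e1)) - 1 = e - s * x1 + s * (e1 - e) - s * (x1 * e1)"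
    by (simp add: x1_def algebra_simps)
  also have "\<dots> = (E - u * y) * iN + u * y * (iN - in1) + (u * y - (u + 1) * x1) * in1
     + s * ((E1 - E) * iN) - s * (x1 * (E1 * iN))"
    unfolding e e1 sx by (simp only: left_diff_distrib right_diff_distrib)
  finally have "\<bar>(1 - s) * (1 + e) + s * (R1 * (1 + e1)) - 1\<bar> \<le>
      ((2 * \<bar>a\<bar> + 2 * b) * h) * h + (2 * B) * ((1 + b) * (h * h)) + ((1 + 4 * B) * h) * h
      + (B + 1) * (((2 + 8 * B + 8 * \<bar>a\<bar> + 4 * b) * h) * h) + (B + 1) * (h * ((2 * B + 2 + 2 * \<bar>a\<bar> + 2 * b) * h))"
    using q1 q2 q3 q4 q5 by linarith
  also have "\<dots> = ((2 * \<bar>a\<bar> + 2 * b) + 2 * B * (1 + b) + (1 + 4 * B) + (B + 1) * (2 + 8 * B + 8 * \<bar>a\<bar> + 4 * b)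
        + (B + 1) * (2 * B + 2 + 2 * \<bar>a\<bar> + 2 * b)) * (h * h)"
    by (simp add: algebra_simps)
  finally show ?thesis unfolding h2[symmetric] by simp
qed

text \<open>Each of the n factors lies between 1 and exp(1/n), so the product is at most e.\<close>

lemma content_F_bounds:
  assumes I: "yideal I" and n: "card I = n" "n \<ge> 1" and u: "u \<ge> 2 * real n"
  shows "0 \<le> content_F I u" "content_F I u \<le> 3"
proof -
  have d: "u - rcontent b \<ge> n" "u - rcontent b > 0" if "b \<in> I" for b
    using rcontent_bound[OF I that] n u by auto
  show "0 \<le> content_F I u" unfolding content_F_def 
  proof (rule prod_nonneg)
    fix b assume "b \<in> I"
    then have "0 \<le> 1 / (u - rcontent b)" using d by (intro divide_nonneg_nonneg) (auto simp: less_imp_le)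
    then show "0 \<le> 1 + 1 / (u - rcontent b)" by linarith
  qed
  have "content_F I u \<le> (\<Prod>b\<in>I. exp (1 / n))"
    unfolding content_F_def
  proof (rule prod_mono)
    fix b assume b: "b \<in> I"
    have "1 / (u - rcontent b) \<le> 1 / n" using d[OF b] n by (intro divide_left_mono) auto
    then have "1 + 1 / (u - rcontent b) \<le> exp (1 / n)" using exp_ge_add_one_self[of "1 / n"] by linarith
    moreover have "0 \<le> 1 / (u - rcontent b)" using d[OF b] by (intro divide_nonneg_nonneg) (auto simp: less_imp_le)
    ultimately show "0 \<le> 1 + 1 / (u - rcontent b) \<and> 1 + 1 / (u - rcontent b) \<le> exp (1 / n)" by linarith
  qed
  also have "\<dots> = exp 1" using n by (simp add: exp_of_nat_mult[symmetric])
  also have "\<dots> \<le> 3" using exp_le by simp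
  finally show "content_F I u \<le> 3" .
qed

text \<open>Adding and removing a box multiplies F by (1 + p)(1 - q) with p and q at most 1/n: a
  relative change of at most 3/n of a quantity of at most 3.\<close>

lemma content_F_move:
  assumes I: "yideal I" and n: "card I = n" "n \<ge> 1" and u: "u \<ge> 2 * real n" "u \<notin> \<int>"
    and x: "x \<in> addable I" and y: "y \<in> removable (insert x I)"
  shows "\<bar>content_F (insert x I - {y}) u - content_F I u\<bar> \<le> 9 / n"
proof -
  have fin: "finite I" using yideal_finite[OF I] .
  have J: "yideal (insert x I)" using addable_ideal[OF x] .
  have cJ: "real (card (insert x I)) = n + 1" using addable_notin[OF x] fin n by simp
  have cx: "\<bar>rcontent x\<bar> \<le> n" "\<bar>rcontent y\<bar> \<le> n"
    using rcontent_bound[OF J, of x] rcontent_bound[OF J removable_in[OF y]] cJ by auto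
  define p where "p = 1 / (u - rcontent x)"
  define q where "q = 1 / (u + 1 - rcontent y)"
  have p: "0 \<le> p" "p \<le> 1 / n" unfolding p_def using cx u n by (auto intro!: divide_left_mono)
  have q: "0 \<le> q" "q \<le> 1 / n" unfolding q_def using cx u n by (auto intro!: divide_left_mono)
  have "content_F (insert x I - {y}) u = content_F I u * (1 + p) * (1 - q)"
    using content_F_remove[OF u(2) _ removable_in[OF y]] content_F_insert[OF fin addable_notin[OF x]] fin
    by (simp add: p_def q_def)
  then have eq: "content_F (insert x I - {y}) u - content_F I u = content_F I u * (p - q - p * q)"
    by (simp add: algebra_simps)
  have "p * q \<le> (1 / n) * 1" using p q n by (intro mult_mono) (auto intro: order_trans)
  moreover have "0 \<le> p * q" using p q by simp
  ultimately have "\<bar>p - q - p * q\<bar> \<le> 3 * (1 / n)" using p q by linarith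
  then have "\<bar>content_F I u * (p - q - p * q)\<bar> \<le> 3 * (3 * (1 / n))"
    using content_F_bounds[OF I n u(1)] by (intro abs_mult_le) auto
  then show ?thesis unfolding eq by simp
qed

lemma Tn_content_F_drift:
  assumes adm: "zz'_admissible z z'" and B: "B \<ge> 3"
  shows "\<exists>C\<ge>0. \<forall>n\<ge>1. \<forall>lam\<in>YD n. \<forall>u. u \<notin> \<int> \<longrightarrow> 2 * real n \<le> u \<longrightarrow> u \<le> B * real n \<longrightarrow>
     \<bar>Tn z z' n (\<lambda>mu. content_F (boxes mu) u) lam - content_F (boxes lam) u\<bar> \<le> C / (real n)\<^sup>2"
proof -
  define a b where "a = Re (z + z')" and "b = Re (z * z')"
  have b: "b > 0" using admissible_facts(4)[OF adm] by (simp add: b_def)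
  define C where "C = ((2 * \<bar>a\<bar> + 2 * b) + 2 * B * (1 + b) + (1 + 4 * B) + (B + 1) * (2 + 8 * B + 8 * \<bar>a\<bar> + 4 * b)
        + (B + 1) * (2 * B + 2 + 2 * \<bar>a\<bar> + 2 * b))"
  have C: "C \<ge> 0" unfolding C_def using b B by (intro add_nonneg_nonneg mult_nonneg_nonneg) auto
  have "\<bar>Tn z z' n (\<lambda>mu. content_F (boxes mu) u) lam - content_F (boxes lam) u\<bar> \<le> 3 * C / (real n)\<^sup>2"
    if n: "n \<ge> 1" and lam: "lam \<in> YD n" and u: "u \<notin> \<int>" "2 * real n \<le> u" "u \<le> B * real n" for n lam u
  proof -
    let ?I = "boxes lam"
    have c: "card ?I = n" and I: "yideal ?I" using lam yideal_boxes by (auto simp: YD_iff)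
    have u1: "u + 1 \<ge> 2 * real n" using u by simp
    note R = content_R_bounds[OF I c n u(2)] and R1 = content_R_bounds[OF I c n u1]
    let ?X = "(1 - (u + 1) / (real n + 1)) * (1 + up_excess a b ?I u)
      + (u + 1) / (real n + 1) * (content_R ?I (u + 1) * (1 + up_excess a b ?I (u + 1)))"
    have X: "\<bar>?X - 1\<bar> \<le> C / (real n)\<^sup>2"
      unfolding up_excess_def c content_Q_def C_def
      using n by (intro drift_bound b u R R1) auto
    have "Tn z z' n (\<lambda>mu. content_F (boxes mu) u) lam - content_F ?I u = content_F ?I u * (?X - 1)"
      unfolding Tn_content_F[OF adm lam u(1)] a_def b_def by (simp only: right_diff_distrib mult_1_right)
    moreover have "\<bar>content_F ?I u * (?X - 1)\<bar> \<le> 3 * (C / (real n)\<^sup>2)"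
      using content_F_bounds[OF I c n u(2)] X by (intro abs_mult_le) auto
    ultimately show ?thesis by simp
  qed
  then show ?thesis using C by (intro exI[of _ "3 * C"]) auto
qed

section \<open>Frobenius coordinates and sums over principal hooks\<close>

lemma diagY_iff:
  assumes y: "young lam" shows "i < diagY lam \<longleftrightarrow> (Suc i, Suc i) \<in> boxes lam"
proof -
  let ?S = "{i. i < length lam \<and> Suc i \<le> lam ! i}"
  have mem: "(Suc i, Suc i) \<in> boxes lam \<longleftrightarrow> i \<in> ?S" for i by (auto simp: boxes_def)
  have "Suc ` ?S = {1..card (Suc ` ?S)}"
  proof (rule initial_segment_eq)
    fix i j assume i: "i \<in> Suc ` ?S" and j: "1 \<le> j" "j \<le> i"
    then obtain k where k: "i = Suc k" "k \<in> ?S" by auto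
    have "(i, i) \<in> boxes lam" using k mem[of k] by simp
    then have "(j, j) \<in> boxes lam" using j yideal_down[OF yideal_boxes[OF y]] by blast
    moreover obtain l where "j = Suc l" using j by (cases j) auto
    ultimately show "j \<in> Suc ` ?S" using mem[of l] by blast
  qed auto
  moreover have "card (Suc ` ?S) = diagY lam" by (simp add: diagY_def card_image)
  ultimately have "Suc i \<in> Suc ` ?S \<longleftrightarrow> Suc i \<in> {1..diagY lam}" by simp
  then show ?thesis unfolding mem by auto
qed

lemma row_eq: "(Suc i, j) \<in> boxes lam \<longleftrightarrow> i < length lam \<and> 1 \<le> j \<and> j \<le> lam ! i"
  by (auto simp: boxes_def)

lemma col_eq:
  assumes y: "young lam" and j: "1 \<le> j" shows "(i, j) \<in> boxes lam \<longleftrightarrow> 1 \<le> i \<and> i \<le> conjY lam j"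
proof -
  let ?S = "{i. i < length lam \<and> j \<le> lam ! i}"
  have mem: "(Suc i, j) \<in> boxes lam \<longleftrightarrow> i \<in> ?S" for i using j by (auto simp: boxes_def)
  have "Suc ` ?S = {1..card (Suc ` ?S)}"
  proof (rule initial_segment_eq)
    fix a b assume i: "a \<in> Suc ` ?S" and b: "1 \<le> b" "b \<le> a"
    then obtain k where k: "a = Suc k" "k \<in> ?S" by auto
    have "(a, j) \<in> boxes lam" using k mem[of k] by simp
    then have "(b, j) \<in> boxes lam" using b j yideal_down[OF yideal_boxes[OF y], of a j b j] by blast
    moreover obtain l where "b = Suc l" using b by (cases b) auto
    ultimately show "b \<in> Suc ` ?S" using mem[of l] by blast
  qed auto
  moreover have "card (Suc ` ?S) = conjY lam j" by (simp add: conjY_def card_image)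
  ultimately have S: "Suc ` ?S = {1..conjY lam j}" by simp
  show ?thesis
  proof (cases i)
    case 0
    then show ?thesis by (auto simp: boxes_def)
  next
    case (Suc k)
    have "i \<in> Suc ` ?S \<longleftrightarrow> i \<in> {1..conjY lam j}" using S by simp
    then show ?thesis unfolding Suc mem by auto
  qed
qed

definition frob_a :: "nat list \<Rightarrow> nat \<Rightarrow> real" where
  "frob_a lam i = real (lam ! i) - real (Suc i) + 1/2"

definition frob_b :: "nat list \<Rightarrow> nat \<Rightarrow> real" where
  "frob_b lam i = real (conjY lam (Suc i)) - real (Suc i) + 1/2"

lemma telescope_contents:
  fixes g :: "real \<Rightarrow> real"
  shows "(\<Sum>k<N. g (real k + 1/2) - g (real k - 1/2)) = g (real N - 1/2) - g (- 1/2)"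
    "(\<Sum>k<N. g (- real (Suc k) + 1/2) - g (- real (Suc k) - 1/2)) = g (- 1/2) - g (- real N - 1/2)"
proof -
  show "(\<Sum>k<N. g (real k + 1/2) - g (real k - 1/2)) = g (real N - 1/2) - g (- 1/2)"
    by (induction N) (auto simp: algebra_simps)
  have "(\<Sum>k<N. g (- real (Suc k) + 1/2) - g (- real (Suc k) - 1/2)) = (\<Sum>k<N. g (- real k - 1/2) - g (- real (Suc k) - 1/2))"
  proof (intro sum.cong refl)
    fix k
    have "- real (Suc k) + 1/2 = - real k - 1/2" by simp
    then show "g (- real (Suc k) + 1/2) - g (- real (Suc k) - 1/2) = g (- real k - 1/2) - g (- real (Suc k) - 1/2)" by (simp only:)
  qed
  then show "(\<Sum>k<N. g (- real (Suc k) + 1/2) - g (- real (Suc k) - 1/2)) = g (- 1/2) - g (- real N - 1/2)"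
    using sum_lessThan_telescope'[of "\<lambda>k. g (- real k - 1/2)" N] by simp
qed

text \<open>\<open>U\<close> parametrises the arms, diagonal box included, and \<open>L\<close> the
  legs strictly below the diagonal.\<close>

lemma boxes_hooks:
  assumes y: "young lam"
  defines "d \<equiv> diagY lam"
  defines "A \<equiv> \<lambda>(i, k). (Suc i, Suc i + k)" and "B \<equiv> \<lambda>(j, k). (Suc (Suc j + k), Suc j :: nat)"
  defines "U \<equiv> SIGMA i:{..<d}. {..<lam ! i - i}" and "L \<equiv> SIGMA j:{..<d}. {..<conjY lam (Suc j) - Suc j}"
  shows "boxes lam = A ` U \<union> B ` L" "A ` U \<inter> B ` L = {}"
proof -
  show "A ` U \<inter> B ` L = {}" by (auto simp: A_def B_def)
  have diag: "i < d \<longleftrightarrow> (Suc i, Suc i) \<in> boxes lam" for i using diagY_iff[OF y] by (simp add: d_def)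
  note I = yideal_boxes[OF y]
  show "boxes lam = A ` U \<union> B ` L"
  proof (rule set_eqI, clarify)
    fix i j
    show "(i, j) \<in> boxes lam \<longleftrightarrow> (i, j) \<in> A ` U \<union> B ` L"
    proof
      assume b: "(i, j) \<in> boxes lam"
      have p: "1 \<le> i" "1 \<le> j" using yideal_pos[OF I b] by auto
      show "(i, j) \<in> A ` U \<union> B ` L"
      proof (cases "i \<le> j")
        case True
        obtain i' where i': "i = Suc i'" using p by (cases i) auto
        have "(i, i) \<in> boxes lam" using yideal_down[OF I b] p True by blast
        then have "i' < d" using diag i' by simp
        moreover have "j \<le> lam ! i'" using b row_eq i' by blast
        ultimately have "(i', j - i) \<in> U" using True i' by (auto simp: U_def)
        moreover have "(i, j) = A (i', j - i)" using True i' by (auto simp: A_def)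
        ultimately show ?thesis by blast
      next
        case False
        obtain j' where j': "j = Suc j'" using p by (cases j) auto
        have "(j, j) \<in> boxes lam" using yideal_down[OF I b] p False by (meson nat_le_linear order_refl)
        then have "j' < d" using diag j' by simp
        moreover have "i \<le> conjY lam j" using b col_eq[OF y p(2)] by blast
        ultimately have "(j', i - Suc j) \<in> L" using False j' by (auto simp: L_def)
        moreover have "(i, j) = B (j', i - Suc j)" using False j' by (auto simp: B_def)
        ultimately show ?thesis by blast
      qed
    next
      assume "(i, j) \<in> A ` U \<union> B ` L"
      then show "(i, j) \<in> boxes lam"
      proof
        assume "(i, j) \<in> A ` U"
        then obtain i' k where k: "i' < d" "k < lam ! i' - i'" "i = Suc i'" "j = Suc i' + k" by (auto simp: A_def U_def)
        have "i' < length lam" using diag k(1) row_eq by blast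
        then show ?thesis using k row_eq by auto
      next
        assume "(i, j) \<in> B ` L"
        then obtain j' k where k: "j' < d" "k < conjY lam (Suc j') - Suc j'" "i = Suc (Suc j' + k)" "j = Suc j'" by (auto simp: B_def L_def)
        then show ?thesis using col_eq[OF y, of j i] by auto
      qed
    qed
  qed
qed

text \<open>Contents run through 0, 1, 2, ... along an arm and -1, -2, ... down a leg, so the
  differences telescope. The boundary values at -1/2 from arm and leg of one hook cancel, and the
  half-integer end points are the modified Frobenius coordinates.\<close>

lemma sum_hooks:
  fixes g :: "real \<Rightarrow> real"
  assumes y: "young lam"
  shows "(\<Sum>b\<in>boxes lam. g (rcontent b + 1/2) - g (rcontent b - 1/2)) = (\<Sum>i<diagY lam. g (frob_a lam i) - g (- frob_b lam i))"
proof -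
  define d where "d = diagY lam"
  define A where "A = (\<lambda>(i, k). (Suc i, Suc i + k))"
  define B where "B = (\<lambda>(j, k). (Suc (Suc j + k), Suc j :: nat))"
  define U where "U = (SIGMA i:{..<d}. {..<lam ! i - i})"
  define L where "L = (SIGMA j:{..<d}. {..<conjY lam (Suc j) - Suc j})"
  have un: "boxes lam = A ` U \<union> B ` L" "A ` U \<inter> B ` L = {}"
    using boxes_hooks[OF y] by (simp_all add: A_def B_def U_def L_def d_def)
  have fin: "finite U" "finite L" by (auto simp: U_def L_def)
  have inj: "inj_on A U" "inj_on B L" by (auto simp: A_def B_def inj_on_def)
  let ?h = "\<lambda>b. g (rcontent b + 1/2) - g (rcontent b - 1/2)"
  have dr: "Suc i \<le> lam ! i" "Suc i \<le> conjY lam (Suc i)" if "i < d" for i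
    using that diagY_iff[OF y, of i] row_eq[of i "Suc i" lam] col_eq[OF y, of "Suc i" "Suc i"] by (auto simp: d_def)
  have "(\<Sum>b\<in>boxes lam. ?h b) = (\<Sum>b\<in>A ` U. ?h b) + (\<Sum>b\<in>B ` L. ?h b)"
    unfolding un(1) using un(2) fin by (intro sum.union_disjoint) auto
  also have "(\<Sum>b\<in>A ` U. ?h b) = (\<Sum>i<d. \<Sum>k<lam ! i - i. ?h (A (i, k)))"
    unfolding U_def using inj(1) by (subst sum.reindex) (auto simp: U_def sum.Sigma comp_def)
  also have "\<dots> = (\<Sum>i<d. g (frob_a lam i) - g (- 1/2))"
  proof (intro sum.cong refl)
    fix i assume i: "i \<in> {..<d}"
    have "(\<Sum>k<lam ! i - i. ?h (A (i, k))) = (\<Sum>k<lam ! i - i. g (real k + 1/2) - g (real k - 1/2))"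
      by (intro sum.cong refl) (simp add: A_def box_content_def)
    also have "\<dots> = g (real (lam ! i - i) - 1/2) - g (- 1/2)" by (rule telescope_contents(1))
    also have "real (lam ! i - i) - 1/2 = frob_a lam i"
      using dr(1)[of i] i by (simp add: frob_a_def of_nat_diff)
    finally show "(\<Sum>k<lam ! i - i. ?h (A (i, k))) = g (frob_a lam i) - g (- 1/2)" .
  qed
  also have "(\<Sum>b\<in>B ` L. ?h b) = (\<Sum>i<d. \<Sum>k<conjY lam (Suc i) - Suc i. ?h (B (i, k)))"
    unfolding L_def using inj(2) by (subst sum.reindex) (auto simp: L_def sum.Sigma comp_def)
  also have "\<dots> = (\<Sum>i<d. g (- 1/2) - g (- frob_b lam i))"
  proof (intro sum.cong refl)
    fix i assume i: "i \<in> {..<d}"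
    have "(\<Sum>k<conjY lam (Suc i) - Suc i. ?h (B (i, k))) = (\<Sum>k<conjY lam (Suc i) - Suc i. g (- real (Suc k) + 1/2) - g (- real (Suc k) - 1/2))"
      by (intro sum.cong refl) (simp add: B_def box_content_def)
    also have "\<dots> = g (- 1/2) - g (- real (conjY lam (Suc i) - Suc i) - 1/2)" by (rule telescope_contents(2))
    also have "- real (conjY lam (Suc i) - Suc i) - 1/2 = - frob_b lam i"
      using dr(2)[of i] i by (simp add: frob_b_def of_nat_diff)
    finally show "(\<Sum>k<conjY lam (Suc i) - Suc i. ?h (B (i, k))) = g (- 1/2) - g (- frob_b lam i)" .
  qed
  finally show ?thesis by (simp add: d_def sum.distrib[symmetric])
qed

lemma frob_bounds:
  assumes y: "young lam" and i: "i < diagY lam"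
  shows "frob_a lam i \<ge> 1/2" "frob_b lam i \<ge> 1/2"
  using i diagY_iff[OF y, of i] row_eq[of i "Suc i" lam] col_eq[OF y, of "Suc i" "Suc i"]
  by (auto simp: frob_a_def frob_b_def)

lemma sum_frob: "young lam \<Longrightarrow> (\<Sum>i<diagY lam. frob_a lam i + frob_b lam i) = real (card (boxes lam))"
  using sum_hooks[of lam "\<lambda>x. x"] by simp

lemma iota_eq: "iota n lam = ((\<lambda>i. if i < diagY lam then frob_a lam i / n else 0), (\<lambda>i. if i < diagY lam then frob_b lam i / n else 0))"
  unfolding iota_def frob_a_def frob_b_def ..

lemma conjY_antimono: "j \<le> k \<Longrightarrow> conjY lam k \<le> conjY lam j"
  unfolding conjY_def by (intro card_mono) auto

lemma iota_thoma:
  assumes lam: "lam \<in> YD n" and n: "n \<ge> 1" shows "iota n lam \<in> thoma"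
proof -
  have y: "young lam" and c: "card (boxes lam) = n" using lam by (auto simp: YD_iff)
  let ?d = "diagY lam"
  have dS: "i < ?d" if "Suc i < ?d" for i using that by simp
  have la: "frob_a lam (Suc i) \<le> frob_a lam i" "frob_b lam (Suc i) \<le> frob_b lam i" if "Suc i < ?d" for i
    using that young_nth_mono[OF y, of i "Suc i"] diagY_iff[OF y, of "Suc i"] row_eq[of "Suc i" "Suc (Suc i)" lam]
      conjY_antimono[of "Suc i" "Suc (Suc i)" lam] by (auto simp: frob_a_def frob_b_def)
  have nn: "0 \<le> frob_a lam i" "0 \<le> frob_b lam i" if "i < ?d" for i using frob_bounds[OF y that] by auto
  have "decseq (\<lambda>i. if i < ?d then frob_a lam i / n else 0)" "decseq (\<lambda>i. if i < ?d then frob_b lam i / n else 0)"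
    unfolding decseq_Suc_iff using la nn n by (auto simp: divide_right_mono)
  moreover have "(\<Sum>i<N. (if i < ?d then frob_a lam i / n else 0) + (if i < ?d then frob_b lam i / n else 0)) \<le> 1" for N
  proof -
    let ?t = "\<lambda>i. (if i < ?d then frob_a lam i / n else 0) + (if i < ?d then frob_b lam i / n else 0)"
    have "(\<Sum>i<N. ?t i) \<le> (\<Sum>i<max N ?d. ?t i)" using nn by (intro sum_mono2) auto
    also have "\<dots> = (\<Sum>i<?d. ?t i)" by (intro sum.mono_neutral_right) auto
    also have "\<dots> = (\<Sum>i<?d. (frob_a lam i + frob_b lam i) / n)" by (intro sum.cong refl) (simp add: add_divide_distrib)
    also have "\<dots> = 1" unfolding sum_divide_distrib[symmetric] sum_frob[OF y] c using n by simp
    finally show ?thesis .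
  qed
  ultimately show ?thesis unfolding iota_eq thoma_def using nn n by auto
qed

section \<open>The observables on the Thoma simplex\<close>

definition log_defect :: "real \<Rightarrow> real \<Rightarrow> real" where
  "log_defect v t = - ln (1 - v * t) - v * t"

definition log_test :: "real \<Rightarrow> thoma_pt \<Rightarrow> real" where
  "log_test v w = (\<Sum>i. log_defect v (fst w i) - log_defect v (- snd w i))"

text \<open>With v = 1/(j + 3) this is Thoma's generating function, the image of the generating
  series of the complete symmetric functions. In \<open>log_defect\<close> the linear term is
  subtracted, so the series is dominated by squares and its sum is continuous, while the total of
  all coordinates is not. The shift 3 keeps v at most 1/3 and the matching u at least 2n.\<close>

definition test_fun :: "nat \<Rightarrow> thoma_pt \<Rightarrow> real" where
  "test_fun j w = exp (1 / real (j + 3) + log_test (1 / real (j + 3)) w)"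

lemma log_defect_0 [simp]: "log_defect v 0 = 0"
  by (simp add: log_defect_def)

lemma log_defect_bound:
  assumes "\<bar>v\<bar> \<le> 1/2" "\<bar>t\<bar> \<le> 1" shows "\<bar>log_defect v t\<bar> \<le> t\<^sup>2"
proof -
  have vt: "\<bar>v * t\<bar> \<le> 1/2 * 1" using assms by (intro abs_mult_le)
  then have "\<bar>ln (1 + (- v * t)) - (- v * t)\<bar> \<le> 2 * (- v * t)\<^sup>2"
    by (intro abs_ln_one_plus_x_minus_x_bound) simp
  then have "\<bar>log_defect v t\<bar> \<le> 2 * (v * t)\<^sup>2" by (simp add: log_defect_def)
  also have "\<dots> = 2 * v\<^sup>2 * t\<^sup>2" by (simp add: power_mult_distrib)
  also have "\<dots> \<le> 1 * t\<^sup>2"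
  proof (rule mult_right_mono)
    have "v\<^sup>2 \<le> (1/2)\<^sup>2" using assms(1) abs_le_square_iff[of v "1/2"] by simp
    then show "2 * v\<^sup>2 \<le> 1" by (simp add: power2_eq_square)
  qed simp
  finally show ?thesis by simp
qed

text \<open>Apply \<open>sum_hooks\<close> to -ln(1 - v x / n). The subtracted linear terms add up
  to v by \<open>sum_frob\<close>, which the prefactor exp(v) restores. The half shifts place u at
  half an odd integer, so u is never a content.\<close>

lemma test_fun_iota:
  assumes lam: "lam \<in> YD n" and n: "n \<ge> 1"
  shows "test_fun j (iota n lam) = content_F (boxes lam) (real (j + 3) * real n - 1/2)"
proof -
  have y: "young lam" and c: "card (boxes lam) = n" using lam by (auto simp: YD_iff)
  have I: "yideal (boxes lam)" using yideal_boxes[OF y] .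
  define v where "v = 1 / real (j + 3)"
  have v: "0 < v" "v \<le> 1/3" by (auto simp: v_def)
  let ?d = "diagY lam"
  define U where "U = real (j + 3) * real n"
  have U: "U > 0" "U = n / v" "U \<ge> 3 * real n" using n by (auto simp: U_def v_def)
  let ?g = "\<lambda>x. - ln (1 - v * (x / n))"
  have 1: "log_test v (iota n lam) = (\<Sum>i<?d. log_defect v (frob_a lam i / n) - log_defect v (- (frob_b lam i / n)))"
    unfolding log_test_def iota_eq by (subst suminf_finite[of "{..<?d}"]) auto
  also have "\<dots> = (\<Sum>i<?d. (?g (frob_a lam i) - ?g (- frob_b lam i)) - v / n * (frob_a lam i + frob_b lam i))"
    by (intro sum.cong refl) (simp add: log_defect_def add_divide_distrib algebra_simps)
  also have "\<dots> = (\<Sum>i<?d. ?g (frob_a lam i) - ?g (- frob_b lam i)) - v / n * real n"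
    unfolding sum_subtractf[of _ "\<lambda>i. v / n * (frob_a lam i + frob_b lam i)"] sum_distrib_left[symmetric] sum_frob[OF y] c ..
  also have "(\<Sum>i<?d. ?g (frob_a lam i) - ?g (- frob_b lam i)) = (\<Sum>b\<in>boxes lam. ?g (rcontent b + 1/2) - ?g (rcontent b - 1/2))"
    by (rule sum_hooks[OF y, symmetric])
  also have "\<dots> = (\<Sum>b\<in>boxes lam. ln (1 + 1 / (U - 1/2 - rcontent b)))"
  proof (intro sum.cong refl)
    fix b assume b: "b \<in> boxes lam"
    have cb: "\<bar>rcontent b\<bar> \<le> real n - 1" using rcontent_bound[OF I b] c by simp
    have pos: "U - 1/2 - rcontent b > 0" using cb U by linarith
    have e: "1 - v * (x / n) = (U - x) / U" for x using n v by (simp add: U(2) field_simps)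
    have "ln ((U - (rcontent b - 1/2)) / U) - ln ((U - (rcontent b + 1/2)) / U)
        = ln (((U - (rcontent b - 1/2)) / U) / ((U - (rcontent b + 1/2)) / U))"
      using pos U(1) by (intro ln_divide_pos[symmetric] divide_pos_pos) auto
    also have "((U - (rcontent b - 1/2)) / U) / ((U - (rcontent b + 1/2)) / U) = 1 + 1 / (U - 1/2 - rcontent b)"
    proof -
      have "((w + 1) / U) / (w / U) = 1 + 1 / w" if "w > 0" for w using that U(1) by (simp add: field_simps)
      from this[OF pos] show ?thesis by (simp add: algebra_simps)
    qed
    finally show "?g (rcontent b + 1/2) - ?g (rcontent b - 1/2) = ln (1 + 1 / (U - 1/2 - rcontent b))"
      unfolding e by simp
  qed
  finally have lt: "log_test v (iota n lam) = (\<Sum>b\<in>boxes lam. ln (1 + 1 / (U - 1/2 - rcontent b))) - v" using n by simp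
  have "exp (\<Sum>b\<in>boxes lam. ln (1 + 1 / (U - 1/2 - rcontent b))) = (\<Prod>b\<in>boxes lam. exp (ln (1 + 1 / (U - 1/2 - rcontent b))))"
    by (rule exp_sum[OF yideal_finite[OF I]])
  also have "\<dots> = content_F (boxes lam) (U - 1/2)"
    unfolding content_F_def
  proof (intro prod.cong refl exp_ln)
    fix b assume b: "b \<in> boxes lam"
    have "\<bar>rcontent b\<bar> \<le> real n - 1" using rcontent_bound[OF I b] c by simp
    then have "0 \<le> 1 / (U - 1/2 - rcontent b)" using U by (intro divide_nonneg_nonneg) auto
    then show "0 < 1 + 1 / (U - 1/2 - rcontent b)" by linarith
  qed
  finally show ?thesis unfolding test_fun_def v_def[symmetric] lt U_def by simp
qed

lemma test_fun_drift:
  assumes adm: "zz'_admissible z z'"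
  shows "\<exists>C\<ge>0. \<forall>n\<ge>1. \<forall>lam\<in>YD n. \<bar>Tn z z' n (proj_n n (test_fun j)) lam - proj_n n (test_fun j) lam\<bar> \<le> C / (real n)\<^sup>2"
proof -
  obtain C where C: "C \<ge> 0" and *: "\<And>n lam u. n \<ge> 1 \<Longrightarrow> lam \<in> YD n \<Longrightarrow> u \<notin> \<int> \<Longrightarrow> 2 * real n \<le> u \<Longrightarrow> u \<le> real (j + 3) * real n \<Longrightarrow>
     \<bar>Tn z z' n (\<lambda>mu. content_F (boxes mu) u) lam - content_F (boxes lam) u\<bar> \<le> C / (real n)\<^sup>2"
    using Tn_content_F_drift[OF adm, of "real (j + 3)"] by auto
  have "\<bar>Tn z z' n (proj_n n (test_fun j)) lam - proj_n n (test_fun j) lam\<bar> \<le> C / (real n)\<^sup>2"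
    if n: "n \<ge> 1" and lam: "lam \<in> YD n" for n lam
  proof -
    let ?u = "real (j + 3) * real n - 1/2"
    have ni: "?u \<notin> \<int>"
    proof
      assume "?u \<in> \<int>"
      then obtain k where "?u = of_int k" by (auto elim: Ints_cases)
      then have "2 * (int (j + 3) * int n) - 1 = 2 * k" by (simp add: of_int_eq_iff[where 'a = real, symmetric] del: of_int_eq_iff)
      then show False by presburger
    qed
    have "3 * real n \<le> real (j + 3) * real n" by (intro mult_right_mono) auto
    then have u2: "2 * real n \<le> ?u" using n by linarith
    have eq: "Tn z z' n (proj_n n (test_fun j)) lam = Tn z z' n (\<lambda>mu. content_F (boxes mu) ?u) lam"
      unfolding Tn_def proj_n_def by (intro sum.cong refl arg_cong2[of _ _ _ _ "(*)"]) (simp only: comp_def test_fun_iota[OF _ n])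
    show ?thesis unfolding eq using *[OF n lam ni u2] test_fun_iota[OF lam n, of j] by (simp add: proj_n_def)
  qed
  then show ?thesis using C by blast
qed

section \<open>The up-down operator as a Markov kernel\<close>

definition kern :: "complex \<Rightarrow> complex \<Rightarrow> nat \<Rightarrow> nat list \<Rightarrow> nat list \<Rightarrow> real" where
  "kern z z' n lam mu = (\<Sum>nu\<in>YD (Suc n). p_up z z' n lam nu * p_down nu mu)"

lemma Tn_kern: "Tn z z' n g lam = (\<Sum>mu\<in>YD n. kern z z' n lam mu * g mu)"
proof -
  have "(\<Sum>mu\<in>YD n. kern z z' n lam mu * g mu) = (\<Sum>mu\<in>YD n. \<Sum>nu\<in>YD (Suc n). p_up z z' n lam nu * (p_down nu mu * g mu))"
    unfolding kern_def sum_distrib_right by (simp add: mult.assoc)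
  then show ?thesis unfolding Tn_def sum_distrib_left by (simp add: sum.swap[of _ "YD n"])
qed

lemma kern_nonneg:
  assumes adm: "zz'_admissible z z'" and lam: "lam \<in> YD n"
  shows "kern z z' n lam mu \<ge> 0"
  unfolding kern_def
proof (intro sum_nonneg mult_nonneg_nonneg)
  fix nu assume nu: "nu \<in> YD (Suc n)"
  show "0 \<le> p_down nu mu" by (simp add: p_down_def)
  show "0 \<le> p_up z z' n lam nu"
  proof (cases "covers lam nu")
    case True
    then obtain x where "x \<in> addable (boxes lam)" "nu = diagram_of (insert x (boxes lam))"
      using covers_iff_addable lam nu by (auto simp: YD_iff)
    then show ?thesis using p_up_eq[OF adm lam] up_prob_nonneg[OF adm] by simp
  qed (simp add: p_up_def)
qed

lemma kern_sum:
  assumes adm: "zz'_admissible z z'" and lam: "lam \<in> YD n"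
  shows "(\<Sum>mu\<in>YD n. kern z z' n lam mu) = 1"
proof -
  let ?I = "boxes lam"
  have I: "yideal ?I" using lam yideal_boxes by (auto simp: YD_iff)
  have "(\<Sum>mu\<in>YD n. kern z z' n lam mu) = Tn z z' n (\<lambda>_. 1) lam" by (simp add: Tn_kern)
  also have "\<dots> = (\<Sum>x\<in>addable ?I. up_prob (Re (z + z')) (Re (z * z')) ?I x)"
    unfolding Tn_eq[OF adm lam] using down_prob_sum[OF addable_ideal insert_not_empty] by (intro sum.cong refl) simp
  also have "\<dots> = 1" using up_prob_sum[OF I admissible_facts(4)[OF adm]] .
  finally show ?thesis .
qed

lemma kern_jump:
  assumes lam: "lam \<in> YD n" and mu: "mu \<in> YD n" and n: "n \<ge> 1" and k: "kern z z' n lam mu \<noteq> 0"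
  shows "\<bar>test_fun j (iota n mu) - test_fun j (iota n lam)\<bar> \<le> 9 / n"
proof -
  from k obtain nu where nu: "nu \<in> YD (Suc n)" "p_up z z' n lam nu * p_down nu mu \<noteq> 0"
    unfolding kern_def by (meson sum.neutral)
  then have c: "covers lam nu" "covers mu nu" by (auto simp: p_up_def p_down_def split: if_splits)
  have y: "young lam" "young nu" "young mu" using lam mu nu by (auto simp: YD_iff)
  have I: "yideal (boxes lam)" "card (boxes lam) = n" using yideal_boxes lam by (auto simp: YD_iff)
  obtain x where x: "x \<in> addable (boxes lam)" "boxes nu = insert x (boxes lam)"
    using covers_iff_addable[OF y(1,2)] c(1) diagram_of(2) addable_ideal by metis
  obtain b where b: "b \<in> removable (boxes nu)" "boxes mu = boxes nu - {b}"
    using covers_iff_removable[OF y(3,2)] c(2) diagram_of(2) removable_ideal by metis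
  let ?u = "real (j + 3) * real n - 1/2"
  have "3 * real n \<le> real (j + 3) * real n" by (intro mult_right_mono) auto
  then have u: "2 * real n \<le> ?u" using n by linarith
  have ni: "?u \<notin> \<int>"
  proof
    assume "?u \<in> \<int>"
    then obtain k where "?u = of_int k" by (auto elim: Ints_cases)
    then have "2 * (int (j + 3) * int n) - 1 = 2 * k" by (simp add: of_int_eq_iff[where 'a = real, symmetric] del: of_int_eq_iff)
    then show False by presburger
  qed
  show ?thesis
    using content_F_move[OF I n u ni x(1), of b] b x(2)
    unfolding test_fun_iota[OF lam n] test_fun_iota[OF mu n] by simp
qed

text \<open>\<open>embed_pmf\<close> needs nonnegative weights of total mass one, which
  \<open>kern_nonneg\<close> and \<open>kern_sum\<close> provide on \<open>YD n\<close>. The point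
  mass elsewhere makes the kernel total.\<close>

definition step_pmf :: "complex \<Rightarrow> complex \<Rightarrow> nat \<Rightarrow> nat list \<Rightarrow> nat list pmf" where
  "step_pmf z z' n lam = (if lam \<in> YD n then embed_pmf (\<lambda>mu. if mu \<in> YD n then kern z z' n lam mu else 0) else return_pmf lam)"

lemma step_pmf:
  assumes adm: "zz'_admissible z z'" and lam: "lam \<in> YD n"
  shows "pmf (step_pmf z z' n lam) mu = (if mu \<in> YD n then kern z z' n lam mu else 0)"
proof -
  have "(\<integral>\<^sup>+ mu. ennreal (if mu \<in> YD n then kern z z' n lam mu else 0) \<partial>count_space UNIV) = (\<Sum>mu\<in>YD n. ennreal (kern z z' n lam mu))"
    by (subst nn_integral_count_space'[of "YD n"]) (auto simp: finite_YD)
  also have "\<dots> = 1" using kern_nonneg[OF adm lam] kern_sum[OF adm lam] by (subst sum_ennreal) auto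
  finally show ?thesis
    unfolding step_pmf_def using lam kern_nonneg[OF adm lam] by (simp add: pmf_embed_pmf)
qed

lemma set_step_pmf:
  assumes adm: "zz'_admissible z z'" and lam: "lam \<in> YD n"
  shows "set_pmf (step_pmf z z' n lam) \<subseteq> YD n"
  using step_pmf[OF adm lam] by (auto simp: set_pmf_iff split: if_splits)

lemma expectation_step_pmf:
  assumes adm: "zz'_admissible z z'" and lam: "lam \<in> YD n"
  shows "measure_pmf.expectation (step_pmf z z' n lam) g = Tn z z' n g lam"
  using set_step_pmf[OF adm lam] step_pmf[OF adm lam]
  by (subst integral_measure_pmf[OF finite_YD]) (auto simp: Tn_kern)

lemma step_pmf_jump:
  assumes adm: "zz'_admissible z z'" and lam: "lam \<in> YD n" and n: "n \<ge> 1" and mu: "mu \<in> set_pmf (step_pmf z z' n lam)"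
  shows "\<bar>test_fun j (iota n mu) - test_fun j (iota n lam)\<bar> \<le> 9 / n"
proof -
  have "mu \<in> YD n" using set_step_pmf[OF adm lam] mu by auto
  moreover have "kern z z' n lam mu \<noteq> 0" using step_pmf[OF adm lam, of mu] mu by (auto simp: set_pmf_iff split: if_splits)
  ultimately show ?thesis using kern_jump[OF lam _ n] by blast
qed

text \<open>With m the integer part of sqrt n, rounding down n \<alpha>_i and n \<beta>_i gives m
  rows and m columns with at most n boxes altogether. The missing boxes, including the mass not
  carried by the coordinates, are taken from a square of side m + 1, so a row or column among the
  first m exceeds its rounded value by at most m + 1, which vanishes after division by n.\<close>

lemma diagram_near:
  assumes w: "(al, be) \<in> thoma" and n: "n \<ge> 1"
  shows "\<exists>lam\<in>YD n. \<forall>i. real i + 1 \<le> sqrt n \<longrightarrow>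
     \<bar>fst (iota n lam) i - al i\<bar> \<le> (sqrt n + real i + 4) / n \<and> \<bar>snd (iota n lam) i - be i\<bar> \<le> (sqrt n + real i + 4) / n"
proof -
  from w have dec: "decseq al" "decseq be" and nn: "\<And>i. 0 \<le> al i" "\<And>i. 0 \<le> be i"
    and sm: "\<And>N. (\<Sum>i<N. al i + be i) \<le> 1" by (auto simp: thoma_def)
  define m where "m = nat \<lfloor>sqrt n\<rfloor>"
  have fl: "real (nat \<lfloor>x\<rfloor>) \<le> x" "x < real (nat \<lfloor>x\<rfloor>) + 1" if "0 \<le> x" for x :: real
  proof -
    have "real (nat \<lfloor>x\<rfloor>) = of_int \<lfloor>x\<rfloor>" using that by simp
    then show "real (nat \<lfloor>x\<rfloor>) \<le> x" "x < real (nat \<lfloor>x\<rfloor>) + 1" by linarith+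
  qed
  have m: "real m \<le> sqrt n" "sqrt n < real m + 1" unfolding m_def by (rule fl; simp)+
  have sq: "n \<le> (m + 1) * (m + 1)"
  proof -
    have "real n = sqrt n * sqrt n" by simp
    also have "\<dots> \<le> (real m + 1) * (real m + 1)" using m by (intro mult_mono) auto
    finally have "real n \<le> real ((m + 1) * (m + 1))" by (simp add: algebra_simps)
    then show ?thesis by (simp only: of_nat_le_iff)
  qed
  define fa where "fa i = nat \<lfloor>n * al i\<rfloor>" for i
  define fb where "fb i = nat \<lfloor>n * be i\<rfloor>" for i
  have fa: "real (fa i) \<le> n * al i" "n * al i < real (fa i) + 1" for i
    unfolding fa_def using nn(1)[of i] by (intro fl; simp)+
  have fb: "real (fb i) \<le> n * be i" "n * be i < real (fb i) + 1" for i
    unfolding fb_def using nn(2)[of i] by (intro fl; simp)+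
  have fam: "fa j \<le> fa i" if "i \<le> j" for i j
    unfolding fa_def using decseqD[OF dec(1) that] n by (intro nat_mono floor_mono mult_left_mono) auto
  have fbm: "fb j \<le> fb i" if "i \<le> j" for i j
    unfolding fb_def using decseqD[OF dec(2) that] n by (intro nat_mono floor_mono mult_left_mono) auto
  define I0 where "I0 = {(i, j). 1 \<le> i \<and> 1 \<le> j \<and> (i \<le> m \<and> j \<le> fa (i - 1) \<or> j \<le> m \<and> i \<le> fb (j - 1))}"
  have sub: "I0 \<subseteq> (SIGMA i:{1..m}. {1..fa (i - 1)}) \<union> prod.swap ` (SIGMA j:{1..m}. {1..fb (j - 1)})"
    unfolding I0_def by force
  have finS: "finite ((SIGMA i:{1..m}. {1..fa (i - 1)}) \<union> prod.swap ` (SIGMA j:{1..m}. {1..fb (j - 1)}))" by auto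
  have fin0: "finite I0" using finite_subset[OF sub finS] .
  have shift: "(\<Sum>i = 1..m. f (i - 1)) = (\<Sum>i<m. f i)" for f :: "nat \<Rightarrow> nat"
    by (rule sum.reindex_bij_witness[of _ Suc "\<lambda>i. i - 1"]) auto
  have "card I0 \<le> card ((SIGMA i:{1..m}. {1..fa (i - 1)}) \<union> prod.swap ` (SIGMA j:{1..m}. {1..fb (j - 1)}))"
    by (rule card_mono[OF finS sub])
  also have "\<dots> \<le> card (SIGMA i:{1..m}. {1..fa (i - 1)}) + card (prod.swap ` (SIGMA j:{1..m}. {1..fb (j - 1)}))"
    by (rule card_Un_le)
  also have "\<dots> \<le> (\<Sum>i<m. fa i) + (\<Sum>i<m. fb i)"
    by (intro add_mono order_trans[OF card_image_le]) (auto simp: shift[unfolded One_nat_def])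
  finally have "real (card I0) \<le> (\<Sum>i<m. real (fa i) + real (fb i))"
    by (simp add: sum.distrib flip: of_nat_sum of_nat_add)
  also have "\<dots> \<le> (\<Sum>i<m. n * (al i + be i))" using fa fb by (intro sum_mono) (auto simp: distrib_left intro: add_mono)
  also have "\<dots> \<le> real n * 1" unfolding sum_distrib_left[symmetric] using sm[of m] by (intro mult_left_mono) auto
  finally have c0: "card I0 \<le> n" by simp
  have y0: "yideal I0"
    unfolding yideal_def
  proof (intro conjI allI impI fin0)
    fix i j i' j' assume a: "(i, j) \<in> I0 \<and> 1 \<le> i' \<and> i' \<le> i \<and> 1 \<le> j' \<and> j' \<le> j"
    then have "fa (i - 1) \<le> fa (i' - 1)" "fb (j - 1) \<le> fb (j' - 1)" by (auto intro!: fam fbm diff_le_mono)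
    then show "(i', j') \<in> I0" using a unfolding I0_def by auto
  qed (auto simp: I0_def)
  \<comment> \<open>Side m + 1 rather than m, since (m + 1)^2 is at least n; hence the union has
    enough boxes.\<close>
  define S where "S = {1..m + 1} \<times> {1..m + 1}"
  have yS: "yideal S" unfolding yideal_def S_def by auto
  have "card S \<le> card (I0 \<union> S)" using fin0 by (intro card_mono) (auto simp: S_def)
  then have c1: "n \<le> card (I0 \<union> S)" using sq by (simp add: S_def)
  obtain J where J: "yideal J" "I0 \<subseteq> J" "J \<subseteq> I0 \<union> S" "card J = n"
    using yideal_between[OF y0 yideal_Un[OF y0 yS] _ c0 c1] by blast
  define lam where "lam = diagram_of J"
  have lam: "young lam" "boxes lam = J" using diagram_of[OF J(1)] by (auto simp: lam_def)
  have lamY: "lam \<in> YD n" using lam J(4) by (simp add: YD_iff)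
  have up: "j \<le> fa i + m + 1" if "(Suc i, j) \<in> J" "i < m" for i j
    using that J(3) by (auto simp: I0_def S_def)
  have up': "i \<le> fb j + m + 1" if "(i, Suc j) \<in> J" "j < m" for i j
    using that J(3) by (auto simp: I0_def S_def)
  have lo: "(Suc i, fa i) \<in> J" if "i < m" "1 \<le> fa i" for i
    using that J(2) by (auto simp: I0_def)
  have lo': "(fb j, Suc j) \<in> J" if "j < m" "1 \<le> fb j" for j
    using that J(2) by (auto simp: I0_def)
  \<comment> \<open>One estimate for rows and columns: \<open>D\<close> says that the diagonal box
    is present, \<open>f\<close> is the rounded target and \<open>r\<close> the actual length.
    Without the diagonal box the coordinate is 0 and the target is at most i.\<close>
  have final: "\<bar>(if D then (real r - real (Suc i) + 1/2) / n else 0) - x\<bar> \<le> (sqrt n + real i + 4) / n"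
    if r: "D \<Longrightarrow> f \<le> r \<and> r \<le> f + m + 1" "\<not> D \<Longrightarrow> f \<le> i" and f: "real f \<le> n * x" "n * x < real f + 1" "0 \<le> x"
    for D and r f i :: nat and x :: real
  proof -
    have n0: "real n > 0" using n by simp
    have e: "(if D then (real r - real (Suc i) + 1/2) / n else 0) - x = ((if D then real r - real (Suc i) + 1/2 else 0) - n * x) / n"
      using n0 by (simp add: field_simps)
    have "\<bar>(if D then real r - real (Suc i) + 1/2 else 0) - n * x\<bar> \<le> sqrt n + real i + 4"
    proof (cases D)
      case True
      then have "real f \<le> real r" "real r \<le> real f + real m + 1" using r(1) by auto
      then show ?thesis using True f m by (simp add: abs_le_iff)
    next
      case False
      then have "real f \<le> real i" using r(2) by auto
      moreover have nx: "0 \<le> real n * x" using f(3) n0 by simp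
      moreover have "0 \<le> sqrt n" by simp
      ultimately have "real n * x \<le> sqrt n + real i + 4" using f(2) by linarith
      then show ?thesis using False nx by simp
    qed
    then show ?thesis unfolding e abs_divide using n0 by (simp add: divide_right_mono)
  qed
  have "\<bar>fst (iota n lam) i - al i\<bar> \<le> (sqrt n + real i + 4) / n \<and> \<bar>snd (iota n lam) i - be i\<bar> \<le> (sqrt n + real i + 4) / n"
    if i: "real i + 1 \<le> sqrt n" for i
  proof -
    have im: "i < m" using i m(2) by linarith
    have D: "i < diagY lam \<longleftrightarrow> (Suc i, Suc i) \<in> J" using diagY_iff[OF lam(1)] lam(2) by simp
    have nd: "fa i \<le> i" if "\<not> i < diagY lam"
    proof (rule ccontr)
      assume "\<not> fa i \<le> i"
      then have "(Suc i, Suc i) \<in> J" using lo[OF im] yideal_down[OF J(1), of "Suc i" "fa i" "Suc i" "Suc i"] by simp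
      then show False using that D by simp
    qed
    have nd': "fb i \<le> i" if "\<not> i < diagY lam"
    proof (rule ccontr)
      assume "\<not> fb i \<le> i"
      then have "(Suc i, Suc i) \<in> J" using lo'[OF im] yideal_down[OF J(1), of "fb i" "Suc i" "Suc i" "Suc i"] by simp
      then show False using that D by simp
    qed
    have r: "fa i \<le> lam ! i \<and> lam ! i \<le> fa i + m + 1" if "i < diagY lam"
    proof
      have len: "i < length lam" "Suc i \<le> lam ! i" using that D row_eq[of i "Suc i" lam] lam(2) by auto
      show "fa i \<le> lam ! i" using lo[OF im] row_eq[of i "fa i" lam] lam(2) by (cases "fa i = 0") auto
      show "lam ! i \<le> fa i + m + 1" using up[of i "lam ! i"] im len row_eq[of i "lam ! i" lam] lam(2) by simp
    qed
    have r': "fb i \<le> conjY lam (Suc i) \<and> conjY lam (Suc i) \<le> fb i + m + 1" if "i < diagY lam"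
    proof
      have len: "Suc i \<le> conjY lam (Suc i)" using that D col_eq[OF lam(1), of "Suc i" "Suc i"] lam(2) by auto
      show "fb i \<le> conjY lam (Suc i)" using lo'[OF im] col_eq[OF lam(1), of "Suc i" "fb i"] lam(2) by (cases "fb i = 0") auto
      show "conjY lam (Suc i) \<le> fb i + m + 1" using up'[of "conjY lam (Suc i)" i] im len col_eq[OF lam(1), of "Suc i" "conjY lam (Suc i)"] lam(2) by simp
    qed
    have "\<bar>fst (iota n lam) i - al i\<bar> \<le> (sqrt n + real i + 4) / n"
      unfolding iota_def fst_conv by (rule final[OF r nd fa nn(1)])
    moreover have "\<bar>snd (iota n lam) i - be i\<bar> \<le> (sqrt n + real i + 4) / n"
      unfolding iota_def snd_conv by (rule final[OF r' nd' fb nn(2)])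
    ultimately show ?thesis by blast
  qed
  then show ?thesis using lamY by blast
qed

lemma tendsto_fun_iff:
  fixes f :: "'b \<Rightarrow> 'i \<Rightarrow> 'a::topological_space"
  shows "(f \<longlongrightarrow> l) F \<longleftrightarrow> (\<forall>i. ((\<lambda>x. f x i) \<longlongrightarrow> l i) F)"
  using limitin_componentwise[of "\<lambda>_. euclidean" UNIV f l F]
  by (simp add: euclidean_product_topology)

lemma thoma_approximation:
  assumes w: "w \<in> thoma"
  obtains L where "\<And>n. n \<ge> 1 \<Longrightarrow> L n \<in> YD n" "(\<lambda>n. iota n (L n)) \<longlonglongrightarrow> w"
proof -
  obtain al be where ab: "w = (al, be)" by (cases w)
  have "\<forall>n. \<exists>lam. n \<ge> 1 \<longrightarrow> lam \<in> YD n \<and> (\<forall>i. real i + 1 \<le> sqrt n \<longrightarrow>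
     \<bar>fst (iota n lam) i - al i\<bar> \<le> (sqrt n + real i + 4) / n \<and> \<bar>snd (iota n lam) i - be i\<bar> \<le> (sqrt n + real i + 4) / n)"
    using diagram_near[of al be] w ab by blast
  then obtain L where L: "\<And>n. n \<ge> 1 \<Longrightarrow> L n \<in> YD n" and
    b: "\<And>n i. n \<ge> 1 \<Longrightarrow> real i + 1 \<le> sqrt n \<Longrightarrow> \<bar>fst (iota n (L n)) i - al i\<bar> \<le> (sqrt n + real i + 4) / n \<and> \<bar>snd (iota n (L n)) i - be i\<bar> \<le> (sqrt n + real i + 4) / n"
    by metis
  have ev: "eventually (\<lambda>n. n \<ge> 1 \<and> real i + 1 \<le> sqrt (real n)) sequentially" for i
  proof -
    have "eventually (\<lambda>n. real i + 1 \<le> sqrt (real n)) sequentially" by real_asymp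
    then show ?thesis using eventually_ge_at_top[of "1::nat"] by eventually_elim auto
  qed
  have lim: "(\<lambda>n. (sqrt (real n) + real i + 4) / real n) \<longlonglongrightarrow> 0" for i by real_asymp
  have "(\<lambda>n. fst (iota n (L n)) i - al i) \<longlonglongrightarrow> 0" for i
    by (rule Lim_null_comparison[OF _ lim[of i]]) (use ev[of i] in \<open>eventually_elim, use b in auto\<close>)
  moreover have "(\<lambda>n. snd (iota n (L n)) i - be i) \<longlonglongrightarrow> 0" for i
    by (rule Lim_null_comparison[OF _ lim[of i]]) (use ev[of i] in \<open>eventually_elim, use b in auto\<close>)
  ultimately have "(\<lambda>n. fst (iota n (L n))) \<longlonglongrightarrow> al" "(\<lambda>n. snd (iota n (L n))) \<longlonglongrightarrow> be"
    unfolding tendsto_fun_iff by (auto simp: LIM_zero_iff)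
  then have "(\<lambda>n. (fst (iota n (L n)), snd (iota n (L n)))) \<longlonglongrightarrow> w"
    unfolding ab by (rule tendsto_Pair)
  then show ?thesis using that[of L] L by simp
qed

lemma YD_nonempty: "YD n \<noteq> {}"
proof (cases "n \<ge> 1")
  case True
  have "((\<lambda>_. 0), (\<lambda>_. 0)) \<in> thoma" by (auto simp: thoma_def decseq_def)
  then show ?thesis using diagram_near[OF _ True] by blast
next
  case False
  then have "[] \<in> YD n" by (simp add: YD_def young_def)
  then show ?thesis by blast
qed

section \<open>Topology of the Thoma simplex and continuity of the observables\<close>

lemma continuous_on_fst_coord: "continuous_on A (\<lambda>w::('i \<Rightarrow> 'a::topological_space) \<times> 'b::topological_space. fst w i)"
  by (rule continuous_on_product_then_coordinatewise[OF continuous_on_fst[OF continuous_on_id]])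

lemma continuous_on_snd_coord: "continuous_on A (\<lambda>w::'b::topological_space \<times> ('i \<Rightarrow> 'a::topological_space). snd w i)"
  by (rule continuous_on_product_then_coordinatewise[OF continuous_on_snd[OF continuous_on_id]])

text \<open>By monotonicity i + 1 copies of coordinate i are bounded by a partial sum, hence by 1.
  The resulting decay 1/(i + 1) makes the squares summable uniformly over the simplex.\<close>

lemma thoma_coords:
  assumes "w \<in> thoma"
  shows "0 \<le> fst w i" "0 \<le> snd w i" "fst w i \<le> 1 / real (Suc i)" "snd w i \<le> 1 / real (Suc i)"
    "i \<le> j \<Longrightarrow> fst w j \<le> fst w i" "i \<le> j \<Longrightarrow> snd w j \<le> snd w i"
proof -
  have dec: "decseq (fst w)" "decseq (snd w)" and nn: "\<And>i. 0 \<le> fst w i" "\<And>i. 0 \<le> snd w i"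
    and sm: "\<And>N. (\<Sum>i<N. fst w i + snd w i) \<le> 1" using assms by (auto simp: thoma_def)
  show "0 \<le> fst w i" "0 \<le> snd w i" by (rule nn)+
  show "i \<le> j \<Longrightarrow> fst w j \<le> fst w i" "i \<le> j \<Longrightarrow> snd w j \<le> snd w i" using dec by (auto simp: decseq_def)
  have "real (Suc i) * fst w i = (\<Sum>k<Suc i. fst w i)" by simp
  also have "\<dots> \<le> (\<Sum>k<Suc i. fst w k + snd w k)"
  proof (rule sum_mono)
    fix k assume "k \<in> {..<Suc i}"
    then have "fst w i \<le> fst w k" using decseqD[OF dec(1), of k i] by auto
    then show "fst w i \<le> fst w k + snd w k" using nn(2)[of k] by linarith
  qed
  finally have "real (Suc i) * fst w i \<le> 1" using sm[of "Suc i"] by linarith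
  then show "fst w i \<le> 1 / real (Suc i)" by (simp add: pos_le_divide_eq mult.commute del: of_nat_Suc)
  have "real (Suc i) * snd w i = (\<Sum>k<Suc i. snd w i)" by simp
  also have "\<dots> \<le> (\<Sum>k<Suc i. fst w k + snd w k)"
  proof (rule sum_mono)
    fix k assume "k \<in> {..<Suc i}"
    then have "snd w i \<le> snd w k" using decseqD[OF dec(2), of k i] by auto
    then show "snd w i \<le> fst w k + snd w k" using nn(1)[of k] by linarith
  qed
  finally have "real (Suc i) * snd w i \<le> 1" using sm[of "Suc i"] by linarith
  then show "snd w i \<le> 1 / real (Suc i)" by (simp add: pos_le_divide_eq mult.commute del: of_nat_Suc)
qed

lemma thoma_coords_le1:
  assumes "w \<in> thoma" shows "fst w i \<le> 1" "snd w i \<le> 1"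
proof -
  have "1 / real (Suc i) \<le> 1" by (simp add: divide_le_eq)
  then show "fst w i \<le> 1" "snd w i \<le> 1" using thoma_coords(3,4)[OF assms, of i] by linarith+
qed

lemma closed_thoma: "closed thoma"
proof -
  have eq: "thoma = {w. (\<forall>i. fst w (Suc i) \<le> fst w i) \<and> (\<forall>i. snd w (Suc i) \<le> snd w i) \<and> (\<forall>i. 0 \<le> fst w i) \<and> (\<forall>i. 0 \<le> snd w i)
      \<and> (\<forall>N. (\<Sum>i<N. fst w i + snd w i) \<le> 1)}"
    by (auto simp: thoma_def decseq_Suc_iff)
  show ?thesis unfolding eq
    by (intro closed_Collect_conj closed_Collect_all closed_Collect_le continuous_on_const continuous_on_sum
        continuous_on_add continuous_on_fst_coord continuous_on_snd_coord)
qed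

lemma compact_thoma: "compact thoma"
proof -
  have "compactin (product_topology (\<lambda>i::nat. euclidean) UNIV) (PiE UNIV (\<lambda>i. {0..1::real}))"
    unfolding compactin_PiE by (simp add: compactin_euclidean_iff)
  then have K: "compact (PiE UNIV (\<lambda>i::nat. {0..1::real}))"
    by (simp add: euclidean_product_topology compactin_euclidean_iff)
  have "w \<in> PiE UNIV (\<lambda>i::nat. {0..1::real}) \<times> PiE UNIV (\<lambda>i::nat. {0..1::real})" if "w \<in> thoma" for w
    using thoma_coords(1,2)[OF that] thoma_coords_le1[OF that] by (simp add: mem_Times_iff PiE_UNIV_domain)
  then have "thoma = thoma \<inter> (PiE UNIV (\<lambda>i::nat. {0..1::real}) \<times> PiE UNIV (\<lambda>i::nat. {0..1::real}))" by blast
  then show ?thesis using closed_Int_compact[OF closed_thoma compact_Times[OF K K]] by simp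
qed

lemma summable_inverse_Suc_sq: "summable (\<lambda>i. 1 / (real (Suc i))\<^sup>2)"
  using inverse_squares_sums by (auto simp: sums_iff)

lemma summable_comparison_coords:
  assumes w: "w \<in> thoma" and f: "\<And>t. \<bar>t\<bar> \<le> 1 \<Longrightarrow> \<bar>f t\<bar> \<le> C * t\<^sup>2" and C: "0 \<le> C"
  shows "summable (\<lambda>i. f (fst w i))" "summable (\<lambda>i. f (- snd w i))"
    "\<bar>f (fst w i)\<bar> \<le> C * (1 / (real (Suc i))\<^sup>2)" "\<bar>f (- snd w i)\<bar> \<le> C * (1 / (real (Suc i))\<^sup>2)"
proof -
  have sq: "t\<^sup>2 \<le> 1 / (real (Suc i))\<^sup>2" if "0 \<le> t" "t \<le> 1 / real (Suc i)" for t i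
    using power_mono[OF that(2,1), of 2] by (simp add: power_divide)
  have 1: "\<bar>f (fst w i)\<bar> \<le> C * (1 / (real (Suc i))\<^sup>2)" for i
    using f[of "fst w i"] thoma_coords[OF w] thoma_coords_le1[OF w] sq[of "fst w i" i] C
    by (meson abs_le_iff mult_left_mono order_trans neg_le_0_iff_le abs_of_nonneg order.trans eq_refl)
  have 2: "\<bar>f (- snd w i)\<bar> \<le> C * (1 / (real (Suc i))\<^sup>2)" for i
  proof -
    have "\<bar>f (- snd w i)\<bar> \<le> C * (- snd w i)\<^sup>2" using thoma_coords(2)[OF w, of i] thoma_coords_le1[OF w, of i] by (intro f) auto
    also have "\<dots> \<le> C * (1 / (real (Suc i))\<^sup>2)" using sq[of "snd w i" i] thoma_coords[OF w] C by (intro mult_left_mono) auto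
    finally show ?thesis .
  qed
  show "\<bar>f (fst w i)\<bar> \<le> C * (1 / (real (Suc i))\<^sup>2)" "\<bar>f (- snd w i)\<bar> \<le> C * (1 / (real (Suc i))\<^sup>2)" by (rule 1, rule 2)
  have sC: "summable (\<lambda>i. C * (1 / (real (Suc i))\<^sup>2))" by (intro summable_mult summable_inverse_Suc_sq)
  show "summable (\<lambda>i. f (fst w i))" "summable (\<lambda>i. f (- snd w i))"
    using 1 2 by (auto intro!: summable_comparison_test'[OF sC, of 0] simp del: of_nat_Suc)
qed

text \<open>Weierstrass' test with majorant 2/(i + 1)^2, which \<open>log_defect\<close> allows by
  being quadratic at 0.\<close>

lemma continuous_on_test_fun: "continuous_on thoma (test_fun j)"
proof -
  define v where "v = 1 / real (j + 3)"
  have v: "0 < v" "v \<le> 1/2" by (auto simp: v_def)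
  let ?f = "\<lambda>i w. log_defect v (fst w i) - log_defect v (- snd w i)"
  have b: "norm (?f i w) \<le> 2 * (1 / (real (Suc i))\<^sup>2)" if "w \<in> thoma" for i w
  proof -
    have "\<bar>t\<bar> \<le> 1 \<Longrightarrow> \<bar>log_defect v t\<bar> \<le> 1 * t\<^sup>2" for t using log_defect_bound[of v t] v by simp
    from summable_comparison_coords(3,4)[OF that this, of i] show ?thesis
      unfolding real_norm_def by linarith
  qed
  have u: "uniform_limit thoma (\<lambda>n w. \<Sum>i<n. ?f i w) (log_test v) sequentially"
    unfolding log_test_def
  proof (rule Weierstrass_m_test)
    show "summable (\<lambda>i. 2 * (1 / (real (Suc i))\<^sup>2))" by (intro summable_mult summable_inverse_Suc_sq)
  qed (rule b)
  have p1: "0 < 1 - v * t" if "t \<le> 1" for t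
  proof -
    show ?thesis using mult_left_mono[of t 1 v] that v by linarith
  qed
  have c: "continuous_on thoma (?f i)" for i
  proof -
    have nz: "\<forall>w\<in>thoma. 1 - v * fst w i \<noteq> 0" "\<forall>w\<in>thoma. 1 - v * - snd w i \<noteq> 0"
    proof (safe, goal_cases)
      case (1 a b) then show ?case using p1[of "fst (a, b) i"] thoma_coords_le1(1)[OF 1(1), of i] by simp
    next
      case (2 a b) then show ?case using p1[of "- snd (a, b) i"] thoma_coords(2)[OF 2(1), of i] by simp
    qed
    show ?thesis unfolding log_defect_def
      by (intro continuous_intros continuous_on_fst_coord continuous_on_snd_coord) (use nz in auto)
  qed
  have "continuous_on thoma (log_test v)"
    by (rule uniform_limit_theorem[OF _ u]) (auto intro!: continuous_on_sum c always_eventually)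
  then show ?thesis unfolding test_fun_def v_def[symmetric] by (intro continuous_intros)
qed

section \<open>The observables separate points and control the metric\<close>

lemma log_defect_expansion:
  assumes x: "\<bar>v * t\<bar> \<le> 1/2"
  shows "\<bar>log_defect v t - (\<Sum>k\<in>{2..m}. (v * t) ^ k / real k)\<bar> \<le> 2 * \<bar>v * t\<bar> ^ Suc m"
proof (cases "m = 0")
  case True
  have "\<bar>v * t\<bar> < 1" using x by simp
  have "\<bar>ln (1 + (- v * t)) - (- v * t)\<bar> \<le> 2 * (- v * t)\<^sup>2"
    using x by (intro abs_ln_one_plus_x_minus_x_bound) simp
  then have "\<bar>log_defect v t\<bar> \<le> 2 * \<bar>v * t\<bar>\<^sup>2" by (simp add: log_defect_def)
  also have "\<dots> \<le> 2 * (\<bar>v * t\<bar> * 1)" unfolding power2_eq_square using x by (intro mult_left_mono) auto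
  finally show ?thesis using True by simp
next
  case False
  define y where "y = v * t"
  have y: "\<bar>y\<bar> \<le> 1/2" using x by (simp add: y_def)
  have s: "(\<lambda>n. y ^ n / real n) sums (- ln (1 - y))"
    using sums_minus[OF ln_series'[of "- y"]] y by simp
  have s': "summable (\<lambda>n. y ^ n / real n)" using s by (simp add: sums_iff)
  have "(\<Sum>k<Suc m. y ^ k / real k) = y + (\<Sum>k\<in>{2..m}. y ^ k / real k)"
  proof -
    have "{..<Suc m} = insert 0 (insert 1 {2..m})" using False by auto
    then show ?thesis by simp
  qed
  then have e: "log_defect v t - (\<Sum>k\<in>{2..m}. y ^ k / real k) = (\<Sum>n. y ^ (n + Suc m) / real (n + Suc m))"
    using suminf_minus_initial_segment[OF s', of "Suc m"] s by (simp add: log_defect_def y_def[symmetric] sums_iff)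
  have g: "(\<lambda>n. \<bar>y\<bar> ^ Suc m * \<bar>y\<bar> ^ n) sums (\<bar>y\<bar> ^ Suc m * (1 / (1 - \<bar>y\<bar>)))"
    using y by (intro sums_mult geometric_sums) simp
  have le: "\<bar>y ^ (n + Suc m) / real (n + Suc m)\<bar> \<le> \<bar>y\<bar> ^ Suc m * \<bar>y\<bar> ^ n" for n
  proof -
    have "\<bar>y ^ (n + Suc m) / real (n + Suc m)\<bar> = \<bar>y\<bar> ^ (n + Suc m) / real (n + Suc m)" by (simp only: power_abs abs_divide abs_of_nat)
    also have "\<dots> \<le> \<bar>y\<bar> ^ (n + Suc m) / 1" by (intro divide_left_mono) auto
    finally show ?thesis by (simp add: power_add mult_ac)
  qed
  have "\<bar>\<Sum>n. y ^ (n + Suc m) / real (n + Suc m)\<bar> \<le> \<bar>y\<bar> ^ Suc m * (1 / (1 - \<bar>y\<bar>))"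
    using norm_suminf_le[of "\<lambda>n. y ^ (n + Suc m) / real (n + Suc m)" "\<lambda>n. \<bar>y\<bar> ^ Suc m * \<bar>y\<bar> ^ n"] le g by (simp add: sums_iff)
  also have "\<dots> \<le> \<bar>y\<bar> ^ Suc m * 2" using y by (intro mult_left_mono) (auto simp: divide_simps)
  finally show ?thesis unfolding y_def[symmetric] using e by (simp add: mult.commute)
qed

text \<open>For k at least 2 this is the moment coordinate q of index k - 1: the power sum of degree
  k in the \<alpha> and the negated \<beta>.\<close>

definition thoma_moment :: "nat \<Rightarrow> thoma_pt \<Rightarrow> real" where
  "thoma_moment k w = (\<Sum>i. (fst w i) ^ k - (- snd w i) ^ k)"

lemma thoma_functional_bound:
  assumes w: "w \<in> thoma" and f: "\<And>t. \<bar>t\<bar> \<le> 1 \<Longrightarrow> \<bar>f t\<bar> \<le> C * t\<^sup>2" and C: "0 \<le> C"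
  shows "summable (\<lambda>i. f (fst w i) - f (- snd w i))" "\<bar>\<Sum>i. f (fst w i) - f (- snd w i)\<bar> \<le> 4 * C"
proof -
  note s = summable_comparison_coords[OF w f C]
  show sm: "summable (\<lambda>i. f (fst w i) - f (- snd w i))" using s(1,2) by (intro summable_diff)
  have i2: "(\<lambda>i. 1 / (real (Suc i))\<^sup>2) sums (pi\<^sup>2 / 6)" using inverse_squares_sums by simp
  have "\<bar>\<Sum>i. f (fst w i) - f (- snd w i)\<bar> \<le> (\<Sum>i. 2 * C * (1 / (real (Suc i))\<^sup>2))"
  proof -
    have "norm (f (fst w i) - f (- snd w i)) \<le> 2 * C * (1 / (real (Suc i))\<^sup>2)" for i
      using s(3,4)[of i] unfolding real_norm_def by linarith
    then show ?thesis
      using norm_suminf_le[of "\<lambda>i. f (fst w i) - f (- snd w i)" "\<lambda>i. 2 * C * (1 / (real (Suc i))\<^sup>2)"]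
        summable_mult[OF summable_inverse_Suc_sq, of "2 * C"] by simp
  qed
  also have "\<dots> = 2 * C * (pi\<^sup>2 / 6)" using sums_unique[OF sums_mult[OF i2, of "2 * C"]] by simp
  also have "\<dots> \<le> 2 * C * 2"
  proof (intro mult_left_mono)
    have "pi \<le> 3.2" using pi_less_4 pi_approx by simp
    then have "pi\<^sup>2 \<le> 3.2\<^sup>2" using pi_gt_zero by (intro power_mono) auto
    then show "pi\<^sup>2 / 6 \<le> 2" by (simp add: power2_eq_square)
  qed (use C in auto)
  finally show "\<bar>\<Sum>i. f (fst w i) - f (- snd w i)\<bar> \<le> 4 * C" by simp
qed

lemma pow_bound: "\<bar>t\<bar> \<le> 1 \<Longrightarrow> 2 \<le> k \<Longrightarrow> \<bar>t ^ k\<bar> \<le> 1 * (t::real)\<^sup>2"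
  using power_decreasing[of 2 k "\<bar>t\<bar>"] by (simp add: power_abs)

text \<open>The expansion of \<open>log_test v w\<close> at \<open>v = 0\<close> recovers the moments one after the other.\<close>

lemma log_test_expansion:
  assumes w: "w \<in> thoma" and v: "0 < v" "v \<le> 1/2" and m: "m \<ge> 1"
  shows "\<bar>log_test v w - (\<Sum>k\<in>{2..m}. v ^ k / real k * thoma_moment k w)\<bar> \<le> 8 * v ^ Suc m"
proof -
  let ?g = "\<lambda>t. log_defect v t - (\<Sum>k\<in>{2..m}. (v * t) ^ k / real k)"
  have g: "\<bar>?g t\<bar> \<le> (2 * v ^ Suc m) * t\<^sup>2" if t: "\<bar>t\<bar> \<le> 1" for t
  proof -
    have "\<bar>v * t\<bar> \<le> 1/2 * 1" using v t by (intro abs_mult_le) auto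
    then have "\<bar>?g t\<bar> \<le> 2 * \<bar>v * t\<bar> ^ Suc m" by (intro log_defect_expansion) simp
    also have "\<dots> = 2 * v ^ Suc m * \<bar>t ^ Suc m\<bar>" using v by (simp add: abs_mult power_mult_distrib power_abs)
    also have "\<dots> \<le> 2 * v ^ Suc m * (1 * t\<^sup>2)" using pow_bound[OF t, of "Suc m"] m v by (intro mult_left_mono) auto
    finally show ?thesis by simp
  qed
  have sl: "summable (\<lambda>i. log_defect v (fst w i) - log_defect v (- snd w i))"
    using log_defect_bound[of v] v by (intro thoma_functional_bound(1)[OF w, of _ 1]) auto
  have sk: "summable (\<lambda>i. (fst w i) ^ k - (- snd w i) ^ k)" if "2 \<le> k" for k
    using pow_bound that by (intro thoma_functional_bound(1)[OF w, of "\<lambda>t. t ^ k" 1]) auto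
  have "(\<Sum>k\<in>{2..m}. v ^ k / real k * thoma_moment k w) = (\<Sum>k\<in>{2..m}. \<Sum>i. v ^ k / real k * ((fst w i) ^ k - (- snd w i) ^ k))"
    unfolding thoma_moment_def using sk by (intro sum.cong refl suminf_mult[symmetric]) auto
  also have "\<dots> = (\<Sum>i. \<Sum>k\<in>{2..m}. v ^ k / real k * ((fst w i) ^ k - (- snd w i) ^ k))"
    using sk by (intro suminf_sum[symmetric] summable_mult) auto
  finally have mm: "(\<Sum>k\<in>{2..m}. v ^ k / real k * thoma_moment k w) = (\<Sum>i. \<Sum>k\<in>{2..m}. v ^ k / real k * ((fst w i) ^ k - (- snd w i) ^ k))" .
  have S: "summable (\<lambda>i. \<Sum>k\<in>{2..m}. v ^ k / real k * ((fst w i) ^ k - (- snd w i) ^ k))"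
    by (intro summable_sum summable_mult sk) auto
  have "log_test v w - (\<Sum>k\<in>{2..m}. v ^ k / real k * thoma_moment k w)
     = (\<Sum>i. (log_defect v (fst w i) - log_defect v (- snd w i)) - (\<Sum>k\<in>{2..m}. v ^ k / real k * ((fst w i) ^ k - (- snd w i) ^ k)))"
    unfolding log_test_def mm by (rule suminf_diff[OF sl S])
  also have "\<dots> = (\<Sum>i. ?g (fst w i) - ?g (- snd w i))"
  proof (intro suminf_cong)
    fix i
    have "v ^ k / real k * (x ^ k - y ^ k) = (v * x) ^ k / real k - (v * y) ^ k / real k" for k x y
      by (simp add: power_mult_distrib algebra_simps diff_divide_distrib)
    then show "(log_defect v (fst w i) - log_defect v (- snd w i)) - (\<Sum>k\<in>{2..m}. v ^ k / real k * ((fst w i) ^ k - (- snd w i) ^ k))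
      = ?g (fst w i) - ?g (- snd w i)" by (simp only: sum_subtractf)
  qed
  finally show ?thesis
    using thoma_functional_bound(2)[OF w g] v by simp
qed

text \<open>Once the lower moments agree, the expansions at v = 1/(j + 3) leave v^m / m times the
  m-th difference, bounded by a multiple of v^(m + 1). Letting j grow forces the difference to be
  0.\<close>

lemma thoma_moments_eq:
  assumes w: "w \<in> thoma" "w' \<in> thoma" and eq: "\<And>j. test_fun j w = test_fun j w'"
  shows "2 \<le> k \<Longrightarrow> thoma_moment k w = thoma_moment k w'"
proof (induction k rule: less_induct)
  case (less m)
  let ?v = "\<lambda>j. 1 / real (j + 3)"
  have lt: "log_test (?v j) w = log_test (?v j) w'" for j using eq[of j] by (simp add: test_fun_def)
  define D where "D = thoma_moment m w - thoma_moment m w'"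
  have b: "\<bar>D\<bar> \<le> 16 * real m * ?v j" for j
  proof -
    let ?s = "\<lambda>w. \<Sum>k\<in>{2..m}. ?v j ^ k / real k * thoma_moment k w"
    have v: "0 < ?v j" "?v j \<le> 1/2" by auto
    have "\<bar>?s w - ?s w'\<bar> \<le> 16 * ?v j ^ Suc m"
      using log_test_expansion[OF w(1) v, of m] log_test_expansion[OF w(2) v, of m] less.prems lt[of j] by linarith
    moreover have "?s w - ?s w' = ?v j ^ m / real m * D"
    proof -
      have "?s w - ?s w' = (\<Sum>k\<in>{2..m}. ?v j ^ k / real k * (thoma_moment k w - thoma_moment k w'))"
        by (simp add: sum_subtractf right_diff_distrib)
      also have "\<dots> = (\<Sum>k\<in>{2..m}. if k = m then ?v j ^ m / real m * D else 0)"
        using less.IH by (intro sum.cong refl) (auto simp: D_def)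
      finally show ?thesis using less.prems by simp
    qed
    ultimately have "?v j ^ m / real m * \<bar>D\<bar> \<le> 16 * ?v j ^ Suc m" by (simp add: abs_mult)
    also have "16 * ?v j ^ Suc m = ?v j ^ m / real m * (16 * real m * ?v j)" using less.prems by simp
    finally show ?thesis by (rule mult_left_le_imp_le) (use less.prems in simp)
  qed
  have "(\<lambda>j. 16 * real m * ?v j) \<longlonglongrightarrow> 0" by real_asymp
  then have "\<bar>D\<bar> \<le> 0" using b by (intro LIMSEQ_le_const) auto
  then show ?case by (simp add: D_def)
qed

text \<open>The moments of order at least 2 are the polynomial integrals against the signed measure
  with mass \<alpha>_i^2 at \<alpha>_i and -\<beta>_i^2 at -\<beta>_i. Its variation is bounded, so
  Weierstrass approximation on [-1, 1] extends the equality to continuous f.\<close>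

lemma thoma_functional_eq:
  assumes w: "w \<in> thoma" "w' \<in> thoma" and eq: "\<And>k. 2 \<le> k \<Longrightarrow> thoma_moment k w = thoma_moment k w'"
    and f: "continuous_on {-1..1} f"
  defines "L \<equiv> \<lambda>f w. (\<Sum>i. (fst w i)\<^sup>2 * f (fst w i) - (- snd w i)\<^sup>2 * f (- snd w i :: real))"
  shows "L f w = L f w'"
proof -
  have bd: "\<bar>t\<^sup>2 * g t\<bar> \<le> C * t\<^sup>2" if "\<And>t. \<bar>t\<bar> \<le> 1 \<Longrightarrow> \<bar>g t\<bar> \<le> C" "\<bar>t\<bar> \<le> 1" for g C and t :: real
    using that(1)[OF that(2)] by (simp add: abs_mult mult.commute mult_right_mono)
  obtain B where B: "\<And>t. \<bar>t\<bar> \<le> 1 \<Longrightarrow> \<bar>f t\<bar> \<le> B" "B \<ge> 0"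
  proof -
    have "bounded (f ` {-1..1})" using f by (intro compact_imp_bounded compact_continuous_image) auto
    then obtain B where B: "\<forall>x\<in>f ` {-1..1}. norm x \<le> B" unfolding bounded_iff by blast
    show ?thesis
    proof (rule that[of "max B 0"])
      fix t :: real assume "\<bar>t\<bar> \<le> 1"
      then have "f t \<in> f ` {-1..1}" by (intro imageI) (simp add: abs_le_iff)
      then have "norm (f t) \<le> B" using B by blast
      then show "\<bar>f t\<bar> \<le> max B 0" by simp
    qed simp
  qed
  have main: "\<bar>L f w - L f w'\<bar> \<le> 8 * e" if e: "e > 0" for e
  proof -
    obtain p where p: "real_polynomial_function p" "\<And>x. x \<in> {-1..1} \<Longrightarrow> \<bar>f x - p x\<bar> < e"
      using Stone_Weierstrass_real_polynomial_function[OF compact_Icc f e] by blast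
    then obtain a n where a: "p = (\<lambda>x. \<Sum>i\<le>n. a i * x ^ i)" unfolding real_polynomial_function_iff_sum by blast
    have ps: "L p w = (\<Sum>k\<le>n. a k * thoma_moment (k + 2) w)" if w: "w \<in> thoma" for w
    proof -
      have sk: "summable (\<lambda>i. (fst w i) ^ (k + 2) - (- snd w i) ^ (k + 2))" for k
      proof (rule thoma_functional_bound(1)[OF w, of "\<lambda>t. t ^ (k + 2)" 1])
        show "\<bar>t ^ (k + 2)\<bar> \<le> 1 * t\<^sup>2" if "\<bar>t\<bar> \<le> 1" for t :: real using that by (rule pow_bound) simp
      qed simp
      have "(\<Sum>k\<le>n. a k * thoma_moment (k + 2) w) = (\<Sum>k\<le>n. \<Sum>i. a k * ((fst w i) ^ (k + 2) - (- snd w i) ^ (k + 2)))"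
        unfolding thoma_moment_def using sk by (intro sum.cong refl suminf_mult[symmetric])
      also have "\<dots> = (\<Sum>i. \<Sum>k\<le>n. a k * ((fst w i) ^ (k + 2) - (- snd w i) ^ (k + 2)))"
        using sk by (intro suminf_sum[symmetric] summable_mult)
      also have "\<dots> = L p w" unfolding L_def a
        by (intro suminf_cong) (simp add: sum_distrib_left sum_subtractf[symmetric] power_add power2_eq_square algebra_simps)
      finally show ?thesis by simp
    qed
    have d: "\<bar>L f w - L p w\<bar> \<le> 4 * e" if w: "w \<in> thoma" for w
    proof -
      obtain B' where B': "\<And>t. \<bar>t\<bar> \<le> 1 \<Longrightarrow> \<bar>p t\<bar> \<le> B'" "B' \<ge> 0"
        using that[of "B + e"] B p(2) e by (smt (verit) atLeastAtMost_iff)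
      have "L f w - L p w = (\<Sum>i. (fst w i)\<^sup>2 * (f (fst w i) - p (fst w i)) - (- snd w i)\<^sup>2 * (f (- snd w i) - p (- snd w i)))"
        unfolding L_def
        using thoma_functional_bound(1)[OF w bd[of f B], OF B(1)] thoma_functional_bound(1)[OF w bd[of p B'], OF B'(1)] B(2) B'(2)
        by (subst suminf_diff) (auto simp: algebra_simps)
      moreover have "\<bar>f t - p t\<bar> \<le> e" if "\<bar>t\<bar> \<le> 1" for t
      proof -
        have "t \<in> {-1..1}" using that by (simp add: abs_le_iff)
        then show ?thesis using p(2) by (simp add: less_imp_le)
      qed
      ultimately show ?thesis using thoma_functional_bound(2)[OF w bd[of "\<lambda>t. f t - p t" e]] e by simp
    qed
    show ?thesis using d[OF w(1)] d[OF w(2)] ps[OF w(1)] ps[OF w(2)] eq by simp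
  qed
  have "\<bar>L f w - L f w'\<bar> \<le> e" if "e > 0" for e using main[of "e / 8"] that by simp
  then have "\<bar>L f w - L f w'\<bar> \<le> 0" by (rule field_le_epsilon[of _ 0, simplified])
  then show ?thesis by simp
qed

definition ramp :: "real \<Rightarrow> real \<Rightarrow> real \<Rightarrow> real" where
  "ramp c d t = max 0 (min 1 ((t - c) / (d - c)))"

text \<open>At the first index i where they differ, say a_i < b_i, use a ramp from their midpoint to
  b_i. It vanishes on a from index i on and is 1 at b_i, so the sum over b is larger by at least
  one.\<close>

lemma ramp_sequences_eq:
  assumes a: "decseq a" "\<And>i. 0 \<le> a i" and b: "decseq b" "\<And>i. 0 \<le> b i"
    and sm: "\<And>c d. 0 < c \<Longrightarrow> c < d \<Longrightarrow> summable (\<lambda>i. ramp c d (a i)) \<and> summable (\<lambda>i. ramp c d (b i)) \<and> (\<Sum>i. ramp c d (a i)) = (\<Sum>i. ramp c d (b i))"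
  shows "a = (b :: nat \<Rightarrow> real)"
proof (rule ccontr)
  assume "a \<noteq> b"
  then have ex: "\<exists>i. a i \<noteq> b i" by auto
  define i where "i = (LEAST i. a i \<noteq> b i)"
  have i: "a i \<noteq> b i" and eq: "\<And>k. k < i \<Longrightarrow> a k = b k"
    using LeastI_ex[OF ex] not_less_Least by (auto simp: i_def)
  have *: False if "a i < b i" and eq: "\<And>k. k < i \<Longrightarrow> a k = b k" and a: "decseq a" "\<And>i. 0 \<le> a i"
    and sm: "\<And>c d. 0 < c \<Longrightarrow> c < d \<Longrightarrow> summable (\<lambda>i. ramp c d (b i)) \<and> (\<Sum>i. ramp c d (a i)) = (\<Sum>i. ramp c d (b i))"
    for a b :: "nat \<Rightarrow> real"
  proof -
    define c where "c = (a i + b i) / 2"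
    have c: "0 < c" "c < b i" "a i < c" using that(1) a(2)[of i] by (auto simp: c_def)
    have z: "ramp c (b i) (a k) = 0" if "k \<notin> {..<i}" for k
    proof -
      have "a k \<le> a i" using that decseqD[OF a(1), of i k] by simp
      then have "(a k - c) / (b i - c) \<le> 0" using c by (intro divide_nonpos_pos) auto
      then show ?thesis by (simp add: ramp_def)
    qed
    have "(\<Sum>k. ramp c (b i) (a k)) = (\<Sum>k<i. ramp c (b i) (a k))" by (rule suminf_finite) (use z in auto)
    moreover have "(\<Sum>k<Suc i. ramp c (b i) (b k)) \<le> (\<Sum>k. ramp c (b i) (b k))"
      using sm[OF c(1,2)] by (intro sum_le_suminf) (auto simp: ramp_def)
    moreover have "ramp c (b i) (b i) = 1" using c by (simp add: ramp_def)
    moreover have "(\<Sum>k<i. ramp c (b i) (b k)) = (\<Sum>k<i. ramp c (b i) (a k))" using eq by simp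
    ultimately show False using sm[OF c(1,2)] by simp
  qed
  consider "a i < b i" | "b i < a i" using i by linarith
  then show False
  proof cases
    case 1 show False by (rule *[OF 1 eq a]) (use sm in auto)
  next
    case 2 show False by (rule *[OF 2 eq[symmetric] b]) (use sm in auto)
  qed
qed

text \<open>A ramp vanishing near 0 is t^2 times a continuous function, so its sums are determined
  by the moments. A ramp on the positive axis sees only the \<alpha>, its reflection only the
  \<beta>.\<close>

lemma test_fun_separates:
  assumes w: "w \<in> thoma" "w' \<in> thoma" and eq: "\<And>j. test_fun j w = test_fun j w'"
  shows "w = w'"
proof -
  have mom: "thoma_moment k w = thoma_moment k w'" if "2 \<le> k" for k
    using thoma_moments_eq[OF w eq that] .
  \<comment> \<open>The maximum with c avoids division by zero without changing t^2 G, because the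
    ramp vanishes up to c.\<close>
  define G where "G c d t = ramp c d t / (max t c)\<^sup>2" for c d t :: real
  have cG: "continuous_on A (G c d)" "continuous_on A (\<lambda>t. G c d (- t))" if "0 < c" "c < d" for A c d
    unfolding G_def ramp_def using that by (auto intro!: continuous_intros)
  have G: "t\<^sup>2 * G c d t = ramp c d t" "t \<le> 0 \<Longrightarrow> G c d t = 0" "\<bar>G c d t\<bar> \<le> 1 / c\<^sup>2" if c: "0 < c" "c < d" for c d t
  proof -
    have r0: "ramp c d t = 0" if "t \<le> c"
    proof -
      have "(t - c) / (d - c) \<le> 0" using that c by (intro divide_nonpos_pos) auto
      then show ?thesis by (simp add: ramp_def)
    qed
    show "t\<^sup>2 * G c d t = ramp c d t" using r0 c by (cases "t \<le> c") (auto simp: G_def max_def)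
    show "t \<le> 0 \<Longrightarrow> G c d t = 0" using r0 c by (simp add: G_def)
    have r1: "0 \<le> ramp c d t" "ramp c d t \<le> 1" by (auto simp: ramp_def)
    have "c\<^sup>2 \<le> (max t c)\<^sup>2" using c by (intro power_mono) auto
    then have "ramp c d t / (max t c)\<^sup>2 \<le> 1 / c\<^sup>2" using r1 c by (intro frac_le) auto
    then show "\<bar>G c d t\<bar> \<le> 1 / c\<^sup>2" unfolding G_def using r1 by simp
  qed
  have sm: "summable (\<lambda>i. ramp c d (fst u i))" "summable (\<lambda>i. ramp c d (snd u i))" if "u \<in> thoma" "0 < c" "c < d" for u c d
  proof -
    have b: "\<bar>ramp c d t\<bar> \<le> 1 / c\<^sup>2 * t\<^sup>2" for t
      unfolding G(1)[OF that(2,3), of t, symmetric] abs_mult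
      using mult_right_mono[OF G(3)[OF that(2,3), of t], of "t\<^sup>2"] by (simp add: mult.commute)
    have b': "\<bar>ramp c d (- t)\<bar> \<le> 1 / c\<^sup>2 * t\<^sup>2" for t using b[of "- t"] by simp
    show "summable (\<lambda>i. ramp c d (fst u i))" using summable_comparison_coords(1)[OF that(1), of "ramp c d" "1 / c\<^sup>2"] b by auto
    show "summable (\<lambda>i. ramp c d (snd u i))" using summable_comparison_coords(2)[OF that(1), of "\<lambda>t. ramp c d (- t)" "1 / c\<^sup>2"] b' by auto
  qed
  have f1: "(\<Sum>i. ramp c d (fst w i)) = (\<Sum>i. ramp c d (fst w' i))" if "0 < c" "c < d" for c d
    using thoma_functional_eq[OF w mom cG(1)[OF that]] G(1,2)[OF that] thoma_coords(2)[OF w(1)] thoma_coords(2)[OF w(2)] by simp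
  have f2: "(\<Sum>i. - ramp c d (snd w i)) = (\<Sum>i. - ramp c d (snd w' i))" if "0 < c" "c < d" for c d
    using thoma_functional_eq[OF w mom cG(2)[OF that]] G(1,2)[OF that] thoma_coords(1)[OF w(1)] thoma_coords(1)[OF w(2)] by simp
  have f2': "(\<Sum>i. ramp c d (snd w i)) = (\<Sum>i. ramp c d (snd w' i))" if "0 < c" "c < d" for c d
    using f2[OF that] sm(2)[OF w(1) that] sm(2)[OF w(2) that] by (simp add: suminf_minus)
  have dec: "decseq (fst w)" "decseq (snd w)" "decseq (fst w')" "decseq (snd w')" using w by (auto simp: thoma_def)
  have "fst w = fst w'"
    by (rule ramp_sequences_eq[OF dec(1) thoma_coords(1)[OF w(1)] dec(3) thoma_coords(1)[OF w(2)]]) (intro conjI sm(1) f1 w; assumption)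
  moreover have "snd w = snd w'"
    by (rule ramp_sequences_eq[OF dec(2) thoma_coords(2)[OF w(1)] dec(4) thoma_coords(2)[OF w(2)]]) (intro conjI sm(2) f2' w; assumption)
  ultimately show ?thesis by (simp add: prod_eq_iff)
qed

text \<open>Otherwise there are pairs at distance at least e on which ever more observables agree
  ever better. By compactness they have a limit pair, on which all observables agree, contradicting
  separation.\<close>

lemma test_fun_dist:
  assumes e: "e > 0"
  obtains J d where "d > 0" "\<And>x y. x \<in> thoma \<Longrightarrow> y \<in> thoma \<Longrightarrow> (\<And>j. j < J \<Longrightarrow> \<bar>test_fun j x - test_fun j y\<bar> < d) \<Longrightarrow> dist x y < e"
proof (rule ccontr)
  assume no: "\<not> thesis"
  have "\<exists>x y. x \<in> thoma \<and> y \<in> thoma \<and> (\<forall>j<n. \<bar>test_fun j x - test_fun j y\<bar> < 1 / real (Suc n)) \<and> \<not> dist x y < e" for n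
  proof (rule ccontr)
    assume h: "\<not> (\<exists>x y. x \<in> thoma \<and> y \<in> thoma \<and> (\<forall>j<n. \<bar>test_fun j x - test_fun j y\<bar> < 1 / real (Suc n)) \<and> \<not> dist x y < e)"
    have thesis
    proof (rule that[of "1 / real (Suc n)" n])
      show "0 < 1 / real (Suc n)" by simp
      show "dist x y < e" if "x \<in> thoma" "y \<in> thoma" "\<And>j. j < n \<Longrightarrow> \<bar>test_fun j x - test_fun j y\<bar> < 1 / real (Suc n)" for x y
        using h that by blast
    qed
    then show False using no by simp
  qed
  then obtain x y where xy: "\<And>n. x n \<in> thoma" "\<And>n. y n \<in> thoma" "\<And>n j. j < n \<Longrightarrow> \<bar>test_fun j (x n) - test_fun j (y n)\<bar> < 1 / real (Suc n)"
    "\<And>n. \<not> dist (x n) (y n) < e" by metis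
  obtain l r where r: "l \<in> thoma \<times> thoma" "strict_mono r" "((\<lambda>n. (x n, y n)) \<circ> r) \<longlonglongrightarrow> l"
  proof -
    have mem: "\<forall>n. (x n, y n) \<in> thoma \<times> thoma" using xy(1,2) by simp
    show ?thesis
      by (rule seq_compactE[OF compact_imp_seq_compact[OF compact_Times[OF compact_thoma compact_thoma]] mem]) (rule that)
  qed
  have lx: "(\<lambda>n. x (r n)) \<longlonglongrightarrow> fst l" and ly: "(\<lambda>n. y (r n)) \<longlonglongrightarrow> snd l"
    using tendsto_fst[OF r(3)] tendsto_snd[OF r(3)] by (simp_all add: comp_def)
  have l: "fst l \<in> thoma" "snd l \<in> thoma" using r(1) by auto
  have "test_fun j (fst l) = test_fun j (snd l)" for j
  proof -
    have tx: "(\<lambda>n. test_fun j (x (r n))) \<longlonglongrightarrow> test_fun j (fst l)"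
      using continuous_on_tendsto_compose[OF continuous_on_test_fun lx l(1)] xy(1) by simp
    have ty: "(\<lambda>n. test_fun j (y (r n))) \<longlonglongrightarrow> test_fun j (snd l)"
      using continuous_on_tendsto_compose[OF continuous_on_test_fun ly l(2)] xy(2) by simp
    have "(\<lambda>n. test_fun j (x (r n)) - test_fun j (y (r n))) \<longlonglongrightarrow> 0"
    proof (rule Lim_null_comparison)
      show "eventually (\<lambda>n. norm (test_fun j (x (r n)) - test_fun j (y (r n))) \<le> 1 / real (Suc (r n))) sequentially"
        using eventually_gt_at_top[of j]
      proof eventually_elim
        case (elim n)
        then have "j < r n" using seq_suble[OF r(2), of n] by simp
        then show ?case using xy(3)[of j "r n"] by simp
      qed
      have "(\<lambda>n. 1 / real (Suc n)) \<longlonglongrightarrow> 0" by real_asymp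
      then show "(\<lambda>n. 1 / real (Suc (r n))) \<longlonglongrightarrow> 0" using LIMSEQ_subseq_LIMSEQ[OF _ r(2)] by (fastforce simp: comp_def)
    qed
    then have "test_fun j (fst l) - test_fun j (snd l) = 0" using LIMSEQ_unique tendsto_diff[OF tx ty] by blast
    then show ?thesis by simp
  qed
  then have "fst l = snd l" using test_fun_separates[OF l] by blast
  moreover have "(\<lambda>n. dist (x (r n)) (y (r n))) \<longlonglongrightarrow> dist (fst l) (snd l)" by (intro tendsto_dist lx ly)
  ultimately have "(\<lambda>n. dist (x (r n)) (y (r n))) \<longlonglongrightarrow> 0" by simp
  then have "eventually (\<lambda>n. dist (x (r n)) (y (r n)) < e) sequentially" using e by (rule order_tendstoD)
  then show False using xy(4) by (auto simp: eventually_sequentially)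
qed

section \<open>Moment estimates and path laws of finite Markov chains\<close>

locale finite_chain =
  fixes K :: "'s \<Rightarrow> 's pmf" and S :: "'s set"
  assumes finite_S: "finite S" and closed_S: "\<And>s. s \<in> S \<Longrightarrow> set_pmf (K s) \<subseteq> S"
begin

definition op :: "('s \<Rightarrow> real) \<Rightarrow> 's \<Rightarrow> real" where
  "op g s = measure_pmf.expectation (K s) g"

lemma finite_set_K: "s \<in> S \<Longrightarrow> finite (set_pmf (K s))"
  using finite_subset[OF closed_S finite_S] .

lemma integrable_K: "s \<in> S \<Longrightarrow> integrable (measure_pmf (K s)) (g :: 's \<Rightarrow> real)"
  by (rule integrable_measure_pmf_finite[OF finite_set_K])

lemma op_mono_supp: "s \<in> S \<Longrightarrow> (\<And>y. y \<in> set_pmf (K s) \<Longrightarrow> g y \<le> h y) \<Longrightarrow> op g s \<le> op h s"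
  unfolding op_def by (intro integral_mono_AE integrable_K) (auto simp: AE_measure_pmf_iff)

lemma op_mono: "s \<in> S \<Longrightarrow> (\<And>y. y \<in> S \<Longrightarrow> g y \<le> h y) \<Longrightarrow> op g s \<le> op h s"
  using closed_S by (intro op_mono_supp) auto

lemma op_affine: "s \<in> S \<Longrightarrow> op (\<lambda>y. a * g y + b * h y + c) s = a * op g s + b * op h s + c"
  unfolding op_def using integrable_K[of s] by simp

lemma iter_mono: "s \<in> S \<Longrightarrow> (\<And>y. y \<in> S \<Longrightarrow> g y \<le> h y) \<Longrightarrow> (op ^^ k) g s \<le> (op ^^ k) h s"
proof (induction k arbitrary: g h)
  case (Suc k)
  show ?case unfolding funpow_Suc_right comp_def using Suc op_mono by (intro Suc.IH) auto
qed simp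

lemma iter_cong: "s \<in> S \<Longrightarrow> (\<And>y. y \<in> S \<Longrightarrow> g y = h y) \<Longrightarrow> (op ^^ k) g s = (op ^^ k) h s"
  by (intro antisym iter_mono) auto

lemma iter_affine: "s \<in> S \<Longrightarrow> (op ^^ k) (\<lambda>y. a * g y + b * h y + c) s = a * (op ^^ k) g s + b * (op ^^ k) h s + c"
proof (induction k arbitrary: g h)
  case (Suc k)
  have "(op ^^ Suc k) (\<lambda>y. a * g y + b * h y + c) s = (op ^^ k) (\<lambda>y. a * op g y + b * op h y + c) s"
    unfolding funpow_Suc_right comp_def using Suc.prems op_affine by (intro iter_cong) auto
  then show ?case using Suc by (simp add: funpow_swap1)
qed simp

lemma iter_bound:
  assumes "s \<in> S" "\<And>y. y \<in> S \<Longrightarrow> \<bar>g y - h y\<bar> \<le> c"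
  shows "\<bar>(op ^^ k) g s - (op ^^ k) h s\<bar> \<le> c"
proof -
  have "(op ^^ k) g s \<le> (op ^^ k) (\<lambda>y. 1 * h y + 0 * h y + c) s"
    using assms by (intro iter_mono) (auto simp: abs_le_iff algebra_simps)
  moreover have "(op ^^ k) h s \<le> (op ^^ k) (\<lambda>y. 1 * g y + 0 * g y + c) s"
    using assms by (intro iter_mono) (auto simp: abs_le_iff algebra_simps)
  ultimately show ?thesis using iter_affine[OF assms(1), of k 1 h 0 h c] iter_affine[OF assms(1), of k 1 g 0 g c] by simp
qed

text \<open>In one step the squared displacement grows by O(h^2) in the mean, so it is O(k h^2)
  after k steps. The fourth power grows by O(h^2) times the square plus O(h^4); summation gives k^2
  h^4. Boundedness of f turns the drift term, cubic in the displacement, into a multiple of the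
  square. With h = 1/n and k about n^2 t the leading term is t^2.\<close>

lemma fourth_moment:
  assumes s0: "s0 \<in> S" and h: "0 \<le> h" and B: "0 \<le> B" and C: "0 \<le> C"
    and bd: "\<And>s. s \<in> S \<Longrightarrow> \<bar>f s\<bar> \<le> B"
    and drift: "\<And>s. s \<in> S \<Longrightarrow> \<bar>op f s - f s\<bar> \<le> C * h\<^sup>2"
    and jump: "\<And>s y. s \<in> S \<Longrightarrow> y \<in> set_pmf (K s) \<Longrightarrow> \<bar>f y - f s\<bar> \<le> C * h"
  shows "(op ^^ k) (\<lambda>y. (f y - f s0) ^ 4) s0
    \<le> ((4 * B * C + C\<^sup>2) * (8 * B * C + 8 * C\<^sup>2) * (real k)\<^sup>2 + 3 * C ^ 4 * real k) * h ^ 4"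
proof -
  define j where "j = C * h"
  have j: "0 \<le> j" using C h by (simp add: j_def)
  let ?p = "\<lambda>y. f y - f s0"
  have pb: "\<bar>?p s\<bar> \<le> 2 * B" if "s \<in> S" for s using bd[OF that] bd[OF s0] by linarith
  have d: "op (\<lambda>y. c * (f y - f s) + b) s \<le> \<bar>c\<bar> * (C * h\<^sup>2) + b" if "s \<in> S" for c b s
  proof -
    have "op (\<lambda>y. c * (f y - f s) + b) s = op (\<lambda>y. c * f y + 0 * f y + (b - c * f s)) s" by (simp add: algebra_simps)
    also have "\<dots> = c * (op f s - f s) + b" using op_affine[OF that, of c f 0 f "b - c * f s"] by (simp add: algebra_simps)
    also have "c * (op f s - f s) \<le> \<bar>c * (op f s - f s)\<bar>" by simp
    also have "\<dots> \<le> \<bar>c\<bar> * (C * h\<^sup>2)" unfolding abs_mult using drift[OF that] by (intro mult_left_mono) auto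
    finally show ?thesis by simp
  qed
  let ?c1 = "4 * B * C + C\<^sup>2" and ?c2 = "8 * B * C + 8 * C\<^sup>2"
  have s2: "op (\<lambda>y. (?p y)\<^sup>2) s \<le> (?p s)\<^sup>2 + ?c1 * h\<^sup>2" if s: "s \<in> S" for s
  proof -
    have "op (\<lambda>y. (?p y)\<^sup>2) s \<le> op (\<lambda>y. 2 * ?p s * (f y - f s) + ((?p s)\<^sup>2 + j\<^sup>2)) s"
    proof (rule op_mono_supp[OF s])
      fix y assume y: "y \<in> set_pmf (K s)"
      have "(f y - f s)\<^sup>2 \<le> j\<^sup>2" using jump[OF s y] by (simp add: j_def abs_le_square_iff[symmetric] abs_mult C h)
      moreover have "(?p y)\<^sup>2 = 2 * ?p s * (f y - f s) + (?p s)\<^sup>2 + (f y - f s)\<^sup>2" by (simp add: power2_eq_square algebra_simps)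
      ultimately show "(?p y)\<^sup>2 \<le> 2 * ?p s * (f y - f s) + ((?p s)\<^sup>2 + j\<^sup>2)" by linarith
    qed
    also have "\<dots> \<le> \<bar>2 * ?p s\<bar> * (C * h\<^sup>2) + ((?p s)\<^sup>2 + j\<^sup>2)" by (rule d[OF s])
    also have "\<bar>2 * ?p s\<bar> * (C * h\<^sup>2) \<le> (4 * B) * (C * h\<^sup>2)" using pb[OF s] C by (intro mult_right_mono) auto
    finally show ?thesis by (simp add: j_def power_mult_distrib algebra_simps)
  qed
  have s4: "op (\<lambda>y. (?p y) ^ 4) s \<le> (?p s) ^ 4 + ?c2 * h\<^sup>2 * (?p s)\<^sup>2 + 3 * C ^ 4 * h ^ 4" if s: "s \<in> S" for s
  proof -
    define q where "q = ?p s"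
    have "op (\<lambda>y. (?p y) ^ 4) s \<le> op (\<lambda>y. 4 * q ^ 3 * (f y - f s) + (q ^ 4 + 8 * q\<^sup>2 * j\<^sup>2 + 3 * j ^ 4)) s"
    proof (rule op_mono_supp[OF s])
      fix y assume y: "y \<in> set_pmf (K s)"
      define e where "e = f y - f s"
      have e: "\<bar>e\<bar> \<le> j" using jump[OF s y] by (simp add: j_def e_def)
      have e2: "e\<^sup>2 \<le> j\<^sup>2" using e j by (simp add: abs_le_square_iff[symmetric])
      have e4: "e ^ 4 \<le> j ^ 4" using power_mono[OF e2, of 2] by (simp add: power_mult[symmetric])
      have q2: "q\<^sup>2 * e\<^sup>2 \<le> q\<^sup>2 * j\<^sup>2" using e2 by (intro mult_left_mono) auto
      \<comment> \<open>This trades the term 4 q e^3 for 2 q^2 e^2 + 2 e^4, raising the coefficients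
        6 and 1 of the binomial expansion to 8 and 3.\<close>
      have "0 \<le> (q * e - e\<^sup>2)\<^sup>2" by simp
      then have e3: "2 * (q * e ^ 3) \<le> q\<^sup>2 * e\<^sup>2 + e ^ 4" by (simp add: power2_eq_square power4_eq_xxxx power3_eq_cube algebra_simps)
      have "?p y = q + e" by (simp add: q_def e_def)
      then have "(?p y) ^ 4 = q ^ 4 + 4 * q ^ 3 * e + 6 * (q\<^sup>2 * e\<^sup>2) + 4 * (q * e ^ 3) + e ^ 4"
        by (simp add: power2_eq_square power4_eq_xxxx power3_eq_cube algebra_simps)
      then have "(?p y) ^ 4 \<le> 4 * q ^ 3 * e + (q ^ 4 + 8 * (q\<^sup>2 * j\<^sup>2) + 3 * j ^ 4)"
        using e3 e4 q2 by linarith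
      then show "(?p y) ^ 4 \<le> 4 * q ^ 3 * (f y - f s) + (q ^ 4 + 8 * q\<^sup>2 * j\<^sup>2 + 3 * j ^ 4)"
        by (simp add: e_def mult.assoc)
    qed
    also have "\<dots> \<le> \<bar>4 * q ^ 3\<bar> * (C * h\<^sup>2) + (q ^ 4 + 8 * q\<^sup>2 * j\<^sup>2 + 3 * j ^ 4)" by (rule d[OF s])
    also have "\<bar>4 * q ^ 3\<bar> * (C * h\<^sup>2) \<le> (8 * B * q\<^sup>2) * (C * h\<^sup>2)"
    proof (rule mult_right_mono)
      have "\<bar>4 * q ^ 3\<bar> = 4 * (\<bar>q\<bar> * q\<^sup>2)" by (simp add: abs_mult power3_eq_cube power2_eq_square)
      also have "\<dots> \<le> 4 * ((2 * B) * q\<^sup>2)" using pb[OF s] by (intro mult_left_mono mult_right_mono) (auto simp: q_def)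
      finally show "\<bar>4 * q ^ 3\<bar> \<le> 8 * B * q\<^sup>2" by simp
    qed (use C in simp)
    finally show ?thesis by (simp add: j_def q_def[symmetric] power_mult_distrib algebra_simps)
  qed
  have i2: "(op ^^ k) (\<lambda>y. (?p y)\<^sup>2) s0 \<le> real k * (?c1 * h\<^sup>2)" for k
  proof (induction k)
    case (Suc k)
    have "(op ^^ Suc k) (\<lambda>y. (?p y)\<^sup>2) s0 = (op ^^ k) (op (\<lambda>y. (?p y)\<^sup>2)) s0" by (simp add: funpow_swap1)
    also have "\<dots> \<le> (op ^^ k) (\<lambda>y. 1 * (?p y)\<^sup>2 + 0 * (?p y)\<^sup>2 + ?c1 * h\<^sup>2) s0" using s2 by (intro iter_mono[OF s0]) auto
    also have "\<dots> = (op ^^ k) (\<lambda>y. (?p y)\<^sup>2) s0 + ?c1 * h\<^sup>2" unfolding iter_affine[OF s0] by simp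
    finally show ?case using Suc by (simp add: algebra_simps)
  qed simp
  show ?thesis
  proof (induction k)
    case (Suc k)
    have c12: "0 \<le> ?c1 * ?c2" using B C by simp
    have "(op ^^ Suc k) (\<lambda>y. (?p y) ^ 4) s0 = (op ^^ k) (op (\<lambda>y. (?p y) ^ 4)) s0" by (simp add: funpow_swap1)
    also have "\<dots> \<le> (op ^^ k) (\<lambda>y. 1 * (?p y) ^ 4 + (?c2 * h\<^sup>2) * (?p y)\<^sup>2 + 3 * C ^ 4 * h ^ 4) s0" using s4 by (intro iter_mono[OF s0]) auto
    also have "\<dots> = (op ^^ k) (\<lambda>y. (?p y) ^ 4) s0 + (?c2 * h\<^sup>2) * (op ^^ k) (\<lambda>y. (?p y)\<^sup>2) s0 + 3 * C ^ 4 * h ^ 4" unfolding iter_affine[OF s0] by simp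
    also have "\<dots> \<le> (?c1 * ?c2 * (real k)\<^sup>2 + 3 * C ^ 4 * real k) * h ^ 4 + (?c2 * h\<^sup>2) * (real k * (?c1 * h\<^sup>2)) + 3 * C ^ 4 * h ^ 4"
      using Suc.IH i2[of k] B C by (intro add_mono mult_left_mono order_refl) auto
    also have "\<dots> = (?c1 * ?c2 * ((real k)\<^sup>2 + real k) + 3 * C ^ 4 * real (Suc k)) * h ^ 4"
    proof -
      have h4: "h ^ 4 = h\<^sup>2 * h\<^sup>2" by (simp flip: power_add)
      have "(a * b * k2 + c * kk) * hh + (b * x) * (kk * (a * x)) + c * hh = (a * b * (k2 + kk) + c * (kk + 1)) * hh" if "hh = x * x" for a b k2 c kk hh x :: real
        unfolding that by (simp add: algebra_simps)
      moreover have "real (Suc k) = real k + 1" by simp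
      ultimately show ?thesis using h4 by metis
    qed
    also have "\<dots> \<le> (?c1 * ?c2 * (real (Suc k))\<^sup>2 + 3 * C ^ 4 * real (Suc k)) * h ^ 4"
      using c12 by (intro mult_right_mono add_mono mult_left_mono order_refl) (auto simp: power2_eq_square algebra_simps)
    finally show ?case .
  qed simp
qed

end

locale started_chain = finite_chain K S for K :: "'s \<Rightarrow> 's pmf" and S +
  fixes I :: "'s pmf" assumes set_I: "set_pmf I \<subseteq> S"
begin

text \<open>The joint law of the trajectory up to time k, as a law on functions of all times:
  positions beyond k still hold the initial state. Hence \<open>dep\<close> records which
  functionals are already determined at time k.\<close>

primrec chain :: "nat \<Rightarrow> (nat \<Rightarrow> 's) pmf" where
  "chain 0 = map_pmf (\<lambda>x _. x) I"
| "chain (Suc k) = bind_pmf (chain k) (\<lambda>p. map_pmf (\<lambda>y. p(Suc k := y)) (K (p k)))"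

lemma set_chain: "p \<in> set_pmf (chain k) \<Longrightarrow> p i \<in> S"
proof (induction k arbitrary: p i)
  case 0
  then show ?case using set_I by auto
next
  case (Suc k)
  then obtain q y where q: "q \<in> set_pmf (chain k)" "y \<in> set_pmf (K (q k))" "p = q(Suc k := y)" by auto
  then show ?case using Suc.IH[OF q(1)] closed_S by auto
qed

lemma finite_chain_set: "finite (set_pmf (chain k))"
proof (induction k)
  case 0
  then show ?case using finite_subset[OF set_I finite_S] by simp
next
  case (Suc k)
  then show ?case using finite_set_K set_chain by simp
qed

abbreviation E :: "nat \<Rightarrow> ((nat \<Rightarrow> 's) \<Rightarrow> real) \<Rightarrow> real" where
  "E k \<equiv> measure_pmf.expectation (chain k)"

lemma E_cong: "(\<And>p. p \<in> set_pmf (chain k) \<Longrightarrow> F p = G p) \<Longrightarrow> E k F = E k G"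
  by (intro integral_cong_AE) (auto simp: AE_measure_pmf_iff)

lemma integrable_chain: "integrable (measure_pmf (chain k)) (F :: _ \<Rightarrow> real)"
  by (rule integrable_measure_pmf_finite[OF finite_chain_set])

lemma E_mono: "(\<And>p. p \<in> set_pmf (chain k) \<Longrightarrow> F p \<le> G p) \<Longrightarrow> E k F \<le> E k G"
  by (intro integral_mono_AE integrable_chain) (auto simp: AE_measure_pmf_iff)

lemma E_Suc: "E (Suc k) F = E k (\<lambda>p. measure_pmf.expectation (K (p k)) (\<lambda>y. F (p(Suc k := y))))"
proof -
  have "E (Suc k) F = (\<Sum>p\<in>set_pmf (chain k). pmf (chain k) p *\<^sub>R measure_pmf.expectation (map_pmf (\<lambda>y. p(Suc k := y)) (K (p k))) F)"
    unfolding chain.simps using finite_set_K set_chain by (intro pmf_expectation_bind finite_chain_set) auto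
  then show ?thesis by (subst integral_measure_pmf[OF finite_chain_set]) auto
qed

definition dep :: "nat \<Rightarrow> ((nat \<Rightarrow> 's) \<Rightarrow> 'b) \<Rightarrow> bool" where
  "dep k F \<longleftrightarrow> (\<forall>p q. (\<forall>i\<le>k. p i = q i) \<longrightarrow> F p = F q)"

lemma dep_upd: "dep k F \<Longrightarrow> k \<le> l \<Longrightarrow> F (p(Suc l := y)) = F p"
  unfolding dep_def by (metis fun_upd_other not_less_eq_eq)

lemma E_dep: "dep k F \<Longrightarrow> k \<le> l \<Longrightarrow> E l F = E k F"
proof (induction l)
  case (Suc l)
  show ?case
  proof (cases "k = Suc l")
    case False
    then have "k \<le> l" using Suc.prems by simp
    have "E (Suc l) F = E l F"
      unfolding E_Suc dep_upd[OF Suc.prems(1) \<open>k \<le> l\<close>] by simp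
    then show ?thesis using Suc \<open>k \<le> l\<close> by simp
  qed simp
qed simp

lemma markov_aux:
  "(\<And>y. dep k (\<lambda>p. H p y)) \<Longrightarrow> E (k + d) (\<lambda>p. H p (p (k + d))) = E k (\<lambda>p. (op ^^ d) (H p) (p k))"
proof (induction d arbitrary: H)
  case (Suc d)
  have *: "H (p(Suc (k + d) := y)) = H p" for p y
    using Suc.prems by (intro ext) (auto intro!: dep_upd[of k "\<lambda>p. H p _"])
  have "E (k + Suc d) (\<lambda>p. H p (p (k + Suc d))) = E (k + d) (\<lambda>p. op (H p) (p (k + d)))"
    by (simp add: E_Suc * op_def del: chain.simps)
  also have "\<dots> = E k (\<lambda>p. (op ^^ d) (op (H p)) (p k))"
  proof (rule Suc.IH)
    have "H p = H q" if "\<forall>i\<le>k. p i = q i" for p q using Suc.prems that unfolding dep_def by blast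
    then show "dep k (\<lambda>p. op (H p) y)" for y unfolding dep_def by metis
  qed
  finally show ?case by (simp add: funpow_swap1)
qed simp

text \<open>Letting \<open>H\<close> carry the past as a parameter covers both products of earlier
  observations and displacements from the state at time k.\<close>

lemma markov:
  assumes dep: "\<And>y. dep k (\<lambda>p. H p y)" and kl: "k \<le> l" "l \<le> L"
  shows "E L (\<lambda>p. H p (p l)) = E L (\<lambda>p. (op ^^ (l - k)) (H p) (p k))"
proof -
  have HH: "H p = H q" if "\<forall>i\<le>k. p i = q i" for p q using dep that unfolding dep_def by blast
  have "E L (\<lambda>p. H p (p l)) = E l (\<lambda>p. H p (p l))"
  proof (rule E_dep[OF _ kl(2)])
    show "dep l (\<lambda>p. H p (p l))" unfolding dep_def using HH kl by (metis le_trans order_refl)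
  qed
  also have "\<dots> = E k (\<lambda>p. (op ^^ (l - k)) (H p) (p k))" using markov_aux[OF dep, of "l - k"] kl by simp
  also have "\<dots> = E L (\<lambda>p. (op ^^ (l - k)) (H p) (p k))"
  proof (rule E_dep[symmetric])
    show "dep k (\<lambda>p. (op ^^ (l - k)) (H p) (p k))" unfolding dep_def using HH by (metis order_refl)
  qed (use kl in simp)
  finally show ?thesis .
qed

end

text \<open>A Schoenberg curve: a continuous map of the line onto the Hilbert cube.  It turns Helly's selection
  theorem on the line into weak compactness of laws on the cube.\<close>

definition tent :: "real \<Rightarrow> real" where
  "tent x = max 0 (min 1 (1/2 - cos (pi * x)))"

text \<open>Coordinate j reads the ternary digits of t at the positions
  \<open>prod_encode (j, k)\<close> as binary digits. The pairing distributes the digits of one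
  number over countably many coordinates, and \<open>tent\<close> reads a digit
  continuously.\<close>

definition schoenberg :: "nat \<Rightarrow> real \<Rightarrow> real" where
  "schoenberg j t = (\<Sum>k. (1/2) ^ Suc k * tent (3 ^ prod_encode (j, k) * t))"

lemma tent_bounds: "0 \<le> tent x" "tent x \<le> 1"
  by (auto simp: tent_def)

lemma tent_low: "0 \<le> y \<Longrightarrow> y \<le> 1/3 \<Longrightarrow> tent (2 * real N + y) = 0"
proof -
  assume y: "0 \<le> y" "y \<le> 1/3"
  have "cos (pi * (2 * real N + y)) = cos (2 * real N * pi + pi * y)" by (simp add: algebra_simps)
  also have "\<dots> = cos (pi * y)" by (simp add: cos_add)
  also have "\<dots> \<ge> cos (pi / 3)" using y by (intro cos_monotone_0_pi_le) auto
  finally show ?thesis by (simp add: tent_def cos_60)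
qed

lemma tent_high: "2/3 \<le> y \<Longrightarrow> y \<le> 1 \<Longrightarrow> tent (2 * real N + y) = 1"
proof -
  assume y: "2/3 \<le> y" "y \<le> 1"
  have "cos (pi * (2 * real N + y)) = cos (2 * real N * pi + pi * y)" by (simp add: algebra_simps)
  also have "\<dots> = cos (pi * y)" by (simp add: cos_add)
  also have "\<dots> \<le> cos (2 * pi / 3)" using y by (intro cos_monotone_0_pi_le) auto
  finally show ?thesis by (simp add: tent_def cos_120)
qed

lemma ternary_tail:
  fixes b :: "nat \<Rightarrow> nat"
  assumes b: "\<And>i. b i \<in> {0, 1}"
  shows "summable (\<lambda>m. 2 * real (b (m + k)) / 3 ^ Suc m)"
    "0 \<le> (\<Sum>m. 2 * real (b (m + k)) / 3 ^ Suc m)" "(\<Sum>m. 2 * real (b (m + k)) / 3 ^ Suc m) \<le> 1"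
proof -
  have g: "(\<lambda>m. 2 * (1/3 :: real) ^ Suc m) sums 1"
    using sums_mult[OF geometric_sums[of "1/3 :: real"], of "2/3"] by simp
  have bd: "0 \<le> real (b m)" "real (b m) \<le> 1" for m using b[of m] by auto
  show sm: "summable (\<lambda>m. 2 * real (b (m + k)) / 3 ^ Suc m)"
  proof (rule summable_comparison_test'[of "\<lambda>m. 2 * (1/3 :: real) ^ Suc m" 0])
    show "norm (2 * real (b (m + k)) / 3 ^ Suc m) \<le> 2 * (1/3) ^ Suc m" for m
      using bd[of "m + k"] by (simp add: power_divide divide_right_mono)
  qed (use g in \<open>simp add: sums_iff\<close>)
  show "0 \<le> (\<Sum>m. 2 * real (b (m + k)) / 3 ^ Suc m)" by (rule suminf_nonneg[OF sm]) simp
    have "(\<Sum>m. 2 * real (b (m + k)) / 3 ^ Suc m) \<le> (\<Sum>m. 2 * (1/3 :: real) ^ Suc m)"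
    proof (rule suminf_le[OF _ sm])
      show "2 * real (b (m + k)) / 3 ^ Suc m \<le> 2 * (1/3) ^ Suc m" for m
        using bd[of "m + k"] by (simp add: power_divide divide_right_mono)
    qed (use g in \<open>simp add: sums_iff\<close>)
    then show "(\<Sum>m. 2 * real (b (m + k)) / 3 ^ Suc m) \<le> 1" using g by (simp add: sums_iff)
  qed

text \<open>All digits are 0 or 2, so 3^i t is an even integer plus y, where y is a third of the
  next digit plus a tail in [0, 1]. Thus y lies in [0, 1/3] or [2/3, 1], where \<open>tent\<close>,
  of period 2, is constant.\<close>

lemma tent_ternary:
  fixes b :: "nat \<Rightarrow> nat"
  assumes b: "\<And>i. b i \<in> {0, 1}"
  shows "tent (3 ^ i * (\<Sum>m. 2 * real (b m) / 3 ^ Suc m)) = real (b i)"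
proof -
  note sm = ternary_tail(1)[of b, OF b] and tail = ternary_tail(2,3)[of b, OF b]
  define y where "y = (2 * real (b i) + (\<Sum>m. 2 * real (b (m + Suc i)) / 3 ^ Suc m)) / 3"
  have step: "(\<Sum>m. 2 * real (b (m + k)) / 3 ^ Suc m) = (2 * real (b k) + (\<Sum>m. 2 * real (b (m + Suc k)) / 3 ^ Suc m)) / 3" for k
  proof -
    have "(\<Sum>m. 2 * real (b (m + k)) / 3 ^ Suc m) = 2 * real (b k) / 3 + (\<Sum>m. 2 * real (b (Suc m + k)) / 3 ^ Suc (Suc m))"
      using suminf_split_head[OF sm[of k]] by simp
    also have "(\<Sum>m. 2 * real (b (Suc m + k)) / 3 ^ Suc (Suc m)) = (\<Sum>m. 2 * real (b (m + Suc k)) / 3 ^ Suc m / 3)"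
      by (intro suminf_cong) simp
    also have "\<dots> = (\<Sum>m. 2 * real (b (m + Suc k)) / 3 ^ Suc m) / 3" by (rule suminf_divide[OF sm])
    finally show ?thesis by (simp add: add_divide_distrib)
  qed
  have N: "\<exists>N::nat. 3 ^ k * (\<Sum>m. 2 * real (b m) / 3 ^ Suc m) = 2 * real N + (\<Sum>m. 2 * real (b (m + k)) / 3 ^ Suc m)" for k
  proof (induction k)
    case 0
    show ?case by (intro exI[of _ 0]) simp
  next
    case (Suc k)
    then obtain N where N: "3 ^ k * (\<Sum>m. 2 * real (b m) / 3 ^ Suc m) = 2 * real N + (\<Sum>m. 2 * real (b (m + k)) / 3 ^ Suc m)" by blast
    have "3 ^ Suc k * (\<Sum>m. 2 * real (b m) / 3 ^ Suc m) = 3 * (2 * real N + (\<Sum>m. 2 * real (b (m + k)) / 3 ^ Suc m))"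
      unfolding N[symmetric] by simp
    also have "\<dots> = 2 * real (3 * N + b k) + (\<Sum>m. 2 * real (b (m + Suc k)) / 3 ^ Suc m)" unfolding step[of k] by simp
    finally show ?case by blast
  qed
  obtain N where N: "3 ^ i * (\<Sum>m. 2 * real (b m) / 3 ^ Suc m) = 2 * real N + y"
    using N[of i] unfolding step[of i] y_def[symmetric] by blast
  show ?thesis
  proof (cases "b i = 0")
    case True
    then have "0 \<le> y" "y \<le> 1/3" using tail[of "Suc i"] by (auto simp: y_def)
    then show ?thesis unfolding N using tent_low True by simp
  next
    case False
    then have bi: "b i = 1" using b[of i] by auto
    then have "2/3 \<le> y" "y \<le> 1" using tail[of "Suc i"] by (auto simp: y_def)
    then show ?thesis unfolding N using tent_high bi by simp
  qed
qed

lemma binary_expansion: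
  assumes x: "0 \<le> x" "x < 1"
  obtains b :: "nat \<Rightarrow> nat" where "\<And>i. b i \<in> {0, 1}" "(\<lambda>k. (1/2) ^ Suc k * real (b k)) sums x"
proof -
  define f where "f k = \<lfloor>2 ^ k * x\<rfloor>" for k :: nat
  have f: "of_int (f k) \<le> 2 ^ k * x" "2 ^ k * x < of_int (f k) + 1" for k unfolding f_def by linarith+
  have d: "f (Suc k) - 2 * f k = 0 \<or> f (Suc k) - 2 * f k = 1" for k
  proof -
    have "of_int (f (Suc k)) < 2 * of_int (f k) + (2::real)" "2 * of_int (f k) - 1 < (of_int (f (Suc k)) :: real)"
      using f[of k] f[of "Suc k"] by auto
    then have "f (Suc k) < 2 * f k + 2" "2 * f k - 1 < f (Suc k)" by linarith+
    then show ?thesis by linarith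
  qed
  define b where "b k = nat (f (Suc k) - 2 * f k)" for k
  have b: "b k \<in> {0, 1}" "real (b k) = of_int (f (Suc k)) - 2 * of_int (f k)" for k
    using d[of k] by (auto simp: b_def)
  have f0: "f 0 = 0" unfolding f_def using x by (simp add: floor_eq_iff)
  have part: "(\<Sum>k<n. (1/2) ^ Suc k * real (b k)) = of_int (f n) / 2 ^ n" for n
  proof (induction n)
    case 0 then show ?case by (simp add: f0)
  next
    case (Suc n) then show ?case by (simp add: b(2) field_simps power_divide)
  qed
  have "(\<lambda>n. of_int (f n) / 2 ^ n) \<longlonglongrightarrow> x"
  proof (rule tendsto_sandwich)
    show "eventually (\<lambda>n. x - 1 / 2 ^ n \<le> of_int (f n) / 2 ^ n) sequentially"
    proof (intro always_eventually allI)
      fix n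
      have "(2 ^ n * x - 1) / 2 ^ n \<le> of_int (f n) / 2 ^ n" using f(2)[of n] by (intro divide_right_mono) auto
      then show "x - 1 / 2 ^ n \<le> of_int (f n) / 2 ^ n" by (simp add: diff_divide_distrib)
    qed
    show "eventually (\<lambda>n. of_int (f n) / 2 ^ n \<le> x) sequentially"
      using f(1) by (intro always_eventually allI) (simp add: field_simps)
    show "(\<lambda>n. x - 1 / 2 ^ n) \<longlonglongrightarrow> x" by real_asymp
  qed simp
  then have "(\<lambda>k. (1/2) ^ Suc k * real (b k)) sums x" unfolding sums_def part .
  then show ?thesis using that b(1) by blast
qed

lemma schoenberg_surj:
  assumes x: "\<And>j. 0 \<le> x j" "\<And>j. x j < 1"
  obtains t where "\<And>j. schoenberg j t = x j" "0 \<le> t" "t \<le> 1"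
proof -
  have "\<exists>b. (\<forall>i. b i \<in> {0, 1}) \<and> (\<lambda>k. (1/2) ^ Suc k * real (b k)) sums x j" for j
    using binary_expansion[OF x] by metis
  then obtain B :: "nat \<Rightarrow> nat \<Rightarrow> nat" where B: "\<And>j i. B j i \<in> {0, 1}" "\<And>j. (\<lambda>k. (1/2) ^ Suc k * real (B j k)) sums x j"
    by metis
  define b where "b i = (case prod_decode i of (j, k) \<Rightarrow> B j k)" for i
  have b: "b i \<in> {0, 1}" for i unfolding b_def using B(1) by (cases "prod_decode i") auto
  have "schoenberg j (\<Sum>m. 2 * real (b m) / 3 ^ Suc m) = x j" for j
    unfolding schoenberg_def tent_ternary[OF b] using B(2)[of j] by (simp add: b_def sums_iff)
  moreover have "0 \<le> (\<Sum>m. 2 * real (b m) / 3 ^ Suc m)" "(\<Sum>m. 2 * real (b m) / 3 ^ Suc m) \<le> 1"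
    using ternary_tail(2,3)[of b 0, OF b] by simp_all
  ultimately show ?thesis using that by blast
qed

lemma continuous_on_schoenberg: "continuous_on UNIV (schoenberg j)"
proof -
  let ?f = "\<lambda>k t. (1/2) ^ Suc k * tent (3 ^ prod_encode (j, k) * t)"
  have "(\<lambda>k. (1/2 :: real) ^ Suc k) sums 1" by (rule power_half_series)
  then have sm: "summable (\<lambda>k. (1/2 :: real) ^ Suc k)" by (simp add: sums_iff)
  have u: "uniform_limit UNIV (\<lambda>n t. \<Sum>k<n. ?f k t) (schoenberg j) sequentially"
    unfolding schoenberg_def
  proof (rule Weierstrass_m_test[OF _ sm])
    show "norm (?f k t) \<le> (1/2) ^ Suc k" for k t
      using tent_bounds[of "3 ^ prod_encode (j, k) * t"] by (simp add: abs_mult mult_left_le)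
  qed
  have "continuous_on UNIV (?f k)" for k
    unfolding tent_def by (intro continuous_intros)
  then show ?thesis by (intro uniform_limit_theorem[OF _ u]) (auto intro!: continuous_on_sum always_eventually)
qed

text \<open>\<open>schoenberg_surj\<close> reaches coordinates strictly below 1, while those of the
  simplex may equal 1; hence they are stored halved. Even positions carry the \<alpha>, odd ones the
  \<beta>.\<close>

definition path_decode :: "real \<Rightarrow> nat \<Rightarrow> thoma_pt" where
  "path_decode u i = ((\<lambda>k. 2 * schoenberg (prod_encode (i, 2 * k)) u), (\<lambda>k. 2 * schoenberg (prod_encode (i, 2 * k + 1)) u))"

lemma continuous_on_path_decode: "continuous_on UNIV (\<lambda>u. path_decode u i)"
  unfolding path_decode_def
  by (intro continuous_on_Pair continuous_on_coordinatewise_then_product continuous_on_mult continuous_on_const continuous_on_schoenberg)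

lemma path_decode_surj:
  assumes "\<And>i. w i \<in> thoma"
  obtains u where "path_decode u = w" "0 \<le> u" "u \<le> 1"
proof -
  define x where "x j = (case prod_decode j of (i, l) \<Rightarrow> (if even l then fst (w i) (l div 2) else snd (w i) (l div 2)) / 2)" for j
  have le1: "0 \<le> fst v k \<and> fst v k \<le> 1 \<and> 0 \<le> snd v k \<and> snd v k \<le> 1" if "v \<in> thoma" for v k
  proof -
    have nn: "0 \<le> fst v i" "0 \<le> snd v i" for i using that by (auto simp: thoma_def)
    have "fst v k + snd v k \<le> (\<Sum>i<Suc k. fst v i + snd v i)" using nn by (intro member_le_sum) auto
    also have "\<dots> \<le> 1" using that by (auto simp: thoma_def simp del: sum.lessThan_Suc)
    finally show ?thesis using nn[of k] by auto
  qed
  have lt2: "fst (w i) k < 2" "snd (w i) k < 2" for i k using le1[OF assms, of i k] by linarith+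
  have x: "0 \<le> x j" "x j < 1" for j
    using le1[OF assms] lt2 unfolding x_def by (auto split: prod.splits)
  obtain u where u: "\<And>j. schoenberg j u = x j" "0 \<le> u" "u \<le> 1" by (rule schoenberg_surj[of x, OF x]) (rule that)
  have "path_decode u i = w i" for i
    unfolding path_decode_def u(1) x_def by simp
  then show ?thesis using that u(2,3) by blast
qed

text \<open>Under a pmf every function is measurable, so codes in [0, 1] may be chosen arbitrarily
  for the trajectories. The laws of the codes are tight, and a continuous functional of the decoded
  sequence is a continuous function of the code.\<close>

lemma weak_limit_of_paths:
  fixes Q :: "nat \<Rightarrow> 'p pmf" and W :: "nat \<Rightarrow> 'p \<Rightarrow> nat \<Rightarrow> thoma_pt"
  assumes W: "\<And>r p i. p \<in> set_pmf (Q r) \<Longrightarrow> W r p i \<in> thoma"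
  obtains M s where "real_distribution M" "strict_mono (s :: nat \<Rightarrow> nat)"
    "\<And>(G :: (nat \<Rightarrow> thoma_pt) \<Rightarrow> real) B. continuous_on UNIV (\<lambda>u. G (path_decode u)) \<Longrightarrow> (\<And>u. \<bar>G (path_decode u)\<bar> \<le> B) \<Longrightarrow>
       (\<lambda>r. measure_pmf.expectation (Q (s r)) (\<lambda>p. G (W (s r) p))) \<longlonglongrightarrow> (\<integral>u. G (path_decode u) \<partial>M)"
proof -
  have "\<forall>r p. \<exists>e. p \<in> set_pmf (Q r) \<longrightarrow> path_decode e = W r p \<and> 0 \<le> e \<and> e \<le> 1"
  proof (intro allI)
    fix r p
    show "\<exists>e. p \<in> set_pmf (Q r) \<longrightarrow> path_decode e = W r p \<and> 0 \<le> e \<and> e \<le> 1"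
    proof (cases "p \<in> set_pmf (Q r)")
      case True
      show ?thesis by (rule path_decode_surj[of "W r p", OF W[OF True]]) blast
    qed simp
  qed
  then obtain e where e: "\<And>r p. p \<in> set_pmf (Q r) \<Longrightarrow> path_decode (e r p) = W r p \<and> 0 \<le> e r p \<and> e r p \<le> 1" by metis
  define mu where "mu r = distr (measure_pmf (Q r)) borel (e r)" for r
  have rd: "real_distribution (mu r)" for r unfolding mu_def by (rule prob_space.real_distribution_distr[OF measure_pmf.prob_space_axioms]) simp
  have tight: "tight mu"
    unfolding tight_def
  proof (intro conjI allI impI rd)
    fix eps :: real assume eps: "eps > 0"
    \<comment> \<open>Tightness is stated with left-open intervals, and the code 0 must be
      covered.\<close>
    have "measure (mu r) {-1<..1} = 1" for r
    proof -
      have "measure (mu r) {-1<..1} = measure (measure_pmf (Q r)) (e r -` {-1<..1})" unfolding mu_def by (subst measure_distr) auto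
      also have "\<dots> = 1" using e[of _ r] by (intro measure_pmf.prob_eq_1[THEN iffD2]) (auto simp: AE_measure_pmf_iff intro: less_le_trans[of "-1" 0])
      finally show ?thesis .
    qed
    then show "\<exists>a b::real. a < b \<and> (\<forall>n. measure (mu n) {a<..b} > 1 - eps)" using eps by (intro exI[of _ "-1"] exI[of _ 1]) auto
  qed
  from tight_imp_convergent_subsubsequence[OF tight, of id]
  obtain s M where s: "strict_mono s" "real_distribution M" "weak_conv_m (mu \<circ> s) M"
    by (auto simp: strict_mono_def)
  show ?thesis
  proof (rule that[OF s(2,1)])
    fix G :: "(nat \<Rightarrow> thoma_pt) \<Rightarrow> real" and B
    assume c: "continuous_on UNIV (\<lambda>u. G (path_decode u))" and B: "\<And>u. \<bar>G (path_decode u)\<bar> \<le> B"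
    have "(\<lambda>r. integral\<^sup>L ((mu \<circ> s) r) (\<lambda>u. G (path_decode u))) \<longlonglongrightarrow> (\<integral>u. G (path_decode u) \<partial>M)"
      using c B rd by (intro weak_conv_imp_integral_bdd_continuous_conv[OF _ s(2,3)]) (auto simp: continuous_on_eq_continuous_at)
    moreover have "integral\<^sup>L ((mu \<circ> s) r) (\<lambda>u. G (path_decode u)) = measure_pmf.expectation (Q (s r)) (\<lambda>p. G (W (s r) p))" for r
    proof -
      have "integral\<^sup>L ((mu \<circ> s) r) (\<lambda>u. G (path_decode u)) = measure_pmf.expectation (Q (s r)) (\<lambda>p. G (path_decode (e (s r) p)))"
        unfolding mu_def comp_def using borel_measurable_continuous_onI[OF c] by (subst integral_distr) auto
      also have "\<dots> = measure_pmf.expectation (Q (s r)) (\<lambda>p. G (W (s r) p))"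
        using e by (intro integral_cong_AE) (auto simp: AE_measure_pmf_iff)
      finally show ?thesis .
    qed
    ultimately show "(\<lambda>r. measure_pmf.expectation (Q (s r)) (\<lambda>p. G (W (s r) p))) \<longlonglongrightarrow> (\<integral>u. G (path_decode u) \<partial>M)" by simp
  qed
qed

section \<open>Estimates for the rescaled chain, and their consequences for the semigroup\<close>

lemma finite_chain_step:
  assumes "zz'_admissible z z'" shows "finite_chain (step_pmf z z' n) (YD n)"
  by standard (use finite_YD set_step_pmf[OF assms] in auto)

lemma Tn_iter_eq:
  assumes adm: "zz'_admissible z z'" and lam: "lam \<in> YD n"
  shows "(finite_chain.op (step_pmf z z' n) ^^ k) g lam = (Tn z z' n ^^ k) g lam"
  using lam
proof (induction k arbitrary: lam)
  case (Suc k)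
  interpret finite_chain "step_pmf z z' n" "YD n" by (rule finite_chain_step[OF adm])
  have "op ((op ^^ k) g) lam = op ((Tn z z' n ^^ k) g) lam"
    using Suc set_step_pmf[OF adm Suc.prems] by (intro antisym op_mono) auto
  also have "\<dots> = Tn z z' n ((Tn z z' n ^^ k) g) lam" by (simp only: op_def expectation_step_pmf[OF adm Suc.prems])
  finally show ?case by simp
qed simp

definition kstep :: "nat \<Rightarrow> real \<Rightarrow> nat" where
  "kstep n t = nat \<lfloor>real n ^ 2 * t\<rfloor>"

lemma kstep_mono: "s \<le> t \<Longrightarrow> kstep n s \<le> kstep n t"
  unfolding kstep_def by (intro nat_mono floor_mono mult_left_mono) auto

text \<open>Floors are additive up to one unit, so the number of steps between two times exceeds the
  step count of the difference by at most one.\<close>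

lemma kstep_diff:
  assumes "0 \<le> s" "0 \<le> t"
  shows "kstep n (s + t) - kstep n s = kstep n t \<or> kstep n (s + t) - kstep n s = Suc (kstep n t)"
    "real (kstep n (s + t) - kstep n s) \<le> real n ^ 2 * t + 1"
proof -
  define x y where "x = real n ^ 2 * s" and "y = real n ^ 2 * t"
  have xy: "0 \<le> x" "0 \<le> y" "real n ^ 2 * (s + t) = x + y" using assms by (auto simp: x_def y_def algebra_simps)
  have f: "\<lfloor>x\<rfloor> + \<lfloor>y\<rfloor> \<le> \<lfloor>x + y\<rfloor>" "\<lfloor>x + y\<rfloor> \<le> \<lfloor>x\<rfloor> + \<lfloor>y\<rfloor> + 1" "0 \<le> \<lfloor>x\<rfloor>" "0 \<le> \<lfloor>y\<rfloor>" using xy by linarith+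
  then have "\<lfloor>x + y\<rfloor> = \<lfloor>x\<rfloor> + \<lfloor>y\<rfloor> \<or> \<lfloor>x + y\<rfloor> = \<lfloor>x\<rfloor> + \<lfloor>y\<rfloor> + 1" by linarith
  then show 1: "kstep n (s + t) - kstep n s = kstep n t \<or> kstep n (s + t) - kstep n s = Suc (kstep n t)"
  proof -
    have "nat \<lfloor>x + y\<rfloor> = nat \<lfloor>x\<rfloor> + nat \<lfloor>y\<rfloor> \<or> nat \<lfloor>x + y\<rfloor> = nat \<lfloor>x\<rfloor> + nat \<lfloor>y\<rfloor> + 1"
      using \<open>\<lfloor>x + y\<rfloor> = \<lfloor>x\<rfloor> + \<lfloor>y\<rfloor> \<or> \<lfloor>x + y\<rfloor> = \<lfloor>x\<rfloor> + \<lfloor>y\<rfloor> + 1\<close> f(3,4) by (simp add: nat_add_distrib) linarith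
    then show ?thesis unfolding kstep_def x_def[symmetric] y_def[symmetric] xy(3) by auto
  qed
  have "real (kstep n t) \<le> y" unfolding kstep_def y_def[symmetric] using f(4) by (simp add: of_nat_nat)
  then show "real (kstep n (s + t) - kstep n s) \<le> real n ^ 2 * t + 1" using 1 by (auto simp: y_def)
qed

lemma bounded_on_thoma:
  assumes "continuous_on thoma f"
  obtains B where "B \<ge> 0" "\<And>x. x \<in> thoma \<Longrightarrow> \<bar>f x\<bar> \<le> (B::real)"
proof -
  have "bounded (f ` thoma)" using assms by (intro compact_imp_bounded compact_continuous_image compact_thoma)
  then obtain B where B: "\<forall>y\<in>f ` thoma. norm y \<le> B" unfolding bounded_iff by blast
  show ?thesis
  proof (rule that[of "max B 0"])
    show "\<bar>f x\<bar> \<le> max B 0" if "x \<in> thoma" for x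
    proof -
      have "norm (f x) \<le> B" using B that by blast
      then show ?thesis by simp
    qed
  qed simp
qed

lemma test_fun_fourth_moment:
  assumes adm: "zz'_admissible z z'"
  obtains M where "M \<ge> 0" "\<And>n lam k. n \<ge> 1 \<Longrightarrow> lam \<in> YD n \<Longrightarrow>
     (Tn z z' n ^^ k) (\<lambda>y. (test_fun j (iota n y) - test_fun j (iota n lam)) ^ 4) lam \<le> M * (((real k)\<^sup>2 + real k) / real n ^ 4)"
proof -
  obtain C0 where C0: "C0 \<ge> 0" and dr: "\<And>n lam. n \<ge> 1 \<Longrightarrow> lam \<in> YD n \<Longrightarrow> \<bar>Tn z z' n (proj_n n (test_fun j)) lam - proj_n n (test_fun j) lam\<bar> \<le> C0 / (real n)\<^sup>2"
    using test_fun_drift[OF adm, of j] by blast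
  obtain B where B: "B \<ge> 0" "\<And>x. x \<in> thoma \<Longrightarrow> \<bar>test_fun j x\<bar> \<le> B" using bounded_on_thoma[OF continuous_on_test_fun] by blast
  \<comment> \<open>One constant for both requirements: \<open>C0\<close> bounds the drift and 9 the
    jumps, by \<open>step_pmf_jump\<close>.\<close>
  define C where "C = C0 + 9"
  have C: "C \<ge> 0" using C0 by (simp add: C_def)
  define M where "M = (4 * B * C + C\<^sup>2) * (8 * B * C + 8 * C\<^sup>2) + 3 * C ^ 4"
  have M0: "0 \<le> (4 * B * C + C\<^sup>2) * (8 * B * C + 8 * C\<^sup>2)" "0 \<le> 3 * C ^ 4" using B C by auto
  show ?thesis
  proof (rule that[of M])
    show "M \<ge> 0" using M0 by (simp add: M_def)
    fix n lam k assume n: "n \<ge> (1::nat)" and lam: "lam \<in> YD n"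
    interpret finite_chain "step_pmf z z' n" "YD n" by (rule finite_chain_step[OF adm])
    let ?f = "\<lambda>y. test_fun j (iota n y)"
    have h: "0 \<le> 1 / real n" by simp
    have drift: "\<bar>op ?f s - ?f s\<bar> \<le> C * (1 / real n)\<^sup>2" if "s \<in> YD n" for s
    proof -
      have "\<bar>op ?f s - ?f s\<bar> \<le> C0 / (real n)\<^sup>2"
        using dr[OF n that] expectation_step_pmf[OF adm that, of ?f] by (simp add: op_def proj_n_def comp_def)
      also have "\<dots> \<le> C / (real n)\<^sup>2" by (intro divide_right_mono) (auto simp: C_def)
      finally show ?thesis by (simp add: power_divide)
    qed
    have jump: "\<bar>?f y - ?f s\<bar> \<le> C * (1 / real n)" if "s \<in> YD n" "y \<in> set_pmf (step_pmf z z' n s)" for s y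
    proof -
      have "\<bar>?f y - ?f s\<bar> \<le> 9 / real n" by (rule step_pmf_jump[OF adm that(1) n that(2)])
      also have "\<dots> \<le> C / real n" using C0 by (intro divide_right_mono) (auto simp: C_def)
      finally show ?thesis by simp
    qed
    have bd: "\<bar>?f s\<bar> \<le> B" if "s \<in> YD n" for s using B(2)[OF iota_thoma[OF that n]] .
    have "(op ^^ k) (\<lambda>y. (?f y - ?f lam) ^ 4) lam
       \<le> ((4 * B * C + C\<^sup>2) * (8 * B * C + 8 * C\<^sup>2) * (real k)\<^sup>2 + 3 * C ^ 4 * real k) * (1 / real n) ^ 4"
      by (rule fourth_moment[OF lam h B(1) C bd drift jump])
    also have "\<dots> \<le> (M * ((real k)\<^sup>2 + real k)) * (1 / real n) ^ 4"
    proof (rule mult_right_mono)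
      have "a * k2 + b * kk \<le> (a + b) * (k2 + kk)" if "0 \<le> a" "0 \<le> b" "0 \<le> k2" "0 \<le> kk" for a b k2 kk :: real
        using that by (simp add: algebra_simps)
      from this[OF M0] show "(4 * B * C + C\<^sup>2) * (8 * B * C + 8 * C\<^sup>2) * (real k)\<^sup>2 + 3 * C ^ 4 * real k \<le> M * ((real k)\<^sup>2 + real k)"
        unfolding M_def by simp
    qed simp
    finally show "(Tn z z' n ^^ k) (\<lambda>y. (?f y - ?f lam) ^ 4) lam \<le> M * (((real k)\<^sup>2 + real k) / real n ^ 4)"
      unfolding Tn_iter_eq[OF adm lam] by (simp add: power_divide)
  qed
qed

text \<open>If finitely many observables nearly agree at x and y, uniform continuity gives e.
  Otherwise one fourth power is at least c^4, and the factor 2B / c^4 outweighs the trivial bound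
  2B.\<close>

lemma test_fun_modulus:
  assumes f: "continuous_on thoma f" and e: "e > 0"
  obtains M J where "M \<ge> 0" "\<And>x y. x \<in> thoma \<Longrightarrow> y \<in> thoma \<Longrightarrow> \<bar>f x - f y\<bar> \<le> e + M * (\<Sum>j<J. (test_fun j x - test_fun j y) ^ 4 :: real)"
proof -
  have "uniformly_continuous_on thoma f" using compact_uniformly_continuous[OF f compact_thoma] .
  then obtain d where d: "d > 0" "\<And>x y. x \<in> thoma \<Longrightarrow> y \<in> thoma \<Longrightarrow> dist x y < d \<Longrightarrow> \<bar>f x - f y\<bar> < e"
    using e unfolding uniformly_continuous_on_def dist_real_def by metis
  obtain J c where c: "c > 0" "\<And>x y. x \<in> thoma \<Longrightarrow> y \<in> thoma \<Longrightarrow> (\<And>j. j < J \<Longrightarrow> \<bar>test_fun j x - test_fun j y\<bar> < c) \<Longrightarrow> dist x y < d"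
    by (rule test_fun_dist[OF d(1)]) (rule that, assumption, blast)
  obtain B where B: "B \<ge> 0" "\<And>x. x \<in> thoma \<Longrightarrow> \<bar>f x\<bar> \<le> B" using bounded_on_thoma[OF f] by blast
  show ?thesis
  proof (rule that[of "2 * B / c ^ 4" J])
    show "2 * B / c ^ 4 \<ge> 0" using B c by simp
    fix x y assume xy: "x \<in> thoma" "y \<in> thoma"
    let ?S = "\<Sum>j<J. (test_fun j x - test_fun j y) ^ 4"
    have S0: "0 \<le> ?S" by (intro sum_nonneg) simp
    show "\<bar>f x - f y\<bar> \<le> e + 2 * B / c ^ 4 * ?S"
    proof (cases "\<forall>j<J. \<bar>test_fun j x - test_fun j y\<bar> < c")
      case True
      then have "\<bar>f x - f y\<bar> < e" using c(2)[OF xy] d(2)[OF xy] by blast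
      moreover have "0 \<le> 2 * B / c ^ 4 * ?S" using B c S0 by (intro mult_nonneg_nonneg) auto
      ultimately show ?thesis by linarith
    next
      case False
      then obtain j where j: "j < J" "c \<le> \<bar>test_fun j x - test_fun j y\<bar>" by force
      have "c ^ 4 \<le> \<bar>test_fun j x - test_fun j y\<bar> ^ 4" using j c by (intro power_mono) auto
      also have "\<dots> = (test_fun j x - test_fun j y) ^ 4" by simp
      also have "\<dots> \<le> ?S" using j by (intro member_le_sum) auto
      finally have "1 \<le> ?S / c ^ 4" using c by (simp add: le_divide_eq)
      then have "2 * B * 1 \<le> 2 * B * (?S / c ^ 4)" using B by (intro mult_left_mono) auto
      moreover have "\<bar>f x - f y\<bar> \<le> 2 * B" using B(2)[OF xy(1)] B(2)[OF xy(2)] by linarith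
      ultimately show ?thesis using e by (simp add: mult_ac)
    qed
  qed
qed

text \<open>The fourth moments transferred from the observables to an arbitrary continuous f,
  uniformly in n and in the starting diagram. It bounds the effect of a surplus step and gives the
  continuity of the semigroup in time.\<close>

lemma Tn_iter_modulus:
  assumes adm: "zz'_admissible z z'" and f: "continuous_on thoma f" and e: "e > 0"
  obtains M where "M \<ge> 0" "\<And>n lam k. n \<ge> 1 \<Longrightarrow> lam \<in> YD n \<Longrightarrow>
     \<bar>(Tn z z' n ^^ k) (proj_n n f) lam - proj_n n f lam\<bar> \<le> e + M * (((real k)\<^sup>2 + real k) / real n ^ 4)"
proof -
  obtain A J where A: "A \<ge> 0" and mod: "\<And>x y. x \<in> thoma \<Longrightarrow> y \<in> thoma \<Longrightarrow> \<bar>f x - f y\<bar> \<le> e + A * (\<Sum>j<J. (test_fun j x - test_fun j y) ^ 4)"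
    using test_fun_modulus[OF f e] by blast
  have "\<forall>j. \<exists>M. M \<ge> 0 \<and> (\<forall>n lam k. n \<ge> 1 \<longrightarrow> lam \<in> YD n \<longrightarrow>
     (Tn z z' n ^^ k) (\<lambda>y. (test_fun j (iota n y) - test_fun j (iota n lam)) ^ 4) lam \<le> M * (((real k)\<^sup>2 + real k) / real n ^ 4))"
    using test_fun_fourth_moment[OF adm] by metis
  then obtain M where M: "\<And>j. M j \<ge> 0" "\<And>j n lam k. n \<ge> 1 \<Longrightarrow> lam \<in> YD n \<Longrightarrow>
     (Tn z z' n ^^ k) (\<lambda>y. (test_fun j (iota n y) - test_fun j (iota n lam)) ^ 4) lam \<le> M j * (((real k)\<^sup>2 + real k) / real n ^ 4)" by metis
  show ?thesis
  proof (rule that[of "A * (\<Sum>j<J. M j)"])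
    show "A * (\<Sum>j<J. M j) \<ge> 0" using A M by (intro mult_nonneg_nonneg sum_nonneg) auto
    fix n lam k assume n: "n \<ge> (1::nat)" and lam: "lam \<in> YD n"
    interpret finite_chain "step_pmf z z' n" "YD n" by (rule finite_chain_step[OF adm])
    let ?g = "\<lambda>j y. (test_fun j (iota n y) - test_fun j (iota n lam)) ^ 4"
    let ?q = "((real k)\<^sup>2 + real k) / real n ^ 4"
    have sum: "(op ^^ k) (\<lambda>y. \<Sum>j<J. ?g j y) lam \<le> (\<Sum>j<J. M j) * ?q" for J
    proof (induction J)
      case 0
      have "(op ^^ k) (\<lambda>y. 0 * (0::real) + 0 * 0 + 0) lam = 0" using iter_affine[OF lam, of k 0 "\<lambda>_. 0" 0 "\<lambda>_. 0" 0] by simp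
      then show ?case by simp
    next
      case (Suc J)
      have "(op ^^ k) (\<lambda>y. \<Sum>j<Suc J. ?g j y) lam = (op ^^ k) (\<lambda>y. 1 * (\<Sum>j<J. ?g j y) + 1 * ?g J y + 0) lam" by simp
      also have "\<dots> = (op ^^ k) (\<lambda>y. \<Sum>j<J. ?g j y) lam + (op ^^ k) (?g J) lam" unfolding iter_affine[OF lam] by simp
      also have "\<dots> \<le> (\<Sum>j<J. M j) * ?q + M J * ?q" using Suc M(2)[OF n lam, of k J] unfolding Tn_iter_eq[OF adm lam] by linarith
      finally show ?case by (simp only: sum.lessThan_Suc distrib_right)
    qed
    let ?f = "proj_n n f"
    have b: "\<bar>?f y - ?f lam\<bar> \<le> e + A * (\<Sum>j<J. ?g j y)" if "y \<in> YD n" for y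
      using mod[OF iota_thoma[OF that n] iota_thoma[OF lam n]] by (simp add: proj_n_def)
    have up: "(op ^^ k) ?f lam \<le> (op ^^ k) (\<lambda>y. A * (\<Sum>j<J. ?g j y) + 0 * 0 + (e + ?f lam)) lam"
      using b by (intro iter_mono[OF lam]) (auto simp: abs_le_iff algebra_simps)
    have lo: "(op ^^ k) (\<lambda>y. (- A) * (\<Sum>j<J. ?g j y) + 0 * 0 + (?f lam - e)) lam \<le> (op ^^ k) ?f lam"
      using b by (intro iter_mono[OF lam]) (auto simp: abs_le_iff algebra_simps)
    have "A * (op ^^ k) (\<lambda>y. \<Sum>j<J. ?g j y) lam \<le> A * ((\<Sum>j<J. M j) * ?q)" using sum A by (intro mult_left_mono) auto
    then have "\<bar>(op ^^ k) ?f lam - ?f lam\<bar> \<le> e + A * ((\<Sum>j<J. M j) * ?q)"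
      using up lo unfolding iter_affine[OF lam, of k _ _ 0 "\<lambda>_. 0"] by (simp add: abs_le_iff)
    then show "\<bar>(Tn z z' n ^^ k) ?f lam - ?f lam\<bar> \<le> e + A * (\<Sum>j<J. M j) * ?q"
      unfolding Tn_iter_eq[OF adm lam] by (simp add: mult.assoc)
  qed
qed

lemma semigroup_continuous_on: "approximates_semigroup z z' T \<Longrightarrow> 0 \<le> t \<Longrightarrow> continuous_on thoma f \<Longrightarrow> continuous_on thoma (T t f)"
  unfolding approximates_semigroup_def by blast

lemma semigroup_uniform:
  assumes ap: "approximates_semigroup z z' T" and t: "0 \<le> t" and f: "continuous_on thoma f" and e: "e > 0"
  shows "eventually (\<lambda>n. \<forall>lam\<in>YD n. \<bar>(Tn z z' n ^^ kstep n t) (proj_n n f) lam - proj_n n (T t f) lam\<bar> < e) sequentially"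
proof -
  let ?h = "\<lambda>n lam. \<bar>(Tn z z' n ^^ kstep n t) (proj_n n f) lam - proj_n n (T t f) lam\<bar>"
  have "(\<lambda>n. Max (?h n ` YD n)) \<longlonglongrightarrow> 0"
    using ap t f unfolding approximates_semigroup_def kstep_def by blast
  then have "eventually (\<lambda>n. Max (?h n ` YD n) < e) sequentially" using e by (rule order_tendstoD)
  then show ?thesis
  proof eventually_elim
    case (elim n)
    show ?case
    proof
      fix lam assume "lam \<in> YD n"
      then have "?h n lam \<le> Max (?h n ` YD n)" using finite_YD by (intro Max_ge) auto
      then show "?h n lam < e" using elim by linarith
    qed
  qed
qed

lemma kstep_limit: "(\<lambda>n. (((real n)\<^sup>2 * c + 1)\<^sup>2 + ((real n)\<^sup>2 * c + 1)) / real n ^ 4) \<longlonglongrightarrow> c\<^sup>2"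
proof -
  have "(\<lambda>n. c\<^sup>2 + (3 * c) / (real n)\<^sup>2 + 2 / real n ^ 4) \<longlonglongrightarrow> c\<^sup>2 + 0 + 0"
    by (intro tendsto_add tendsto_const) real_asymp+
  moreover have "eventually (\<lambda>n. c\<^sup>2 + (3 * c) / (real n)\<^sup>2 + 2 / real n ^ 4 = (((real n)\<^sup>2 * c + 1)\<^sup>2 + ((real n)\<^sup>2 * c + 1)) / real n ^ 4) sequentially"
    using eventually_gt_at_top[of 0]
    by eventually_elim (simp add: field_simps power2_eq_square power4_eq_xxxx)
  ultimately show ?thesis using Lim_transform_eventually by fastforce
qed

lemma Tn_iter_diff:
  assumes adm: "zz'_admissible z z'" and lam: "lam \<in> YD n" and kl: "k \<le> l"
    and b: "\<And>mu. mu \<in> YD n \<Longrightarrow> \<bar>(Tn z z' n ^^ (l - k)) g mu - g mu\<bar> \<le> c"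
  shows "\<bar>(Tn z z' n ^^ l) g lam - (Tn z z' n ^^ k) g lam\<bar> \<le> c"
proof -
  interpret finite_chain "step_pmf z z' n" "YD n" by (rule finite_chain_step[OF adm])
  have "l = k + (l - k)" using kl by simp
  then have "(op ^^ l) g lam = (op ^^ k) ((op ^^ (l - k)) g) lam" by (metis funpow_add comp_apply)
  moreover have "\<bar>(op ^^ k) ((op ^^ (l - k)) g) lam - (op ^^ k) g lam\<bar> \<le> c"
    using b Tn_iter_eq[OF adm] by (intro iter_bound[OF lam]) auto
  ultimately show ?thesis using Tn_iter_eq[OF adm lam] by simp
qed

text \<open>\<open>approximates_semigroup\<close> treats each time separately, so dependence on time
  is recovered from the chain: the bound of \<open>Tn_iter_modulus\<close> passes to the limit along
  diagrams converging to x.\<close>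

lemma semigroup_time_modulus:
  assumes adm: "zz'_admissible z z'" and ap: "approximates_semigroup z z' T" and f: "continuous_on thoma f" and e: "e > 0"
  obtains M where "M \<ge> 0" "\<And>s t x. 0 \<le> s \<Longrightarrow> s \<le> t \<Longrightarrow> x \<in> thoma \<Longrightarrow> \<bar>T t f x - T s f x\<bar> \<le> e + M * (t - s)\<^sup>2"
proof -
  obtain M where M: "M \<ge> 0" and mod: "\<And>n lam k. n \<ge> 1 \<Longrightarrow> lam \<in> YD n \<Longrightarrow>
     \<bar>(Tn z z' n ^^ k) (proj_n n f) lam - proj_n n f lam\<bar> \<le> e + M * (((real k)\<^sup>2 + real k) / real n ^ 4)"
    using Tn_iter_modulus[OF adm f e] by blast
  show ?thesis
  proof (rule that[OF M])
    fix s t x assume s: "0 \<le> s" "s \<le> (t::real)" and x: "x \<in> thoma"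
    obtain L where L: "\<And>n. n \<ge> 1 \<Longrightarrow> L n \<in> YD n" "(\<lambda>n. iota n (L n)) \<longlonglongrightarrow> x" using thoma_approximation[OF x] by blast
    have conv: "(\<lambda>n. (Tn z z' n ^^ kstep n r) (proj_n n f) (L n)) \<longlonglongrightarrow> T r f x" if r: "0 \<le> r" for r
    proof -
      have "(\<lambda>n. proj_n n (T r f) (L n)) \<longlonglongrightarrow> T r f x"
        unfolding proj_n_def comp_def
        using continuous_on_tendsto_compose[OF semigroup_continuous_on[OF ap r f] L(2) x] L(1) iota_thoma
        by (metis (mono_tags, lifting) eventually_sequentially)
      moreover have "(\<lambda>n. (Tn z z' n ^^ kstep n r) (proj_n n f) (L n) - proj_n n (T r f) (L n)) \<longlonglongrightarrow> 0"
      proof (rule tendstoI)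
        fix d :: real assume "d > 0"
        from semigroup_uniform[OF ap r f this] eventually_ge_at_top[of 1]
        show "eventually (\<lambda>n. dist ((Tn z z' n ^^ kstep n r) (proj_n n f) (L n) - proj_n n (T r f) (L n)) 0 < d) sequentially"
          by eventually_elim (use L(1) in \<open>simp add: dist_real_def\<close>)
      qed
      ultimately show ?thesis using tendsto_add by fastforce
    qed
    have t: "0 \<le> t" using s by simp
    have lim: "(\<lambda>n. \<bar>(Tn z z' n ^^ kstep n t) (proj_n n f) (L n) - (Tn z z' n ^^ kstep n s) (proj_n n f) (L n)\<bar>) \<longlonglongrightarrow> \<bar>T t f x - T s f x\<bar>"
      by (intro tendsto_intros conv s t)
    have lim2: "(\<lambda>n. e + M * ((((real n)\<^sup>2 * (t - s) + 1)\<^sup>2 + ((real n)\<^sup>2 * (t - s) + 1)) / real n ^ 4)) \<longlonglongrightarrow> e + M * (t - s)\<^sup>2"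
      by (intro tendsto_intros kstep_limit)
    show "\<bar>T t f x - T s f x\<bar> \<le> e + M * (t - s)\<^sup>2"
    proof (rule LIMSEQ_le[OF lim lim2], intro exI[of _ 1] allI impI)
      fix n :: nat assume n: "n \<ge> 1"
      let ?k = "kstep n t - kstep n s"
      have kb: "real ?k \<le> (real n)\<^sup>2 * (t - s) + 1" using kstep_diff(2)[of s "t - s" n] s by simp
      have "\<bar>(Tn z z' n ^^ ?k) (proj_n n f) mu - proj_n n f mu\<bar> \<le> e + M * ((((real n)\<^sup>2 * (t - s) + 1)\<^sup>2 + ((real n)\<^sup>2 * (t - s) + 1)) / real n ^ 4)" if "mu \<in> YD n" for mu
      proof -
        have "M * (((real ?k)\<^sup>2 + real ?k) / real n ^ 4) \<le> M * ((((real n)\<^sup>2 * (t - s) + 1)\<^sup>2 + ((real n)\<^sup>2 * (t - s) + 1)) / real n ^ 4)"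
          using M kb by (intro mult_left_mono divide_right_mono add_mono power_mono) auto
        then show ?thesis using mod[OF n that, of ?k] by linarith
      qed
      then show "\<bar>(Tn z z' n ^^ kstep n t) (proj_n n f) (L n) - (Tn z z' n ^^ kstep n s) (proj_n n f) (L n)\<bar>
         \<le> e + M * ((((real n)\<^sup>2 * (t - s) + 1)\<^sup>2 + ((real n)\<^sup>2 * (t - s) + 1)) / real n ^ 4)"
        by (intro Tn_iter_diff[OF adm L(1)[OF n] kstep_mono[OF s(2)]])
    qed
  qed
qed

text \<open>Decoded points may lie outside the simplex, and weak convergence tests against functions
  continuous on the whole line of codes; so functions on the simplex are extended by Tietze's
  theorem.\<close>

lemma continuous_extension_thoma:
  assumes "continuous_on thoma (f :: thoma_pt \<Rightarrow> real)"
  obtains g B where "continuous_on UNIV g" "\<And>x. x \<in> thoma \<Longrightarrow> g x = f x" "\<And>x. \<bar>g x\<bar> \<le> B"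
proof -
  obtain B where B: "B \<ge> 0" "\<And>x. x \<in> thoma \<Longrightarrow> \<bar>f x\<bar> \<le> B" using bounded_on_thoma[OF assms] by blast
  have cl: "closedin (top_of_set UNIV) thoma" using closed_thoma by simp
  obtain g where "continuous_on UNIV g" "\<And>x. x \<in> thoma \<Longrightarrow> g x = f x" "\<And>x. x \<in> UNIV \<Longrightarrow> norm (g x) \<le> B"
    by (rule Tietze[OF assms cl B(1)]) (use B(2) in auto)
  then show ?thesis using that[of g B] by simp
qed

section \<open>Initial laws and the limit process at dyadic times\<close>

lemma space_thoma_space: "space thoma_space = thoma"
  by (simp add: thoma_space_def space_restrict_space)

lemma borel_measurable_thoma_space: "continuous_on thoma f \<Longrightarrow> f \<in> borel_measurable thoma_space"
  unfolding thoma_space_def by (rule borel_measurable_continuous_on_restrict)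

lemma measurable_thoma_spaceI: "f \<in> borel_measurable M \<Longrightarrow> (\<And>x. x \<in> space M \<Longrightarrow> f x \<in> thoma) \<Longrightarrow> f \<in> measurable M thoma_space"
  unfolding thoma_space_def by (intro measurable_restrict_space2) auto

text \<open>Each point is rounded to a nearest embedded diagram, and \<open>I n\<close> is the law
  of the result under \<open>mu\<close>. Ties go to the least index in a fixed enumeration, which
  makes the rounding measurable. Density of the diagrams and dominated convergence give the
  limit.\<close>

lemma initial_laws:
  assumes mu: "prob_space mu" "sets mu = sets thoma_space"
  obtains I :: "nat \<Rightarrow> nat list pmf" where "\<And>n. set_pmf (I n) \<subseteq> YD n"
    "\<And>f :: thoma_pt \<Rightarrow> real. continuous_on thoma f \<Longrightarrow> (\<lambda>n. measure_pmf.expectation (I n) (\<lambda>lam. f (iota n lam))) \<longlonglongrightarrow> (\<integral>x. f x \<partial>mu)"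
proof -
  interpret prob_space mu by fact
  have sp: "space mu = thoma" using sets_eq_imp_space_eq[OF mu(2)] by (simp add: space_thoma_space)
  have meas: "f \<in> borel_measurable mu" if "continuous_on thoma f" for f :: "thoma_pt \<Rightarrow> real"
    using borel_measurable_thoma_space[OF that] measurable_cong_sets[OF mu(2) refl] by blast
  define e where "e n = (SOME e. bij_betw e {..<card (YD n)} (YD n))" for n
  have e: "bij_betw (e n) {..<card (YD n)} (YD n)" for n
  proof -
    have "\<exists>e. bij_betw e {..<card (YD n)} (YD n)" using ex_bij_betw_nat_finite[OF finite_YD, of n] by (simp add: atLeast0LessThan)
    then show ?thesis unfolding e_def by (rule someI_ex)
  qed
  define N where "N n = card (YD n)" for n
  have N: "N n > 0" for n using YD_nonempty finite_YD by (simp add: N_def card_gt_0_iff)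
  define near where "near n i x \<longleftrightarrow> i < N n \<and> (\<forall>k<N n. dist x (iota n (e n i)) \<le> dist x (iota n (e n k)))" for n i and x :: thoma_pt
  define rnd where "rnd n x = e n (LEAST i. near n i x)" for n x
  have ex: "\<exists>i. near n i x" for n x
  proof -
    let ?D = "(\<lambda>k. dist x (iota n (e n k))) ` {..<N n}"
    have "Min ?D \<in> ?D" using N[of n] by (intro Min_in) auto
    then obtain i where i: "i < N n" "Min ?D = dist x (iota n (e n i))" by auto
    have "dist x (iota n (e n i)) \<le> dist x (iota n (e n k))" if "k < N n" for k
      unfolding i(2)[symmetric] using that by (intro Min_le) auto
    then show ?thesis using i(1) unfolding near_def by blast
  qed
  have rndY: "rnd n x \<in> YD n" for n x
    using LeastI_ex[OF ex[of n x]] e[of n] unfolding rnd_def near_def N_def bij_betw_def by blast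
  have rnd_min: "dist x (iota n (rnd n x)) \<le> dist x (iota n lam)" if "lam \<in> YD n" for n x lam
  proof -
    have "lam \<in> e n ` {..<N n}" using that e[of n] by (simp add: N_def bij_betw_def)
    then obtain k where "k < N n" "lam = e n k" by auto
    then show ?thesis using LeastI_ex[OF ex[of n x]] unfolding rnd_def near_def by blast
  qed
  have ml: "(\<lambda>x. LEAST i. near n i x) \<in> measurable mu (count_space UNIV)" for n
  proof (rule measurable_Least)
    fix i
    have "(\<lambda>x. dist x (iota n (e n k))) \<in> borel_measurable mu" for k by (intro meas continuous_intros)
    then show "Measurable.pred mu (near n i)" unfolding near_def by measurable
  qed
  have mr: "rnd n \<in> measurable mu (count_space UNIV)" for n
    unfolding rnd_def using measurable_compose[OF ml[of n], of "e n" "count_space UNIV"] by simp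
  define I where "I n = map_pmf (e n) (Abs_pmf (distr mu (count_space UNIV) (\<lambda>x. LEAST i. near n i x)))" for n
  have ab: "measure_pmf (Abs_pmf (distr mu (count_space UNIV) (\<lambda>x. LEAST i. near n i x))) = distr mu (count_space UNIV) (\<lambda>x. LEAST i. near n i x)" for n
  proof (rule Abs_pmf_inverse, intro CollectI conjI)
    interpret D: prob_space "distr mu (count_space UNIV) (\<lambda>x. LEAST i. near n i x)" by (rule prob_space_distr[OF ml])
    show "prob_space (distr mu (count_space UNIV) (\<lambda>x. LEAST i. near n i x))" by (rule D.prob_space_axioms)
    show "AE x in distr mu (count_space UNIV) (\<lambda>x. LEAST i. near n i x). measure (distr mu (count_space UNIV) (\<lambda>x. LEAST i. near n i x)) {x} \<noteq> 0"
      by (subst D.AE_support_countable) (auto intro!: exI[of _ UNIV])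
  qed simp
  show ?thesis
  proof (rule that[of I])
    have int: "measure_pmf.expectation (I n) g = (\<integral>x. g (rnd n x) \<partial>mu)" for n and g :: "nat list \<Rightarrow> real"
      unfolding I_def rnd_def by (simp add: ab integral_distr[OF ml])
    show "set_pmf (I n) \<subseteq> YD n" for n
    proof -
      have "AE i in distr mu (count_space UNIV) (\<lambda>x. LEAST i. near n i x). i < N n"
        by (subst AE_distr_iff[OF ml]) (use LeastI_ex[OF ex] in \<open>auto simp: near_def\<close>)
      then have "AE i in measure_pmf (Abs_pmf (distr mu (count_space UNIV) (\<lambda>x. LEAST i. near n i x))). i < N n" unfolding ab .
      then show ?thesis unfolding I_def AE_measure_pmf_iff using e[of n] by (auto simp: N_def bij_betw_def)
    qed
    fix f :: "thoma_pt \<Rightarrow> real" assume f: "continuous_on thoma f"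
    obtain B where B: "\<And>x. x \<in> thoma \<Longrightarrow> \<bar>f x\<bar> \<le> B" using bounded_on_thoma[OF f] by blast
    \<comment> \<open>The index is shifted because \<open>iota n\<close> maps into the simplex for
      positive n.\<close>
    have "(\<lambda>n. \<integral>x. f (iota (Suc n) (rnd (Suc n) x)) \<partial>mu) \<longlonglongrightarrow> (\<integral>x. f x \<partial>mu)"
    proof (rule integral_dominated_convergence[where w = "\<lambda>_. B"])
      show "f \<in> borel_measurable mu" by (rule meas[OF f])
      show "(\<lambda>x. f (iota (Suc n) (rnd (Suc n) x))) \<in> borel_measurable mu" for n
        using measurable_compose[OF mr[of "Suc n"], of "\<lambda>lam. f (iota (Suc n) lam)" borel] by simp
      show "AE x in mu. (\<lambda>n. f (iota (Suc n) (rnd (Suc n) x))) \<longlonglongrightarrow> f x"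
      proof (rule AE_I2)
        fix x assume "x \<in> space mu"
        then have x: "x \<in> thoma" by (simp add: sp)
        obtain L where L: "\<And>n. n \<ge> 1 \<Longrightarrow> L n \<in> YD n" "(\<lambda>n. iota n (L n)) \<longlonglongrightarrow> x" using thoma_approximation[OF x] by blast
        have "(\<lambda>n. dist x (iota (Suc n) (L (Suc n)))) \<longlonglongrightarrow> dist x x"
          using LIMSEQ_Suc[OF L(2)] by (intro tendsto_dist tendsto_const)
        then have "(\<lambda>n. dist (iota (Suc n) (rnd (Suc n) x)) x) \<longlonglongrightarrow> 0"
          by (intro tendsto_sandwich[of "\<lambda>_. 0" "\<lambda>n. dist (iota (Suc n) (rnd (Suc n) x)) x" _ "\<lambda>n. dist x (iota (Suc n) (L (Suc n)))"])
            (auto intro!: always_eventually simp: dist_commute[of _ x] rnd_min[OF L(1)])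
        then have "(\<lambda>n. iota (Suc n) (rnd (Suc n) x)) \<longlonglongrightarrow> x" using tendsto_dist_iff by blast
        then show "(\<lambda>n. f (iota (Suc n) (rnd (Suc n) x))) \<longlonglongrightarrow> f x"
          by (rule continuous_on_tendsto_compose[OF f _ x]) (auto intro!: always_eventually iota_thoma rndY)
      qed
      show "AE x in mu. norm (f (iota (Suc n) (rnd (Suc n) x))) \<le> B" for n
        using B[OF iota_thoma[OF rndY]] by simp
    qed simp
    then have "(\<lambda>n. measure_pmf.expectation (I (Suc n)) (\<lambda>lam. f (iota (Suc n) lam))) \<longlonglongrightarrow> (\<integral>x. f x \<partial>mu)" unfolding int .
    then show "(\<lambda>n. measure_pmf.expectation (I n) (\<lambda>lam. f (iota n lam))) \<longlonglongrightarrow> (\<integral>x. f x \<partial>mu)" by (rule LIMSEQ_imp_Suc)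
  qed
qed

text \<open>An enumeration with repetitions: a dyadic number has a code for every sufficiently fine
  level. That codes of one time give almost surely equal values is derived later from the moment
  bound.\<close>

definition dtime :: "nat \<Rightarrow> real" where
  "dtime i = (case prod_decode i of (k, m) \<Rightarrow> real k / 2 ^ m)"

lemma dtime_nonneg: "0 \<le> dtime i"
  by (simp add: dtime_def split: prod.splits)

lemma thoma_zero: "((\<lambda>_. 0), (\<lambda>_. 0)) \<in> thoma"
  by (auto simp: thoma_def decseq_def)

text \<open>The r-th approximation runs the chain on diagrams with r + 1 boxes and records it at the
  first r enumerated times. Each property is an equation or inequality between expectations of
  continuous functionals of finitely many recorded points, and passes to the weak limit.\<close>

lemma dyadic_limit:
  assumes adm: "zz'_admissible z z'" and ap: "approximates_semigroup z z' T"
    and mu: "prob_space mu" "sets mu = sets thoma_space"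
  obtains M :: "real measure" and Z :: "nat \<Rightarrow> real \<Rightarrow> thoma_pt" where "real_distribution M"
    "\<And>i. Z i \<in> borel_measurable M" "\<And>i u. Z i u \<in> thoma"
    "\<And>i (f :: thoma_pt \<Rightarrow> real). dtime i = 0 \<Longrightarrow> continuous_on thoma f \<Longrightarrow> (\<integral>u. f (Z i u) \<partial>M) = (\<integral>x. f x \<partial>mu)"
    "\<And>j. \<exists>C\<ge>0. \<forall>a b. (\<integral>u. (test_fun j (Z a u) - test_fun j (Z b u)) ^ 4 \<partial>M) \<le> C * (dtime a - dtime b)\<^sup>2"
    "\<And>I g f a b. finite I \<Longrightarrow> (\<And>i. i \<in> I \<Longrightarrow> continuous_on thoma (g i)) \<Longrightarrow> continuous_on thoma f \<Longrightarrow>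
        (\<And>i. i \<in> I \<Longrightarrow> dtime i \<le> dtime b) \<Longrightarrow> dtime b \<le> dtime a \<Longrightarrow>
        (\<integral>u. (\<Prod>i\<in>I. g i (Z i u)) * f (Z a u) \<partial>M) = (\<integral>u. (\<Prod>i\<in>I. g i (Z i u)) * T (dtime a - dtime b) f (Z b u) \<partial>M)"
proof -
  obtain I where I: "\<And>n. set_pmf (I n) \<subseteq> YD n" and Ilim: "\<And>f :: thoma_pt \<Rightarrow> real. continuous_on thoma f \<Longrightarrow> (\<lambda>n. measure_pmf.expectation (I n) (\<lambda>lam. f (iota n lam))) \<longlonglongrightarrow> (\<integral>x. f x \<partial>mu)"
    using initial_laws[OF mu] by blast
  define x0 :: thoma_pt where "x0 = ((\<lambda>_. 0), (\<lambda>_. 0))"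
  have x0: "x0 \<in> thoma" using thoma_zero by (simp add: x0_def)
  have sc: "started_chain (step_pmf z z' n) (YD n) (I n)" for n
    by (intro started_chain.intro finite_chain_step[OF adm] started_chain_axioms.intro I)
  \<comment> \<open>A horizon that is at least each of the first r observation times; a sum bounds
    them all.\<close>
  define len where "len r = (\<Sum>i<r. kstep (Suc r) (dtime i))" for r
  define Q where "Q r = started_chain.chain (step_pmf z z' (Suc r)) (I (Suc r)) (len r)" for r
  define W where "W r p i = (if i < r then iota (Suc r) (p (kstep (Suc r) (dtime i))) else x0)" for r p i
  have kl: "kstep (Suc r) (dtime i) \<le> len r" if "i < r" for r i
    unfolding len_def using that by (intro member_le_sum) auto
  have pY: "p i \<in> YD (Suc r)" if "p \<in> set_pmf (Q r)" for p i r
    using started_chain.set_chain[OF sc that[unfolded Q_def]] .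
  have W: "W r p i \<in> thoma" if "p \<in> set_pmf (Q r)" for r p i
    unfolding W_def using x0 iota_thoma[OF pY[OF that]] by auto
  obtain M s where M: "real_distribution M" and s: "strict_mono s"
    and lim: "\<And>(G :: (nat \<Rightarrow> thoma_pt) \<Rightarrow> real) B. continuous_on UNIV (\<lambda>u. G (path_decode u)) \<Longrightarrow> (\<And>u. \<bar>G (path_decode u)\<bar> \<le> B) \<Longrightarrow>
       (\<lambda>r. measure_pmf.expectation (Q (s r)) (\<lambda>p. G (W (s r) p))) \<longlonglongrightarrow> (\<integral>u. G (path_decode u) \<partial>M)"
  proof (rule weak_limit_of_paths[of Q W])
    show "W r p i \<in> thoma" if "p \<in> set_pmf (Q r)" for r p i by (rule W[OF that])
  next
    fix M and s :: "nat \<Rightarrow> nat"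
    assume 1: "real_distribution M" "strict_mono s"
      and 2: "\<And>(G :: (nat \<Rightarrow> thoma_pt) \<Rightarrow> real) B. continuous_on UNIV (\<lambda>u. G (path_decode u)) \<Longrightarrow> (\<And>u. \<bar>G (path_decode u)\<bar> \<le> B) \<Longrightarrow>
       (\<lambda>r. measure_pmf.expectation (Q (s r)) (\<lambda>p. G (W (s r) p))) \<longlonglongrightarrow> (\<integral>u. G (path_decode u) \<partial>M)"
    show ?thesis by (rule that[OF 1 2])
  qed
  interpret M: real_distribution M by fact
  have pdc: "continuous_on UNIV (\<lambda>u. g (path_decode u i))" if "continuous_on UNIV g" for g :: "thoma_pt \<Rightarrow> real" and i
    using continuous_on_compose2[OF that continuous_on_path_decode[of i]] by simp
  have pdm: "(\<lambda>u. path_decode u i) \<in> borel_measurable M" for i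
    using borel_measurable_continuous_onI[OF continuous_on_path_decode[of i]] by simp
  have ae: "AE u in M. \<forall>i. path_decode u i \<in> thoma"
    unfolding AE_all_countable
  proof
    fix i
    \<comment> \<open>A bounded continuous function that vanishes exactly on the simplex. Its mean
      is 0 along the approximations, hence also in the limit, so decoded points lie in the simplex
      almost surely.\<close>
    let ?g = "\<lambda>x. min 1 (infdist x thoma)"
    have cg: "continuous_on UNIV ?g" by (intro continuous_intros)
    have g01: "0 \<le> ?g x" "?g x \<le> 1" for x by (auto simp: infdist_nonneg)
    have "(\<lambda>r. measure_pmf.expectation (Q (s r)) (\<lambda>p. ?g (W (s r) p i))) \<longlonglongrightarrow> (\<integral>u. ?g (path_decode u i) \<partial>M)"
      using g01 by (intro lim[of "\<lambda>w. ?g (w i)" 1] pdc cg) (auto simp: abs_le_iff intro: order_trans[of _ 0])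
    moreover have "measure_pmf.expectation (Q (s r)) (\<lambda>p. ?g (W (s r) p i)) = measure_pmf.expectation (Q (s r)) (\<lambda>p. 0)" for r
      using W by (intro integral_cong_AE) (auto simp: AE_measure_pmf_iff infdist_zero)
    ultimately have "(\<integral>u. ?g (path_decode u i) \<partial>M) = 0" using LIMSEQ_unique[of "\<lambda>_. 0::real"] by simp
    moreover have mg: "(\<lambda>u. ?g (path_decode u i)) \<in> borel_measurable M"
      using borel_measurable_continuous_onI[OF pdc[OF cg, of i]] by simp
    moreover have "integrable M (\<lambda>u. ?g (path_decode u i))"
      using g01 by (intro M.integrable_const_bound[of _ 1] mg) auto
    ultimately have "AE u in M. ?g (path_decode u i) = 0" using g01 by (subst (asm) integral_nonneg_eq_0_iff_AE) auto
    then show "AE u in M. path_decode u i \<in> thoma"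
    proof eventually_elim
      case (elim u)
      then have "infdist (path_decode u i) thoma = 0" by (auto simp: min_def split: if_splits)
      then show ?case using in_closed_iff_infdist_zero[OF closed_thoma] x0 by blast
    qed
  qed
  define ok where "ok = {u. \<forall>i. path_decode u i \<in> thoma}"
  have okm: "ok \<in> sets M"
  proof -
    have "ok = (\<Inter>i. (\<lambda>u. path_decode u i) -` thoma \<inter> space M)" by (auto simp: ok_def)
    also have "\<dots> \<in> sets M"
      by (intro sets.countable_INT image_subsetI measurable_sets[OF pdm borel_closed[OF closed_thoma]]) simp
    finally show ?thesis .
  qed
  define Z where "Z i u = (if u \<in> ok then path_decode u i else x0)" for i u
  have Zm: "Z i \<in> borel_measurable M" for i
    unfolding Z_def using okm by (intro measurable_If_set pdm) auto
  have Zt: "Z i u \<in> thoma" for i u using x0 by (auto simp: Z_def ok_def)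
  have Zae: "AE u in M. \<forall>i. Z i u = path_decode u i" using ae by eventually_elim (auto simp: Z_def ok_def)
  have sr: "eventually (\<lambda>r. N < s r) sequentially" for N
  proof -
    have "eventually (\<lambda>r. Suc N \<le> s r) sequentially" using filterlim_subseq[OF s] unfolding filterlim_at_top by blast
    then show ?thesis by (simp add: Suc_le_eq)
  qed
  \<comment> \<open>\<open>G\<close> is built from continuous extensions and is tested by weak
    convergence; \<open>H\<close> is the functional of interest and agrees with it on sequences in
    the simplex. Bad codes form a null set, on which \<open>Z\<close> is constantly
    \<open>x0\<close>.\<close>
  have limZ: "(\<lambda>r. measure_pmf.expectation (Q (s r)) (\<lambda>p. G (W (s r) p))) \<longlonglongrightarrow> (\<integral>u. H (\<lambda>i. Z i u) \<partial>M)"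
    if c: "continuous_on UNIV (\<lambda>u. G (path_decode u))" and B: "\<And>u. \<bar>G (path_decode u)\<bar> \<le> B"
      and GH: "\<And>w. (\<And>i. w i \<in> thoma) \<Longrightarrow> G w = H w" for G H :: "(nat \<Rightarrow> thoma_pt) \<Rightarrow> real" and B
  proof -
    have "(\<integral>u. G (path_decode u) \<partial>M) = (\<integral>u. indicator ok u * G (path_decode u) + indicator (- ok) u * H (\<lambda>_. x0) \<partial>M)"
    proof (rule integral_cong_AE)
      show "(\<lambda>u. G (path_decode u)) \<in> borel_measurable M" using borel_measurable_continuous_onI[OF c] by simp
      then show "(\<lambda>u. indicator ok u * G (path_decode u) + indicator (- ok) u * H (\<lambda>_. x0)) \<in> borel_measurable M"
        using okm by (intro borel_measurable_add borel_measurable_times borel_measurable_indicator) auto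
      show "AE u in M. G (path_decode u) = indicator ok u * G (path_decode u) + indicator (- ok) u * H (\<lambda>_. x0)"
        using ae by eventually_elim (auto simp: ok_def)
    qed
    also have "\<dots> = (\<integral>u. H (\<lambda>i. Z i u) \<partial>M)"
    proof (rule Bochner_Integration.integral_cong[OF refl])
      fix u
      show "indicator ok u * G (path_decode u) + indicator (- ok) u * H (\<lambda>_. x0) = H (\<lambda>i. Z i u)"
      proof (cases "u \<in> ok")
        case True
        then have "G (path_decode u) = H (path_decode u)" by (intro GH) (simp add: ok_def)
        then show ?thesis using True by (simp add: Z_def)
      qed (simp add: Z_def)
    qed
    finally show ?thesis using lim[OF c B] by simp
  qed
  show ?thesis
  proof (rule that[of M Z, OF M Zm Zt])
    fix i f assume i: "dtime i = 0" and f: "continuous_on thoma (f :: thoma_pt \<Rightarrow> real)"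
    obtain g B where g: "continuous_on UNIV g" "\<And>x. x \<in> thoma \<Longrightarrow> g x = f x" "\<And>x. \<bar>g x\<bar> \<le> B" using continuous_extension_thoma[OF f] by blast
    have l1: "(\<lambda>r. measure_pmf.expectation (Q (s r)) (\<lambda>p. g (W (s r) p i))) \<longlonglongrightarrow> (\<integral>u. f (Z i u) \<partial>M)"
      by (rule limZ[of "\<lambda>w. g (w i)" B "\<lambda>w. f (w i)"]) (auto intro!: pdc g)
    have ev: "eventually (\<lambda>r. measure_pmf.expectation (I (Suc (s r))) (\<lambda>lam. f (iota (Suc (s r)) lam)) = measure_pmf.expectation (Q (s r)) (\<lambda>p. g (W (s r) p i))) sequentially"
      using sr[of i]
    proof eventually_elim
      case (elim r)
      interpret started_chain "step_pmf z z' (Suc (s r))" "YD (Suc (s r))" "I (Suc (s r))" by (rule sc)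
      have k0: "kstep (Suc (s r)) (dtime i) = 0" by (simp add: kstep_def i)
      have "measure_pmf.expectation (Q (s r)) (\<lambda>p. g (W (s r) p i)) = E (len (s r)) (\<lambda>p. f (iota (Suc (s r)) (p 0)))"
        using elim unfolding Q_def by (intro E_cong) (auto simp: W_def k0 intro!: g(2) iota_thoma set_chain)
      also have "\<dots> = E 0 (\<lambda>p. f (iota (Suc (s r)) (p 0)))" by (rule E_dep) (auto simp: dep_def)
      finally show ?case by simp
    qed
    have li: "(\<lambda>r. measure_pmf.expectation (I (Suc (s r))) (\<lambda>lam. f (iota (Suc (s r)) lam))) \<longlonglongrightarrow> (\<integral>x. f x \<partial>mu)"
      using LIMSEQ_subseq_LIMSEQ[OF LIMSEQ_Suc[OF Ilim[OF f]] s] by (simp add: comp_def)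
    have "(\<lambda>r. measure_pmf.expectation (Q (s r)) (\<lambda>p. g (W (s r) p i))) \<longlonglongrightarrow> (\<integral>x. f x \<partial>mu)"
      by (rule Lim_transform_eventually[OF li ev])
    then show "(\<integral>u. f (Z i u) \<partial>M) = (\<integral>x. f x \<partial>mu)" using LIMSEQ_unique[OF l1] by blast
  next
    fix j
    obtain C where C: "C \<ge> 0" and mom: "\<And>n lam k. n \<ge> 1 \<Longrightarrow> lam \<in> YD n \<Longrightarrow>
     (Tn z z' n ^^ k) (\<lambda>y. (test_fun j (iota n y) - test_fun j (iota n lam)) ^ 4) lam \<le> C * (((real k)\<^sup>2 + real k) / real n ^ 4)"
      using test_fun_fourth_moment[OF adm] by blast
    obtain g B where g: "continuous_on UNIV g" "\<And>x. x \<in> thoma \<Longrightarrow> g x = test_fun j x" "\<And>x. \<bar>g x\<bar> \<le> B"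
      using continuous_extension_thoma[OF continuous_on_test_fun] by blast
    have main: "(\<integral>u. (test_fun j (Z a u) - test_fun j (Z b u)) ^ 4 \<partial>M) \<le> C * (dtime a - dtime b)\<^sup>2" if ab: "dtime b \<le> dtime a" for a b
    proof -
      let ?c = "dtime a - dtime b"
      have l1: "(\<lambda>r. measure_pmf.expectation (Q (s r)) (\<lambda>p. (g (W (s r) p a) - g (W (s r) p b)) ^ 4)) \<longlonglongrightarrow> (\<integral>u. (test_fun j (Z a u) - test_fun j (Z b u)) ^ 4 \<partial>M)"
      proof (rule limZ[of "\<lambda>w. (g (w a) - g (w b)) ^ 4" "(2 * B) ^ 4" "\<lambda>w. (test_fun j (w a) - test_fun j (w b)) ^ 4"])
        show "continuous_on UNIV (\<lambda>u. (g (path_decode u a) - g (path_decode u b)) ^ 4)" by (intro continuous_intros pdc g)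
        show "\<bar>(g (path_decode u a) - g (path_decode u b)) ^ 4\<bar> \<le> (2 * B) ^ 4" for u
        proof -
          have "\<bar>g (path_decode u a) - g (path_decode u b)\<bar> \<le> 2 * B" using g(3)[of "path_decode u a"] g(3)[of "path_decode u b"] by linarith
          then show ?thesis unfolding power_abs by (intro power_mono) auto
        qed
      qed (simp add: g(2))
      let ?u = "\<lambda>n. C * ((((real n)\<^sup>2 * ?c + 1)\<^sup>2 + ((real n)\<^sup>2 * ?c + 1)) / real n ^ 4)"
      have l2: "(\<lambda>r. ?u (Suc (s r))) \<longlonglongrightarrow> C * ?c\<^sup>2"
        using LIMSEQ_subseq_LIMSEQ[OF LIMSEQ_Suc[OF tendsto_mult[OF tendsto_const kstep_limit[of ?c]]] s, of C] by (simp add: comp_def)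
      have ev: "eventually (\<lambda>r. measure_pmf.expectation (Q (s r)) (\<lambda>p. (g (W (s r) p a) - g (W (s r) p b)) ^ 4) \<le> ?u (Suc (s r))) sequentially"
        using sr[of "max a b"]
      proof eventually_elim
        case (elim r)
        define n where "n = Suc (s r)"
        interpret started_chain "step_pmf z z' n" "YD n" "I n" by (rule sc)
        let ?ka = "kstep n (dtime a)" and ?kb = "kstep n (dtime b)"
        let ?L = "len (s r)"
        have k: "?kb \<le> ?ka" "?ka \<le> ?L" using kl[of a "s r"] elim ab by (auto simp: n_def intro!: kstep_mono)
        have n1: "n \<ge> 1" by (simp add: n_def)
        have Wn: "W (s r) p a = iota n (p ?ka)" "W (s r) p b = iota n (p ?kb)" for p using elim by (auto simp: W_def n_def)
        have "measure_pmf.expectation (Q (s r)) (\<lambda>p. (g (W (s r) p a) - g (W (s r) p b)) ^ 4)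
           = E ?L (\<lambda>p. (test_fun j (iota n (p ?ka)) - test_fun j (iota n (p ?kb))) ^ 4)"
          unfolding Q_def n_def[symmetric] by (intro E_cong) (simp add: Wn g(2)[OF iota_thoma[OF set_chain n1]])
        also have "\<dots> = E ?L (\<lambda>p. (op ^^ (?ka - ?kb)) (\<lambda>y. (test_fun j (iota n y) - test_fun j (iota n (p ?kb))) ^ 4) (p ?kb))"
          by (rule markov[where H = "\<lambda>p y. (test_fun j (iota n y) - test_fun j (iota n (p ?kb))) ^ 4", OF _ k]) (auto simp: dep_def)
        also have "\<dots> \<le> E ?L (\<lambda>p. ?u n)"
        proof (rule E_mono)
          fix p assume p: "p \<in> set_pmf (chain ?L)"
          have pk: "p ?kb \<in> YD n" using set_chain[OF p] .
          have kb: "real (?ka - ?kb) \<le> (real n)\<^sup>2 * ?c + 1" using kstep_diff(2)[of "dtime b" ?c n] dtime_nonneg[of b] ab by simp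
          have "(op ^^ (?ka - ?kb)) (\<lambda>y. (test_fun j (iota n y) - test_fun j (iota n (p ?kb))) ^ 4) (p ?kb)
             \<le> C * (((real (?ka - ?kb))\<^sup>2 + real (?ka - ?kb)) / real n ^ 4)"
            unfolding Tn_iter_eq[OF adm pk] by (rule mom[OF n1 pk])
          also have "\<dots> \<le> ?u n" using C kb by (intro mult_left_mono divide_right_mono add_mono power_mono) auto
          finally show "(op ^^ (?ka - ?kb)) (\<lambda>y. (test_fun j (iota n y) - test_fun j (iota n (p ?kb))) ^ 4) (p ?kb) \<le> ?u n" .
        qed
        finally show ?case by (simp add: n_def)
      qed
      show ?thesis using tendsto_le[OF _ l2 l1 ev] by simp
    qed
    have "(\<integral>u. (test_fun j (Z a u) - test_fun j (Z b u)) ^ 4 \<partial>M) \<le> C * (dtime a - dtime b)\<^sup>2" for a b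
    proof (cases "dtime b \<le> dtime a")
      case False
      then have "(\<integral>u. (test_fun j (Z b u) - test_fun j (Z a u)) ^ 4 \<partial>M) \<le> C * (dtime b - dtime a)\<^sup>2" by (intro main) simp
      moreover have "(x - y) ^ 4 = (y - x) ^ 4" for x y :: real by (simp add: power4_eq_xxxx algebra_simps)
      ultimately show ?thesis by (metis (no_types, lifting) Bochner_Integration.integral_cong power2_commute)
    qed (rule main)
    then show "\<exists>C\<ge>0. \<forall>a b. (\<integral>u. (test_fun j (Z a u) - test_fun j (Z b u)) ^ 4 \<partial>M) \<le> C * (dtime a - dtime b)\<^sup>2" using C by blast
  next
    fix J :: "nat set" and g :: "nat \<Rightarrow> thoma_pt \<Rightarrow> real" and f :: "thoma_pt \<Rightarrow> real" and a b
    assume J: "finite J" and gc: "\<And>i. i \<in> J \<Longrightarrow> continuous_on thoma (g i)" and f: "continuous_on thoma f"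
      and Jb: "\<And>i. i \<in> J \<Longrightarrow> dtime i \<le> dtime b" and ab: "dtime b \<le> dtime a"
    let ?t = "dtime a - dtime b"
    have t: "0 \<le> ?t" using ab by simp
    have "\<forall>i. \<exists>h B. i \<in> J \<longrightarrow> continuous_on UNIV h \<and> (\<forall>x\<in>thoma. h x = g i x) \<and> (\<forall>x. \<bar>h x\<bar> \<le> B)"
      using gc continuous_extension_thoma by metis
    then obtain h B where h: "\<And>i. i \<in> J \<Longrightarrow> continuous_on UNIV (h i)" "\<And>i x. i \<in> J \<Longrightarrow> x \<in> thoma \<Longrightarrow> h i x = g i x" "\<And>i x. i \<in> J \<Longrightarrow> \<bar>h i x\<bar> \<le> B i"
      by metis
    obtain F BF where F: "continuous_on UNIV F" "\<And>x. x \<in> thoma \<Longrightarrow> F x = f x" "\<And>x. \<bar>F x\<bar> \<le> BF" using continuous_extension_thoma[OF f] by blast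
    have Tf: "continuous_on thoma (T ?t f)" by (rule semigroup_continuous_on[OF ap t f])
    obtain F' BF' where F': "continuous_on UNIV F'" "\<And>x. x \<in> thoma \<Longrightarrow> F' x = T ?t f x" "\<And>x. \<bar>F' x\<bar> \<le> BF'" using continuous_extension_thoma[OF Tf] by blast
    define P where "P = (\<Prod>i\<in>J. B i)"
    have Pb: "\<bar>\<Prod>i\<in>J. h i (w i)\<bar> \<le> P" for w unfolding P_def abs_prod using h(3) by (intro prod_mono) auto
    have P0: "P \<ge> 0" using Pb[of undefined] by linarith
    have l1: "(\<lambda>r. measure_pmf.expectation (Q (s r)) (\<lambda>p. (\<Prod>i\<in>J. h i (W (s r) p i)) * F (W (s r) p a))) \<longlonglongrightarrow> (\<integral>u. (\<Prod>i\<in>J. g i (Z i u)) * f (Z a u) \<partial>M)"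
      by (rule limZ[of "\<lambda>w. (\<Prod>i\<in>J. h i (w i)) * F (w a)" "P * BF" "\<lambda>w. (\<Prod>i\<in>J. g i (w i)) * f (w a)"])
        (auto intro!: continuous_intros pdc h(1) F(1) abs_mult_le Pb F(3) simp: h(2) F(2))
    have l2: "(\<lambda>r. measure_pmf.expectation (Q (s r)) (\<lambda>p. (\<Prod>i\<in>J. h i (W (s r) p i)) * F' (W (s r) p b))) \<longlonglongrightarrow> (\<integral>u. (\<Prod>i\<in>J. g i (Z i u)) * T ?t f (Z b u) \<partial>M)"
      by (rule limZ[of "\<lambda>w. (\<Prod>i\<in>J. h i (w i)) * F' (w b)" "P * BF'" "\<lambda>w. (\<Prod>i\<in>J. g i (w i)) * T ?t f (w b)"])
        (auto intro!: continuous_intros pdc h(1) F'(1) abs_mult_le Pb F'(3) simp: h(2) F'(2))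
    let ?D = "\<lambda>r. measure_pmf.expectation (Q (s r)) (\<lambda>p. (\<Prod>i\<in>J. h i (W (s r) p i)) * F (W (s r) p a))
       - measure_pmf.expectation (Q (s r)) (\<lambda>p. (\<Prod>i\<in>J. h i (W (s r) p i)) * F' (W (s r) p b))"
    have "?D \<longlonglongrightarrow> 0"
    proof (rule tendstoI)
      fix d :: real assume d: "d > 0"
      \<comment> \<open>The final error is P times 3e, hence below d; adding 1 to P avoids division
        by zero.\<close>
      define e where "e = d / (4 * (P + 1))"
      have e: "e > 0" using d P0 by (simp add: e_def)
      obtain A where A: "A \<ge> 0" and mod: "\<And>n lam k. n \<ge> 1 \<Longrightarrow> lam \<in> YD n \<Longrightarrow>
          \<bar>(Tn z z' n ^^ k) (proj_n n f) lam - proj_n n f lam\<bar> \<le> e + A * (((real k)\<^sup>2 + real k) / real n ^ 4)"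
        using Tn_iter_modulus[OF adm f e] by blast
      have "(\<lambda>n. A * (((real 1)\<^sup>2 + real 1) / real n ^ 4)) \<longlonglongrightarrow> 0" by real_asymp
      then have "eventually (\<lambda>n. A * (((real 1)\<^sup>2 + real 1) / real n ^ 4) < e) sequentially" using e by (rule order_tendstoD)
      then have "eventually (\<lambda>n. A * (((real 1)\<^sup>2 + real 1) / real n ^ 4) < e \<and> n \<ge> 1 \<and> (\<forall>lam\<in>YD n. \<bar>(Tn z z' n ^^ kstep n ?t) (proj_n n f) lam - proj_n n (T ?t f) lam\<bar> < e)) sequentially"
        using semigroup_uniform[OF ap t f e] eventually_ge_at_top[of 1] by eventually_elim auto
      then obtain N where N: "\<And>n. n \<ge> N \<Longrightarrow> A * (((real 1)\<^sup>2 + real 1) / real n ^ 4) < e \<and> n \<ge> 1 \<and> (\<forall>lam\<in>YD n. \<bar>(Tn z z' n ^^ kstep n ?t) (proj_n n f) lam - proj_n n (T ?t f) lam\<bar> < e)"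
        unfolding eventually_sequentially by blast
      show "eventually (\<lambda>r. dist (?D r) 0 < d) sequentially"
        using sr[of "Max (insert a (insert b J))"] sr[of N]
      proof eventually_elim
        case (elim r)
        define n where "n = Suc (s r)"
        have nN: "N \<le> n" using elim by (simp add: n_def)
        have ir: "i < s r" if "i \<in> insert a (insert b J)" for i
          using elim(1) Max_ge[of "insert a (insert b J)" i] J that by auto
        interpret started_chain "step_pmf z z' n" "YD n" "I n" by (rule sc)
        let ?k = "\<lambda>i. kstep n (dtime i)" and ?L = "len (s r)"
        have k: "?k b \<le> ?k a" "?k a \<le> ?L" using kl[of a "s r"] ir ab by (auto simp: n_def intro!: kstep_mono)
        have kJ: "?k i \<le> ?k b" if "i \<in> J" for i using Jb[OF that] by (rule kstep_mono)
        let ?G = "\<lambda>p. \<Prod>i\<in>J. h i (iota n (p (?k i)))"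
        have n1: "n \<ge> 1" by (simp add: n_def)
        have Wn: "W (s r) p i = iota n (p (?k i))" if "i \<in> insert a (insert b J)" for p i using ir[OF that] by (simp add: W_def n_def)
        have e1: "measure_pmf.expectation (Q (s r)) (\<lambda>p. (\<Prod>i\<in>J. h i (W (s r) p i)) * F (W (s r) p a)) = E ?L (\<lambda>p. ?G p * proj_n n f (p (?k a)))"
          unfolding Q_def n_def[symmetric] using Wn by (intro E_cong) (auto simp: proj_n_def F(2)[OF iota_thoma[OF set_chain n1]])
        have e2: "measure_pmf.expectation (Q (s r)) (\<lambda>p. (\<Prod>i\<in>J. h i (W (s r) p i)) * F' (W (s r) p b)) = E ?L (\<lambda>p. ?G p * proj_n n (T ?t f) (p (?k b)))"
          unfolding Q_def n_def[symmetric] using Wn by (intro E_cong) (auto simp: proj_n_def F'(2)[OF iota_thoma[OF set_chain n1]])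
        have dG: "dep (?k b) (\<lambda>p. ?G p * c)" for c
          unfolding dep_def using kJ by (auto intro!: arg_cong2[of _ _ _ _ "(*)"] prod.cong)
        have "E ?L (\<lambda>p. ?G p * proj_n n f (p (?k a))) = E ?L (\<lambda>p. (op ^^ (?k a - ?k b)) (\<lambda>y. ?G p * proj_n n f y) (p (?k b)))"
          by (rule markov[where H = "\<lambda>p y. ?G p * proj_n n f y", OF dG k])
        also have "\<dots> = E ?L (\<lambda>p. ?G p * (Tn z z' n ^^ (?k a - ?k b)) (proj_n n f) (p (?k b)))"
        proof (rule E_cong)
          fix p assume p: "p \<in> set_pmf (chain ?L)"
          have pk: "p (?k b) \<in> YD n" using set_chain[OF p] .
          show "(op ^^ (?k a - ?k b)) (\<lambda>y. ?G p * proj_n n f y) (p (?k b)) = ?G p * (Tn z z' n ^^ (?k a - ?k b)) (proj_n n f) (p (?k b))"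
            using iter_affine[OF pk, of "?k a - ?k b" "?G p" "proj_n n f" 0 "proj_n n f" 0] Tn_iter_eq[OF adm pk] by simp
        qed
        finally have e3: "E ?L (\<lambda>p. ?G p * proj_n n f (p (?k a))) = E ?L (\<lambda>p. ?G p * (Tn z z' n ^^ (?k a - ?k b)) (proj_n n f) (p (?k b)))" .
        \<comment> \<open>One e is the error of the semigroup approximation at the exact step count;
          2e pays for the possible surplus step from rounding the times.\<close>
        have close: "\<bar>(Tn z z' n ^^ (?k a - ?k b)) (proj_n n f) lam - proj_n n (T ?t f) lam\<bar> \<le> 3 * e" if lam: "lam \<in> YD n" for lam
        proof -
          have 1: "\<bar>(Tn z z' n ^^ kstep n ?t) (proj_n n f) lam - proj_n n (T ?t f) lam\<bar> < e" using N[OF nN] lam by blast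
          have kk: "?k a - ?k b = kstep n ?t \<or> ?k a - ?k b = Suc (kstep n ?t)"
            using kstep_diff(1)[of "dtime b" ?t n] dtime_nonneg[of b] t by simp
          have 2: "\<bar>(Tn z z' n ^^ Suc (kstep n ?t)) (proj_n n f) lam - (Tn z z' n ^^ kstep n ?t) (proj_n n f) lam\<bar> \<le> 2 * e"
          proof (rule Tn_iter_diff[OF adm lam])
            fix mu assume m: "mu \<in> YD n"
            show "\<bar>(Tn z z' n ^^ (Suc (kstep n ?t) - kstep n ?t)) (proj_n n f) mu - proj_n n f mu\<bar> \<le> 2 * e"
              using mod[OF n1 m, of 1] N[OF nN] by (simp add: Suc_diff_le)
          qed simp
          from kk show ?thesis
          proof
            assume k: "?k a - ?k b = kstep n ?t"
            show ?thesis unfolding k using 1 e by linarith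
          next
            assume k: "?k a - ?k b = Suc (kstep n ?t)"
            show ?thesis unfolding k using 1 2 by linarith
          qed
        qed
        have "\<bar>?D r\<bar> = \<bar>E ?L (\<lambda>p. ?G p * ((Tn z z' n ^^ (?k a - ?k b)) (proj_n n f) (p (?k b)) - proj_n n (T ?t f) (p (?k b))))\<bar>"
          unfolding e1 e2 e3 by (subst Bochner_Integration.integral_diff[symmetric]) (auto simp: integrable_chain right_diff_distrib)
        also have "\<dots> \<le> E ?L (\<lambda>p. P * (3 * e))"
        proof (rule order_trans[OF integral_abs_bound E_mono])
          fix p assume p: "p \<in> set_pmf (chain ?L)"
          show "\<bar>?G p * ((Tn z z' n ^^ (?k a - ?k b)) (proj_n n f) (p (?k b)) - proj_n n (T ?t f) (p (?k b)))\<bar> \<le> P * (3 * e)"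
            using Pb[of "\<lambda>i. iota n (p (?k i))"] close[OF set_chain[OF p]] by (intro abs_mult_le)
        qed
        also have "\<dots> = P * (3 * e)" by simp
        also have "\<dots> < d"
        proof -
          have "P * (3 * e) \<le> (P + 1) * (3 * e)" using e by (intro mult_right_mono) auto
          also have "\<dots> = 3 / 4 * d" using P0 by (simp add: e_def field_simps)
          also have "\<dots> < d" using d by simp
          finally show ?thesis .
        qed
        finally show ?case by (simp add: dist_real_def)
      qed
    qed
    moreover have "?D \<longlonglongrightarrow> (\<integral>u. (\<Prod>i\<in>J. g i (Z i u)) * f (Z a u) \<partial>M) - (\<integral>u. (\<Prod>i\<in>J. g i (Z i u)) * T ?t f (Z b u) \<partial>M)"
      by (intro tendsto_diff l1 l2)
    ultimately show "(\<integral>u. (\<Prod>i\<in>J. g i (Z i u)) * f (Z a u) \<partial>M) = (\<integral>u. (\<Prod>i\<in>J. g i (Z i u)) * T ?t f (Z b u) \<partial>M)"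
      using LIMSEQ_unique by fastforce
  qed
qed

section \<open>Kolmogorov-Chentsov: from dyadic moments to continuous paths\<close>

lemma dyadic_chaining_level:
  fixes f :: "nat \<Rightarrow> nat \<Rightarrow> real"
  assumes cons: "\<And>k m. f (2 * k) (Suc m) = f k m" and S: "0 \<le> S"
    and inc: "\<And>m k. k < K * 2 ^ m \<Longrightarrow> \<bar>f (Suc k) m - f k m\<bar> \<le> S * (9/10) ^ m"
  shows "k \<le> K * 2 ^ (q + d) \<Longrightarrow> \<bar>f k (q + d) - f (k div 2 ^ d) q\<bar> \<le> 9 * S * ((9/10) ^ q - (9/10) ^ (q + d))"
proof (induction d arbitrary: k)
  case (Suc d)
  have k2: "k div 2 \<le> K * 2 ^ (q + d)" using Suc.prems by simp
  have 1: "\<bar>f k (Suc (q + d)) - f (k div 2) (q + d)\<bar> \<le> S * (9/10) ^ Suc (q + d)"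
  proof (cases "even k")
    case True
    then have "f k (Suc (q + d)) = f (k div 2) (q + d)" using cons[of "k div 2" "q + d"] by simp
    then show ?thesis using S by simp
  next
    case False
    then have k: "k = Suc (2 * (k div 2))" by presburger
    have "\<bar>f (Suc (2 * (k div 2))) (Suc (q + d)) - f (2 * (k div 2)) (Suc (q + d))\<bar> \<le> S * (9/10) ^ Suc (q + d)"
      using k Suc.prems by (intro inc) simp
    then show ?thesis using k cons[of "k div 2" "q + d"] by simp
  qed
  have 2: "\<bar>f (k div 2) (q + d) - f (k div 2 div 2 ^ d) q\<bar> \<le> 9 * S * ((9/10) ^ q - (9/10) ^ (q + d))" by (rule Suc.IH[OF k2])
  have e: "k div 2 div 2 ^ d = k div 2 ^ Suc d" by (simp add: div_mult2_eq)
  have "9 * S * ((9/10) ^ q - (9/10) ^ (q + d)) + S * (9/10) ^ Suc (q + d) = 9 * S * ((9/10) ^ q - (9/10) ^ Suc (q + d))"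
    by (simp add: algebra_simps)
  then have "\<bar>f k (Suc (q + d)) - f (k div 2 ^ Suc d) q\<bar> \<le> 9 * S * ((9/10) ^ q - (9/10) ^ Suc (q + d))"
    using 1 2 unfolding e by linarith
  then show ?case by (simp only: add_Suc_right)
qed simp

text \<open>Lift both points to a common fine level and descend to their ancestors at level q. Each
  descent costs at most 9 S (9/10)^q, a geometric tail; the ancestors are equal or adjacent, which
  costs one more S (9/10)^q. Together this is 19.\<close>

lemma dyadic_chaining:
  fixes f :: "nat \<Rightarrow> nat \<Rightarrow> real"
  assumes cons: "\<And>k m. f (2 * k) (Suc m) = f k m" and S: "0 \<le> S"
    and inc: "\<And>m k. k < K * 2 ^ m \<Longrightarrow> \<bar>f (Suc k) m - f k m\<bar> \<le> S * (9/10) ^ m"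
    and kl: "real k / 2 ^ m \<le> K" "real l / 2 ^ m' \<le> K" and d: "\<bar>real k / 2 ^ m - real l / 2 ^ m'\<bar> \<le> 1 / 2 ^ q"
  shows "\<bar>f k m - f l m'\<bar> \<le> 19 * S * (9/10) ^ q"
proof -
  have lift: "f (k * 2 ^ d) (m + d) = f k m" for k m d
  proof (induction d)
    case (Suc d)
    have "f (k * 2 ^ Suc d) (m + Suc d) = f (2 * (k * 2 ^ d)) (Suc (m + d))" by (simp add: mult_ac)
    then show ?case using cons Suc by simp
  qed simp
  define d where "d = m + m'"
  let ?n = "q + d"
  define a where "a = k * 2 ^ (q + m')"
  define b where "b = l * 2 ^ (q + m)"
  have fa: "f a ?n = f k m" using lift[of k "q + m'" m] by (simp add: a_def d_def add_ac)
  have fb: "f b ?n = f l m'" using lift[of l "q + m" m'] by (simp add: b_def d_def add_ac)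
  have ra: "real a / 2 ^ ?n = real k / 2 ^ m" by (simp add: a_def d_def power_add)
  have rb: "real b / 2 ^ ?n = real l / 2 ^ m'" by (simp add: b_def d_def power_add)
  have bound: "c \<le> K * 2 ^ ?n" if "real c / 2 ^ ?n \<le> K" for c
  proof -
    have "real c \<le> real K * 2 ^ ?n" using that by (simp add: divide_le_eq)
    then have "real c \<le> real (K * 2 ^ ?n)" by simp
    then show ?thesis by (simp only: of_nat_le_iff)
  qed
  have main: "\<bar>f c ?n - f e ?n\<bar> \<le> 19 * S * (9/10) ^ q"
    if ce: "c \<le> e" "e \<le> K * 2 ^ ?n" "real e / 2 ^ ?n - real c / 2 ^ ?n \<le> 1 / 2 ^ q" for c e
  proof -
    have "(real e - real c) / 2 ^ ?n \<le> 1 / 2 ^ q" using ce(3) by (simp add: diff_divide_distrib)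
    then have "real e - real c \<le> 2 ^ ?n / 2 ^ q" by (simp add: divide_le_eq)
    also have "\<dots> = 2 ^ d" by (simp add: power_add)
    finally have "real e \<le> real (c + 2 ^ d)" by simp
    then have "e \<le> c + 2 ^ d" by (simp only: of_nat_le_iff)
    then have "e div 2 ^ d \<le> (c + 2 ^ d) div 2 ^ d" by (rule div_le_mono)
    then have le: "e div 2 ^ d \<le> Suc (c div 2 ^ d)" by simp
    have ge: "c div 2 ^ d \<le> e div 2 ^ d" using ce(1) by (rule div_le_mono)
    have eK: "e div 2 ^ d \<le> K * 2 ^ q" using div_le_mono[OF ce(2), of "2 ^ d"] by (simp add: power_add mult.assoc)
    have mid: "\<bar>f (c div 2 ^ d) q - f (e div 2 ^ d) q\<bar> \<le> S * (9/10) ^ q"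
    proof (cases "e div 2 ^ d = c div 2 ^ d")
      case False
      then have e: "e div 2 ^ d = Suc (c div 2 ^ d)" using le ge by simp
      show ?thesis unfolding e using inc[of "c div 2 ^ d" q] eK e by (simp add: abs_minus_commute)
    qed (use S in simp)
    have pw: "9 * S * ((9/10) ^ q - (9/10) ^ ?n) \<le> 9 * S * (9/10) ^ q" using S by (intro mult_left_mono) auto
    have "\<bar>f c ?n - f (c div 2 ^ d) q\<bar> \<le> 9 * S * ((9/10) ^ q - (9/10) ^ ?n)" "\<bar>f e ?n - f (e div 2 ^ d) q\<bar> \<le> 9 * S * ((9/10) ^ q - (9/10) ^ ?n)"
      using ce by (auto intro!: dyadic_chaining_level[OF cons S inc])
    then show ?thesis using mid pw by linarith
  qed
  have d': "\<bar>real a / 2 ^ ?n - real b / 2 ^ ?n\<bar> \<le> 1 / 2 ^ q" using d unfolding ra rb .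
  have "\<bar>f a ?n - f b ?n\<bar> \<le> 19 * S * (9/10) ^ q"
  proof (cases "a \<le> b")
    case True
    show ?thesis using d' bound[of b] kl rb by (intro main[OF True]) (auto simp: abs_le_iff)
  next
    case False
    then have "\<bar>f b ?n - f a ?n\<bar> \<le> 19 * S * (9/10) ^ q" using d' bound[of a] kl ra by (intro main) (auto simp: abs_le_iff)
    then show ?thesis by (simp add: abs_minus_commute)
  qed
  then show ?thesis unfolding fa fb .
qed

lemma dtime_encode: "dtime (prod_encode (k, m)) = real k / 2 ^ m"
  by (simp add: dtime_def)

text \<open>Weight the fourth powers at level m by (10/9)^(4m). There are K 2^m increments with
  moment at most C 4^-m each, so the means are at most K C times powers of (10/9)^4 / 2 =
  10000/13122 < 1. Their sum is finite almost surely, which bounds all increments at once. Any ratio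
  between 2^(-1/4) and 1 could replace 9/10.\<close>

lemma (in prob_space) kolmogorov_increments:
  fixes Y :: "nat \<Rightarrow> 'a \<Rightarrow> real"
  assumes Y: "\<And>i. Y i \<in> borel_measurable M" and bd: "\<And>i u. \<bar>Y i u\<bar> \<le> B"
    and mom: "\<And>a b. (\<integral>u. (Y a u - Y b u) ^ 4 \<partial>M) \<le> C * (dtime a - dtime b)\<^sup>2" and C: "0 \<le> C"
  shows "AE u in M. \<exists>S\<ge>0. \<forall>m k. k < K * 2 ^ m \<longrightarrow> \<bar>Y (prod_encode (Suc k, m)) u - Y (prod_encode (k, m)) u\<bar> \<le> S * (9/10) ^ m"
proof -
  let ?D = "\<lambda>m k u. Y (prod_encode (Suc k, m)) u - Y (prod_encode (k, m)) u"
  let ?w = "\<lambda>m. (10/9 :: real) ^ (4 * m)"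
  define R where "R m u = (\<Sum>k<K * 2 ^ m. ?w m * ?D m k u ^ 4)" for m u
  have R0: "0 \<le> R m u" for m u unfolding R_def by (intro sum_nonneg mult_nonneg_nonneg) auto
  have int4: "integrable M (\<lambda>u. ?D m k u ^ 4)" for m k
  proof (rule integrable_const_bound[of _ "(2 * B) ^ 4"])
    show "AE u in M. norm (?D m k u ^ 4) \<le> (2 * B) ^ 4"
    proof (rule AE_I2)
      fix u
      have "\<bar>?D m k u\<bar> \<le> 2 * B" using bd[of "prod_encode (Suc k, m)" u] bd[of "prod_encode (k, m)" u] by linarith
      then show "norm (?D m k u ^ 4) \<le> (2 * B) ^ 4" unfolding real_norm_def power_abs by (intro power_mono) auto
    qed
  qed (use Y in measurable)
  have intR: "integrable M (R m)" for m unfolding R_def by (intro Bochner_Integration.integrable_sum integrable_mult_right int4)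
  have ER: "(\<integral>u. R m u \<partial>M) \<le> real K * C * (10000/13122) ^ m" for m
  proof -
    have "(\<integral>u. R m u \<partial>M) = (\<Sum>k<K * 2 ^ m. ?w m * (\<integral>u. ?D m k u ^ 4 \<partial>M))"
      unfolding R_def using int4 by (subst Bochner_Integration.integral_sum) auto
    also have "\<dots> \<le> (\<Sum>k<K * 2 ^ m. ?w m * (C * (1 / 2 ^ m)\<^sup>2))"
    proof (intro sum_mono mult_left_mono)
      fix k
      have "dtime (prod_encode (Suc k, m)) - dtime (prod_encode (k, m)) = 1 / 2 ^ m"
        unfolding dtime_encode by (simp add: diff_divide_distrib[symmetric])
      then show "(\<integral>u. ?D m k u ^ 4 \<partial>M) \<le> C * (1 / 2 ^ m)\<^sup>2" using mom[of "prod_encode (Suc k, m)" "prod_encode (k, m)"] by simp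
    qed simp
    also have "\<dots> = real K * C * ((10/9) ^ 4 * 2 * (1/4)) ^ m"
    proof -
      have "(2::real) ^ m * ((10/9) ^ (4 * m) * (1 / 2 ^ m)\<^sup>2) = ((10/9) ^ 4 * 2 * (1/4)) ^ m"
        unfolding power_mult power_mult_distrib by (simp add: power_divide power2_eq_square flip: power_mult_distrib)
      then show ?thesis by (simp add: mult_ac)
    qed
    finally show ?thesis by (simp add: power_divide)
  qed
  have "(\<integral>\<^sup>+ u. (\<Sum>m. ennreal (R m u)) \<partial>M) = (\<Sum>m. \<integral>\<^sup>+ u. ennreal (R m u) \<partial>M)"
    using intR by (intro nn_integral_suminf) auto
  also have "\<dots> = (\<Sum>m. ennreal (\<integral>u. R m u \<partial>M))"
    using intR R0 by (intro suminf_cong nn_integral_eq_integral) auto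
  also have "\<dots> \<le> (\<Sum>m. ennreal (real K * C * (10000/13122) ^ m))"
    using ER by (intro suminf_le ennreal_leI) auto
  also have "\<dots> = ennreal (\<Sum>m. real K * C * (10000/13122) ^ m)"
    using C by (intro suminf_ennreal2) (auto intro!: summable_mult summable_geometric)
  also have "\<dots> < \<infinity>" by simp
  finally have fin: "(\<integral>\<^sup>+ u. (\<Sum>m. ennreal (R m u)) \<partial>M) \<noteq> \<infinity>" by simp
  have "AE u in M. (\<Sum>m. ennreal (R m u)) \<noteq> \<infinity>"
    using intR by (intro nn_integral_noteq_infinite fin) auto
  then show ?thesis
  proof eventually_elim
    case (elim u)
    define S where "S = max 1 (enn2real (\<Sum>m. ennreal (R m u)))"
    have S: "1 \<le> S" by (simp add: S_def)
    have RS: "R m u \<le> S" for m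
    proof -
      have "ennreal (R m u) \<le> (\<Sum>m. ennreal (R m u))" using sum_le_suminf[of "\<lambda>m. ennreal (R m u)" "{m}"] by simp
      also have "\<dots> = ennreal (enn2real (\<Sum>m. ennreal (R m u)))" using elim by (simp add: ennreal_enn2real top.not_eq_extremum)
      finally have "R m u \<le> enn2real (\<Sum>m. ennreal (R m u))" by (simp add: ennreal_le_iff enn2real_nonneg)
      then show ?thesis by (simp add: S_def)
    qed
    have "\<bar>?D m k u\<bar> \<le> S * (9/10) ^ m" if k: "k < K * 2 ^ m" for m k
    proof -
      have "?w m * ?D m k u ^ 4 \<le> R m u" unfolding R_def using k by (intro member_le_sum) auto
      then have "?w m * ?D m k u ^ 4 \<le> S" using RS[of m] by linarith
      also have "S \<le> S ^ 4" using S power_increasing[of 1 4 S] by simp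
      finally have "(9/10) ^ (4 * m) * (?w m * ?D m k u ^ 4) \<le> (9/10) ^ (4 * m) * S ^ 4" by (intro mult_left_mono) auto
      moreover have "(9/10 :: real) ^ (4 * m) * (10/9) ^ (4 * m) = 1" by (simp flip: power_mult_distrib)
      ultimately have "?D m k u ^ 4 \<le> (9/10) ^ (4 * m) * S ^ 4" by (simp add: mult.assoc[symmetric])
      also have "\<dots> = (S * (9/10) ^ m) ^ 4" by (simp add: power_mult_distrib power_mult[symmetric] mult.commute)
      finally have "\<bar>?D m k u\<bar> ^ 4 \<le> (S * (9/10) ^ m) ^ 4" by simp
      then show ?thesis by (rule power_le_imp_le_base[of _ 3, simplified numeral_eq_Suc, simplified]) (use S in auto)
    qed
    then show ?case using S by (intro exI[of _ S]) auto
  qed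
qed

text \<open>The code of the smallest dyadic number of level m that is not below t. Approximation
  from above is what stopping times require.\<close>

definition dix :: "nat \<Rightarrow> real \<Rightarrow> nat" where
  "dix m t = prod_encode (nat \<lceil>2 ^ m * t\<rceil>, m)"

lemma dtime_dix: "0 \<le> t \<Longrightarrow> dtime (dix m t) = of_int \<lceil>2 ^ m * t\<rceil> / 2 ^ m"
  by (simp add: dix_def dtime_encode)

lemma dtime_dix_bounds:
  assumes "0 \<le> t" shows "t \<le> dtime (dix m t)" "dtime (dix m t) < t + 1 / 2 ^ m"
proof -
  have "2 ^ m * t \<le> of_int \<lceil>2 ^ m * t\<rceil>" "of_int \<lceil>2 ^ m * t\<rceil> < 2 ^ m * t + 1" by linarith+
  then show "t \<le> dtime (dix m t)" "dtime (dix m t) < t + 1 / 2 ^ m"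
    unfolding dtime_dix[OF assms] by (simp_all add: field_simps)
qed

lemma dtime_dix_mono: "0 \<le> s \<Longrightarrow> s \<le> t \<Longrightarrow> dtime (dix m s) \<le> dtime (dix m t)"
  by (simp add: dtime_dix divide_right_mono ceiling_mono)

lemma dtime_dix_le: assumes "0 \<le> t" "t \<le> real K" shows "dtime (dix m t) \<le> real K"
proof -
  have "2 ^ m * t \<le> 2 ^ m * real K" using assms by simp
  then have "\<lceil>2 ^ m * t\<rceil> \<le> \<lceil>of_int (2 ^ m * int K) :: real\<rceil>" by (intro ceiling_mono) simp
  then have "\<lceil>2 ^ m * t\<rceil> \<le> 2 ^ m * int K" by (simp only: ceiling_of_int)
  then have "real_of_int \<lceil>2 ^ m * t\<rceil> \<le> of_int (2 ^ m * int K)" by (simp only: of_int_le_iff)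
  then show ?thesis unfolding dtime_dix[OF assms(1)] by (simp add: divide_le_eq mult.commute)
qed

lemma dtime_dix_dtime: assumes "prod_decode i = (k, q)" "q \<le> m" shows "dtime (dix m (dtime i)) = dtime i"
proof -
  obtain r where m: "m = q + r" using assms(2) le_Suc_ex by blast
  have "2 ^ m * dtime i = of_int (int k * 2 ^ r)"
    using assms(1) by (simp add: dtime_def m power_add)
  then have "\<lceil>2 ^ m * dtime i\<rceil> = int k * 2 ^ r" by (simp only: ceiling_of_int)
  then have "dtime (dix m (dtime i)) = real k * 2 ^ r / 2 ^ m" by (simp add: dtime_dix[OF dtime_nonneg])
  also have "\<dots> = dtime i" using assms(1) by (simp add: dtime_def m power_add)
  finally show ?thesis .
qed

lemma dtime_dix_tendsto: assumes "0 \<le> t" shows "(\<lambda>m. dtime (dix m t)) \<longlonglongrightarrow> t"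
proof (rule tendsto_sandwich[of "\<lambda>_. t" _ _ "\<lambda>m. t + 1 / 2 ^ m"])
  show "(\<lambda>m. t + 1 / 2 ^ m) \<longlonglongrightarrow> t" by real_asymp
qed (use dtime_dix_bounds[OF assms] in \<open>auto intro!: always_eventually less_imp_le\<close>)

locale regular_dyadic_path =
  fixes h :: "nat \<Rightarrow> thoma_pt"
  assumes in_thoma: "\<And>i. h i \<in> thoma"
    and consistent: "\<And>a b. dtime a = dtime b \<Longrightarrow> h a = h b"
    and increments: "\<And>j K. \<exists>S\<ge>0. \<forall>m k. k < K * 2 ^ m \<longrightarrow>
      \<bar>test_fun j (h (prod_encode (Suc k, m))) - test_fun j (h (prod_encode (k, m)))\<bar> \<le> S * (9/10) ^ m"
begin

text \<open>\<open>test_fun_dist\<close> reduces closeness to finitely many observables, and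
  chaining bounds each of these by its own constant times (9/10)^q.\<close>

lemma modulus:
  assumes e: "0 < e"
  obtains q where "\<And>a b. dtime a \<le> real K \<Longrightarrow> dtime b \<le> real K \<Longrightarrow> \<bar>dtime a - dtime b\<bar> \<le> 1 / 2 ^ q \<Longrightarrow> dist (h a) (h b) < e"
proof -
  obtain J d where d: "0 < d" and close: "\<And>x y. x \<in> thoma \<Longrightarrow> y \<in> thoma \<Longrightarrow> (\<And>j. j < J \<Longrightarrow> \<bar>test_fun j x - test_fun j y\<bar> < d) \<Longrightarrow> dist x y < e"
    by (rule test_fun_dist[OF e]) (rule that, assumption, blast)
  have "\<forall>j. \<exists>S\<ge>0. \<forall>m k. k < K * 2 ^ m \<longrightarrow>
      \<bar>test_fun j (h (prod_encode (Suc k, m))) - test_fun j (h (prod_encode (k, m)))\<bar> \<le> S * (9/10) ^ m" using increments by blast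
  then obtain S where S: "\<And>j. 0 \<le> S j" and inc: "\<And>j m k. k < K * 2 ^ m \<Longrightarrow>
      \<bar>test_fun j (h (prod_encode (Suc k, m))) - test_fun j (h (prod_encode (k, m)))\<bar> \<le> S j * (9/10) ^ m" by metis
  define s where "s = 1 + (\<Sum>j<J. S j)"
  have s: "0 < s" unfolding s_def using S by (simp add: add_pos_nonneg sum_nonneg)
  obtain q where q: "(9/10 :: real) ^ q < d / (19 * s)" using real_arch_pow_inv[of "d / (19 * s)" "9/10"] d s by auto
  show ?thesis
  proof (rule that[of q])
    fix a b assume ab: "dtime a \<le> real K" "dtime b \<le> real K" "\<bar>dtime a - dtime b\<bar> \<le> 1 / 2 ^ q"
    obtain k m where a: "a = prod_encode (k, m)" by (metis prod_decode_inverse surj_pair)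
    obtain l m' where b: "b = prod_encode (l, m')" by (metis prod_decode_inverse surj_pair)
    show "dist (h a) (h b) < e"
    proof (rule close[OF in_thoma in_thoma])
      fix j assume j: "j < J"
      have cons: "test_fun j (h (prod_encode (2 * k, Suc m))) = test_fun j (h (prod_encode (k, m)))" for k m
        by (intro arg_cong[of _ _ "test_fun j"] consistent) (simp add: dtime_encode)
      have "\<bar>test_fun j (h (prod_encode (k, m))) - test_fun j (h (prod_encode (l, m')))\<bar> \<le> 19 * S j * (9/10) ^ q"
        by (rule dyadic_chaining[of "\<lambda>k m. test_fun j (h (prod_encode (k, m)))" "S j" K, OF cons S inc])
          (use ab in \<open>simp_all add: a b dtime_encode\<close>)
      also have "\<dots> \<le> 19 * s * (9/10) ^ q"
        using member_le_sum[of j "{..<J}" S] j S by (intro mult_right_mono mult_left_mono) (auto simp: s_def)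
      also have "\<dots> < d" using q s by (simp add: field_simps)
      finally show "\<bar>test_fun j (h a) - test_fun j (h b)\<bar> < d" unfolding a b .
    qed
  qed
qed

definition extension :: "real \<Rightarrow> thoma_pt" where
  "extension t = lim (\<lambda>m. h (dix m t))"

lemma extension_tendsto: assumes t: "0 \<le> t" shows "(\<lambda>m. h (dix m t)) \<longlonglongrightarrow> extension t"
proof -
  obtain K where K: "t \<le> real K" using real_arch_simple by blast
  have "Cauchy (\<lambda>m. h (dix m t))"
  proof (rule metric_CauchyI)
    fix e :: real assume "0 < e"
    then obtain q where q: "\<And>a b. dtime a \<le> real K \<Longrightarrow> dtime b \<le> real K \<Longrightarrow> \<bar>dtime a - dtime b\<bar> \<le> 1 / 2 ^ q \<Longrightarrow> dist (h a) (h b) < e"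
      by (rule modulus[where K = K]) (rule that, assumption)
    have near: "dtime (dix m t) \<le> t + 1 / 2 ^ q" if "q \<le> m" for m
    proof -
      have "1 / 2 ^ m \<le> (1 / 2 ^ q :: real)" using that by (simp add: frac_le)
      then show ?thesis using dtime_dix_bounds(2)[OF t, of m] by linarith
    qed
    have "dist (h (dix m t)) (h (dix n t)) < e" if "q \<le> m" "q \<le> n" for m n
      using near[OF that(1)] near[OF that(2)] dtime_dix_bounds(1)[OF t, of m] dtime_dix_bounds(1)[OF t, of n]
      by (intro q dtime_dix_le t K) linarith
    then show "\<exists>q. \<forall>m\<ge>q. \<forall>n\<ge>q. dist (h (dix m t)) (h (dix n t)) < e" by blast
  qed
  moreover have "\<forall>m. h (dix m t) \<in> thoma" using in_thoma by blast
  ultimately obtain l where "(\<lambda>m. h (dix m t)) \<longlonglongrightarrow> l"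
    using completeE[OF compact_imp_complete[OF compact_thoma]] by metis
  then show ?thesis unfolding extension_def using limI by metis
qed

lemma extension_in_thoma: "0 \<le> t \<Longrightarrow> extension t \<in> thoma"
  by (rule closed_sequentially[OF closed_thoma _ extension_tendsto]) (rule in_thoma)

lemma extension_dtime: "extension (dtime i) = h i"
proof -
  obtain k q where i: "prod_decode i = (k, q)" by (metis surj_pair)
  have "eventually (\<lambda>m. h (dix m (dtime i)) = h i) sequentially"
    using eventually_ge_at_top[of q]
  proof eventually_elim
    case (elim m)
    show ?case by (rule consistent) (rule dtime_dix_dtime[OF i elim])
  qed
  then have "(\<lambda>m. h (dix m (dtime i))) \<longlonglongrightarrow> h i" by (rule tendsto_eventually)
  then show ?thesis using extension_tendsto[OF dtime_nonneg] LIMSEQ_unique by blast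
qed

lemma continuous_on_extension: "continuous_on {0..} extension"
  unfolding continuous_on_iff
proof (intro ballI allI impI)
  fix t e :: real assume t: "t \<in> {0..}" and e: "0 < e"
  obtain K where K: "t + 1 \<le> real K" using real_arch_simple by blast
  \<comment> \<open>Half of e is used because the strict bound becomes weak when the dyadic
    approximations pass to the limit.\<close>
  obtain q where q: "\<And>a b. dtime a \<le> real K \<Longrightarrow> dtime b \<le> real K \<Longrightarrow> \<bar>dtime a - dtime b\<bar> \<le> 1 / 2 ^ q \<Longrightarrow> dist (h a) (h b) < e / 2"
    by (rule modulus[of "e / 2", where K = K]) (use e in simp, rule that, assumption)
  have "dist (extension s) (extension t) < e" if s: "s \<in> {0..}" "dist s t < 1 / 2 ^ q" for s
  proof -
    have st: "0 \<le> s" "0 \<le> t" using s t by auto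
    have q1: "1 / 2 ^ q \<le> (1 :: real)" by simp
    have sK: "s \<le> real K" "t \<le> real K" using s(2) K q1 unfolding dist_real_def by linarith+
    have "(\<lambda>m. \<bar>dtime (dix m s) - dtime (dix m t)\<bar>) \<longlonglongrightarrow> \<bar>s - t\<bar>"
      by (intro tendsto_intros dtime_dix_tendsto st)
    then have "eventually (\<lambda>m. \<bar>dtime (dix m s) - dtime (dix m t)\<bar> < 1 / 2 ^ q) sequentially"
      using s(2) unfolding dist_real_def by (rule order_tendstoD(2))
    then have "eventually (\<lambda>m. dist (h (dix m s)) (h (dix m t)) \<le> e / 2) sequentially"
    proof eventually_elim
      case (elim m)
      show ?case using elim by (intro less_imp_le q dtime_dix_le st sK) auto
    qed
    moreover have "(\<lambda>m. dist (h (dix m s)) (h (dix m t))) \<longlonglongrightarrow> dist (extension s) (extension t)"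
      by (intro tendsto_dist extension_tendsto st)
    ultimately have "dist (extension s) (extension t) \<le> e / 2" by (intro tendsto_upperbound) auto
    then show ?thesis using e by linarith
  qed
  then show "\<exists>d>0. \<forall>s\<in>{0..}. dist s t < d \<longrightarrow> dist (extension s) (extension t) < e"
    by (intro exI[of _ "1 / 2 ^ q"]) auto
qed

end

text \<open>Almost every path is regular: increments by \<open>kolmogorov_increments\<close>, and
  consistency because the moment bound is 0 for equal times. The remaining paths are replaced by a
  constant, so that all paths are continuous and stay in the simplex.\<close>

lemma (in prob_space) continuous_version:
  fixes Z :: "nat \<Rightarrow> 'a \<Rightarrow> thoma_pt"
  assumes Z: "\<And>i. Z i \<in> borel_measurable M" and Zt: "\<And>i u. Z i u \<in> thoma"
    and mom: "\<And>j. \<exists>C\<ge>0. \<forall>a b. (\<integral>u. (test_fun j (Z a u) - test_fun j (Z b u)) ^ 4 \<partial>M) \<le> C * (dtime a - dtime b)\<^sup>2"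
  obtains X :: "real \<Rightarrow> 'a \<Rightarrow> thoma_pt" where "\<And>t. 0 \<le> t \<Longrightarrow> X t \<in> borel_measurable M" "\<And>t u. 0 \<le> t \<Longrightarrow> X t u \<in> thoma"
    "\<And>u. continuous_on {0..} (\<lambda>t. X t u)" "\<And>i. AE u in M. X (dtime i) u = Z i u"
proof -
  have Y: "(\<lambda>u. test_fun j (Z i u)) \<in> borel_measurable M" for i j
    by (rule measurable_compose[OF measurable_thoma_spaceI[OF Z Zt] borel_measurable_thoma_space[OF continuous_on_test_fun]])
  have bd: "\<exists>B. \<forall>i u. \<bar>test_fun j (Z i u)\<bar> \<le> B" for j
    by (rule bounded_on_thoma[OF continuous_on_test_fun[of j]]) (use Zt in blast)
  have inc: "AE u in M. \<exists>S\<ge>0. \<forall>m k. k < K * 2 ^ m \<longrightarrow>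
      \<bar>test_fun j (Z (prod_encode (Suc k, m)) u) - test_fun j (Z (prod_encode (k, m)) u)\<bar> \<le> S * (9/10) ^ m" for j K
  proof -
    obtain B where B: "\<And>i u. \<bar>test_fun j (Z i u)\<bar> \<le> B" using bd by blast
    obtain C where C: "0 \<le> C" "\<And>a b. (\<integral>u. (test_fun j (Z a u) - test_fun j (Z b u)) ^ 4 \<partial>M) \<le> C * (dtime a - dtime b)\<^sup>2"
      using mom[of j] by blast
    show ?thesis by (rule kolmogorov_increments[where Y = "\<lambda>i u. test_fun j (Z i u)", OF Y B C(2) C(1)])
  qed
  have eq: "AE u in M. test_fun j (Z a u) = test_fun j (Z b u)" if ab: "dtime a = dtime b" for j a b
  proof -
    obtain B where B: "\<And>i u. \<bar>test_fun j (Z i u)\<bar> \<le> B" using bd by blast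
    let ?d = "\<lambda>u. (test_fun j (Z a u) - test_fun j (Z b u)) ^ 4"
    have int: "integrable M ?d"
    proof (rule integrable_const_bound[of _ "(2 * B) ^ 4"])
      show "AE u in M. norm (?d u) \<le> (2 * B) ^ 4"
      proof (rule AE_I2)
        fix u
        have "\<bar>test_fun j (Z a u) - test_fun j (Z b u)\<bar> \<le> 2 * B" using B[of a u] B[of b u] by linarith
        then show "norm (?d u) \<le> (2 * B) ^ 4" unfolding real_norm_def power_abs by (intro power_mono) auto
      qed
    qed (use Y in measurable)
    obtain C where "\<And>a b. (\<integral>u. (test_fun j (Z a u) - test_fun j (Z b u)) ^ 4 \<partial>M) \<le> C * (dtime a - dtime b)\<^sup>2"
      using mom[of j] by blast
    from this[of a b] have "(\<integral>u. ?d u \<partial>M) \<le> 0" using ab by simp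
    then have "(\<integral>u. ?d u \<partial>M) = 0" by (intro antisym integral_nonneg_AE) auto
    then have "AE u in M. ?d u = 0" using integral_nonneg_eq_0_iff_AE[OF int] by auto
    then show ?thesis by eventually_elim simp
  qed
  have "AE u in M. \<forall>a b j. dtime a = dtime b \<longrightarrow> test_fun j (Z a u) = test_fun j (Z b u)"
    unfolding AE_all_countable
  proof (intro allI)
    fix a b j show "AE u in M. dtime a = dtime b \<longrightarrow> test_fun j (Z a u) = test_fun j (Z b u)"
      using eq[of a b j] by (cases "dtime a = dtime b") auto
  qed
  moreover have "AE u in M. \<forall>j K. \<exists>S\<ge>0. \<forall>m k. k < K * 2 ^ m \<longrightarrow>
      \<bar>test_fun j (Z (prod_encode (Suc k, m)) u) - test_fun j (Z (prod_encode (k, m)) u)\<bar> \<le> S * (9/10) ^ m"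
    unfolding AE_all_countable using inc by blast
  ultimately have "AE u in M. regular_dyadic_path (\<lambda>i. Z i u)"
  proof eventually_elim
    case (elim u)
    show ?case
    proof
      fix a b assume "dtime a = dtime b"
      then have "\<And>j. test_fun j (Z a u) = test_fun j (Z b u)" using elim(1) by blast
      then show "Z a u = Z b u" by (rule test_fun_separates[OF Zt Zt])
    qed (use Zt elim(2) in blast)+
  qed
  then obtain N where N: "{u \<in> space M. \<not> regular_dyadic_path (\<lambda>i. Z i u)} \<subseteq> N" "N \<in> null_sets M"
    by (auto elim!: AE_E simp: null_sets_def)
  define G where "G = space M - N"
  have G: "G \<in> sets M" using N(2) by (auto simp: G_def)
  have reg: "regular_dyadic_path (\<lambda>i. Z i u)" if "u \<in> G" for u using N(1) that unfolding G_def by blast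
  define x0 :: thoma_pt where "x0 = ((\<lambda>_. 0), (\<lambda>_. 0))"
  have x0: "x0 \<in> thoma" using thoma_zero by (simp add: x0_def)
  define X where "X t u = (if u \<in> G then regular_dyadic_path.extension (\<lambda>i. Z i u) t else x0)" for t u
  show ?thesis
  proof (rule that[of X])
    fix t :: real assume t: "0 \<le> t"
    show "X t \<in> borel_measurable M"
    proof (rule borel_measurable_LIMSEQ_metric)
      show "(\<lambda>u. if u \<in> G then Z (dix m t) u else x0) \<in> borel_measurable M" for m
        using G Z by (intro measurable_If_set) auto
      show "(\<lambda>m. if u \<in> G then Z (dix m t) u else x0) \<longlonglongrightarrow> X t u" if "u \<in> space M" for u
        using regular_dyadic_path.extension_tendsto[OF reg t, of u] by (cases "u \<in> G") (simp_all add: X_def)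
    qed
    show "X t u \<in> thoma" for u
      using regular_dyadic_path.extension_in_thoma[OF reg t, of u] x0 by (cases "u \<in> G") (simp_all only: X_def if_True if_False)
  next
    fix u show "continuous_on {0..} (\<lambda>t. X t u)"
      using regular_dyadic_path.continuous_on_extension[OF reg, of u] by (cases "u \<in> G") (simp_all add: X_def cong: if_cong)
  next
    fix i
    have "AE u in M. u \<in> G" using AE_not_in[OF N(2)] AE_space unfolding G_def by eventually_elim simp
    then show "AE u in M. X (dtime i) u = Z i u"
    proof eventually_elim
      case (elim u)
      then show ?case using regular_dyadic_path.extension_dtime[OF reg, of u i] by (simp add: X_def)
    qed
  qed
qed

section \<open>The Markov property at real times\<close>

lemma bump_tendsto_indicator:
  fixes C :: "'a::metric_space set"
  assumes "closed C" "C \<noteq> {}"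
  shows "(\<lambda>k. max 0 (1 - real k * infdist x C)) \<longlonglongrightarrow> indicator C x"
proof (cases "x \<in> C")
  case False
  then have pos: "0 < infdist x C" using assms by (simp add: infdist_pos_not_in_closed)
  obtain k0 where k0: "1 / infdist x C < real k0" using reals_Archimedean2 by blast
  have "eventually (\<lambda>k. max 0 (1 - real k * infdist x C) = 0) sequentially"
    using eventually_ge_at_top[of k0]
  proof eventually_elim
    case (elim k)
    have "1 \<le> real k0 * infdist x C" using k0 pos by (simp add: field_simps)
    also have "\<dots> \<le> real k * infdist x C" using elim pos by (intro mult_right_mono) auto
    finally show ?case by simp
  qed
  then show ?thesis using False tendsto_eventually by simp
qed simp

text \<open>The empty set is treated separately because \<open>infdist x {}\<close> is 0, which
  would make the function constantly 1.\<close>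

definition bump :: "nat \<Rightarrow> 'a::metric_space set \<Rightarrow> 'a \<Rightarrow> real" where
  "bump k C x = (if C = {} then 0 else max 0 (1 - real k * infdist x C))"

lemma bump_tendsto: "closed C \<Longrightarrow> (\<lambda>k. bump k C x) \<longlonglongrightarrow> indicator C x"
  using bump_tendsto_indicator[of C x] by (cases "C = {}") (auto simp: bump_def)

lemma bump_bounds: "0 \<le> bump k C x" "bump k C x \<le> 1"
  by (auto simp: bump_def infdist_nonneg)

lemma continuous_on_bump: "continuous_on S (bump k C)"
  unfolding bump_def by (cases "C = {}") (auto intro!: continuous_intros)

lemma prod_unit_interval:
  assumes "\<And>i. i \<in> I \<Longrightarrow> 0 \<le> f i" "\<And>i. i \<in> I \<Longrightarrow> f i \<le> (1::real)"
  shows "0 \<le> prod f I" "prod f I \<le> 1"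
  using assms by (auto intro!: prod_nonneg prod_le_1)

locale thoma_process = prob_space M for M :: "'a measure" +
  fixes X :: "real \<Rightarrow> 'a \<Rightarrow> thoma_pt"
  assumes X_measurable: "\<And>t. 0 \<le> t \<Longrightarrow> X t \<in> borel_measurable M"
    and X_thoma: "\<And>t u. 0 \<le> t \<Longrightarrow> X t u \<in> thoma"
    and X_continuous: "\<And>u. continuous_on {0..} (\<lambda>t. X t u)"
begin

lemma measurable_fun_X: "0 \<le> t \<Longrightarrow> continuous_on thoma f \<Longrightarrow> (\<lambda>u. f (X t u)) \<in> borel_measurable M"
  by (rule measurable_compose[OF measurable_thoma_spaceI[OF X_measurable X_thoma] borel_measurable_thoma_space])

lemma tendsto_X:
  assumes "s \<longlonglongrightarrow> t" "\<And>m. 0 \<le> s m" shows "(\<lambda>m. X (s m) u) \<longlonglongrightarrow> X t u"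
proof -
  have "0 \<le> t" using assms by (intro LIMSEQ_le_const) auto
  then show ?thesis using assms by (intro continuous_on_tendsto_compose[OF X_continuous]) auto
qed

lemma tendsto_fun_X:
  assumes "continuous_on thoma (f :: thoma_pt \<Rightarrow> real)" "s \<longlonglongrightarrow> t" "\<And>m. 0 \<le> s m"
  shows "(\<lambda>m. f (X (s m) u)) \<longlonglongrightarrow> f (X t u)"
proof -
  have "0 \<le> t" using assms by (intro LIMSEQ_le_const) auto
  then show ?thesis using assms(3) X_thoma
    by (intro continuous_on_tendsto_compose[OF assms(1) tendsto_X[OF assms(2,3)]]) auto
qed

text \<open>All times are rounded up to level m, which preserves their order. The rounded increment
  \<open>S m\<close> only tends to s, so \<open>T (S m) f\<close> has to converge to
  \<open>T s f\<close> uniformly on the simplex, which \<open>semigroup_time_modulus\<close>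
  provides. Continuity of the paths and dominated convergence do the rest.\<close>

lemma markov_from_dyadic:
  assumes adm: "zz'_admissible z z'" and ap: "approximates_semigroup z z' T"
    and Z: "\<And>i. Z i \<in> borel_measurable M" and Zt: "\<And>i u. Z i u \<in> thoma"
    and XZ: "\<And>i. AE u in M. X (dtime i) u = Z i u"
    and mk: "\<And>I g f a b. finite I \<Longrightarrow> (\<And>i. i \<in> I \<Longrightarrow> continuous_on thoma (g i)) \<Longrightarrow> continuous_on thoma f \<Longrightarrow>
        (\<And>i. i \<in> I \<Longrightarrow> dtime i \<le> dtime b) \<Longrightarrow> dtime b \<le> dtime a \<Longrightarrow>
        (\<integral>u. (\<Prod>i\<in>I. g i (Z i u)) * f (Z a u) \<partial>M) = (\<integral>u. (\<Prod>i\<in>I. g i (Z i u)) * T (dtime a - dtime b) f (Z b u) \<partial>M)"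
    and I: "finite I" "\<And>i. i \<in> I \<Longrightarrow> 0 \<le> r i" "\<And>i. i \<in> I \<Longrightarrow> r i \<le> t"
    and g: "\<And>i. i \<in> I \<Longrightarrow> continuous_on thoma (g i)" "\<And>i x. 0 \<le> g i x" "\<And>i x. g i x \<le> 1"
    and f: "continuous_on thoma f" and t: "0 \<le> t" and s: "0 \<le> s"
  shows "(\<integral>u. (\<Prod>i\<in>I. g i (X (r i) u)) * f (X (t + s) u) \<partial>M) = (\<integral>u. (\<Prod>i\<in>I. g i (X (r i) u)) * T s f (X t u) \<partial>M)"
proof -
  have ts: "0 \<le> t + s" using t s by simp
  define d where "d m r = dtime (dix m r)" for m r
  have d0: "0 \<le> d m r" for m r unfolding d_def by (rule dtime_nonneg)
  have dl: "(\<lambda>m. d m r) \<longlonglongrightarrow> r" if "0 \<le> r" for r unfolding d_def by (rule dtime_dix_tendsto[OF that])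
  define S where "S m = d m (t + s) - d m t" for m
  have S0: "0 \<le> S m" for m unfolding S_def d_def using dtime_dix_mono[OF t, of "t + s" m] s by simp
  have Sl: "S \<longlonglongrightarrow> s" using tendsto_diff[OF dl[OF ts] dl[OF t]] by (simp add: S_def[abs_def])
  have S1: "\<bar>S m - s\<bar> \<le> 1" for m
  proof -
    have "(1::real) / 2 ^ m \<le> 1" by simp
    then show ?thesis using dtime_dix_bounds[OF t, of m] dtime_dix_bounds[OF ts, of m] unfolding S_def d_def by linarith
  qed
  have time: "\<exists>L\<ge>0. \<forall>m. \<forall>x\<in>thoma. \<bar>T (S m) f x - T s f x\<bar> \<le> e + L * (S m - s)\<^sup>2" if e: "0 < e" for e :: real
  proof -
    obtain L where L: "0 \<le> L" "\<And>s t x. 0 \<le> s \<Longrightarrow> s \<le> t \<Longrightarrow> x \<in> thoma \<Longrightarrow> \<bar>T t f x - T s f x\<bar> \<le> e + L * (t - s)\<^sup>2"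
      by (rule semigroup_time_modulus[OF adm ap f e]) (rule that, assumption, assumption)
    have "\<bar>T (S m) f x - T s f x\<bar> \<le> e + L * (S m - s)\<^sup>2" if "x \<in> thoma" for m x
    proof (cases "S m \<le> s")
      case True
      show ?thesis using L(2)[OF S0 True that] by (simp add: abs_minus_commute power2_commute)
    qed (use L(2)[OF s _ that] in simp)
    then show ?thesis using L(1) by blast
  qed
  have cT: "continuous_on thoma (T r f)" if "0 \<le> r" for r by (rule semigroup_continuous_on[OF ap that f])
  obtain B where B: "\<And>x. x \<in> thoma \<Longrightarrow> \<bar>f x\<bar> \<le> B" using bounded_on_thoma[OF f] by blast
  obtain BT where BT: "\<And>x. x \<in> thoma \<Longrightarrow> \<bar>T s f x\<bar> \<le> BT" using bounded_on_thoma[OF cT[OF s]] by blast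
  obtain L1 where L1: "0 \<le> L1" "\<And>m x. x \<in> thoma \<Longrightarrow> \<bar>T (S m) f x - T s f x\<bar> \<le> 1 + L1 * (S m - s)\<^sup>2" using time[of 1] by auto
  have BS: "\<bar>T (S m) f x\<bar> \<le> BT + 1 + L1" if x: "x \<in> thoma" for m x
  proof -
    have "(S m - s)\<^sup>2 \<le> 1" using S1[of m] by (simp add: abs_square_le_1)
    then have "L1 * (S m - s)\<^sup>2 \<le> L1 * 1" using L1(1) by (intro mult_left_mono) auto
    then show ?thesis using L1(2)[OF x, of m] BT[OF x] by linarith
  qed
  define G where "G m u = (\<Prod>i\<in>I. g i (X (d m (r i)) u))" for m u
  have G: "0 \<le> G m u" "G m u \<le> 1" for m u unfolding G_def by (intro prod_unit_interval g)+
  have Gm: "G m \<in> borel_measurable M" for m unfolding G_def[abs_def]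
    by (intro borel_measurable_prod measurable_fun_X d0 g)
  have Glim: "(\<lambda>m. G m u) \<longlonglongrightarrow> (\<Prod>i\<in>I. g i (X (r i) u))" for u
    unfolding G_def by (intro tendsto_prod tendsto_fun_X g dl I d0)
  have lm: "(\<lambda>u. \<Prod>i\<in>I. g i (X (r i) u)) \<in> borel_measurable M"
    by (intro borel_measurable_prod measurable_fun_X I g)
  have dyadic: "(\<integral>u. G m u * f (X (d m (t + s)) u) \<partial>M) = (\<integral>u. G m u * T (S m) f (X (d m t) u) \<partial>M)" for m
  proof -
    let ?h = "\<lambda>i. dix m (r i)"
    \<comment> \<open>Several times may be rounded to one dyadic code, so the factors are multiplied
      together code by code.\<close>
    define g' where "g' n x = (\<Prod>i\<in>{i \<in> I. ?h i = n}. g i x)" for n x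
    have g': "continuous_on thoma (g' n)" for n unfolding g'_def[abs_def] using g(1) by (intro continuous_on_prod) auto
    have regroup: "(\<Prod>i\<in>I. g i (Z (?h i) u)) = (\<Prod>n\<in>?h ` I. g' n (Z n u))" for u
      unfolding g'_def prod.image_gen[OF I(1), of _ ?h] by (intro prod.cong refl) auto
    have "AE u in M. \<forall>i. X (dtime i) u = Z i u" unfolding AE_all_countable using XZ by blast
    then have ae: "AE u in M. G m u = (\<Prod>n\<in>?h ` I. g' n (Z n u)) \<and> X (d m (t + s)) u = Z (dix m (t + s)) u \<and> X (d m t) u = Z (dix m t) u"
      by eventually_elim (simp add: G_def d_def regroup[symmetric])
    have Zm: "(\<lambda>u. k (Z i u)) \<in> borel_measurable M" if "continuous_on thoma (k :: thoma_pt \<Rightarrow> real)" for k i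
      by (rule measurable_compose[OF measurable_thoma_spaceI[OF Z Zt] borel_measurable_thoma_space[OF that]])
    have Gm': "(\<lambda>u. \<Prod>n\<in>?h ` I. g' n (Z n u)) \<in> borel_measurable M" by (intro borel_measurable_prod Zm g')
    have "(\<integral>u. G m u * f (X (d m (t + s)) u) \<partial>M) = (\<integral>u. (\<Prod>n\<in>?h ` I. g' n (Z n u)) * f (Z (dix m (t + s)) u) \<partial>M)"
      by (intro integral_cong_AE borel_measurable_times Gm Gm' Zm measurable_fun_X d0 f) (rule eventually_mono[OF ae], simp)
    also have "\<dots> = (\<integral>u. (\<Prod>n\<in>?h ` I. g' n (Z n u)) * T (dtime (dix m (t + s)) - dtime (dix m t)) f (Z (dix m t) u) \<partial>M)"
      by (rule mk) (use I g' f s in \<open>auto intro!: dtime_dix_mono t\<close>)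
    also have "\<dots> = (\<integral>u. (\<Prod>n\<in>?h ` I. g' n (Z n u)) * T (S m) f (Z (dix m t) u) \<partial>M)" by (simp add: S_def d_def)
    also have "\<dots> = (\<integral>u. G m u * T (S m) f (X (d m t) u) \<partial>M)"
      by (intro integral_cong_AE borel_measurable_times Gm Gm' Zm measurable_fun_X d0 cT S0) (rule eventually_mono[OF ae], simp)
    finally show ?thesis .
  qed
  have le1: "\<bar>a * b\<bar> \<le> c" if "0 \<le> a" "a \<le> 1" "\<bar>b\<bar> \<le> c" for a b c :: real
  proof -
    have "\<bar>a\<bar> * \<bar>b\<bar> \<le> 1 * \<bar>b\<bar>" using that by (intro mult_right_mono) auto
    then show ?thesis using that(3) by (simp add: abs_mult)
  qed
  have 1: "(\<lambda>m. \<integral>u. G m u * f (X (d m (t + s)) u) \<partial>M) \<longlonglongrightarrow> (\<integral>u. (\<Prod>i\<in>I. g i (X (r i) u)) * f (X (t + s) u) \<partial>M)"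
  proof (rule integral_dominated_convergence[where w = "\<lambda>_. B"])
    show "(\<lambda>u. (\<Prod>i\<in>I. g i (X (r i) u)) * f (X (t + s) u)) \<in> borel_measurable M" by (intro borel_measurable_times lm measurable_fun_X ts f)
    show "(\<lambda>u. G m u * f (X (d m (t + s)) u)) \<in> borel_measurable M" for m by (intro borel_measurable_times Gm measurable_fun_X d0 f)
    show "AE u in M. (\<lambda>m. G m u * f (X (d m (t + s)) u)) \<longlonglongrightarrow> (\<Prod>i\<in>I. g i (X (r i) u)) * f (X (t + s) u)"
      by (intro AE_I2 tendsto_mult Glim tendsto_fun_X f dl ts d0)
    show "AE u in M. norm (G m u * f (X (d m (t + s)) u)) \<le> B" for m
      unfolding real_norm_def by (intro AE_I2 le1 G B X_thoma d0)
  qed simp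
  have Tl: "(\<lambda>m. T (S m) f (X (d m t) u)) \<longlonglongrightarrow> T s f (X t u)" for u
  proof -
    have "(\<lambda>m. T (S m) f (X (d m t) u) - T s f (X (d m t) u)) \<longlonglongrightarrow> 0"
      unfolding LIMSEQ_def
    proof (intro allI impI)
      fix e :: real assume e: "0 < e"
      obtain L where L: "\<And>m x. x \<in> thoma \<Longrightarrow> \<bar>T (S m) f x - T s f x\<bar> \<le> e / 2 + L * (S m - s)\<^sup>2" using time[of "e / 2"] e by auto
      have "(\<lambda>m. L * (S m - s)\<^sup>2) \<longlonglongrightarrow> L * (s - s)\<^sup>2" by (intro tendsto_intros Sl)
      then have "eventually (\<lambda>m. L * (S m - s)\<^sup>2 < e / 2) sequentially" using e by (intro order_tendstoD(2)[of _ 0]) auto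
      then obtain m0 where m0: "\<And>m. m \<ge> m0 \<Longrightarrow> L * (S m - s)\<^sup>2 < e / 2" unfolding eventually_sequentially by blast
      have "dist (T (S m) f (X (d m t) u) - T s f (X (d m t) u)) 0 < e" if "m \<ge> m0" for m
        unfolding dist_real_def using L[OF X_thoma[OF d0], of m m t u] m0[OF that] by simp
      then show "\<exists>m0. \<forall>m\<ge>m0. dist (T (S m) f (X (d m t) u) - T s f (X (d m t) u)) 0 < e" by blast
    qed
    from tendsto_add[OF this tendsto_fun_X[OF cT[OF s] dl[OF t] d0, of u]] show ?thesis by simp
  qed
  have 2: "(\<lambda>m. \<integral>u. G m u * T (S m) f (X (d m t) u) \<partial>M) \<longlonglongrightarrow> (\<integral>u. (\<Prod>i\<in>I. g i (X (r i) u)) * T s f (X t u) \<partial>M)"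
  proof (rule integral_dominated_convergence[where w = "\<lambda>_. BT + 1 + L1"])
    show "(\<lambda>u. (\<Prod>i\<in>I. g i (X (r i) u)) * T s f (X t u)) \<in> borel_measurable M" by (intro borel_measurable_times lm measurable_fun_X t s cT)
    show "(\<lambda>u. G m u * T (S m) f (X (d m t) u)) \<in> borel_measurable M" for m by (intro borel_measurable_times Gm measurable_fun_X d0 cT S0)
    show "AE u in M. (\<lambda>m. G m u * T (S m) f (X (d m t) u)) \<longlonglongrightarrow> (\<Prod>i\<in>I. g i (X (r i) u)) * T s f (X t u)"
      by (intro AE_I2 tendsto_mult Glim Tl)
    show "AE u in M. norm (G m u * T (S m) f (X (d m t) u)) \<le> BT + 1 + L1" for m
      unfolding real_norm_def by (intro AE_I2 le1 G BS X_thoma d0)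
  qed simp
  show ?thesis using 1 2 unfolding dyadic by (rule LIMSEQ_unique)
qed

end

text \<open>The factors are indexed by pairs of a time and a set, the data of a cylinder, so that
  several constraints at one time are allowed. Values in [0, 1] suffice for the factors, since they
  will be bumps.\<close>

locale markov_thoma_process = thoma_process M X for M :: "'a measure" and X +
  fixes T :: "real \<Rightarrow> (thoma_pt \<Rightarrow> real) \<Rightarrow> thoma_pt \<Rightarrow> real"
  assumes T_continuous: "\<And>t f. 0 \<le> t \<Longrightarrow> continuous_on thoma f \<Longrightarrow> continuous_on thoma (T t f)"
    and markov: "\<And>(I :: (real \<times> thoma_pt set) set) g f t s. finite I \<Longrightarrow> (\<And>i. i \<in> I \<Longrightarrow> 0 \<le> fst i) \<Longrightarrow> (\<And>i. i \<in> I \<Longrightarrow> fst i \<le> t) \<Longrightarrow>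
      (\<And>i. i \<in> I \<Longrightarrow> continuous_on thoma (g i)) \<Longrightarrow> (\<And>i x. 0 \<le> g i x) \<Longrightarrow> (\<And>i x. g i x \<le> 1) \<Longrightarrow>
      continuous_on thoma f \<Longrightarrow> 0 \<le> t \<Longrightarrow> 0 \<le> s \<Longrightarrow>
      (\<integral>u. (\<Prod>i\<in>I. g i (X (fst i) u)) * f (X (t + s) u) \<partial>M) = (\<integral>u. (\<Prod>i\<in>I. g i (X (fst i) u)) * T s f (X t u) \<partial>M)"
begin

section \<open>The natural filtration and the Markov property relative to it\<close>

definition cylinder :: "(real \<times> thoma_pt set) set \<Rightarrow> 'a set" where
  "cylinder I = {u \<in> space M. \<forall>i\<in>I. X (fst i) u \<in> snd i}"

definition cylinders :: "real \<Rightarrow> 'a set set" where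
  "cylinders t = {cylinder I | I. finite I \<and> (\<forall>i\<in>I. 0 \<le> fst i \<and> fst i \<le> t \<and> closed (snd i))}"

definition filt :: "real \<Rightarrow> 'a measure" where
  "filt t = sigma (space M) (cylinders t)"

lemma cylinders_Pow: "cylinders t \<subseteq> Pow (space M)"
  unfolding cylinders_def cylinder_def by blast

lemma Int_stable_cylinders: "Int_stable (cylinders t)"
proof (rule Int_stableI)
  fix a b assume "a \<in> cylinders t" "b \<in> cylinders t"
  then obtain I J where I: "a = cylinder I" "finite I" "\<forall>i\<in>I. 0 \<le> fst i \<and> fst i \<le> t \<and> closed (snd i)"
    and J: "b = cylinder J" "finite J" "\<forall>i\<in>J. 0 \<le> fst i \<and> fst i \<le> t \<and> closed (snd i)"
    unfolding cylinders_def by blast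
  have "a \<inter> b = cylinder (I \<union> J)" unfolding I J cylinder_def by blast
  moreover have "finite (I \<union> J)" "\<forall>i\<in>I \<union> J. 0 \<le> fst i \<and> fst i \<le> t \<and> closed (snd i)" using I J by blast+
  ultimately show "a \<inter> b \<in> cylinders t" unfolding cylinders_def by blast
qed

lemma cylinders_mono: "s \<le> t \<Longrightarrow> cylinders s \<subseteq> cylinders t"
  unfolding cylinders_def by fastforce

lemma cylinder_sets:
  assumes "finite I" "\<forall>i\<in>I. 0 \<le> fst i \<and> fst i \<le> t \<and> closed (snd i)" shows "cylinder I \<in> sets M"
proof -
  have "{u \<in> space M. X (fst i) u \<in> snd i} \<in> sets M" if "i \<in> I" for i
  proof -
    have "X (fst i) -` snd i \<inter> space M \<in> sets M" using assms that by (intro measurable_sets[OF X_measurable] borel_closed) auto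
    moreover have "X (fst i) -` snd i \<inter> space M = {u \<in> space M. X (fst i) u \<in> snd i}" by blast
    ultimately show ?thesis by simp
  qed
  then show ?thesis unfolding cylinder_def by (rule sets.sets_Collect_finite_All) (assumption, rule assms(1))
qed

lemma cylinders_sets: "cylinders t \<subseteq> sets M"
  unfolding cylinders_def using cylinder_sets by blast

lemma space_filt: "space (filt t) = space M"
  unfolding filt_def by (rule space_measure_of[OF cylinders_Pow])

lemma sets_filt: "sets (filt t) = sigma_sets (space M) (cylinders t)"
  unfolding filt_def by (rule sets_measure_of[OF cylinders_Pow])

lemma sets_filt_subset: "sets (filt t) \<subseteq> sets M"
  unfolding sets_filt by (rule sets.sigma_sets_subset[OF cylinders_sets])

lemma sets_filt_mono: "s \<le> t \<Longrightarrow> sets (filt s) \<subseteq> sets (filt t)"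
  unfolding sets_filt by (intro sigma_sets_mono' cylinders_mono)

lemma X_filt: assumes "0 \<le> s" "s \<le> t" shows "X s \<in> borel_measurable (filt t)"
  unfolding borel_eq_closed
proof (rule measurable_measure_of)
  fix C :: "thoma_pt set" assume C: "C \<in> Collect closed"
  have "X s -` C \<inter> space (filt t) = cylinder {(s, C)}" unfolding cylinder_def space_filt by auto
  also have "\<dots> \<in> cylinders t" unfolding cylinders_def using assms C by force
  finally show "X s -` C \<inter> space (filt t) \<in> sets (filt t)" unfolding sets_filt by (rule sigma_sets.Basic)
qed auto

lemma fun_X_filt: "0 \<le> s \<Longrightarrow> s \<le> t \<Longrightarrow> continuous_on thoma f \<Longrightarrow> (\<lambda>u. f (X s u)) \<in> borel_measurable (filt t)"
  by (rule measurable_compose[OF measurable_thoma_spaceI[OF X_filt X_thoma] borel_measurable_thoma_space])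

lemma integrable_fun_X:
  assumes "0 \<le> t" "continuous_on thoma (f :: thoma_pt \<Rightarrow> real)" shows "integrable M (\<lambda>u. f (X t u))"
proof -
  obtain B where "\<And>x. x \<in> thoma \<Longrightarrow> \<bar>f x\<bar> \<le> B" using bounded_on_thoma[OF assms(2)] by blast
  then show ?thesis using X_thoma[OF assms(1)] measurable_fun_X[OF assms] by (intro integrable_const_bound[of _ B]) auto
qed

text \<open>The indicator of a closed cylinder is a limit of products of bumps, to which the Markov
  property for continuous factors applies.\<close>

lemma markov_cylinder:
  assumes I: "finite I" "\<forall>i\<in>I. 0 \<le> fst i \<and> fst i \<le> t \<and> closed (snd i)"
    and f: "continuous_on thoma f" and t: "0 \<le> t" and s: "0 \<le> s"
  shows "(\<integral>u. indicator (cylinder I) u * f (X (t + s) u) \<partial>M) = (\<integral>u. indicator (cylinder I) u * T s f (X t u) \<partial>M)"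
proof -
  define G where "G k u = (\<Prod>i\<in>I. bump k (snd i) (X (fst i) u))" for k u
  have G: "0 \<le> G k u" "G k u \<le> 1" for k u unfolding G_def by (intro prod_unit_interval bump_bounds)+
  have Gm: "G k \<in> borel_measurable M" for k unfolding G_def[abs_def]
    using I by (intro borel_measurable_prod measurable_fun_X continuous_on_bump) auto
  have Gl: "(\<lambda>k. G k u) \<longlonglongrightarrow> indicator (cylinder I) u" if u: "u \<in> space M" for u
  proof -
    have "(\<lambda>k. G k u) \<longlonglongrightarrow> (\<Prod>i\<in>I. indicator (snd i) (X (fst i) u))" unfolding G_def using I by (intro tendsto_prod bump_tendsto) auto
    also have "(\<Prod>i\<in>I. indicator (snd i) (X (fst i) u)) = (indicator (cylinder I) u :: real)"
    proof (cases "u \<in> cylinder I")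
      case True
      then show ?thesis by (simp add: cylinder_def)
    next
      case False
      then obtain i where "i \<in> I" "X (fst i) u \<notin> snd i" using u unfolding cylinder_def by blast
      then have "(\<Prod>i\<in>I. indicator (snd i) (X (fst i) u) :: real) = 0" using I(1) by (intro prod_zero) (auto intro!: bexI[of _ i])
      then show ?thesis using False by simp
    qed
    finally show ?thesis .
  qed
  have lim: "(\<lambda>k. \<integral>u. G k u * f (X t u) \<partial>M) \<longlonglongrightarrow> (\<integral>u. indicator (cylinder I) u * f (X t u) \<partial>M)"
    if f: "continuous_on thoma f" and t: "0 \<le> t" for f t
  proof (rule integral_dominated_convergence[where w = "\<lambda>u. \<bar>f (X t u)\<bar>"])
    show "(\<lambda>u. indicator (cylinder I) u * f (X t u)) \<in> borel_measurable M"
      by (intro borel_measurable_times borel_measurable_indicator cylinder_sets[OF I] measurable_fun_X f t)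
    show "(\<lambda>u. G k u * f (X t u)) \<in> borel_measurable M" for k by (intro borel_measurable_times Gm measurable_fun_X f t)
    show "integrable M (\<lambda>u. \<bar>f (X t u)\<bar>)" by (intro integrable_abs integrable_fun_X f t)
    show "AE u in M. (\<lambda>k. G k u * f (X t u)) \<longlonglongrightarrow> indicator (cylinder I) u * f (X t u)"
      by (intro AE_I2 tendsto_mult Gl tendsto_const)
    show "AE u in M. norm (G k u * f (X t u)) \<le> \<bar>f (X t u)\<bar>" for k
      using G by (intro AE_I2) (simp add: abs_mult mult_left_le_one_le)
  qed
  have "(\<integral>u. G k u * f (X (t + s) u) \<partial>M) = (\<integral>u. G k u * T s f (X t u) \<partial>M)" for k
    unfolding G_def using I by (intro markov continuous_on_bump bump_bounds f t s) auto
  then show ?thesis using lim[OF f, of "t + s"] lim[OF T_continuous[OF s f] t] t s LIMSEQ_unique by auto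
qed

text \<open>Closed cylinders are stable under intersection and generate the filtration, so Dynkin's
  theorem extends the identity from cylinders to all events of time t.\<close>

lemma markov_filt:
  assumes A: "A \<in> sets (filt t)" and f: "continuous_on thoma f" and t: "0 \<le> t" and s: "0 \<le> s"
  shows "(\<integral>u. indicator A u * f (X (t + s) u) \<partial>M) = (\<integral>u. indicator A u * T s f (X t u) \<partial>M)"
proof -
  let ?f = "\<lambda>u. f (X (t + s) u)" and ?g = "\<lambda>u. T s f (X t u)"
  have if': "integrable M ?f" using t s f by (intro integrable_fun_X) auto
  have ig: "integrable M ?g" by (intro integrable_fun_X T_continuous t s f)
  have si: "set_integrable M A h" if "A \<in> sets M" "integrable M h" for A and h :: "'a \<Rightarrow> real"
    using that unfolding set_integrable_def by (intro integrable_mult_indicator)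
  have "A \<in> sigma_sets (space M) (cylinders t)" using A by (simp only: sets_filt)
  with Int_stable_cylinders cylinders_Pow have "(LINT u:A|M. ?f u) = (LINT u:A|M. ?g u)"
  proof (induction rule: sigma_sets_induct_disjoint)
    case (basic A)
    then obtain I where "A = cylinder I" "finite I" "\<forall>i\<in>I. 0 \<le> fst i \<and> fst i \<le> t \<and> closed (snd i)" unfolding cylinders_def by blast
    then show ?case using markov_cylinder[OF _ _ f t s, of I] by (simp add: set_lebesgue_integral_def)
  next
    case empty
    then show ?case by (simp add: set_lebesgue_integral_def)
  next
    case (compl A)
    have AM: "A \<in> sets M" using compl(1) sets_filt_subset by (auto simp: sets_filt)
    have sp: "(LINT u:space M|M. ?f u) = (LINT u:space M|M. ?g u)"
    proof -
      \<comment> \<open>The cylinder without constraints gives the identity on the whole space, from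
        which complements follow by subtraction.\<close>
      have "cylinder {} = space M" by (simp add: cylinder_def)
      then show ?thesis using markov_cylinder[OF _ _ f t s, of "{}"] by (simp add: set_lebesgue_integral_def)
    qed
    have split: "(LINT u:space M - A|M. h u) = (LINT u:space M|M. h u) - (LINT u:A|M. h u)" if "integrable M h" for h :: "'a \<Rightarrow> real"
    proof -
      have "(LINT u:A \<union> (space M - A)|M. h u) = (LINT u:A|M. h u) + (LINT u:space M - A|M. h u)"
        using AM that by (intro set_integral_Un si) auto
      moreover have "A \<union> (space M - A) = space M" using sets.sets_into_space[OF AM] by blast
      ultimately show ?thesis by simp
    qed
    show ?case using split[OF if'] split[OF ig] sp compl(2) by simp
  next
    case (union A)
    have AM: "A i \<in> sets M" for i using union(2) sets_filt_subset by (auto simp: sets_filt)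
    have "(LINT u:(\<Union>i. A i)|M. h u) = (\<Sum>i. LINT u:A i|M. h u)" if "integrable M h" for h :: "'a \<Rightarrow> real"
      using union(1) AM that by (intro lebesgue_integral_countable_add si) (auto simp: disjoint_family_on_def)
    then show ?case using if' ig union(3) by simp
  qed
  then show ?thesis by (simp add: set_lebesgue_integral_def)
qed

end

context markov_thoma_process begin

section \<open>Stopping times and the strong Markov property\<close>

lemma stopping_time_measurable:
  assumes "is_stopping_time M filt \<tau>" shows "\<tau> \<in> borel_measurable M"
proof (rule borel_measurableI_le)
  fix y show "{u \<in> space M. \<tau> u \<le> y} \<in> sets M"
  proof (cases y)
    case (real r)
    then show ?thesis using assms sets_filt_subset unfolding is_stopping_time_def by blast
  qed simp
qed

lemma dix_measurable: "g \<in> borel_measurable N \<Longrightarrow> (\<lambda>u. dix m (g u)) \<in> measurable N (count_space UNIV)"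
proof -
  assume "g \<in> borel_measurable N"
  then have "(\<lambda>u. \<lceil>2 ^ m * g u\<rceil>) \<in> measurable N (count_space UNIV)" by measurable
  then show ?thesis unfolding dix_def by (rule measurable_compose) simp
qed

text \<open>At a random time with countably many values measurability is patched together from fixed
  times; a general random time is the limit of its dyadic approximations, by continuity of the
  paths.\<close>

lemma fun_X_random_time_measurable:
  assumes g: "g \<in> borel_measurable M" "\<And>u. 0 \<le> g u" and f: "continuous_on thoma (f :: thoma_pt \<Rightarrow> real)" and s: "0 \<le> s"
  shows "(\<lambda>u. f (X (g u + s) u)) \<in> borel_measurable M"
    "(\<lambda>u. f (X (dtime (dix m (g u)) + s) u)) \<in> borel_measurable M"
    "(\<lambda>m. f (X (dtime (dix m (g u)) + s) u)) \<longlonglongrightarrow> f (X (g u + s) u)"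
proof -
  have pos: "0 \<le> dtime i + s" for i using dtime_nonneg[of i] s by simp
  show 1: "(\<lambda>u. f (X (dtime (dix m (g u)) + s) u)) \<in> borel_measurable M" for m
    by (rule measurable_compose_countable[where f = "\<lambda>i u. f (X (dtime i + s) u)", OF measurable_fun_X[OF pos f] dix_measurable[OF g(1)]])
  show 2: "(\<lambda>m. f (X (dtime (dix m (g u)) + s) u)) \<longlonglongrightarrow> f (X (g u + s) u)" for u
    by (intro tendsto_fun_X f tendsto_add dtime_dix_tendsto g tendsto_const pos)
  show "(\<lambda>u. f (X (g u + s) u)) \<in> borel_measurable M"
    by (rule borel_measurable_LIMSEQ_real[OF 2 1])
qed

text \<open>On this event the rounded time is k / 2^m and is not below the stopping time. The event
  is the difference of two sublevel events, or a single one for k = 0, and hence known at time k /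
  2^m.\<close>

lemma pre_tau_level:
  assumes tau: "is_stopping_time M filt \<tau>" and A: "A \<in> pre_tau_sets M filt \<tau>"
  shows "{u \<in> A. \<tau> u < \<infinity> \<and> nat \<lceil>2 ^ m * enn2real (\<tau> u)\<rceil> = k} \<in> sets (filt (real k / 2 ^ m))" (is "?E \<in> _")
proof -
  have L: "{u \<in> A. \<tau> u \<le> ennreal t} \<in> sets (filt t)" if "0 \<le> t" for t
    using A that unfolding pre_tau_sets_def by blast
  define N where "N u = nat \<lceil>2 ^ m * enn2real (\<tau> u)\<rceil>" for u
  have level: "\<tau> u \<le> ennreal (real l / 2 ^ m) \<longleftrightarrow> \<tau> u < \<infinity> \<and> N u \<le> l" for u l
  proof (cases "\<tau> u")
    case (real r)
    have "\<tau> u \<le> ennreal (real l / 2 ^ m) \<longleftrightarrow> r \<le> real l / 2 ^ m" using real by (simp add: ennreal_le_iff)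
    also have "\<dots> \<longleftrightarrow> 2 ^ m * r \<le> of_int (int l)" by (simp add: field_simps)
    also have "\<dots> \<longleftrightarrow> nat \<lceil>2 ^ m * r\<rceil> \<le> l" unfolding ceiling_le_iff[symmetric] by linarith
    finally show ?thesis using real by (simp add: N_def)
  qed (simp add: top_unique)
  have EN: "?E = {u \<in> A. \<tau> u < \<infinity> \<and> N u = k}" by (simp only: N_def)
  show ?thesis
  proof (cases k)
    case 0
    have "?E = {u \<in> A. \<tau> u \<le> ennreal (real k / 2 ^ m)}" unfolding EN level using 0 by auto
    then show ?thesis using L[of "real k / 2 ^ m"] by simp
  next
    case (Suc l)
    have "?E = {u \<in> A. \<tau> u \<le> ennreal (real k / 2 ^ m)} - {u \<in> A. \<tau> u \<le> ennreal (real l / 2 ^ m)}" unfolding EN level using Suc by auto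
    moreover have "{u \<in> A. \<tau> u \<le> ennreal (real l / 2 ^ m)} \<in> sets (filt (real k / 2 ^ m))"
    proof -
      have "real l / 2 ^ m \<le> real k / 2 ^ m" unfolding Suc by (simp add: divide_right_mono)
      then show ?thesis using sets_filt_mono L[of "real l / 2 ^ m"] by auto
    qed
    ultimately show ?thesis using L[of "real k / 2 ^ m"] by auto
  qed
qed

lemma integrable_stopped:
  assumes tau: "is_stopping_time M filt \<tau>" and f: "continuous_on thoma (f :: thoma_pt \<Rightarrow> real)" and s: "0 \<le> s" and B: "B \<in> sets M"
  shows "integrable M (\<lambda>u. indicator B u * f (X (enn2real (\<tau> u) + s) u))"
    "integrable M (\<lambda>u. indicator B u * f (X (dtime (dix m (enn2real (\<tau> u))) + s) u))"
    "(\<lambda>m. \<integral>u. indicator B u * f (X (dtime (dix m (enn2real (\<tau> u))) + s) u) \<partial>M)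
        \<longlonglongrightarrow> (\<integral>u. indicator B u * f (X (enn2real (\<tau> u) + s) u) \<partial>M)"
proof -
  have g: "(\<lambda>u. enn2real (\<tau> u)) \<in> borel_measurable M" using stopping_time_measurable[OF tau] by measurable
  note m = fun_X_random_time_measurable[OF g enn2real_nonneg f s]
  obtain b where b: "\<And>x. x \<in> thoma \<Longrightarrow> \<bar>f x\<bar> \<le> b" using bounded_on_thoma[OF f] by blast
  have nb: "norm (indicator B u * f (X r u)) \<le> b" if "0 \<le> r" for u r
    using b[OF X_thoma[OF that, of u]] by (auto simp: indicator_def)
  have p: "0 \<le> enn2real (\<tau> u) + s" "0 \<le> dtime (dix m (enn2real (\<tau> u))) + s" for u m
    using s dtime_nonneg by auto
  show "integrable M (\<lambda>u. indicator B u * f (X (enn2real (\<tau> u) + s) u))"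
    by (rule integrable_const_bound[of _ b]) (intro AE_I2 nb p, intro borel_measurable_times borel_measurable_indicator B m)
  show "integrable M (\<lambda>u. indicator B u * f (X (dtime (dix m (enn2real (\<tau> u))) + s) u))"
    by (rule integrable_const_bound[of _ b]) (intro AE_I2 nb p, intro borel_measurable_times borel_measurable_indicator B m)
  show "(\<lambda>m. \<integral>u. indicator B u * f (X (dtime (dix m (enn2real (\<tau> u))) + s) u) \<partial>M)
        \<longlonglongrightarrow> (\<integral>u. indicator B u * f (X (enn2real (\<tau> u) + s) u) \<partial>M)"
  proof (rule integral_dominated_convergence[where w = "\<lambda>_. b"])
    show "(\<lambda>u. indicator B u * f (X (enn2real (\<tau> u) + s) u)) \<in> borel_measurable M"
      "(\<lambda>u. indicator B u * f (X (dtime (dix m (enn2real (\<tau> u))) + s) u)) \<in> borel_measurable M" for m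
      by (intro borel_measurable_times borel_measurable_indicator B m)+
    show "AE u in M. (\<lambda>m. indicator B u * f (X (dtime (dix m (enn2real (\<tau> u))) + s) u)) \<longlonglongrightarrow> indicator B u * f (X (enn2real (\<tau> u) + s) u)"
      by (intro AE_I2 tendsto_mult tendsto_const m)
    show "AE u in M. norm (indicator B u * f (X (dtime (dix m (enn2real (\<tau> u))) + s) u)) \<le> b" for m by (intro AE_I2 nb p)
  qed simp
qed

text \<open>Split the event according to the value k / 2^m of the rounded stopping time, apply
  \<open>markov_filt\<close> at that fixed time on every piece, and sum. As m grows, both sides
  converge because the paths, \<open>f\<close> and \<open>T s f\<close> are continuous.\<close>

lemma strong_markov:
  assumes tau: "is_stopping_time M filt \<tau>" and A: "A \<in> pre_tau_sets M filt \<tau>"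
    and f: "continuous_on thoma f" and s: "0 \<le> s"
  shows "(\<integral>u. indicator (A \<inter> {u. \<tau> u < \<infinity>}) u * f (X (enn2real (\<tau> u) + s) u) \<partial>M)
       = (\<integral>u. indicator (A \<inter> {u. \<tau> u < \<infinity>}) u * T s f (X (enn2real (\<tau> u)) u) \<partial>M)"
proof -
  define B where "B = A \<inter> {u. \<tau> u < \<infinity>}"
  define E where "E m k = {u \<in> A. \<tau> u < \<infinity> \<and> nat \<lceil>2 ^ m * enn2real (\<tau> u)\<rceil> = k}" for m k
  have E: "E m k \<in> sets (filt (real k / 2 ^ m))" for m k unfolding E_def by (rule pre_tau_level[OF tau A])
  have EM: "E m k \<in> sets M" for m k using E sets_filt_subset by blast
  have BE: "B = (\<Union>k. E m k)" for m unfolding B_def E_def by auto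
  have BM: "B \<in> sets M" unfolding BE[of 0] using EM by (intro sets.countable_UN) auto
  have sum: "(\<integral>u. indicator B u * h (X (dtime (dix m (enn2real (\<tau> u))) + s) u) \<partial>M) = (\<Sum>k. \<integral>u. indicator (E m k) u * h (X (real k / 2 ^ m + s) u) \<partial>M)"
    if h: "continuous_on thoma (h :: thoma_pt \<Rightarrow> real)" and s: "0 \<le> s" for h s m
  proof -
    let ?h = "\<lambda>u. h (X (dtime (dix m (enn2real (\<tau> u))) + s) u)"
    have "(LINT u:(\<Union>k. E m k)|M. ?h u) = (\<Sum>k. LINT u:E m k|M. ?h u)"
    proof (rule lebesgue_integral_countable_add[OF EM])
      show "E m i \<inter> E m j = {}" if "i \<noteq> j" for i j using that unfolding E_def by blast
      show "set_integrable M (\<Union>k. E m k) ?h"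
        unfolding set_integrable_def real_scaleR_def BE[symmetric] by (rule integrable_stopped(2)[OF tau h s BM])
    qed
    moreover have "(LINT u:E m k|M. ?h u) = (\<integral>u. indicator (E m k) u * h (X (real k / 2 ^ m + s) u) \<partial>M)" for k
      unfolding set_lebesgue_integral_def real_scaleR_def
    proof (rule Bochner_Integration.integral_cong[OF refl])
      fix u show "indicator (E m k) u * ?h u = indicator (E m k) u * h (X (real k / 2 ^ m + s) u)"
        by (cases "u \<in> E m k") (simp_all add: E_def dix_def dtime_encode)
    qed
    ultimately show ?thesis unfolding BE[symmetric] by (simp add: set_lebesgue_integral_def)
  qed
  \<comment> \<open>The summand 0 on the right puts both sides into the shape of \<open>sum\<close>,
    with increments s and 0.\<close>
  have "(\<integral>u. indicator B u * f (X (dtime (dix m (enn2real (\<tau> u))) + s) u) \<partial>M) = (\<integral>u. indicator B u * T s f (X (dtime (dix m (enn2real (\<tau> u))) + 0) u) \<partial>M)" for m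
    unfolding sum[OF f s] sum[OF T_continuous[OF s f] order_refl] using markov_filt[OF E f _ s] by simp
  then have "(\<integral>u. indicator B u * f (X (enn2real (\<tau> u) + s) u) \<partial>M) = (\<integral>u. indicator B u * T s f (X (enn2real (\<tau> u) + 0) u) \<partial>M)"
    using integrable_stopped(3)[OF tau f s BM] integrable_stopped(3)[OF tau T_continuous[OF s f] order_refl BM] LIMSEQ_unique by simp
  then show ?thesis by (simp add: B_def)
qed

text \<open>For fixed t replace the stopping time by its minimum with t, called \<sigma>. The state
  at \<sigma> is measurable at time t and agrees with the stopped state where the stopping time is
  at most t.\<close>

lemma stopped_pre_tau_measurable:
  assumes tau: "is_stopping_time M filt \<tau>" and f: "continuous_on thoma (f :: thoma_pt \<Rightarrow> real)"
  shows "(\<lambda>u. indicator {u. \<tau> u < \<infinity>} u * f (X (enn2real (\<tau> u)) u)) \<in> borel_measurable (sigma (space M) (pre_tau_sets M filt \<tau>))"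
    (is "?g \<in> _")
proof (rule borel_measurableI_le)
  fix y
  have Pow: "pre_tau_sets M filt \<tau> \<subseteq> Pow (space M)" unfolding pre_tau_sets_def using sets.sets_into_space by blast
  have tm: "\<tau> \<in> borel_measurable M" by (rule stopping_time_measurable[OF tau])
  have "{u \<in> space M. ?g u \<le> y} \<in> pre_tau_sets M filt \<tau>"
    unfolding pre_tau_sets_def
  proof (intro CollectI conjI allI impI)
    have "(\<lambda>u. f (X (enn2real (\<tau> u) + 0) u)) \<in> borel_measurable M"
      using tm by (intro fun_X_random_time_measurable f) auto
    moreover have "(indicator {u. \<tau> u < \<infinity>} :: 'a \<Rightarrow> real) \<in> borel_measurable M"
      using tm by (intro borel_measurable_indicator') measurable
    ultimately have "?g \<in> borel_measurable M" by simp
    then show "{u \<in> space M. ?g u \<le> y} \<in> sets M" by measurable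
  next
    fix t :: real assume t: "0 \<le> t"
    define \<sigma> where "\<sigma> u = (if \<tau> u \<le> ennreal t then enn2real (\<tau> u) else t)" for u
    have \<sigma>: "0 \<le> \<sigma> u" for u using t by (simp add: \<sigma>_def)
    have \<sigma>t: "\<sigma> u \<le> t" for u using t by (cases "\<tau> u") (auto simp: \<sigma>_def ennreal_le_iff)
    have L: "{u \<in> space M. \<tau> u \<le> ennreal r} \<in> sets (filt t)" if "0 \<le> r" "r \<le> t" for r
      using tau that sets_filt_mono[OF that(2)] unfolding is_stopping_time_def by blast
    have "\<sigma> \<in> borel_measurable (filt t)"
    proof (rule borel_measurableI_le)
      fix r
      consider "t \<le> r" | "r < 0" | "0 \<le> r" "r < t" by linarith
      then show "{u \<in> space (filt t). \<sigma> u \<le> r} \<in> sets (filt t)"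
      proof cases
        case 1
        have "\<sigma> u \<le> r" for u using \<sigma>t[of u] 1 by linarith
        then have "{u \<in> space (filt t). \<sigma> u \<le> r} = space (filt t)" by blast
        then show ?thesis by (simp only: sets.top)
      next
        case 2
        have "\<not> \<sigma> u \<le> r" for u using 2 \<sigma>[of u] by linarith
        then have "{u \<in> space (filt t). \<sigma> u \<le> r} = {}" by blast
        then show ?thesis by (simp only: sets.empty_sets)
      next
        case 3
        have "\<sigma> u \<le> r \<longleftrightarrow> \<tau> u \<le> ennreal r" for u
        proof (cases "\<tau> u")
          case (real a)
          then have "\<tau> u \<le> ennreal t \<longleftrightarrow> a \<le> t" "\<tau> u \<le> ennreal r \<longleftrightarrow> a \<le> r" "enn2real (\<tau> u) = a" using 3 t by (simp_all add: ennreal_le_iff)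
          then show ?thesis using 3 unfolding \<sigma>_def by simp
        next
          case top
          then show ?thesis using 3 by (simp add: \<sigma>_def top_unique)
        qed
        then show ?thesis using L[of r] 3 by (simp add: space_filt)
      qed
    qed
    then have dm: "(\<lambda>u. dix m (\<sigma> u)) \<in> measurable (filt t) (count_space UNIV)" for m by (rule dix_measurable)
    have "(\<lambda>u. f (X (\<sigma> u) u)) \<in> borel_measurable (filt t)"
    proof (rule borel_measurable_LIMSEQ_real)
      \<comment> \<open>The cap at t is essential: dyadic approximations from above would otherwise
        look beyond time t.\<close>
      show "(\<lambda>u. f (X (min t (dtime (dix m (\<sigma> u)))) u)) \<in> borel_measurable (filt t)" for m
        by (rule measurable_compose_countable[where f = "\<lambda>i u. f (X (min t (dtime i)) u)", OF fun_X_filt[OF _ _ f] dm])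
          (use t dtime_nonneg in auto)
      show "(\<lambda>m. f (X (min t (dtime (dix m (\<sigma> u)))) u)) \<longlonglongrightarrow> f (X (\<sigma> u) u)" for u
      proof (rule tendsto_fun_X[OF f])
        have "(\<lambda>m. min t (dtime (dix m (\<sigma> u)))) \<longlonglongrightarrow> min t (\<sigma> u)" by (intro tendsto_min tendsto_const dtime_dix_tendsto \<sigma>)
        moreover have "min t (\<sigma> u) = \<sigma> u" using \<sigma>t[of u] by simp
        ultimately show "(\<lambda>m. min t (dtime (dix m (\<sigma> u)))) \<longlonglongrightarrow> \<sigma> u" by (simp only:)
      qed (use t dtime_nonneg in simp)
    qed
    then have "{u \<in> space (filt t). f (X (\<sigma> u) u) \<le> y} \<in> sets (filt t)" by measurable
    then have "{u \<in> space M. f (X (\<sigma> u) u) \<le> y} \<inter> {u \<in> space M. \<tau> u \<le> ennreal t} \<in> sets (filt t)"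
      using L[of t] t by (intro sets.Int) (simp_all add: space_filt)
    also have "{u \<in> space M. f (X (\<sigma> u) u) \<le> y} \<inter> {u \<in> space M. \<tau> u \<le> ennreal t} = {u \<in> {u \<in> space M. ?g u \<le> y}. \<tau> u \<le> ennreal t}"
    proof -
      have "?g u = f (X (\<sigma> u) u)" if "\<tau> u \<le> ennreal t" for u
        using that le_less_trans[OF that ennreal_less_top] by (simp add: \<sigma>_def)
      then show ?thesis by auto
    qed
    finally show "{u \<in> {u \<in> space M. ?g u \<le> y}. \<tau> u \<le> ennreal t} \<in> sets (filt t)" .
  qed
  then show "{u \<in> space (sigma (space M) (pre_tau_sets M filt \<tau>)). ?g u \<le> y} \<in> sets (sigma (space M) (pre_tau_sets M filt \<tau>))"
    unfolding space_measure_of[OF Pow] sets_measure_of[OF Pow] by (rule sigma_sets.Basic)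
qed

lemma diffusion:
  assumes "distr M thoma_space (X 0) = mu" shows "is_diffusion T mu M filt X"
  unfolding is_diffusion_def
proof (intro conjI allI impI)
  show "prob_space M" by (rule prob_space_axioms)
  show "is_filtration M filt" unfolding is_filtration_def using space_filt sets_filt_subset sets_filt_mono by blast
  show "X t \<in> measurable (filt t) thoma_space" if "0 \<le> t" for t
    by (rule measurable_thoma_spaceI[OF X_filt[OF that order_refl] X_thoma[OF that]])
  show "AE u in M. continuous_on {0..} (\<lambda>t. X t u)" using X_continuous by (intro AE_I2)
next
  fix \<tau> and s :: real and f :: "thoma_pt \<Rightarrow> real" and A
  assume a: "is_stopping_time M filt \<tau> \<and> 0 \<le> s \<and> continuous_on thoma f \<and> A \<in> pre_tau_sets M filt \<tau>"
  then have tau: "is_stopping_time M filt \<tau>" and s: "0 \<le> s" and f: "continuous_on thoma f" and A: "A \<in> pre_tau_sets M filt \<tau>" by blast+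
  define B where "B = A \<inter> {u. \<tau> u < \<infinity>}"
  have "B = A \<inter> {u \<in> space M. \<tau> u < \<infinity>}" using A sets.sets_into_space unfolding B_def pre_tau_sets_def by blast
  moreover have "{u \<in> space M. \<tau> u < \<infinity>} \<in> sets M" using stopping_time_measurable[OF tau] by measurable
  ultimately have B: "B \<in> sets M" using A unfolding pre_tau_sets_def by auto
  show "let B = A \<inter> {\<omega>. \<tau> \<omega> < \<infinity>} in
          integrable M (\<lambda>\<omega>. indicator B \<omega> * f (X (enn2real (\<tau> \<omega>) + s) \<omega>)) \<and>
          integrable M (\<lambda>\<omega>. indicator B \<omega> * T s f (X (enn2real (\<tau> \<omega>)) \<omega>)) \<and>
          (\<lambda>\<omega>. indicator {\<omega>. \<tau> \<omega> < \<infinity>} \<omega> * f (X (enn2real (\<tau> \<omega>)) \<omega>))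
             \<in> borel_measurable (sigma (space M) (pre_tau_sets M filt \<tau>)) \<and>
          (\<integral>\<omega>. indicator B \<omega> * f (X (enn2real (\<tau> \<omega>) + s) \<omega>) \<partial>M)
            = (\<integral>\<omega>. indicator B \<omega> * T s f (X (enn2real (\<tau> \<omega>)) \<omega>) \<partial>M)"
    unfolding Let_def B_def[symmetric]
    using integrable_stopped(1)[OF tau f s B] integrable_stopped(1)[OF tau T_continuous[OF s f] order_refl B]
      stopped_pre_tau_measurable[OF tau f] strong_markov[OF tau A f s, folded B_def] by simp
qed (rule assms)

end

section \<open>Identification of the initial law, and transport to a probability space of
  paths\<close>

lemma measure_thoma_eqI:
  assumes M: "prob_space M" "sets M = sets thoma_space" and N: "prob_space N" "sets N = sets thoma_space"
    and eq: "\<And>f :: thoma_pt \<Rightarrow> real. continuous_on thoma f \<Longrightarrow> (\<integral>x. f x \<partial>M) = (\<integral>x. f x \<partial>N)"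
  shows "M = N"
proof -
  have id: "(\<lambda>x. x) \<in> borel_measurable K" if "sets K = sets thoma_space" for K
    unfolding measurable_cong_sets[OF that refl] thoma_space_def by (intro measurable_restrict_space1) simp
  have lim: "(\<lambda>k. \<integral>x. bump k C x \<partial>K) \<longlonglongrightarrow> measure (distr K borel (\<lambda>x. x)) C"
    if K: "prob_space K" "sets K = sets thoma_space" and C: "closed C" for K and C :: "thoma_pt set"
  proof -
    interpret prob_space K by fact
    have bm: "(\<lambda>x. bump k C x) \<in> borel_measurable K" for k
      unfolding measurable_cong_sets[OF K(2) refl] by (rule borel_measurable_thoma_space[OF continuous_on_bump])
    have CK: "C \<inter> space K \<in> sets K" using measurable_sets[OF id[OF K(2)] borel_closed[OF C]] by (simp add: vimage_def Int_def)
    have "(\<lambda>k. \<integral>x. bump k C x \<partial>K) \<longlonglongrightarrow> (\<integral>x. indicator (C \<inter> space K) x \<partial>K)"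
    proof (rule integral_dominated_convergence[where w = "\<lambda>_. 1"])
      show "AE x in K. (\<lambda>k. bump k C x) \<longlonglongrightarrow> indicator (C \<inter> space K) x"
      proof (rule AE_I2)
        fix x assume "x \<in> space K"
        then have "indicator (C \<inter> space K) x = (indicator C x :: real)" by (simp add: indicator_def)
        then show "(\<lambda>k. bump k C x) \<longlonglongrightarrow> indicator (C \<inter> space K) x" using bump_tendsto[OF C, of x] by simp
      qed
      show "AE x in K. norm (bump k C x) \<le> 1" for k using bump_bounds[of k C] by (intro AE_I2) simp
    qed (use bm CK in auto)
    also have "(\<integral>x. indicator (C \<inter> space K) x \<partial>K) = measure (distr K borel (\<lambda>x. x)) C"
      using measure_distr[OF id[OF K(2)], of C] borel_closed[OF C] by (simp add: vimage_def Int_assoc)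
    finally show ?thesis .
  qed
  have pK: "prob_space (distr K borel (\<lambda>x. x))" if "prob_space K" "sets K = sets thoma_space" for K
    by (rule prob_space.prob_space_distr[OF that(1) id[OF that(2)]])
  interpret M': prob_space "distr M borel (\<lambda>x. x)" by (rule pK[OF M])
  interpret N': prob_space "distr N borel (\<lambda>x. x)" by (rule pK[OF N])
  have borel: "distr M borel (\<lambda>x. x) = distr N borel (\<lambda>x. x)"
  proof (rule measure_eqI_generator_eq[of "Collect closed" UNIV _ _ "\<lambda>_. UNIV"])
    show "Int_stable (Collect closed :: thoma_pt set set)" by (auto intro!: Int_stableI)
    fix C :: "thoma_pt set" assume "C \<in> Collect closed"
    then have C: "closed C" by simp
    have "(\<integral>x. bump k C x \<partial>M) = (\<integral>x. bump k C x \<partial>N)" for k by (rule eq[OF continuous_on_bump])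
    then have "measure (distr M borel (\<lambda>x. x)) C = measure (distr N borel (\<lambda>x. x)) C"
      using lim[OF M C] lim[OF N C] LIMSEQ_unique by simp
    then show "emeasure (distr M borel (\<lambda>x. x)) C = emeasure (distr N borel (\<lambda>x. x)) C"
      by (simp add: M'.emeasure_eq_measure N'.emeasure_eq_measure)
  next
    show "emeasure (distr M borel (\<lambda>x. x)) UNIV \<noteq> \<infinity>" using M'.emeasure_finite[of UNIV] by (simp only: infinity_ennreal_def not_False_eq_True)
    show "sets (distr M borel (\<lambda>x. x)) = sigma_sets UNIV (Collect closed)" "sets (distr N borel (\<lambda>x. x)) = sigma_sets UNIV (Collect closed)"
      by (simp_all add: borel_eq_closed)
  qed auto
  show ?thesis
  proof (rule measure_eqI)
    show "sets M = sets N" using M N by simp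
    fix A assume A: "A \<in> sets M"
    have sp: "space M = thoma" "space N = thoma" using M(2) N(2) sets_eq_imp_space_eq space_thoma_space by metis+
    obtain A' where A': "A' \<in> sets borel" "A = thoma \<inter> A'" using A unfolding M(2) thoma_space_def sets_restrict_space by auto
    have "emeasure K A = emeasure (distr K borel (\<lambda>x. x)) A'" if "sets K = sets thoma_space" "space K = thoma" for K
      using emeasure_distr[OF id[OF that(1)] A'(1)] that(2) A'(2) by (simp add: vimage_def Int_def conj_commute)
    then show "emeasure M A = emeasure N A" using M(2) N(2) sp borel by metis
  qed
qed

text \<open>The limit lives on the real line of codes, whereas the theorem asks for a probability
  measure on \<open>path\<close>. An embedding with measurable left inverse moves the process
  without changing any expectation.\<close>

lemma markov_thoma_process_transport:
  fixes M :: "real measure" and e :: "real \<Rightarrow> 'b::topological_space" and q :: "'b \<Rightarrow> real"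
  assumes "markov_thoma_process M X T" and sM: "sets M = sets borel"
    and e: "e \<in> borel_measurable borel" and q: "q \<in> borel_measurable borel" and qe: "\<And>u. q (e u) = u"
  shows "markov_thoma_process (distr M borel e) (\<lambda>t w. X t (q w)) T"
proof -
  interpret markov_thoma_process M X T by fact
  have eM: "e \<in> borel_measurable M" using e by (simp add: measurable_cong_sets[OF sM refl])
  have qm: "q \<in> measurable (distr M borel e) M" using q by (simp add: measurable_cong_sets[OF refl sM])
  have int: "(\<integral>w. h (q w) \<partial>distr M borel e) = (\<integral>u. h u \<partial>M)" if "h \<in> borel_measurable M" for h :: "real \<Rightarrow> real"
  proof -
    have "(\<lambda>w. h (q w)) \<in> borel_measurable borel" using measurable_compose[OF qm that] by simp
    then show ?thesis using integral_distr[OF eM, of "\<lambda>w. h (q w)"] by (simp add: qe)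
  qed
  show ?thesis
  proof (intro markov_thoma_process.intro thoma_process.intro thoma_process_axioms.intro markov_thoma_process_axioms.intro)
    show "prob_space (distr M borel e)" by (rule prob_space_distr[OF eM])
    show "(\<lambda>w. X t (q w)) \<in> borel_measurable (distr M borel e)" if "0 \<le> t" for t
      by (rule measurable_compose[OF qm X_measurable[OF that]])
    show "X t (q w) \<in> thoma" if "0 \<le> t" for t w by (rule X_thoma[OF that])
    show "continuous_on {0..} (\<lambda>t. X t (q w))" for w by (rule X_continuous)
    show "continuous_on thoma (T t f)" if "0 \<le> t" "continuous_on thoma f" for t f by (rule T_continuous[OF that])
  next
    fix I :: "(real \<times> thoma_pt set) set" and g :: "real \<times> thoma_pt set \<Rightarrow> thoma_pt \<Rightarrow> real" and f :: "thoma_pt \<Rightarrow> real" and t s :: real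
    assume I: "finite I" "\<And>i. i \<in> I \<Longrightarrow> 0 \<le> fst i" "\<And>i. i \<in> I \<Longrightarrow> fst i \<le> t"
      and g: "\<And>i. i \<in> I \<Longrightarrow> continuous_on thoma (g i)" "\<And>i x. 0 \<le> g i x" "\<And>i x. g i x \<le> 1"
      and f: "continuous_on thoma f" and t: "0 \<le> t" and s: "0 \<le> s"
    have ts: "0 \<le> t + s" using t s by simp
    have m: "(\<lambda>u. (\<Prod>i\<in>I. g i (X (fst i) u)) * h (X r u)) \<in> borel_measurable M" if "continuous_on thoma h" "0 \<le> r" for h r
      by (intro borel_measurable_times borel_measurable_prod measurable_fun_X I g that)
    show "(\<integral>w. (\<Prod>i\<in>I. g i (X (fst i) (q w))) * f (X (t + s) (q w)) \<partial>distr M borel e)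
        = (\<integral>w. (\<Prod>i\<in>I. g i (X (fst i) (q w))) * T s f (X t (q w)) \<partial>distr M borel e)"
      unfolding int[OF m[OF f ts]] int[OF m[OF T_continuous[OF s f] t]] by (rule markov[OF I g f t s])
  qed
qed

theorem theorem7p1:
  fixes z z' :: complex
    and T :: "real \<Rightarrow> (thoma_pt \<Rightarrow> real) \<Rightarrow> (thoma_pt \<Rightarrow> real)"
  assumes "zz'_admissible z z'"
    and "approximates_semigroup z z' T"
  shows "\<forall>mu. prob_space mu \<and> sets mu = sets thoma_space \<longrightarrow>
           (\<exists>(P :: path measure) F X. is_diffusion T mu P F X)"
proof (intro allI impI)
  fix mu :: "thoma_pt measure" assume "prob_space mu \<and> sets mu = sets thoma_space"
  then have mu: "prob_space mu" "sets mu = sets thoma_space" by auto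
  show "\<exists>(P :: path measure) F X. is_diffusion T mu P F X"
  proof (rule dyadic_limit[OF assms mu])
    fix M :: "real measure" and Z :: "nat \<Rightarrow> real \<Rightarrow> thoma_pt"
    assume "real_distribution M" and Z: "\<And>i. Z i \<in> borel_measurable M" "\<And>i u. Z i u \<in> thoma"
      and init: "\<And>i (f :: thoma_pt \<Rightarrow> real). dtime i = 0 \<Longrightarrow> continuous_on thoma f \<Longrightarrow> (\<integral>u. f (Z i u) \<partial>M) = (\<integral>x. f x \<partial>mu)"
      and mom: "\<And>j. \<exists>C\<ge>0. \<forall>a b. (\<integral>u. (test_fun j (Z a u) - test_fun j (Z b u)) ^ 4 \<partial>M) \<le> C * (dtime a - dtime b)\<^sup>2"
      and mk: "\<And>I g f a b. finite I \<Longrightarrow> (\<And>i. i \<in> I \<Longrightarrow> continuous_on thoma (g i)) \<Longrightarrow> continuous_on thoma f \<Longrightarrow>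
        (\<And>i. i \<in> I \<Longrightarrow> dtime i \<le> dtime b) \<Longrightarrow> dtime b \<le> dtime a \<Longrightarrow>
        (\<integral>u. (\<Prod>i\<in>I. g i (Z i u)) * f (Z a u) \<partial>M) = (\<integral>u. (\<Prod>i\<in>I. g i (Z i u)) * T (dtime a - dtime b) f (Z b u) \<partial>M)"
    interpret real_distribution M by fact
    obtain X :: "real \<Rightarrow> real \<Rightarrow> thoma_pt" where X: "\<And>t. 0 \<le> t \<Longrightarrow> X t \<in> borel_measurable M" "\<And>t u. 0 \<le> t \<Longrightarrow> X t u \<in> thoma"
      "\<And>u. continuous_on {0..} (\<lambda>t. X t u)" and XZ: "\<And>i. AE u in M. X (dtime i) u = Z i u"
    proof (rule continuous_version[OF Z mom])
      fix X :: "real \<Rightarrow> real \<Rightarrow> thoma_pt"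
      assume "\<And>t. 0 \<le> t \<Longrightarrow> X t \<in> borel_measurable M" "\<And>t u. 0 \<le> t \<Longrightarrow> X t u \<in> thoma"
        "\<And>u. continuous_on {0..} (\<lambda>t. X t u)" "\<And>i. AE u in M. X (dtime i) u = Z i u"
      then show ?thesis by (rule that)
    qed
    interpret X: thoma_process M X by standard (rule X(1), assumption, rule X(2), assumption, rule X(3))
    have mtp: "markov_thoma_process M X T"
    proof (intro markov_thoma_process.intro X.thoma_process_axioms markov_thoma_process_axioms.intro)
      show "continuous_on thoma (T t f)" if "0 \<le> t" "continuous_on thoma f" for t f
        by (rule semigroup_continuous_on[OF assms(2) that])
    next
      fix I :: "(real \<times> thoma_pt set) set" and g :: "real \<times> thoma_pt set \<Rightarrow> thoma_pt \<Rightarrow> real" and f :: "thoma_pt \<Rightarrow> real" and t s :: real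
      assume I: "finite I" "\<And>i. i \<in> I \<Longrightarrow> 0 \<le> fst i" "\<And>i. i \<in> I \<Longrightarrow> fst i \<le> t"
        and g: "\<And>i. i \<in> I \<Longrightarrow> continuous_on thoma (g i)" "\<And>i x. 0 \<le> g i x" "\<And>i x. g i x \<le> 1"
        and f: "continuous_on thoma f" and t: "0 \<le> t" and s: "0 \<le> s"
      show "(\<integral>u. (\<Prod>i\<in>I. g i (X (fst i) u)) * f (X (t + s) u) \<partial>M) = (\<integral>u. (\<Prod>i\<in>I. g i (X (fst i) u)) * T s f (X t u) \<partial>M)"
      proof (rule X.markov_from_dyadic[OF assms Z XZ _ I g f t s])
        fix I and g :: "nat \<Rightarrow> thoma_pt \<Rightarrow> real" and f :: "thoma_pt \<Rightarrow> real" and a b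
        assume "finite I" "\<And>i. i \<in> I \<Longrightarrow> continuous_on thoma (g i)" "continuous_on thoma f"
          "\<And>i. i \<in> I \<Longrightarrow> dtime i \<le> dtime b" "dtime b \<le> dtime a"
        then show "(\<integral>u. (\<Prod>i\<in>I. g i (Z i u)) * f (Z a u) \<partial>M) = (\<integral>u. (\<Prod>i\<in>I. g i (Z i u)) * T (dtime a - dtime b) f (Z b u) \<partial>M)"
          by (rule mk)
      qed
    qed
    \<comment> \<open>The path \<open>e u\<close> merely stores the code u and is not the sample
      path; the process on the new space is \<open>Y\<close>, which recovers u through
      \<open>q\<close>.\<close>
    define e :: "real \<Rightarrow> path" where "e u = (\<lambda>_. ((\<lambda>_. u), (\<lambda>_. 0)))" for u
    define q :: "path \<Rightarrow> real" where "q w = fst (w 0) 0" for w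
    have e: "e \<in> borel_measurable borel" unfolding e_def[abs_def]
      by (intro borel_measurable_continuous_onI continuous_on_coordinatewise_then_product continuous_on_Pair continuous_on_const continuous_on_id)
    have q: "q \<in> borel_measurable borel" unfolding q_def[abs_def]
      by (intro borel_measurable_continuous_onI continuous_on_product_then_coordinatewise[where f = "\<lambda>w. fst (w 0)"] continuous_on_fst
          continuous_on_product_then_coordinatewise[where f = "\<lambda>w. w"] continuous_on_id)
    define P where "P = distr M borel e"
    define Y where "Y t w = X t (q w)" for t w
    interpret Y: markov_thoma_process P Y T unfolding P_def Y_def[abs_def]
      by (rule markov_thoma_process_transport[OF mtp events_eq_borel e q]) (simp add: e_def q_def)
    have Y0: "Y 0 \<in> measurable P thoma_space" by (intro measurable_thoma_spaceI Y.X_measurable Y.X_thoma) auto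
    have "distr P thoma_space (Y 0) = mu"
    proof (rule measure_thoma_eqI[OF Y.prob_space_distr[OF Y0] _ mu])
      fix f :: "thoma_pt \<Rightarrow> real" assume f: "continuous_on thoma f"
      define i where "i = prod_encode (0, 0)"
      have i: "dtime i = 0" by (simp add: i_def dtime_encode)
      have "(\<integral>x. f x \<partial>distr P thoma_space (Y 0)) = (\<integral>w. f (Y 0 w) \<partial>P)"
        by (rule integral_distr[OF Y0 borel_measurable_thoma_space[OF f]])
      also have "\<dots> = (\<integral>u. f (X 0 u) \<partial>M)"
        unfolding P_def using Y.measurable_fun_X[OF order_refl f] e
        by (subst integral_distr) (simp_all add: P_def Y_def q_def e_def)
      also have "\<dots> = (\<integral>u. f (Z i u) \<partial>M)"
      proof (rule integral_cong_AE)
        show "(\<lambda>u. f (Z i u)) \<in> borel_measurable M"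
          by (rule measurable_compose[OF measurable_thoma_spaceI[OF Z] borel_measurable_thoma_space[OF f]])
        show "AE u in M. f (X 0 u) = f (Z i u)" using XZ[of i] unfolding i by eventually_elim simp
      qed (rule X.measurable_fun_X[OF order_refl f])
      also have "\<dots> = (\<integral>x. f x \<partial>mu)" by (rule init[OF i f])
      finally show "(\<integral>x. f x \<partial>distr P thoma_space (Y 0)) = (\<integral>x. f x \<partial>mu)" .
    qed simp
    then show ?thesis using Y.diffusion by blast
  qed
qed

end
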